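(* Assume $|\chi|=\bar s<\infty$, let $s$ be the order of $q=\chi^{-1}(a)$, so $\bar s=ss'$ with $s'\ge1$, and let $\xi\in k$ be a root of unity of order $s'$. Let $X=\{y,z\}\cup\{x_{[\alpha]}\mid[\alpha]\in k^\times/\langle\xi\rangle\}$ and let $\mathbb Z[X]$ be the polynomial ring over $\mathbb Z$ in the commuting variables $X$. For $\lambda\in\hat G$ let $r\mapsto r^\lambda$ be the ring automorphism of $\mathbb Z[X]$ with $y^\lambda=y$, $z^\lambda=z$, $x_{[\alpha]}^\lambda=x_{[\lambda(a)^s\alpha]}$; this is a right action of $\hat G$. Let $\mathbb Z[X]\sharp\hat G$ be the skew group ring: a free right $\mathbb Z[X]$-module with basis $\hat G$ and multiplication $(\lambda r)(\sigma t)=(\lambda\sigma)(r^\sigma t)$ for $\lambda,\sigma\in\hat G$, $r,t\in\mathbb Z[X]$ (containing $\hat G$ and $\mathbb Z[X]$ via $\lambda=\lambda 1$, $r=\varepsilon r$). Let $J$ be the two-sided ideal of $\mathbb Z[X]\sharp\hat G$ generated by the elements $$y^{s}-(1+\chi)\sum_{i=0}^{[\frac{s-1}{2}]}(-1)^i\binom{s-1-i}{i}\chi^iy^{s-1-2i}-\sum_{1\le i\le[\frac{s-1}{2}]}\sum_{j=0}^{[\frac{s-2i-1}{2}]}(-1)^j\frac{s-2i}{s-i}\binom{s-1}{i}\binom{s-2i-1-j}{j}\chi^{i+j}y^{s-2i-2j},$$ $\chi x_{[\alpha]}-x_{[\alpha]}$, $yx_{[\alpha]}-2x_{[\alpha]}$,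 $x_{[\alpha]}x_{[\beta]}-\sum_{i=0}^{s'-1}s\,x_{[\alpha+\beta\xi^i]}$ (for $[\beta]\ne[-\alpha]$), and $$x_{[\alpha]}x_{[-\alpha]}-\sum_{1\le i\le s'-1}s\,x_{[(1-\xi^i)\alpha]}-\sum_{i=0}^{\bar s-1}\sum_{j=0}^{[\frac{s-1}{2}]}(-1)^j\binom{s-1-j}{j}\chi^iy^{s-1-2j},$$ for all $[\alpha],[\beta]\in k^\times/\langle\xi\rangle$. Then the Green ring $r(\mathcal W)$ is isomorphic to $(\mathbb Z[X]\sharp\hat G)/J$, via the map sending $\lambda\in\hat G$ to $[V_1(\lambda)]$, $y\mapsto[V_2(\varepsilon)]$, $z\mapsto[V_{s+1}(\varepsilon)]$, $x_{[\alpha]}\mapsto[V_1(\varepsilon,\alpha^{s'})]$.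
   Context: Let $k$ be an algebraically closed field of characteristic zero, $G$ a group, $a$ a central element of $G$, $\hat G$ the group of characters $G\to k^\times$ with identity $\varepsilon$, and $\chi\in\hat G$ with $\chi(a)\ne1$. $H=kG(\chi^{-1},a,0)$ is the Hopf algebra generated by the group $G$ and $x$ with $xg=\chi^{-1}(g)gx$, $\Delta(g)=g\otimes g$, $\Delta(x)=x\otimes a+1\otimes x$; tensor products of modules: $g(m\otimes n)=gm\otimes gn$, $x(m\otimes n)=xm\otimes an+m\otimes xn$. $V_t(\lambda)$ ($\lambda\in\hat G$, $t\ge1$) has basis $m_0,\dots,m_{t-1}$ with $gm_i=\chi^i(g)\lambda(g)m_i$, $xm_i=m_{i+1}$ ($i\le t-2$), $xm_{t-1}=0$. For $|\chi|=\bar s<\infty$, $\lambda\in\hat G$, $\beta\in k$, $t\ge1$, $V_t(\lambda,\beta)$ has basis $m_0,\dots,m_{t\bar s-1}$ with $gm_i=\chi^i(g)\lambda(g)m_i$, $xm_i=m_{i+1}$ ($i\le t\bar s-2$), $xm_{t\bar s-1}=\sum_{j=0}^{t-1}\alpha_jm_{j\bar s}$ where $(Y-\beta)^t=Y^t-\sum_{j=0}^{t-1}\alpha_jY^j$. $\mathcal W$ is the category of finite-dimensional weight $H$-modules (direct sums of $M_{(\lambda)}=\{v:gv=\lambda(g)v\ \forall g\}$), and $r(\mathcal W)$ its Green ring (abelian group on isoclasses modulo $[U\oplus V]=[U]+[V]$, product $[U][V]=[U\otimes V]$). $[r]$ is the integer part; empty sums are $0$; $[\alpha]$ is the class of $\alpha$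 in $k^\times/\langle\xi\rangle$. *)

theory Defs
  imports "HOL-Algebra.Group" "HOL-Library.Poly_Mapping" "Jordan_Normal_Form.Matrix"
begin

definition alg_closed :: "'k::field itself \<Rightarrow> bool" where
  "alg_closed _ \<longleftrightarrow> (\<forall>(n::nat) (c::nat \<Rightarrow> 'k). n \<ge> 1 \<longrightarrow>
      (\<exists>x. x ^ n + (\<Sum>i<n. c i * x ^ i) = 0))"

definition characters :: "('g, 'm) monoid_scheme \<Rightarrow> ('g \<Rightarrow> 'k::field) set" where
  "characters G = {l. l \<in> extensional (carrier G) \<and> (\<forall>g\<in>carrier G. l g \<noteq> 0) \<and>
      (\<forall>g\<in>carrier G. \<forall>h\<in>carrier G. l (g \<otimes>\<^bsub>G\<^esub> h) = l g * l h)}"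

definition char_mult :: "('g, 'm) monoid_scheme \<Rightarrow> ('g \<Rightarrow> 'k::field) \<Rightarrow> ('g \<Rightarrow> 'k) \<Rightarrow> 'g \<Rightarrow> 'k" where
  "char_mult G l m = restrict (\<lambda>g. l g * m g) (carrier G)"

definition char_one :: "('g, 'm) monoid_scheme \<Rightarrow> 'g \<Rightarrow> 'k::field" where
  "char_one G = restrict (\<lambda>g. 1) (carrier G)"

definition char_pow :: "('g, 'm) monoid_scheme \<Rightarrow> ('g \<Rightarrow> 'k::field) \<Rightarrow> nat \<Rightarrow> 'g \<Rightarrow> 'k" where
  "char_pow G l i = restrict (\<lambda>g. l g ^ i) (carrier G)"

definition char_order :: "('g, 'm) monoid_scheme \<Rightarrow> ('g \<Rightarrow> 'k::field) \<Rightarrow> nat" where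
  "char_order G l = (if \<exists>n>0. char_pow G l n = char_one G
      then (LEAST n. n > 0 \<and> char_pow G l n = char_one G) else 0)"

definition elem_order :: "'k::field \<Rightarrow> nat" where
  "elem_order q = (if \<exists>n>0. q ^ n = 1 then (LEAST n. n > 0 \<and> q ^ n = 1) else 0)"

section \<open>Finite-dimensional H-modules, H = kG(chi^-1, a, 0)\<close>

text \<open>A module of dimension n on k^n (column vectors, standard basis m_0..m_{n-1}):
  the matrices of the actions of the group elements and of x.\<close>
type_synonym ('g, 'k) hmod = "nat \<times> ('g \<Rightarrow> 'k mat) \<times> 'k mat"

definition hmod_dim :: "('g, 'k) hmod \<Rightarrow> nat" where "hmod_dim M = fst M"
definition hmod_g :: "('g, 'k) hmod \<Rightarrow> 'g \<Rightarrow> 'k mat" where "hmod_g M = fst (snd M)"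
definition hmod_x :: "('g, 'k) hmod \<Rightarrow> 'k mat" where "hmod_x M = snd (snd M)"

definition is_hmod :: "('g, 'm) monoid_scheme \<Rightarrow> ('g \<Rightarrow> 'k::field) \<Rightarrow> ('g, 'k) hmod \<Rightarrow> bool" where
  "is_hmod G chi M \<longleftrightarrow>
     (let n = hmod_dim M; r = hmod_g M; X = hmod_x M in
       (\<forall>g\<in>carrier G. r g \<in> carrier_mat n n) \<and> X \<in> carrier_mat n n \<and>
       r \<one>\<^bsub>G\<^esub> = 1\<^sub>m n \<and>
       (\<forall>g\<in>carrier G. \<forall>h\<in>carrier G. r (g \<otimes>\<^bsub>G\<^esub> h) = r g * r h) \<and>
       (\<forall>g\<in>carrier G. X * r g = inverse (chi g) \<cdot>\<^sub>m (r g * X)))"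

definition is_weight_hmod :: "('g, 'm) monoid_scheme \<Rightarrow> ('g \<Rightarrow> 'k::field) \<Rightarrow> ('g, 'k) hmod \<Rightarrow> bool" where
  "is_weight_hmod G chi M \<longleftrightarrow> is_hmod G chi M \<and>
     (\<exists>P Q. P \<in> carrier_mat (hmod_dim M) (hmod_dim M) \<and> Q \<in> carrier_mat (hmod_dim M) (hmod_dim M) \<and>
        P * Q = 1\<^sub>m (hmod_dim M) \<and> Q * P = 1\<^sub>m (hmod_dim M) \<and>
        (\<forall>g\<in>carrier G. diagonal_mat (Q * hmod_g M g * P)))"

definition hmod_iso :: "('g, 'm) monoid_scheme \<Rightarrow> ('g, 'k::field) hmod \<Rightarrow> ('g, 'k) hmod \<Rightarrow> bool" where
  "hmod_iso G M N \<longleftrightarrow> hmod_dim M = hmod_dim N \<and>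
     (\<exists>P Q. P \<in> carrier_mat (hmod_dim M) (hmod_dim M) \<and> Q \<in> carrier_mat (hmod_dim M) (hmod_dim M) \<and>
        P * Q = 1\<^sub>m (hmod_dim M) \<and> Q * P = 1\<^sub>m (hmod_dim M) \<and>
        (\<forall>g\<in>carrier G. P * hmod_g M g = hmod_g N g * P) \<and> P * hmod_x M = hmod_x N * P)"

definition dsum_hmod :: "('g, 'm) monoid_scheme \<Rightarrow> ('g, 'k::field) hmod \<Rightarrow> ('g, 'k) hmod \<Rightarrow> ('g, 'k) hmod" where
  "dsum_hmod G M N =
     (let m = hmod_dim M; n = hmod_dim N in
      (m + n,
       restrict (\<lambda>g. four_block_mat (hmod_g M g) (0\<^sub>m m n) (0\<^sub>m n m) (hmod_g N g)) (carrier G),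
       four_block_mat (hmod_x M) (0\<^sub>m m n) (0\<^sub>m n m) (hmod_x N)))"

text \<open>Kronecker product; the basis vector m_i (x) n_j is the (i * dim N + j)-th one.\<close>
definition kron_mat :: "'k::semiring_1 mat \<Rightarrow> 'k mat \<Rightarrow> 'k mat" where
  "kron_mat A B = mat (dim_row A * dim_row B) (dim_col A * dim_col B)
     (\<lambda>(i, j). A $$ (i div dim_row B, j div dim_col B) * B $$ (i mod dim_row B, j mod dim_col B))"

text \<open>g (m (x) n) = gm (x) gn,  x (m (x) n) = xm (x) an + m (x) xn.\<close>
definition tensor_hmod :: "('g, 'm) monoid_scheme \<Rightarrow> 'g \<Rightarrow> ('g, 'k::field) hmod \<Rightarrow> ('g, 'k) hmod \<Rightarrow> ('g, 'k) hmod" where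
  "tensor_hmod G a M N =
     (hmod_dim M * hmod_dim N,
      restrict (\<lambda>g. kron_mat (hmod_g M g) (hmod_g N g)) (carrier G),
      kron_mat (hmod_x M) (hmod_g N a) + kron_mat (1\<^sub>m (hmod_dim M)) (hmod_x N))"

definition Vt :: "('g, 'm) monoid_scheme \<Rightarrow> ('g \<Rightarrow> 'k::field) \<Rightarrow> nat \<Rightarrow> ('g \<Rightarrow> 'k) \<Rightarrow> ('g, 'k) hmod" where
  "Vt G chi t l =
     (t, restrict (\<lambda>g. mat t t (\<lambda>(i, j). if i = j then chi g ^ i * l g else 0)) (carrier G),
      mat t t (\<lambda>(i, j). if i = j + 1 then 1 else 0))"

text \<open>V_t(lambda, beta) for sbar = |chi|: x m_{t sbar - 1} = sum_j alpha_j m_{j sbar}, where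
  (Y - beta)^t = Y^t - sum_{j<t} alpha_j Y^j, i.e. alpha_j = - (t choose j) (-beta)^(t-j).\<close>
definition Vtb :: "('g, 'm) monoid_scheme \<Rightarrow> ('g \<Rightarrow> 'k::field) \<Rightarrow> nat \<Rightarrow> ('g \<Rightarrow> 'k) \<Rightarrow> 'k \<Rightarrow> ('g, 'k) hmod" where
  "Vtb G chi t l beta =
     (let sb = char_order G chi; n = t * sb in
      (n, restrict (\<lambda>g. mat n n (\<lambda>(i, j). if i = j then chi g ^ i * l g else 0)) (carrier G),
       mat n n (\<lambda>(i, j). if i = j + 1 then 1
          else if j = n - 1 \<and> sb dvd i then - (of_nat (t choose (i div sb)) * (- beta) ^ (t - i div sb))
          else 0)))"

section \<open>The Green ring r(W), presented as formal Z-combinations of modules modulo relations\<close>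

type_synonym ('g, 'k) formal = "('g, 'k) hmod \<Rightarrow>\<^sub>0 int"

definition formal_W :: "('g, 'm) monoid_scheme \<Rightarrow> ('g \<Rightarrow> 'k::field) \<Rightarrow> ('g, 'k) formal set" where
  "formal_W G chi = {u. \<forall>M\<in>Poly_Mapping.keys u. is_weight_hmod G chi M}"

definition cls :: "('g, 'k) hmod \<Rightarrow> ('g, 'k) formal" where
  "cls M = Poly_Mapping.single M 1"

inductive_set green_rel :: "('g, 'm) monoid_scheme \<Rightarrow> ('g \<Rightarrow> 'k::field) \<Rightarrow> ('g, 'k) formal set"
  for G chi where
  zero: "0 \<in> green_rel G chi"
| iso: "is_weight_hmod G chi M \<Longrightarrow> is_weight_hmod G chi N \<Longrightarrow> hmod_iso G M N \<Longrightarrow>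
         cls M - cls N \<in> green_rel G chi"
| dsum: "is_weight_hmod G chi M \<Longrightarrow> is_weight_hmod G chi N \<Longrightarrow>
         cls (dsum_hmod G M N) - cls M - cls N \<in> green_rel G chi"
| add: "u \<in> green_rel G chi \<Longrightarrow> v \<in> green_rel G chi \<Longrightarrow> u + v \<in> green_rel G chi"
| neg: "u \<in> green_rel G chi \<Longrightarrow> - u \<in> green_rel G chi"

definition formal_mult :: "('g, 'm) monoid_scheme \<Rightarrow> 'g \<Rightarrow> ('g, 'k::field) formal \<Rightarrow> ('g, 'k) formal \<Rightarrow> ('g, 'k) formal" where
  "formal_mult G a u v = (\<Sum>M\<in>Poly_Mapping.keys u. \<Sum>N\<in>Poly_Mapping.keys v.
      Poly_Mapping.single (tensor_hmod G a M N) (Poly_Mapping.lookup u M * Poly_Mapping.lookup v N))"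

text \<open>Variables: y, z and x_S for S a class [alpha] = alpha <xi> in k^x / <xi>.\<close>
datatype 'k var = VY | VZ | VX "'k set"

definition coset :: "'k::field \<Rightarrow> 'k \<Rightarrow> 'k set" where
  "coset xi al = {al * xi ^ i | i. True}"

definition allowed_vars :: "'k::field \<Rightarrow> 'k var set" where
  "allowed_vars xi = {VY, VZ} \<union> {VX (coset xi al) | al. al \<noteq> 0}"

type_synonym 'k zpoly = "('k var \<Rightarrow>\<^sub>0 nat) \<Rightarrow>\<^sub>0 int"

definition zvar :: "'k var \<Rightarrow> 'k zpoly" where
  "zvar v = Poly_Mapping.single (Poly_Mapping.single v 1) 1"

definition zpoly_in :: "'k::field \<Rightarrow> 'k zpoly \<Rightarrow> bool" where
  "zpoly_in xi p \<longleftrightarrow> (\<forall>m\<in>Poly_Mapping.keys p. Poly_Mapping.keys m \<subseteq> allowed_vars xi)"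

definition ren_var :: "'g \<Rightarrow> nat \<Rightarrow> ('g \<Rightarrow> 'k::field) \<Rightarrow> 'k var \<Rightarrow> 'k var" where
  "ren_var a s l v = (case v of VX S \<Rightarrow> VX ((\<lambda>b. l a ^ s * b) ` S) | _ \<Rightarrow> v)"

definition zact :: "'g \<Rightarrow> nat \<Rightarrow> ('g \<Rightarrow> 'k::field) \<Rightarrow> 'k zpoly \<Rightarrow> 'k zpoly" where
  "zact a s l p = (\<Sum>m\<in>Poly_Mapping.keys p. Poly_Mapping.single
       (\<Sum>v\<in>Poly_Mapping.keys m. Poly_Mapping.single (ren_var a s l v) (Poly_Mapping.lookup m v)) (Poly_Mapping.lookup p m))"

type_synonym ('g, 'k) skew = "('g \<Rightarrow> 'k) \<Rightarrow>\<^sub>0 'k zpoly"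

text \<open>elements sum_lambda lambda r_lambda; (lambda r)(sigma t) = (lambda sigma)(r^sigma t)\<close>
definition skew_mult :: "('g, 'm) monoid_scheme \<Rightarrow> 'g \<Rightarrow> nat \<Rightarrow> ('g, 'k::field) skew \<Rightarrow> ('g, 'k) skew \<Rightarrow> ('g, 'k) skew" where
  "skew_mult G a s u v = (\<Sum>l\<in>Poly_Mapping.keys u. \<Sum>sg\<in>Poly_Mapping.keys v.
      Poly_Mapping.single (char_mult G l sg) (zact a s sg (Poly_Mapping.lookup u l) * Poly_Mapping.lookup v sg))"

definition skew_carrier :: "('g, 'm) monoid_scheme \<Rightarrow> 'k::field \<Rightarrow> ('g, 'k) skew set" where
  "skew_carrier G xi = {u. Poly_Mapping.keys u \<subseteq> characters G \<and> (\<forall>l. zpoly_in xi (Poly_Mapping.lookup u l))}"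

definition skel :: "('g \<Rightarrow> 'k) \<Rightarrow> 'k zpoly \<Rightarrow> ('g, 'k::field) skew" where
  "skel l r = Poly_Mapping.single l r"

inductive_set skew_ideal :: "('g, 'm) monoid_scheme \<Rightarrow> 'g \<Rightarrow> nat \<Rightarrow> 'k::field \<Rightarrow> ('g, 'k) skew set \<Rightarrow> ('g, 'k) skew set"
  for G a s xi gens where
  zero: "0 \<in> skew_ideal G a s xi gens"
| gen: "g \<in> gens \<Longrightarrow> u \<in> skew_carrier G xi \<Longrightarrow> v \<in> skew_carrier G xi \<Longrightarrow>
         skew_mult G a s (skew_mult G a s u g) v \<in> skew_ideal G a s xi gens"
| add: "u \<in> skew_ideal G a s xi gens \<Longrightarrow> v \<in> skew_ideal G a s xi gens \<Longrightarrow> u + v \<in> skew_ideal G a s xi gens"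

definition J_gens :: "('g, 'm) monoid_scheme \<Rightarrow> ('g \<Rightarrow> 'k::field) \<Rightarrow> nat \<Rightarrow> nat \<Rightarrow> nat \<Rightarrow> 'k \<Rightarrow> ('g, 'k) skew set" where
  "J_gens G chi s sp sb xi =
    (let eps = char_one G; y = zvar VY; X = (\<lambda>al. zvar (VX (coset xi al)));
         cy = (\<lambda>(c::int) i n. skel (char_pow G chi i) (of_int c * y ^ n)) in
    {skel eps (y ^ s)
      - (\<Sum>i\<in>{0..(s - 1) div 2}. cy ((-1) ^ i * int ((s - 1 - i) choose i)) i (s - 1 - 2 * i)
                                  + cy ((-1) ^ i * int ((s - 1 - i) choose i)) (i + 1) (s - 1 - 2 * i))
      - (\<Sum>i\<in>{1..(s - 1) div 2}. \<Sum>j\<in>{0..(s - 2 * i - 1) div 2}.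
           cy ((-1) ^ j * ((int (s - 2 * i) * int ((s - 1) choose i)) div int (s - i))
                   * int ((s - 2 * i - 1 - j) choose j)) (i + j) (s - 2 * i - 2 * j))}
    \<union> {skel chi (X al) - skel eps (X al) | al. al \<noteq> 0}
    \<union> {skel eps (y * X al - 2 * X al) | al. al \<noteq> 0}
    \<union> {skel eps (X al * X be - (\<Sum>i<sp. of_nat s * X (al + be * xi ^ i))) | al be.
          al \<noteq> 0 \<and> be \<noteq> 0 \<and> coset xi be \<noteq> coset xi (- al)}
    \<union> {skel eps (X al * X (- al) - (\<Sum>i\<in>{1..<sp}. of_nat s * X ((1 - xi ^ i) * al)))
          - (\<Sum>i<sb. \<Sum>j\<in>{0..(s - 1) div 2}. cy ((-1) ^ j * int ((s - 1 - j) choose j)) i (s - 1 - 2 * j))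
         | al. al \<noteq> 0})"

end

theory Submission
  imports Defs "HOL-Library.Function_Algebras" "Jordan_Normal_Form.Determinant" "HOL-Computational_Algebra.Polynomial"
begin

text \<open>Every weight module is a direct sum of the blocks \<open>V t l b\<close>: a vector of maximal order under
  \<open>x\<close> (or under \<open>x ^ sb - b\<close>) generates a block, and a linear functional that does not vanish on
  the socle of that block cuts out a graded complement. The tensor products of a block with the modules of
  the variables are computed on the grid \<open>x ^ i m\<^sub>0 \<otimes> x ^ j n\<^sub>0\<close>, using the \<open>q\<close>-binomial theorem at the root
  of unity \<open>chi a\<close>; they show that the variables commute and satisfy the relations, so that the
  homomorphism to the Green ring is well defined. Modulo the ideal every element is a combination of the
  normal monomials \<open>l y ^ i z ^ j\<close> with \<open>i < s\<close> and \<open>l z ^ j x_al\<close> with \<open>l\<close> a representative modulo the powers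
  of \<open>chi\<close>. Their images are blocks \<open>V t l 0\<close>, respectively \<open>V t l b\<close> with \<open>b = al ^ sp\<close>, plus smaller
  blocks, which gives surjectivity; the numbers \<open>dim ker T ^ n - dim ker T ^ (n - 1)\<close> on weight spaces, with \<open>T = x\<close> or
  \<open>T = x ^ sb - b\<close>, detect the leading blocks, which gives injectivity.\<close>

section \<open>Linear algebra\<close>

text \<open>Few isomorphisms are written down. A weight vector killed by
  \<open>(x ^ p - b) ^ t\<close> is an image of the generator of \<open>V t l b\<close>, so a
  product is decomposed as soon as such vectors generate it and the sizes of their blocks add up to
  its dimension. A single operator \<open>x ^ p - b\<close>, with \<open>p = 1\<close> for
  \<open>b = 0\<close> and \<open>p = sb\<close> otherwise, treats nilpotent and invertible modules
  together. The product of \<open>z\<close> with a nilpotent block is never decomposed completely: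
  only its longest summand is identified, which is all that a triangularity argument needs.
  Characteristic zero enters through the integers that couple the first and last rows of a product
  with \<open>V (s + 1)\<close>; they must be invertible for a block to grow. The relation of degree
  \<open>s\<close> for \<open>y\<close> comes from a Chebyshev recursion, because multiplication by
  \<open>V 2\<close> sends \<open>V t\<close> to \<open>V (t + 1)\<close> plus a twist of
  \<open>V (t - 1)\<close> until \<open>t\<close> reaches \<open>s\<close>, where the recursion
  breaks. Products of formal sums are associative, and the variables commute, only modulo the
  relations; monomials are therefore evaluated along lists and shown to be independent of the
  order.\<close>

lemma square_system_inverse:
  fixes A :: "nat \<Rightarrow> nat \<Rightarrow> 'k::field"
  assumes "\<And>c. (\<And>i. i < n \<Longrightarrow> (\<Sum>j<n. A i j * c j) = 0) \<Longrightarrow> (\<forall>j<n. c j = 0)"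
  shows "\<exists>B. B \<in> carrier_mat n n \<and> mat n n (\<lambda>(i, j). A i j) * B = 1\<^sub>m n \<and> B * mat n n (\<lambda>(i, j). A i j) = 1\<^sub>m n"
proof -
  let ?A = "mat n n (\<lambda>(i, j). A i j)"
  have A: "?A \<in> carrier_mat n n" by simp
  have "det ?A \<noteq> 0"
  proof
    assume "det ?A = 0"
    then obtain v where v: "v \<in> carrier_vec n" "v \<noteq> 0\<^sub>v n" "?A *\<^sub>v v = 0\<^sub>v n"
      using det_0_iff_vec_prod_zero[OF A] by auto
    have "(\<Sum>j<n. A i j * v $ j) = 0" if "i < n" for i
    proof -
      have "(?A *\<^sub>v v) $ i = (\<Sum>j<n. A i j * v $ j)"
        using that v(1) by (auto simp: scalar_prod_def atLeast0LessThan intro!: sum.cong)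
      with v that show ?thesis by simp
    qed
    then have "\<forall>j<n. v $ j = 0" by (rule assms)
    with v show False by (auto simp: vec_eq_iff)
  qed
  from det_non_zero_imp_unit[OF A this, of "()"] show ?thesis
    using mat_mult_left_right_inverse by (auto simp: Units_def ring_mat_def)
qed

text \<open>The index set is arbitrary because the system solved later is indexed by pairs of
  exponents. Numbering it reduces the claim to a square matrix, where a trivial kernel gives an
  inverse.\<close>

lemma square_system_solvable:
  fixes A :: "'i \<Rightarrow> 'i \<Rightarrow> 'k::field"
  assumes fin: "finite I"
    and inj: "\<And>c. (\<And>i. i \<in> I \<Longrightarrow> (\<Sum>j\<in>I. A i j * c j) = 0) \<Longrightarrow> (\<forall>j\<in>I. c j = 0)"
  shows "\<exists>c. \<forall>i\<in>I. (\<Sum>j\<in>I. A i j * c j) = y i"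
proof -
  define n where "n = card I"
  obtain h where h: "bij_betw h {..<n} I"
    using ex_bij_betw_nat_finite[OF fin] by (auto simp: n_def atLeast0LessThan)
  define k where "k = the_inv_into {..<n} h"
  have k: "bij_betw k I {..<n}" "\<And>i. i < n \<Longrightarrow> k (h i) = i" "\<And>i. i \<in> I \<Longrightarrow> h (k i) = i"
    using h bij_betw_the_inv_into[OF h]
    by (auto simp: k_def bij_betw_def the_inv_into_f_f f_the_inv_into_f)
  have re: "(\<Sum>j\<in>I. f j) = (\<Sum>j<n. f (h j))" for f :: "'i \<Rightarrow> 'k"
    using sum.reindex_bij_betw[OF h, of f] by simp
  have "\<exists>B. B \<in> carrier_mat n n \<and> mat n n (\<lambda>(i, j). A (h i) (h j)) * B = 1\<^sub>m n \<and> B * mat n n (\<lambda>(i, j). A (h i) (h j)) = 1\<^sub>m n"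
  proof (rule square_system_inverse)
    fix c assume c: "\<And>i. i < n \<Longrightarrow> (\<Sum>j<n. A (h i) (h j) * c j) = 0"
    have "\<forall>j\<in>I. (c \<circ> k) j = 0"
    proof (rule inj)
      fix i assume i: "i \<in> I"
      have "(\<Sum>j\<in>I. A i j * (c \<circ> k) j) = (\<Sum>j<n. A (h (k i)) (h j) * c j)"
        unfolding re using k i by (intro sum.cong) auto
      also have "\<dots> = 0" using c[of "k i"] k(1) i by (auto simp: bij_betw_def)
      finally show "(\<Sum>j\<in>I. A i j * (c \<circ> k) j) = 0" .
    qed
    then show "\<forall>j<n. c j = 0" using k h by (auto simp: bij_betw_def)
  qed
  then obtain B where B: "B \<in> carrier_mat n n" "mat n n (\<lambda>(i, j). A (h i) (h j)) * B = 1\<^sub>m n" by blast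
  have AB: "(\<Sum>j<n. A (h i) (h j) * B $$ (j, l)) = (if i = l then 1 else 0)" if "i < n" "l < n" for i l
  proof -
    have "(mat n n (\<lambda>(i, j). A (h i) (h j)) * B) $$ (i, l) = (\<Sum>j<n. A (h i) (h j) * B $$ (j, l))"
      using that B(1) by (auto simp: scalar_prod_def atLeast0LessThan intro!: sum.cong)
    with B(2) that show ?thesis by simp
  qed
  show ?thesis
  proof (intro exI ballI)
    fix i assume i: "i \<in> I"
    have ki: "k i < n" using k i by (auto simp: bij_betw_def)
    have "(\<Sum>j\<in>I. A i j * (\<Sum>l<n. B $$ (k j, l) * y (h l))) = (\<Sum>j<n. \<Sum>l<n. A (h (k i)) (h j) * B $$ (j, l) * y (h l))"
      unfolding re sum_distrib_left using k i by (intro sum.cong) (auto simp: mult.assoc)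
    also have "\<dots> = (\<Sum>l<n. (\<Sum>j<n. A (h (k i)) (h j) * B $$ (j, l)) * y (h l))"
      by (subst sum.swap) (simp add: sum_distrib_right)
    also have "\<dots> = (\<Sum>l<n. (if k i = l then y (h l) else 0))"
      using ki AB by (intro sum.cong) auto
    also have "\<dots> = y i" using ki k i by (simp add: sum.delta')
    finally show "(\<Sum>j\<in>I. A i j * (\<Sum>l<n. B $$ (k j, l) * y (h l))) = y i" .
  qed
qed

lemma funpow_commute:
  assumes "\<And>v. f (g v) = g (f v)"
  shows "(f ^^ i) ((g ^^ j) v) = (g ^^ j) ((f ^^ i) v)"
proof -
  have 1: "f ((g ^^ j) v) = (g ^^ j) (f v)" for v by (induction j) (auto simp: assms)
  show ?thesis by (induction i) (auto simp: 1)
qed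

lemma funpow_invariant: "v \<in> S \<Longrightarrow> (\<And>u. u \<in> S \<Longrightarrow> f u \<in> S) \<Longrightarrow> (f ^^ i) v \<in> S"
  by (induction i) auto

lemma funpow_plus: "(f ^^ i) ((f ^^ j) v) = (f ^^ (i + j)) v"
  by (simp add: funpow_add)

section \<open>Linear operators, functionals and dimension counts\<close>

locale vspace = vector_space scale
  for scale :: "'a::field \<Rightarrow> 'b::ab_group_add \<Rightarrow> 'b" (infixr "*s" 75)
begin

definition linop :: "('b \<Rightarrow> 'b) \<Rightarrow> bool" where
  "linop f \<longleftrightarrow> (\<forall>u v. f (u + v) = f u + f v) \<and> (\<forall>c v. f (c *s v) = c *s f v)"

lemma linop_add: "linop f \<Longrightarrow> f (u + v) = f u + f v" by (simp add: linop_def)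
lemma linop_scale: "linop f \<Longrightarrow> f (c *s v) = c *s f v" by (simp add: linop_def)
lemma linop_0: "linop f \<Longrightarrow> f 0 = 0" using linop_add[of f 0 0] by simp
lemma linop_diff: "linop f \<Longrightarrow> f (u - v) = f u - f v"
  using linop_add[of f "u - v" v] by simp
lemma linop_sum: "linop f \<Longrightarrow> f (\<Sum>i\<in>I. g i) = (\<Sum>i\<in>I. f (g i))"
  by (induction I rule: infinite_finite_induct) (auto simp: linop_0 linop_add)
lemma linop_comb: "linop f \<Longrightarrow> f (\<Sum>i\<in>I. c i *s g i) = (\<Sum>i\<in>I. c i *s f (g i))"
  by (simp add: linop_sum linop_scale)
lemma linop_id: "linop (\<lambda>v. v)" by (simp add: linop_def)
lemma linop_funpow: "linop f \<Longrightarrow> linop (f ^^ n)"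
  by (induction n) (auto simp: linop_def)
lemma linop_comp: "linop f \<Longrightarrow> linop g \<Longrightarrow> linop (\<lambda>v. f (g v))"
  by (auto simp: linop_def)

lemma linop_span:
  assumes "linop f" "v \<in> span A" "\<And>a. a \<in> A \<Longrightarrow> f a \<in> W" "subspace W"
  shows "f v \<in> W"
  using assms(2)
proof (induction rule: span_induct_alt)
  case base then show ?case using assms by (simp add: linop_0 subspace_0)
next
  case (step c x y) then show ?case using assms
    by (simp add: linop_add linop_scale subspace_add subspace_scale)
qed

lemma linop_image_subspace:
  assumes "linop f" "subspace S"
  shows "subspace (f ` S)"
proof (rule subspaceI)
  show "0 \<in> f ` S" using assms subspace_0 linop_0 by (metis image_eqI)
next
  fix u v assume "u \<in> f ` S" "v \<in> f ` S"
  then obtain u' v' where "u' \<in> S" "v' \<in> S" "u = f u'" "v = f v'" by blast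
  then show "u + v \<in> f ` S" using assms by (metis linop_add subspace_add image_eqI)
next
  fix c u assume "u \<in> f ` S"
  then obtain u' where "u' \<in> S" "u = f u'" by blast
  then show "c *s u \<in> f ` S" using assms by (metis linop_scale subspace_scale image_eqI)
qed

lemma span_image_comb:
  assumes "finite I"
  shows "v \<in> span (c ` I) \<longleftrightarrow> (\<exists>u. v = (\<Sum>i\<in>I. u i *s c i))"
proof
  assume "v \<in> span (c ` I)"
  then show "\<exists>u. v = (\<Sum>i\<in>I. u i *s c i)"
  proof (induction rule: span_induct_alt)
    case base then show ?case by (intro exI[of _ "\<lambda>_. 0"]) simp
  next
    case (step a x y)
    then obtain j u where j: "j \<in> I" "x = c j" and y: "y = (\<Sum>i\<in>I. u i *s c i)" by auto
    have "a *s x + y = (\<Sum>i\<in>I. ((if i = j then a else 0) + u i) *s c i)"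
      unfolding scale_left_distrib sum.distrib y using j assms
      by (simp add: if_distrib[of "\<lambda>z. z *s _"] sum.delta cong: if_cong)
    then show ?case by (rule exI[where x = "\<lambda>i. (if i = j then a else 0) + u i"])
  qed
next
  assume "\<exists>u. v = (\<Sum>i\<in>I. u i *s c i)"
  then show "v \<in> span (c ` I)" by (auto intro!: span_sum span_scale intro: span_base)
qed

text \<open>A basis of \<open>W\<close> stays independent when \<open>w\<close> is added, so the
  values 0 on the basis and 1 at \<open>w\<close> extend linearly. The functional will later be
  normalised on the socle of a block.\<close>

lemma functional_exists:
  assumes W: "subspace W" and w: "w \<notin> W"
  shows "\<exists>f :: 'b \<Rightarrow> 'a. (\<forall>u v. f (u + v) = f u + f v) \<and> (\<forall>c v. f (c *s v) = c * f v) \<and> f w = 1 \<and> (\<forall>v\<in>W. f v = 0)"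
proof -
  interpret vp: vector_space_pair scale "(*) :: 'a \<Rightarrow> 'a \<Rightarrow> 'a"
    by unfold_locales (auto simp: algebra_simps)
  obtain B where B: "B \<subseteq> W" "independent B" "W \<subseteq> span B" using maximal_independent_subset by blast
  have sB: "span B = W" using B W by (metis span_minimal subset_antisym)
  have "independent (insert w B)" using B w sB by (simp add: independent_insertI)
  then obtain g where g: "Vector_Spaces.linear scale (*) g" "\<forall>x\<in>insert w B. g x = (if x = w then 1 else 0)"
    using vp.linear_independent_extend[of "insert w B" "\<lambda>x. if x = w then 1 else 0"] by blast
  have add: "g (u + v) = g u + g v" and sc: "g (c *s v) = c * g v" for u v c
    using g(1) unfolding Vector_Spaces.linear_iff by auto
  have "g v = 0" if "v \<in> W" for v
    using that unfolding sB[symmetric]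
  proof (induction rule: span_induct_alt)
    case base then show ?case using sc[of 0] by simp
  next
    case (step c x y) then show ?case using g(2) w B by (auto simp: add sc)
  qed
  then show ?thesis using g(2) add sc by (intro exI[of _ g]) auto
qed

text \<open>The ambient space may be infinite-dimensional, so finiteness enters through a finite set
  \<open>B0\<close> whose span contains all vectors in question. The same hypothesis recurs in the
  dimension counts below.\<close>

lemma dim_insert_notin:
  assumes "subspace N" "N \<subseteq> span B0" "finite B0" "y \<notin> N"
  shows "dim (span (insert y N)) = Suc (dim N)"
proof -
  obtain B where B: "B \<subseteq> N" "independent B" "N \<subseteq> span B" "card B = dim N" using basis_exists by blast
  have sB: "span B = N" using B assms by (metis span_minimal subset_antisym)
  have "B \<subseteq> span B0" using B assms by auto
  then have fin: "finite B" using independent_span_bound[OF \<open>finite B0\<close> B(2)] by blast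
  have "independent (insert y B)" using B assms sB by (simp add: independent_insertI)
  moreover have "span (insert y B) = span (insert y N)"
    using span_mono[of B "insert y B"] B by (subst span_eq) (auto intro: span_base)
  moreover have "card (insert y B) = Suc (dim N)" using fin B assms by (metis card_insert_disjoint subsetD)
  ultimately show ?thesis by (metis dim_eq_card dim_span)
qed

lemma dim_mono':
  assumes "N \<subseteq> span S" "S \<subseteq> span B0" "finite B0"
  shows "dim N \<le> dim S"
proof -
  obtain B where B: "B \<subseteq> S" "independent B" "S \<subseteq> span B" "card B = dim S" using basis_exists by blast
  have "B \<subseteq> span B0" using B assms by auto
  then have fin: "finite B" using independent_span_bound[OF \<open>finite B0\<close> B(2)] by blast
  have "N \<subseteq> span B" using assms(1) B by (metis span_mono span_span subset_trans)
  then show ?thesis using dim_le_card[OF _ fin] B by metis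
qed

text \<open>Independence modulo \<open>N\<close> keeps each \<open>c i\<close> out of the span of
  \<open>N\<close> and the vectors added before it, so every vector raises the dimension by one.
  With \<open>N = 0\<close> this bounds the length of an independent family, with \<open>N\<close> a
  complement it bounds the size of that complement.\<close>

lemma dim_add_independent:
  assumes fin: "finite I" "finite B0" and S: "subspace S" "S \<subseteq> span B0"
    and N: "subspace N" "N \<subseteq> S" and c: "\<And>i. i \<in> I \<Longrightarrow> c i \<in> S"
    and ind: "\<And>u. (\<Sum>i\<in>I. u i *s c i) \<in> N \<Longrightarrow> (\<forall>i\<in>I. u i = 0)"
  shows "dim N + card I \<le> dim S"
  using fin(1) N c ind
proof (induction I arbitrary: N rule: finite_induct)
  case empty
  then show ?case using dim_mono'[of N S B0] S fin span_superset by (metis add.right_neutral card.empty subset_trans)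
next
  case (insert j I)
  let ?N = "span (insert (c j) N)"
  have cj: "c j \<notin> N"
  proof
    assume "c j \<in> N"
    then have "(\<Sum>i\<in>insert j I. (if i = j then 1 else 0) *s c i) \<in> N"
      using insert.hyps by (simp add: if_distrib[of "\<lambda>z. z *s _"] sum.delta cong: if_cong)
    from insert.prems(4)[OF this] show False by auto
  qed
  have "dim ?N + card I \<le> dim S"
  proof (rule insert.IH)
    show "subspace ?N" by simp
    show "?N \<subseteq> S" using insert.prems S by (intro span_minimal) auto
    show "\<And>i. i \<in> I \<Longrightarrow> c i \<in> S" using insert.prems by auto
    fix u assume "(\<Sum>i\<in>I. u i *s c i) \<in> ?N"
    then obtain k where k: "(\<Sum>i\<in>I. u i *s c i) - k *s c j \<in> span N"
      unfolding span_breakdown_eq by blast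
    have sN: "span N = N" using insert.prems(1) by (metis span_eq_iff)
    have "(\<Sum>i\<in>insert j I. (if i = j then - k else u i) *s c i) = (\<Sum>i\<in>I. u i *s c i) - k *s c j"
      using insert.hyps by (auto simp: scale_minus_left intro!: sum.cong)
    with k sN have "(\<Sum>i\<in>insert j I. (if i = j then - k else u i) *s c i) \<in> N" by simp
    from insert.prems(4)[OF this] show "\<forall>i\<in>I. u i = 0" using insert.hyps by (metis insertCI)
  qed
  moreover have "dim ?N = Suc (dim N)"
    using insert.prems S fin cj by (intro dim_insert_notin) auto
  ultimately show ?case using insert.hyps by simp
qed

end

section \<open>Homogeneous operators and the splitting off of cyclic blocks\<close>

text \<open>A linear operator that is homogeneous of degree one for a grading by a set on which the shift
  has order \<open>sb\<close>; \<open>pr m\<close> projects to the component of degree \<open>m\<close>.\<close>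

locale graded_op = vspace scale for scale :: "'a::field \<Rightarrow> 'b::ab_group_add \<Rightarrow> 'b" (infixr "*s" 75) +
  fixes x :: "'b \<Rightarrow> 'b" and pr :: "'w \<Rightarrow> 'b \<Rightarrow> 'b" and sh :: "'w \<Rightarrow> 'w" and C F :: "'w set" and sb :: nat
  assumes x_lin: "linop x" and pr_lin: "linop (pr m)"
    and pr_pr: "pr m (pr n v) = (if m = n then pr n v else 0)"
    and x_pr: "m \<in> C \<Longrightarrow> x (pr m v) = pr (sh m) (x v)"
    and sh_C: "m \<in> C \<Longrightarrow> sh m \<in> C" and sh_inj: "inj_on sh C"
    and F: "finite F" "F \<subseteq> C" "v = (\<Sum>m\<in>F. pr m v)"
    and sb: "sb > 0" "m \<in> C \<Longrightarrow> (sh ^^ sb) m = m" "m \<in> C \<Longrightarrow> 0 < i \<Longrightarrow> i < sb \<Longrightarrow> (sh ^^ i) m \<noteq> m"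
begin

text \<open>The exponent that makes \<open>x ^ per b - b\<close> homogeneous: for nonzero
  \<open>b\<close> the operator \<open>x - b\<close> would mix degrees, whereas
  \<open>x ^ sb\<close> preserves them.\<close>

definition per :: "'a \<Rightarrow> nat" where "per b = (if b = 0 then 1 else sb)"
definition T :: "'a \<Rightarrow> 'b \<Rightarrow> 'b" where "T b v = (x ^^ per b) v - b *s v"
text \<open>The effect of \<open>T b\<close> on degrees.\<close>

definition tw :: "'a \<Rightarrow> 'w \<Rightarrow> 'w" where "tw b m = (if b = 0 then sh m else m)"

lemma per_pos: "per b > 0" using sb by (simp add: per_def)
lemma x_lin_pow: "linop (x ^^ i)" by (rule linop_funpow[OF x_lin])
lemma T_lin: "linop (T b)"
  using x_lin_pow[of "per b"] by (auto simp: T_def linop_def algebra_simps scale_right_diff_distrib)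
lemma T_lin_pow: "linop (T b ^^ i)" by (rule linop_funpow[OF T_lin])
lemma xT: "(x ^^ i) ((T b ^^ k) v) = (T b ^^ k) ((x ^^ i) v)"
proof (rule funpow_commute)
  fix v show "x (T b v) = T b (x v)"
    using funpow_commute[of x x "1" "per b" v]
    by (simp add: T_def linop_diff[OF x_lin] linop_scale[OF x_lin])
qed
lemma x_per: "(x ^^ per b) v = T b v + b *s v" by (simp add: T_def)
lemma T0: "T 0 = x" by (auto simp: T_def per_def fun_eq_iff)

lemma pr_out: assumes "m \<notin> F" shows "pr m v = 0"
proof -
  have "pr m v = (\<Sum>n\<in>F. pr m (pr n v))"
    by (subst F(3)[of v]) (rule linop_sum[OF pr_lin])
  also have "\<dots> = 0" using assms by (intro sum.neutral) (auto simp: pr_pr)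
  finally show ?thesis .
qed

lemma sh_pow_C: "m \<in> C \<Longrightarrow> (sh ^^ i) m \<in> C" by (induction i) (auto simp: sh_C)
lemma tw_C: "m \<in> C \<Longrightarrow> tw b m \<in> C" by (auto simp: tw_def sh_C)
lemma tw_pow_C: "m \<in> C \<Longrightarrow> (tw b ^^ i) m \<in> C" by (induction i) (auto simp: tw_C)
lemma x_pow_pr: "m \<in> C \<Longrightarrow> (x ^^ i) (pr m v) = pr ((sh ^^ i) m) ((x ^^ i) v)"
  by (induction i) (auto simp: x_pr sh_pow_C)
lemma T_pr: "m \<in> C \<Longrightarrow> T b (pr m v) = pr (tw b m) (T b v)"
  using sb x_pow_pr[of m "per b" v]
  by (auto simp: T_def tw_def per_def linop_diff[OF pr_lin] linop_scale[OF pr_lin])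
lemma T_pow_pr: "m \<in> C \<Longrightarrow> (T b ^^ i) (pr m v) = pr ((tw b ^^ i) m) ((T b ^^ i) v)"
  by (induction i) (auto simp: T_pr tw_pow_C)

lemma pr_other: "pr m v = v \<Longrightarrow> n \<noteq> m \<Longrightarrow> pr n v = 0"
  using pr_pr[of n m v] by auto

lemma T_pow_span:
  "(T b ^^ k) ((x ^^ j) v) \<in> span ((\<lambda>i. (x ^^ i) v) ` {..<k * per b + Suc j})"
proof (induction k)
  case 0
  show ?case by (auto intro: span_base)
next
  case (Suc k)
  have "T b ((T b ^^ k) ((x ^^ j) v)) \<in> span ((\<lambda>i. (x ^^ i) v) ` {..<Suc k * per b + Suc j})"
  proof (rule linop_span[OF T_lin Suc.IH])
    fix a assume "a \<in> (\<lambda>i. (x ^^ i) v) ` {..<k * per b + Suc j}"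
    then obtain i where i: "i < k * per b + Suc j" "a = (x ^^ i) v" by auto
    have "T b a = (x ^^ (per b + i)) v - b *s (x ^^ i) v" by (simp add: T_def i funpow_add)
    also have "\<dots> \<in> span ((\<lambda>i. (x ^^ i) v) ` {..<Suc k * per b + Suc j})"
      using i(1) by (intro span_diff span_scale span_base) auto
    finally show "T b a \<in> span ((\<lambda>i. (x ^^ i) v) ` {..<Suc k * per b + Suc j})" .
  qed simp
  then show ?case by simp
qed

text \<open>The Gram matrix of the vectors \<open>x ^ j T ^ k v\<close> under \<open>f\<close> is
  triangular in \<open>k\<close>. Testing with \<open>T ^ (t - k)\<close> kills the terms of larger
  exponent because \<open>T ^ (t + 1) v = 0\<close>, the terms of smaller exponent have coefficient
  zero by induction, and among those of exponent \<open>k\<close> a suitable power of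
  \<open>x\<close> isolates one.\<close>

lemma pairing_nondegenerate:
  fixes f :: "'b \<Rightarrow> 'a"
  assumes f_add: "\<And>u v. f (u + v) = f u + f v" and f_scale: "\<And>c v. f (c *s v) = c * f v"
    and f0: "\<And>n. n < 2 * per b \<Longrightarrow> f ((x ^^ n) ((T b ^^ t) v)) = (if n = 0 then 1 else if n = per b then b else 0)"
    and v: "(T b ^^ Suc t) v = 0"
    and c: "\<And>i l. i < per b \<Longrightarrow> l \<le> t \<Longrightarrow>
      f ((x ^^ i) ((T b ^^ l) (\<Sum>(j, k)\<in>{..<per b} \<times> {..t}. c (j, k) *s (x ^^ j) ((T b ^^ k) v)))) = 0"
    and "j < per b" "k \<le> t"
  shows "c (j, k) = 0"
  using assms(6,7)
proof (induction k arbitrary: j rule: less_induct)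
  case (less k)
  have f_sum: "f (\<Sum>i\<in>I. g i) = (\<Sum>i\<in>I. f (g i))" for I :: "(nat \<times> nat) set" and g
    using f_scale[of 0 0] by (induction I rule: infinite_finite_induct) (auto simp: f_add)
  have f00: "f 0 = 0" using f_scale[of 0 0] by simp
  \<comment> \<open>Then \<open>i + j\<close> is 0 or \<open>per b\<close>, the only exponents below
    \<open>2 * per b\<close> at which \<open>f\<close> can be nonzero.\<close>
  define i where "i = (if j = 0 then 0 else per b - j)"
  have i: "i < per b" using less.prems per_pos by (auto simp: i_def)
  have Tz: "(T b ^^ l) v = 0" if "l > t" for l
  proof -
    have "l = (l - Suc t) + Suc t" using that by simp
    then obtain d where "l = d + Suc t" by blast
    then show ?thesis using v linop_0[OF T_lin_pow, of d b] by (simp only: funpow_add comp_apply)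
  qed
  have trm: "f (c (j', k') *s (x ^^ i) ((T b ^^ (t - k)) ((x ^^ j') ((T b ^^ k') v))))
      = (if (j', k') = (j, k) then c (j, k) * (if j = 0 then 1 else b) else 0)"
    if "j' < per b" "k' \<le> t" for j' k'
  proof -
    have e: "(x ^^ i) ((T b ^^ (t - k)) ((x ^^ j') ((T b ^^ k') v))) = (x ^^ (i + j')) ((T b ^^ (t - k + k')) v)"
      by (simp add: xT[symmetric] funpow_plus)
    consider "k' < k" | "k' = k" | "k' > k" by linarith
    then show ?thesis
    proof cases
      case 1
      then have "c (j', k') = 0" using less.IH[of k' j'] that less.prems by auto
      then show ?thesis using 1 by (simp add: f00)
    next
      case 2
      have "f ((x ^^ (i + j')) ((T b ^^ t) v)) = (if j' = j then (if j = 0 then 1 else b) else 0)"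
        using f0[of "i + j'"] i that less.prems by (auto simp: i_def split: if_splits)
      then show ?thesis using 2 less.prems unfolding e by (auto simp: f_scale)
    next
      case 3
      then have "(T b ^^ (t - k + k')) v = 0" using less.prems by (intro Tz) auto
      then show ?thesis using 3 unfolding e by (simp add: linop_0[OF x_lin_pow] f00)
    qed
  qed
  have "0 = f ((x ^^ i) ((T b ^^ (t - k)) (\<Sum>(j, k)\<in>{..<per b} \<times> {..t}. c (j, k) *s (x ^^ j) ((T b ^^ k) v))))"
    using c[of i "t - k"] i by simp
  also have "\<dots> = (\<Sum>p\<in>{..<per b} \<times> {..t}. f (c p *s (x ^^ i) ((T b ^^ (t - k)) ((x ^^ fst p) ((T b ^^ snd p) v)))))"
    by (simp add: linop_sum[OF x_lin_pow] linop_sum[OF T_lin_pow] linop_scale[OF x_lin_pow] linop_scale[OF T_lin_pow]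
        f_sum case_prod_unfold)
  also have "\<dots> = (\<Sum>p\<in>{..<per b} \<times> {..t}. if p = (j, k) then c (j, k) * (if j = 0 then 1 else b) else 0)"
  proof (rule sum.cong)
    fix p :: "nat \<times> nat" assume p: "p \<in> {..<per b} \<times> {..t}"
    show "f (c p *s (x ^^ i) ((T b ^^ (t - k)) ((x ^^ fst p) ((T b ^^ snd p) v))))
        = (if p = (j, k) then c (j, k) * (if j = 0 then 1 else b) else 0)"
      using p trm[of "fst p" "snd p"] by (cases p) (simp del: if_split)
  qed simp
  also have "\<dots> = c (j, k) * (if j = 0 then 1 else b)" using less.prems by (simp add: sum.delta)
  \<comment> \<open>For \<open>j > 0\<close> the period exceeds one, so \<open>b\<close> is nonzero
    and can be cancelled.\<close>
  finally show ?case using less.prems by (auto simp: per_def split: if_splits)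
qed

text \<open>The complement is the annihilator \<open>N\<close> of the functionals
  \<open>f (x ^ i (T ^ l _))\<close>. It is stable under \<open>x\<close> because
  \<open>x ^ per b = T b + b\<close> and \<open>f\<close> vanishes on \<open>T ^ (t + 1) S\<close>;
  the last hypothesis on \<open>v\<close> is what makes such an \<open>f\<close> with value 1 at
  \<open>T ^ t v\<close> possible. That \<open>N\<close> meets the line of \<open>T ^ t v\<close>
  only in zero is recorded because it later excludes a second block of the same length.\<close>

lemma split_block:
  assumes S: "subspace S" "S \<subseteq> span B0" "finite B0" and xS: "\<And>u. u \<in> S \<Longrightarrow> x u \<in> S"
    and prS: "\<And>u n. u \<in> S \<Longrightarrow> pr n u \<in> S"
    and v: "v \<in> S" "m \<in> C" "pr m v = v" "(T b ^^ Suc t) v = 0" "(T b ^^ t) v \<notin> (T b ^^ Suc t) ` S"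
  shows "\<exists>N. subspace N \<and> N \<subseteq> S \<and> (\<forall>u\<in>N. x u \<in> N) \<and> (\<forall>n. \<forall>u\<in>N. pr n u \<in> N)
    \<and> (\<forall>u\<in>S. \<exists>y\<in>span ((\<lambda>i. (x ^^ i) v) ` {..<Suc t * per b}). u - y \<in> N)
    \<and> dim N + Suc t * per b \<le> dim S \<and> (\<forall>c. c *s (T b ^^ t) v \<in> N \<longrightarrow> c = 0)"
proof -
  let ?p = "per b"
  have xpS: "(x ^^ i) u \<in> S" if "u \<in> S" for i u using that by (induction i) (auto simp: xS)
  have TS: "T b u \<in> S" if "u \<in> S" for u using that xpS S by (auto simp: T_def intro!: subspace_diff subspace_scale)
  have TpS: "(T b ^^ i) u \<in> S" if "u \<in> S" for i u using that by (induction i) (auto simp: TS)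
  define w0 where "w0 = (T b ^^ t) v"
  define m' where "m' = (tw b ^^ t) m"
  have m': "m' \<in> C" "pr m' w0 = w0" using v T_pow_pr[of m t b v] by (auto simp: m'_def w0_def tw_pow_C)
  have "subspace ((T b ^^ Suc t) ` S)"
    by (rule linop_image_subspace[OF T_lin_pow S(1)])
  from functional_exists[OF this v(5)] obtain f0 :: "'b \<Rightarrow> 'a" where
    f0: "\<And>u v. f0 (u + v) = f0 u + f0 v" "\<And>c v. f0 (c *s v) = c * f0 v" "f0 w0 = 1"
      "\<And>u. u \<in> S \<Longrightarrow> f0 ((T b ^^ Suc t) u) = 0" unfolding w0_def by blast
  have f00: "f0 0 = 0" using f0(2)[of 0 0] by simp
  \<comment> \<open>Composing with the projection to the degree of \<open>w0\<close> lets
    \<open>f\<close> see one degree only, which makes \<open>N\<close> a graded subspace.\<close>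
  define f where "f u = f0 (pr m' u)" for u
  have f_add: "f (u + v) = f u + f v" and f_scale: "f (c *s v) = c * f v" for u v c
    by (auto simp: f_def linop_add[OF pr_lin] linop_scale[OF pr_lin] f0)
  have f_diff: "f (u - v) = f u - f v" for u v using f_add[of "u - v" v] by simp
  \<comment> \<open>Projecting does not leave \<open>T ^ (t + 1) S\<close>: the component of
    \<open>T ^ (t + 1) u\<close> in degree \<open>m'\<close> is \<open>T ^ (t + 1)\<close> of a sum
    of components of \<open>u\<close>.\<close>
  have fT: "f ((T b ^^ Suc t) u) = 0" if "u \<in> S" for u
  proof -
    have "(T b ^^ Suc t) u = (\<Sum>n\<in>F. (T b ^^ Suc t) (pr n u))"
      by (subst F(3)[of u]) (rule linop_sum[OF T_lin_pow])
    then have "pr m' ((T b ^^ Suc t) u) = (\<Sum>n\<in>F. pr m' ((T b ^^ Suc t) (pr n u)))"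
      by (simp only: linop_sum[OF pr_lin])
    also have "\<dots> = (\<Sum>n\<in>F. if m' = (tw b ^^ Suc t) n then (T b ^^ Suc t) (pr n u) else 0)"
    proof (rule sum.cong)
      fix n assume "n \<in> F"
      then have "(T b ^^ Suc t) (pr n u) = pr ((tw b ^^ Suc t) n) ((T b ^^ Suc t) u)"
        using F(2) by (intro T_pow_pr) auto
      then show "pr m' ((T b ^^ Suc t) (pr n u)) = (if m' = (tw b ^^ Suc t) n then (T b ^^ Suc t) (pr n u) else 0)"
        by (simp only: pr_pr split: if_split)
    qed simp
    finally have "f ((T b ^^ Suc t) u) = f0 (\<Sum>n\<in>F. if m' = (tw b ^^ Suc t) n then (T b ^^ Suc t) (pr n u) else 0)"
      by (simp add: f_def)
    also have "\<dots> = f0 ((T b ^^ Suc t) (\<Sum>n\<in>F. if m' = (tw b ^^ Suc t) n then pr n u else 0))"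
      unfolding linop_sum[OF T_lin_pow] by (intro arg_cong[of _ _ f0] sum.cong) (auto simp: linop_0[OF T_lin_pow] simp del: funpow.simps)
    also have "\<dots> = 0"
      by (rule f0(4)) (use that prS S in \<open>auto intro!: subspace_sum simp: subspace_0\<close>)
    finally show ?thesis .
  qed
  have fw: "f ((x ^^ n) w0) = (if n = 0 then 1 else if n = ?p then b else 0)" if n: "n < 2 * ?p" for n
  proof -
    have *: "pr ((sh ^^ n) m') ((x ^^ n) w0) = (x ^^ n) w0" using x_pow_pr[of m' n w0] m' by simp
    consider "n = 0" | "n = ?p" "n \<noteq> 0" | "n \<noteq> 0" "n \<noteq> ?p" by blast
    then show ?thesis
    proof cases
      case 1 then show ?thesis using f0 m' by (simp add: f_def)
    next
      case 2
      have "f ((x ^^ ?p) w0) = f (T b w0) + b * f w0" by (simp add: x_per f_add f_scale)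
      also have "f (T b w0) = 0" using v(4) f00 by (simp add: w0_def f_def linop_0[OF pr_lin])
      also have "f w0 = 1" using f0 m' by (simp add: f_def)
      finally show ?thesis using 2 by simp
    next
      case 3
      then have b: "?p = sb" using n by (auto simp: per_def split: if_splits)
      \<comment> \<open>The shift has exact order \<open>sb\<close>, so below \<open>2 * sb\<close>
        only the exponents 0 and \<open>sb\<close> return to the degree \<open>m'\<close>.\<close>
      have "(sh ^^ n) m' \<noteq> m'"
      proof (cases "n < sb")
        case True then show ?thesis using sb(3)[OF m'(1)] 3 by auto
      next
        case False
        then have "n = sb + (n - sb)" "n - sb < sb" "n - sb > 0" using 3 b n by auto
        moreover have "(sh ^^ n) m' = (sh ^^ (n - sb)) m'"
          using calculation(1) sb(2)[OF m'(1)] by (metis add.commute comp_apply funpow_add)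
        ultimately show ?thesis using sb(3)[OF m'(1), of "n - sb"] by auto
      qed
      then have "pr m' ((x ^^ n) w0) = 0" using pr_other[OF *, of m'] by auto
      then show ?thesis using 3 f00 by (simp add: f_def)
    qed
  qed
  let ?I = "{..<?p} \<times> {..t}"
  define c where "c q = (x ^^ fst q) ((T b ^^ snd q) v)" for q :: "nat \<times> nat"
  define ph where "ph q u = f ((x ^^ fst q) ((T b ^^ snd q) u))" for q :: "nat \<times> nat" and u
  have ph_add: "ph q (u + u') = ph q u + ph q u'" and ph_scale: "ph q (a *s u) = a * ph q u"
    and ph_diff: "ph q (u - u') = ph q u - ph q u'" for q u u' a
    by (auto simp: ph_def linop_add[OF x_lin_pow] linop_add[OF T_lin_pow] linop_scale[OF x_lin_pow] linop_scale[OF T_lin_pow] f_add f_scale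
        linop_diff[OF x_lin_pow] linop_diff[OF T_lin_pow] f_diff)
  have ph_sum: "ph q (\<Sum>i\<in>I. a i *s g i) = (\<Sum>i\<in>I. ph q (g i) * a i)" for q g a and I :: "(nat \<times> nat) set"
    using ph_scale[of q 0 0] by (induction I rule: infinite_finite_induct) (auto simp: ph_add ph_scale mult.commute)
  have nd: "\<forall>q\<in>?I. u q = 0" if "\<And>q. q \<in> ?I \<Longrightarrow> ph q (\<Sum>r\<in>?I. u r *s c r) = 0" for u
  proof -
    have "u (j, k) = 0" if "j < ?p" "k \<le> t" for j k
    proof (rule pairing_nondegenerate[of f b t v u, OF f_add f_scale _ v(4) _ that])
      show "\<And>n. n < 2 * ?p \<Longrightarrow> f ((x ^^ n) ((T b ^^ t) v)) = (if n = 0 then 1 else if n = ?p then b else 0)"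
        using fw unfolding w0_def .
      fix i l assume "i < ?p" "l \<le> t"
      then show "f ((x ^^ i) ((T b ^^ l) (\<Sum>(j, k)\<in>?I. u (j, k) *s (x ^^ j) ((T b ^^ k) v)))) = 0"
        using \<open>\<And>q. q \<in> ?I \<Longrightarrow> ph q (\<Sum>r\<in>?I. u r *s c r) = 0\<close>[of "(i, l)"]
        by (simp add: ph_def c_def case_prod_unfold)
    qed
    then show ?thesis by auto
  qed
  define N where "N = {u\<in>S. \<forall>q\<in>?I. ph q u = 0}"
  have sN: "subspace N" using S(1) ph_add ph_scale ph_scale[of _ 0 0] unfolding N_def subspace_def by auto
  have NS: "N \<subseteq> S" by (auto simp: N_def)
  have phN: "f ((x ^^ i) ((T b ^^ l) u)) = 0" if "u \<in> N" "i < ?p" "l \<le> t" for u i l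
  proof -
    have "ph (i, l) u = 0" using that unfolding N_def by blast
    then show ?thesis by (simp add: ph_def)
  qed
  have xN: "x u \<in> N" if u: "u \<in> N" for u
  proof -
    have "ph (i, l) (x u) = 0" if "i < ?p" "l \<le> t" for i l
    proof -
      have e: "ph (i, l) (x u) = f ((x ^^ Suc i) ((T b ^^ l) u))"
        using xT[of 1 l b u] by (simp add: ph_def funpow_swap1)
      show ?thesis
      proof (cases "Suc i < ?p")
        case True then show ?thesis using phN[OF u True] that unfolding e by blast
      next
        case False
        then have "Suc i = ?p" using that by auto
        then have "ph (i, l) (x u) = f ((T b ^^ Suc l) u) + b * f ((T b ^^ l) u)"
          unfolding e by (simp only: x_per f_add f_scale) simp
        moreover have "f ((T b ^^ l) u) = 0" using phN[OF u, of 0 l] that per_pos[of b] by simp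
        moreover have "f ((T b ^^ Suc l) u) = 0"
        proof (cases "l = t")
          case True then show ?thesis using fT[of u] u NS by (auto simp del: funpow.simps)
        next
          case False then show ?thesis using phN[OF u, of 0 "Suc l"] that per_pos[of b] by simp
        qed
        ultimately show ?thesis by simp
      qed
    qed
    then show ?thesis using u xS by (auto simp: N_def)
  qed
  have prN: "pr n u \<in> N" if u: "u \<in> N" for n u
  proof (cases "n \<in> F")
    case False then show ?thesis using sN by (simp add: pr_out subspace_0)
  next
    case True
    then have n: "n \<in> C" using F by auto
    have "ph q (pr n u) = 0" if "q \<in> ?I" for q
    proof -
      have "ph q u = 0" using u that by (auto simp: N_def)
      then show ?thesis using f00
        by (auto simp: ph_def f_def T_pow_pr[OF n] x_pow_pr[OF tw_pow_C[OF n]] pr_pr linop_0[OF pr_lin])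
    qed
    then show ?thesis using u prS by (auto simp: N_def)
  qed
  have cS: "c q \<in> S" for q using v xpS TpS by (auto simp: c_def)
  have card: "card ?I = Suc t * ?p" by (simp add: card_cartesian_product)
  have dimN: "dim N + Suc t * ?p \<le> dim S"
    unfolding card[symmetric]
  proof (rule dim_add_independent[OF _ S(3) S(1,2) sN NS cS])
    fix u assume "(\<Sum>i\<in>?I. u i *s c i) \<in> N"
    then show "\<forall>i\<in>?I. u i = 0" by (intro nd) (auto simp: N_def)
  qed auto
  have compl: "\<exists>y\<in>span ((\<lambda>i. (x ^^ i) v) ` {..<Suc t * ?p}). u - y \<in> N" if u: "u \<in> S" for u
  proof -
    have "\<exists>a. \<forall>q\<in>?I. (\<Sum>r\<in>?I. ph q (c r) * a r) = ph q u"
    proof (rule square_system_solvable)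
      show "finite ?I" by simp
      fix a assume "\<And>i. i \<in> ?I \<Longrightarrow> (\<Sum>j\<in>?I. ph i (c j) * a j) = 0"
      then show "\<forall>j\<in>?I. a j = 0" by (intro nd) (simp add: ph_sum)
    qed
    then obtain a where a: "\<And>q. q \<in> ?I \<Longrightarrow> ph q (\<Sum>r\<in>?I. a r *s c r) = ph q u" by (auto simp: ph_sum)
    show ?thesis
    proof (rule bexI)
      show "u - (\<Sum>r\<in>?I. a r *s c r) \<in> N"
        using a u cS S by (auto simp: N_def ph_diff intro!: subspace_diff subspace_sum subspace_scale)
      show "(\<Sum>r\<in>?I. a r *s c r) \<in> span ((\<lambda>i. (x ^^ i) v) ` {..<Suc t * ?p})"
      proof (intro span_sum span_scale)
        fix r assume "r \<in> ?I"
        then obtain j k where r: "r = (j, k)" "j < ?p" "k \<le> t" by auto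
        have "k * ?p + Suc j \<le> Suc k * ?p" using r by simp
        also have "\<dots> \<le> Suc t * ?p" using r by (intro mult_right_mono) auto
        finally have "span ((\<lambda>i. (x ^^ i) v) ` {..<k * ?p + Suc j}) \<subseteq> span ((\<lambda>i. (x ^^ i) v) ` {..<Suc t * ?p})"
          by (intro span_mono image_mono) auto
        then show "c r \<in> span ((\<lambda>i. (x ^^ i) v) ` {..<Suc t * ?p})"
          using T_pow_span[of k b j v] r by (auto simp: c_def xT)
      qed
    qed
  qed
  have k0: "k = 0" if "k *s w0 \<in> N" for k
  proof -
    have "ph (0, 0) (k *s w0) = 0" using that per_pos unfolding N_def by blast
    then show ?thesis using fw[of 0] per_pos[of b] by (simp add: ph_scale) (simp add: ph_def)
  qed
  show ?thesis unfolding w0_def[symmetric]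
    by (intro exI[of _ N] conjI ballI allI impI; (rule sN NS dimN | erule xN prN compl k0))
qed

text \<open>The vectors \<open>v, T v, ..., T ^ t v\<close> are independent. The bound guarantees
  that a vector of maximal order exists.\<close>

lemma chain_bound:
  assumes S: "subspace S" "S \<subseteq> span B0" "finite B0"
    and TS: "\<And>u. u \<in> S \<Longrightarrow> T b u \<in> S"
    and v: "v \<in> S" "(T b ^^ t) v \<noteq> 0" "(T b ^^ Suc t) v = 0"
  shows "t < dim S"
proof -
  have Tz: "(T b ^^ l) v = 0" if "l > t" for l
  proof -
    have "l = (l - Suc t) + Suc t" using that by simp
    then obtain d where "l = d + Suc t" by blast
    then show ?thesis using v(3) linop_0[OF T_lin_pow, of d b] by (simp only: funpow_add comp_apply)
  qed
  have "dim {0} + card {..t} \<le> dim S"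
  proof (rule dim_add_independent[OF _ S(3) S(1,2)])
    show "\<And>i. i \<in> {..t} \<Longrightarrow> (T b ^^ i) v \<in> S"
      using v(1) TS by (rule funpow_invariant)
    fix u assume z: "(\<Sum>i\<le>t. u i *s (T b ^^ i) v) \<in> {0}"
    have "u i = 0" if "i \<le> t" for i using that
    proof (induction i rule: less_induct)
      case (less i)
      have "0 = (T b ^^ (t - i)) (\<Sum>j\<le>t. u j *s (T b ^^ j) v)"
        using z linop_0[OF T_lin_pow] by simp
      also have "\<dots> = (\<Sum>j\<le>t. u j *s (T b ^^ (t - i + j)) v)"
        by (simp add: linop_comb[OF T_lin_pow] funpow_plus)
      also have "\<dots> = (\<Sum>j\<le>t. if j = i then u i *s (T b ^^ t) v else 0)"
      proof (rule sum.cong)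
        fix j assume "j \<in> {..t}"
        consider "j < i" | "j = i" | "j > i" by linarith
        then show "u j *s (T b ^^ (t - i + j)) v = (if j = i then u i *s (T b ^^ t) v else 0)"
          by cases (use less Tz[of "t - i + j"] in auto)
      qed simp
      also have "\<dots> = u i *s (T b ^^ t) v" using less.prems by (simp add: sum.delta)
      finally show "u i = 0" using v(2) by simp
    qed
    then show "\<forall>i\<in>{..t}. u i = 0" by auto
  qed (use S in \<open>auto simp: subspace_0\<close>)
  then show ?thesis by simp
qed

text \<open>A homogeneous vector of maximal finite order works: if \<open>T ^ t v\<close> were in
  \<open>T ^ (t + 1) S\<close>, then a preimage would have order \<open>t + 2\<close>, and so would
  one of its homogeneous components.\<close>

lemma kernel_block:
  assumes S: "subspace S" "S \<subseteq> span B0" "finite B0" and xS: "\<And>u. u \<in> S \<Longrightarrow> x u \<in> S"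
    and prS: "\<And>u n. u \<in> S \<Longrightarrow> pr n u \<in> S"
    and u: "u \<in> S" "u \<noteq> 0" "T b u = 0"
  shows "\<exists>m\<in>C. \<exists>v\<in>S. \<exists>t. pr m v = v \<and> (T b ^^ Suc t) v = 0 \<and> (T b ^^ t) v \<notin> (T b ^^ Suc t) ` S"
proof -
  have xpS: "(x ^^ i) u \<in> S" if "u \<in> S" for i u using that by (induction i) (auto simp: xS)
  have TS: "T b u \<in> S" if "u \<in> S" for u using that xpS S by (auto simp: T_def intro!: subspace_diff subspace_scale)
  define P where "P t \<longleftrightarrow> (\<exists>m\<in>C. \<exists>v\<in>S. pr m v = v \<and> (T b ^^ t) v \<noteq> 0 \<and> (T b ^^ Suc t) v = 0)" for t
  have comp: "P t" if w: "w \<in> S" "(T b ^^ t) w \<noteq> 0" "(T b ^^ Suc t) w = 0" for t w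
  proof -
    have "(T b ^^ t) w = (\<Sum>m\<in>F. (T b ^^ t) (pr m w))"
      by (subst F(3)[of w]) (rule linop_sum[OF T_lin_pow])
    then obtain m where m: "m \<in> F" "(T b ^^ t) (pr m w) \<noteq> 0" using w(2) by (metis (no_types, lifting) sum.neutral)
    have "(T b ^^ Suc t) (pr m w) = 0"
      using m(1) F(2) T_pow_pr[of m "Suc t" b w] w(3) linop_0[OF pr_lin] by (metis subsetD)
    then show ?thesis using m F(2) w(1) prS unfolding P_def by (intro bexI[of _ m] bexI[of _ "pr m w"]) (auto simp: pr_pr)
  qed
  have "P 0" using comp[of u 0] u by simp
  moreover have bound: "P t \<Longrightarrow> t \<le> dim S" for t
    using chain_bound[OF S TS] unfolding P_def by (meson less_imp_le)
  ultimately obtain t where t: "P t" "\<And>t'. P t' \<Longrightarrow> t' \<le> t"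
    using GreatestI_nat[of P 0 "dim S"] Greatest_le_nat[of P _ "dim S"] by blast
  then obtain m v where v: "m \<in> C" "v \<in> S" "pr m v = v" "(T b ^^ t) v \<noteq> 0" "(T b ^^ Suc t) v = 0"
    unfolding P_def by blast
  have "(T b ^^ t) v \<notin> (T b ^^ Suc t) ` S"
  proof
    assume "(T b ^^ t) v \<in> (T b ^^ Suc t) ` S"
    then obtain w where w: "w \<in> S" "(T b ^^ t) v = (T b ^^ Suc t) w" by auto
    then have "(T b ^^ Suc t) w \<noteq> 0" "(T b ^^ Suc (Suc t)) w = 0" using v by auto
    then have "P (Suc t)" using comp w by blast
    then show False using t(2)[of "Suc t"] by simp
  qed
  then show ?thesis using v by blast
qed

text \<open>More than \<open>dim S\<close> powers \<open>U ^ i u\<close> satisfy a relation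
  \<open>p(U) u = 0\<close>. Splitting a root \<open>z\<close> off \<open>p = (X - z) q\<close>
  leaves either the eigenvector \<open>q(U) u\<close> or a relation of smaller degree.\<close>

lemma eigenvector_exists:
  assumes alg: "\<And>p :: 'a poly. degree p > 0 \<Longrightarrow> \<exists>z. poly p z = 0"
    and S: "subspace S" "S \<subseteq> span B0" "finite B0" and US: "\<And>u. u \<in> S \<Longrightarrow> U u \<in> S" and U: "linop U"
    and u: "u \<in> S" "u \<noteq> 0"
  shows "\<exists>w\<in>S. \<exists>b. w \<noteq> 0 \<and> U w = b *s w"
proof -
  have UpS: "(U ^^ i) u \<in> S" if "u \<in> S" for i u using that by (induction i) (auto simp: US)
  have Upl: "linop (U ^^ i)" for i by (rule linop_funpow[OF U])
  \<comment> \<open>This is the value \<open>p(U) u\<close>.\<close>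
  define pe where "pe p = (\<Sum>i\<le>degree p. coeff p i *s (U ^^ i) u)" for p
  have pe: "pe p = (\<Sum>i\<le>n. coeff p i *s (U ^^ i) u)" if "degree p \<le> n" for p n
    unfolding pe_def using that by (intro sum.mono_neutral_left) (auto simp: coeff_eq_0)
  have main: "\<exists>w\<in>S. \<exists>b. w \<noteq> 0 \<and> U w = b *s w" if "p \<noteq> 0" "pe p = 0" for p
    using that
  proof (induction "degree p" arbitrary: p)
    case 0
    then have "coeff p 0 *s u = 0" by (simp add: pe_def)
    moreover have "coeff p 0 \<noteq> 0" using 0 by (metis leading_coeff_0_iff)
    ultimately show ?case using u by simp
  next
    case (Suc n)
    then obtain z where "poly p z = 0" using alg[of p] by auto
    then obtain q where q: "p = [:- z, 1:] * q" by (auto simp: poly_eq_0_iff_dvd dvd_def)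
    have q0: "q \<noteq> 0" using q Suc by auto
    have "degree p = degree [:- z, 1:] + degree q" unfolding q using q0 by (intro degree_mult_eq) auto
    then have dq: "degree q = n" using Suc(2) by simp
    have "pe p = (\<Sum>i\<le>Suc n. coeff p i *s (U ^^ i) u)" using Suc by (intro pe) simp
    also have "\<dots> = (\<Sum>i\<le>Suc n. coeff (pCons 0 q) i *s (U ^^ i) u) - z *s (\<Sum>i\<le>Suc n. coeff q i *s (U ^^ i) u)"
      unfolding q by (simp add: scale_left_diff_distrib scale_minus_left sum_subtractf scale_sum_right del: sum.atMost_Suc)
    also have "(\<Sum>i\<le>Suc n. coeff (pCons 0 q) i *s (U ^^ i) u) = U (pe q)"
      by (subst sum.atMost_Suc_shift) (simp add: pe_def dq linop_comb[OF U])
    also have "(\<Sum>i\<le>Suc n. coeff q i *s (U ^^ i) u) = pe q" using dq by (intro pe[symmetric]) simp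
    finally have e: "U (pe q) = z *s pe q" using Suc by simp
    show ?case
    proof (cases "pe q = 0")
      case True then show ?thesis using Suc(1)[of q] dq q0 by auto
    next
      case False
      have "pe q \<in> S" unfolding pe_def using S UpS u by (intro subspace_sum subspace_scale) auto
      then show ?thesis using False e by blast
    qed
  qed
  have "\<exists>c. (\<Sum>i\<le>dim S. c i *s (U ^^ i) u) = 0 \<and> (\<exists>i\<le>dim S. c i \<noteq> 0)"
  proof (rule ccontr)
    assume *: "\<not> ?thesis"
    have "dim {0} + card {..dim S} \<le> dim S"
      by (rule dim_add_independent[OF _ S(3) S(1,2), where c = "\<lambda>i. (U ^^ i) u"])
        (use * S UpS u in \<open>auto simp: subspace_0\<close>)
    then show False by simp
  qed
  then obtain c i where c: "(\<Sum>i\<le>dim S. c i *s (U ^^ i) u) = 0" "i \<le> dim S" "c i \<noteq> 0" by blast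
  define p where "p = (\<Sum>i\<le>dim S. monom (c i) i)"
  have cp: "coeff p j = (if j \<le> dim S then c j else 0)" for j
    by (auto simp: p_def coeff_sum sum.delta)
  have "degree p \<le> dim S" by (rule degree_le) (simp add: cp)
  then have "pe p = 0" using c by (simp add: pe[of p "dim S"] cp)
  moreover have "p \<noteq> 0" using cp[of i] c by auto
  ultimately show ?thesis using main by blast
qed

definition is_block :: "'b set \<Rightarrow> 'b \<times> 'w \<times> nat \<times> 'a \<Rightarrow> bool" where
  "is_block S = (\<lambda>(v, m, t, b). v \<in> S \<and> m \<in> C \<and> pr m v = v \<and> t > 0 \<and> (T b ^^ t) v = 0 \<and> (T b ^^ (t - 1)) v \<noteq> 0)"

definition block_size :: "'b \<times> 'w \<times> nat \<times> 'a \<Rightarrow> nat" where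
  "block_size = (\<lambda>(v, m, t, b). t * per b)"

definition block_vecs :: "'b \<times> 'w \<times> nat \<times> 'a \<Rightarrow> 'b set" where
  "block_vecs = (\<lambda>(v, m, t, b). (\<lambda>i. (x ^^ i) v) ` {..<t * per b})"

text \<open>Every nonzero \<open>S\<close> contains a kernel vector of some \<open>T b\<close>,
  hence a vector of maximal order, whose block splits off; the dimension of the complement is
  smaller. Only an upper bound for the total size is carried along, since together with the spanning
  property it becomes an equality by counting.\<close>

theorem classification:
  assumes alg: "\<And>p :: 'a poly. degree p > 0 \<Longrightarrow> \<exists>z. poly p z = 0"
    and S: "subspace S" "S \<subseteq> span B0" "finite B0" and xS: "\<And>u. u \<in> S \<Longrightarrow> x u \<in> S"
    and prS: "\<And>u n. u \<in> S \<Longrightarrow> pr n u \<in> S"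
  shows "\<exists>Bs. (\<forall>B\<in>set Bs. is_block S B) \<and> (\<Sum>B\<leftarrow>Bs. block_size B) \<le> dim S \<and> S \<subseteq> span (\<Union>B\<in>set Bs. block_vecs B)"
  using S(1,2) xS prS
proof (induction "dim S" arbitrary: S rule: less_induct)
  case less
  note S = less.prems(1,2) \<open>finite B0\<close> and xS = less.prems(3) and prS = less.prems(4)
  have xpS: "(x ^^ i) u \<in> S" if "u \<in> S" for i u using that by (induction i) (auto simp: xS)
  show ?case
  proof (cases "S = {0}")
    case True
    then show ?thesis by (intro exI[of _ "[]"]) (auto simp: span_zero)
  next
    case False
    have "\<exists>b. \<exists>u\<in>S. u \<noteq> 0 \<and> T b u = 0"
    proof (cases "\<exists>u\<in>S. u \<noteq> 0 \<and> x u = 0")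
      case True then show ?thesis by (intro exI[of _ 0]) (simp add: T0)
    next
      case no: False
      obtain u where u: "u \<in> S" "u \<noteq> 0" using False subspace_0[OF S(1)] by blast
      have "\<exists>w\<in>S. \<exists>b. w \<noteq> 0 \<and> (x ^^ sb) w = b *s w"
        using u by (intro eigenvector_exists[OF alg S xpS x_lin_pow])
      then obtain w b where w: "w \<in> S" "w \<noteq> 0" "(x ^^ sb) w = b *s w" by blast
      \<comment> \<open>Since \<open>x\<close> is injective on \<open>S\<close>, the eigenvalue of
        \<open>x ^ sb\<close> is nonzero, so that \<open>per b\<close> is indeed
        \<open>sb\<close>.\<close>
      have "(x ^^ i) w \<noteq> 0" for i using no w xpS by (induction i) auto
      then have "b \<noteq> 0" using w by (metis scale_zero_left)
      then show ?thesis using w by (intro exI[of _ b] bexI[of _ w]) (auto simp: T_def per_def)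
    qed
    then obtain b u where "u \<in> S" "u \<noteq> 0" "T b u = 0" by blast
    from kernel_block[OF S xS prS this] obtain m v t where
      v: "m \<in> C" "v \<in> S" "pr m v = v" "(T b ^^ Suc t) v = 0" "(T b ^^ t) v \<notin> (T b ^^ Suc t) ` S" by blast
    from split_block[OF S xS prS v(2,1,3,4,5)] obtain N where
      N: "subspace N" "N \<subseteq> S" "\<And>u. u \<in> N \<Longrightarrow> x u \<in> N" "\<And>u n. u \<in> N \<Longrightarrow> pr n u \<in> N"
        "\<And>u. u \<in> S \<Longrightarrow> \<exists>y\<in>span ((\<lambda>i. (x ^^ i) v) ` {..<Suc t * per b}). u - y \<in> N"
        "dim N + Suc t * per b \<le> dim S" by blast
    have "dim N < dim S" using N(6) per_pos[of b] by (cases "per b") auto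
    from less.hyps[OF this N(1) _ N(3,4)] N(2) S obtain Bs where
      Bs: "\<forall>B\<in>set Bs. is_block N B" "(\<Sum>B\<leftarrow>Bs. block_size B) \<le> dim N" "N \<subseteq> span (\<Union>B\<in>set Bs. block_vecs B)" by blast
    let ?B = "(v, m, Suc t, b)"
    have "(T b ^^ t) v \<noteq> 0" using v(5) linop_0[OF T_lin_pow] subspace_0[OF S(1)] by (metis image_eqI)
    then have "is_block S ?B" using v by (simp add: is_block_def del: funpow.simps)
    moreover have "\<forall>B\<in>set Bs. is_block S B" using Bs(1) N(2) by (auto simp: is_block_def)
    moreover have "S \<subseteq> span (\<Union>B\<in>set (?B # Bs). block_vecs B)"
    proof
      fix u assume "u \<in> S"
      then obtain y where y: "y \<in> span (block_vecs ?B)" "u - y \<in> N" using N(5) by (auto simp: block_vecs_def)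
      have "y \<in> span (\<Union>B\<in>set (?B # Bs). block_vecs B)" by (rule subsetD[OF span_mono y(1)]) auto
      moreover have "u - y \<in> span (\<Union>B\<in>set (?B # Bs). block_vecs B)"
        using y(2) Bs(3) span_mono[of "\<Union>B\<in>set Bs. block_vecs B" "\<Union>B\<in>set (?B # Bs). block_vecs B"] by auto
      ultimately show "u \<in> span (\<Union>B\<in>set (?B # Bs). block_vecs B)" by (metis diff_add_cancel span_add)
    qed
    ultimately show ?thesis using Bs(2) N(6)
      by (intro exI[of _ "?B # Bs"]) (auto simp: block_size_def)
  qed
qed

end

section \<open>Modules as operators on coordinate functions\<close>

definition fscale :: "'k::field \<Rightarrow> (nat \<Rightarrow> 'k) \<Rightarrow> nat \<Rightarrow> 'k" where
  "fscale c f = (\<lambda>i. c * f i)"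

lemma fscale_apply [simp]: "fscale c f i = c * f i" by (simp add: fscale_def)

interpretation fv: vspace fscale
  by unfold_locales (auto simp: fscale_def algebra_simps fun_eq_iff)

definition ev :: "nat \<Rightarrow> nat \<Rightarrow> 'k::field" where "ev i = (\<lambda>j. if j = i then 1 else 0)"

text \<open>All modules live in the one space \<open>nat \<Rightarrow> 'k\<close>, those of
  dimension \<open>n\<close> as the functions that vanish from \<open>n\<close> on. Submodules,
  direct sums and tensor products then need no change of type.\<close>

definition kn :: "nat \<Rightarrow> (nat \<Rightarrow> 'k::field) set" where "kn n = {f. \<forall>i\<ge>n. f i = 0}"

definition matop :: "nat \<Rightarrow> 'k::field mat \<Rightarrow> (nat \<Rightarrow> 'k) \<Rightarrow> nat \<Rightarrow> 'k" where
  "matop n A f = (\<lambda>i. if i < n then \<Sum>j<n. A $$ (i, j) * f j else 0)"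

lemma fsum_apply: "(\<Sum>i\<in>I. F i) j = (\<Sum>i\<in>I. F i (j :: nat) :: 'k::field)"
  by (induction I rule: infinite_finite_induct) auto

lemma linop_matop [simp]: "fv.linop (matop n A)"
  by (auto simp: fv.linop_def matop_def fun_eq_iff algebra_simps sum.distrib sum_distrib_left)

lemma subspace_kn [simp]: "fv.subspace (kn n)"
  by (auto simp: fv.subspace_def kn_def)

lemma matop_kn [simp]: "matop n A f \<in> kn n" by (auto simp: matop_def kn_def)

lemma ev_kn [simp]: "ev i \<in> kn n \<longleftrightarrow> i < n" by (auto simp: ev_def kn_def)

lemma kn_expand: "f \<in> kn n \<Longrightarrow> f = (\<Sum>i<n. fscale (f i) (ev i))"
  by (auto simp: kn_def fun_eq_iff fsum_apply ev_def if_distrib[of "\<lambda>z. _ * z"] sum.delta' cong: if_cong)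

lemma kn_span: "kn n = fv.span (ev ` {..<n})"
proof
  show "kn n \<subseteq> fv.span (ev ` {..<n})"
    by (auto simp: fv.span_image_comb intro!: exI dest: kn_expand)
  show "fv.span (ev ` {..<n}) \<subseteq> kn n" by (rule fv.span_minimal) auto
qed

lemma dim_kn: "fv.dim (kn n :: (nat \<Rightarrow> 'k::field) set) = n"
proof -
  have inj: "inj_on (ev :: nat \<Rightarrow> nat \<Rightarrow> 'k) {..<n}"
    by (rule inj_onI) (metis ev_def zero_neq_one)
  have "fv.independent (ev ` {..<n} :: (nat \<Rightarrow> 'k) set)"
  proof (rule fv.independent_if_scalars_zero)
    fix u :: "(nat \<Rightarrow> 'k) \<Rightarrow> 'k" and x :: "nat \<Rightarrow> 'k"
    assume s: "(\<Sum>x\<in>ev ` {..<n}. fscale (u x) x) = 0" and "x \<in> ev ` {..<n}"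
    then obtain i where i: "i < n" "x = ev i" by auto
    have "(\<Sum>j<n. fscale (u (ev j)) (ev j)) = 0"
      using s sum.reindex[OF inj, of "\<lambda>x. fscale (u x) x"] by (simp add: o_def)
    then have "(\<Sum>j<n. fscale (u (ev j)) (ev j)) i = 0" by simp
    then show "u x = 0" using i
      by (simp add: fsum_apply ev_def if_distrib[of "\<lambda>z. _ * z"] sum.delta' cong: if_cong)
  qed simp
  then have "fv.dim (kn n :: (nat \<Rightarrow> 'k) set) = card (ev ` {..<n} :: (nat \<Rightarrow> 'k) set)"
    unfolding kn_span fv.dim_span by (rule fv.dim_eq_card_independent)
  then show ?thesis using inj by (simp add: card_image)
qed

lemma matop_ev: "j < n \<Longrightarrow> matop n A (ev j) = (\<lambda>i. if i < n then A $$ (i, j) else 0)"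
  by (auto simp: matop_def ev_def fun_eq_iff if_distrib[of "\<lambda>z. _ * z"] sum.delta cong: if_cong)

lemma matop_mult:
  assumes "A \<in> carrier_mat n n" "B \<in> carrier_mat n n"
  shows "matop n (A * B) f = matop n A (matop n B f)"
proof
  fix i
  show "matop n (A * B) f i = matop n A (matop n B f) i"
  proof (cases "i < n")
    case True
    have "(\<Sum>j<n. (A * B) $$ (i, j) * f j) = (\<Sum>j<n. \<Sum>k<n. A $$ (i, k) * B $$ (k, j) * f j)"
      using assms True by (intro sum.cong) (auto simp: scalar_prod_def atLeast0LessThan sum_distrib_right)
    also have "\<dots> = (\<Sum>k<n. A $$ (i, k) * (\<Sum>j<n. B $$ (k, j) * f j))"
      by (subst sum.swap) (simp add: sum_distrib_left mult.assoc)
    finally show ?thesis using True by (simp add: matop_def)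
  qed (simp add: matop_def)
qed

lemma matop_one: "f \<in> kn n \<Longrightarrow> matop n (1\<^sub>m n) f = f"
  by (auto simp: matop_def kn_def fun_eq_iff if_distrib[of "\<lambda>z. z * _"] sum.delta cong: if_cong)

lemma matop_smult: "A \<in> carrier_mat n n \<Longrightarrow> matop n (c \<cdot>\<^sub>m A) f = fscale c (matop n A f)"
  by (auto simp: matop_def fun_eq_iff sum_distrib_left mult.assoc intro!: sum.cong)

section \<open>The actions as operators, and copies of one module inside another\<close>

definition opx :: "('g, 'k::field) hmod \<Rightarrow> (nat \<Rightarrow> 'k) \<Rightarrow> nat \<Rightarrow> 'k" where
  "opx M = matop (hmod_dim M) (hmod_x M)"
definition opg :: "('g, 'k::field) hmod \<Rightarrow> 'g \<Rightarrow> (nat \<Rightarrow> 'k) \<Rightarrow> nat \<Rightarrow> 'k" where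
  "opg M g = matop (hmod_dim M) (hmod_g M g)"

lemma linop_opx [simp]: "fv.linop (opx M)" and linop_opg [simp]: "fv.linop (opg M g)"
  by (auto simp: opx_def opg_def)
lemma opx_kn [simp]: "opx M f \<in> kn (hmod_dim M)" and opg_kn [simp]: "opg M g f \<in> kn (hmod_dim M)"
  by (auto simp: opx_def opg_def)
lemma opx_pow_kn: "f \<in> kn (hmod_dim M) \<Longrightarrow> (opx M ^^ i) f \<in> kn (hmod_dim M)"
  by (induction i) auto
lemma linop_opx_pow [simp]: "fv.linop (opx M ^^ i)" by (rule fv.linop_funpow) simp

lemma is_hmodD:
  assumes "is_hmod G chi M"
  shows "\<And>g. g \<in> carrier G \<Longrightarrow> hmod_g M g \<in> carrier_mat (hmod_dim M) (hmod_dim M)"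
    "hmod_x M \<in> carrier_mat (hmod_dim M) (hmod_dim M)" "hmod_g M \<one>\<^bsub>G\<^esub> = 1\<^sub>m (hmod_dim M)"
    "\<And>g h. g \<in> carrier G \<Longrightarrow> h \<in> carrier G \<Longrightarrow> hmod_g M (g \<otimes>\<^bsub>G\<^esub> h) = hmod_g M g * hmod_g M h"
    "\<And>g. g \<in> carrier G \<Longrightarrow> hmod_x M * hmod_g M g = inverse (chi g) \<cdot>\<^sub>m (hmod_g M g * hmod_x M)"
  using assms by (auto simp: is_hmod_def Let_def)

lemma is_weight_hmodD: "is_weight_hmod G chi M \<Longrightarrow> is_hmod G chi M"
  by (simp add: is_weight_hmod_def)

text \<open>The family \<open>c\<close> spans a copy of \<open>N\<close> (or of a quotient of \<open>N\<close>) inside \<open>M\<close>.\<close>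

definition realizes :: "('g, 'm) monoid_scheme \<Rightarrow> ('g, 'k::field) hmod \<Rightarrow> (nat \<Rightarrow> nat \<Rightarrow> 'k) \<Rightarrow> ('g, 'k) hmod \<Rightarrow> bool" where
  "realizes G M c N \<longleftrightarrow> (\<forall>j<hmod_dim N. c j \<in> kn (hmod_dim M)
     \<and> opx M (c j) = (\<Sum>i<hmod_dim N. fscale (hmod_x N $$ (i, j)) (c i))
     \<and> (\<forall>g\<in>carrier G. opg M g (c j) = (\<Sum>i<hmod_dim N. fscale (hmod_g N g $$ (i, j)) (c i))))"

text \<open>A spanning family of as many vectors as the dimension is a basis, so the matrix
  \<open>P\<close> with columns \<open>c j\<close> is invertible, and realizing \<open>N\<close>
  says precisely that \<open>P\<close> intertwines the two actions.\<close>

lemma realizes_iso: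
  fixes M N :: "('g, 'k::field) hmod"
  assumes M: "is_hmod G chi M" and N: "is_hmod G chi N" and d: "hmod_dim N = hmod_dim M"
    and r: "realizes G M c N"
    and sp: "\<And>i. i < hmod_dim M \<Longrightarrow> ev i \<in> fv.span (c ` {..<hmod_dim M})"
  shows "hmod_iso G N M"
proof -
  let ?n = "hmod_dim M"
  define P where "P = mat ?n ?n (\<lambda>(i, j). c j i)"
  have "\<forall>i. \<exists>u. i < ?n \<longrightarrow> ev i = (\<Sum>j<?n. fscale (u j) (c j))"
    using sp by (auto simp: fv.span_image_comb)
  then obtain u where u: "\<And>i. i < ?n \<Longrightarrow> ev i = (\<Sum>j<?n. fscale (u i j) (c j))" by metis
  define Q where "Q = mat ?n ?n (\<lambda>(j, i). u i j)"
  have P: "P \<in> carrier_mat ?n ?n" and Q: "Q \<in> carrier_mat ?n ?n" by (auto simp: P_def Q_def)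
  have PQ: "P * Q = 1\<^sub>m ?n"
  proof (rule eq_matI)
    fix i j assume "i < dim_row (1\<^sub>m ?n :: 'k mat)" "j < dim_col (1\<^sub>m ?n :: 'k mat)"
    then have ij: "i < ?n" "j < ?n" by auto
    have "(P * Q) $$ (i, j) = (\<Sum>k<?n. u j k * c k i)"
      using ij by (auto simp: P_def Q_def scalar_prod_def atLeast0LessThan mult.commute intro!: sum.cong)
    also have "\<dots> = ev j i" using u[OF ij(2)] by (simp add: fsum_apply)
    finally show "(P * Q) $$ (i, j) = 1\<^sub>m ?n $$ (i, j)" using ij by (simp add: ev_def)
  qed (use P Q in auto)
  have QP: "Q * P = 1\<^sub>m ?n" using mat_mult_left_right_inverse[OF P Q PQ] .
  have inter: "P * B = A * P"
    if A: "A \<in> carrier_mat ?n ?n" and B: "B \<in> carrier_mat ?n ?n"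
      and AB: "\<And>j. j < ?n \<Longrightarrow> matop ?n A (c j) = (\<Sum>i<?n. fscale (B $$ (i, j)) (c i))" for A B
  proof (rule eq_matI)
    fix i j assume "i < dim_row (A * P)" "j < dim_col (A * P)"
    then have ij: "i < ?n" "j < ?n" using A P by auto
    have "(P * B) $$ (i, j) = (\<Sum>k<?n. B $$ (k, j) * c k i)"
      using ij B by (auto simp: P_def scalar_prod_def atLeast0LessThan mult.commute intro!: sum.cong)
    also have "\<dots> = matop ?n A (c j) i" using AB[OF ij(2)] by (simp add: fsum_apply)
    also have "\<dots> = (A * P) $$ (i, j)"
      using ij A by (auto simp: P_def matop_def scalar_prod_def atLeast0LessThan intro!: sum.cong)
    finally show "(P * B) $$ (i, j) = (A * P) $$ (i, j)" .
  qed (use A B P in auto)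
  show ?thesis unfolding hmod_iso_def d
  proof (rule conjI[OF refl], rule exI[of _ P], rule exI[of _ Q], intro conjI ballI)
    show "P * hmod_x N = hmod_x M * P"
      using r d is_hmodD(2)[OF M] is_hmodD(2)[OF N] by (intro inter) (auto simp: realizes_def opx_def)
    fix g assume "g \<in> carrier G"
    then show "P * hmod_g N g = hmod_g M g * P"
      using r d is_hmodD(1)[OF M] is_hmodD(1)[OF N] by (intro inter) (auto simp: realizes_def opg_def)
  qed (use P Q PQ QP in auto)
qed

lemma hmod_dim_dsum [simp]: "hmod_dim (dsum_hmod G M N) = hmod_dim M + hmod_dim N"
  by (simp add: dsum_hmod_def Let_def hmod_dim_def)
lemma hmod_x_dsum: "hmod_x (dsum_hmod G M N) = four_block_mat (hmod_x M) (0\<^sub>m (hmod_dim M) (hmod_dim N))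
    (0\<^sub>m (hmod_dim N) (hmod_dim M)) (hmod_x N)"
  by (simp add: dsum_hmod_def Let_def hmod_x_def)
lemma hmod_g_dsum: "g \<in> carrier G \<Longrightarrow> hmod_g (dsum_hmod G M N) g = four_block_mat (hmod_g M g) (0\<^sub>m (hmod_dim M) (hmod_dim N))
    (0\<^sub>m (hmod_dim N) (hmod_dim M)) (hmod_g N g)"
  by (simp add: dsum_hmod_def Let_def hmod_g_def)

lemma realizes_dsum:
  fixes M N1 N2 :: "('g, 'k::field) hmod"
  assumes N1: "is_hmod G chi N1" and N2: "is_hmod G chi N2" and r1: "realizes G M c1 N1" and r2: "realizes G M c2 N2"
  shows "realizes G M (\<lambda>i. if i < hmod_dim N1 then c1 i else c2 (i - hmod_dim N1)) (dsum_hmod G N1 N2)"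
proof -
  let ?m = "hmod_dim N1" and ?n = "hmod_dim N2"
  let ?c = "\<lambda>i. if i < ?m then c1 i else c2 (i - ?m)"
  have split: "(\<Sum>i<?m + ?n. f i) = (\<Sum>i<?m. f i) + (\<Sum>i<?n. f (?m + i))" for f :: "nat \<Rightarrow> nat \<Rightarrow> 'k"
    using sum.atLeastLessThan_concat[of 0 ?m "?m + ?n" f] sum.shift_bounds_nat_ivl[of f 0 ?m ?n]
    by (simp add: atLeast0LessThan add.commute)
  have blk: "(\<Sum>i<?m + ?n. fscale (four_block_mat A (0\<^sub>m ?m ?n) (0\<^sub>m ?n ?m) B $$ (i, j)) (?c i))
     = (if j < ?m then (\<Sum>i<?m. fscale (A $$ (i, j)) (c1 i)) else (\<Sum>i<?n. fscale (B $$ (i, j - ?m)) (c2 i)))"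
    if "A \<in> carrier_mat ?m ?m" "B \<in> carrier_mat ?n ?n" "j < ?m + ?n" for A B j
    unfolding split using that by (auto simp: fscale_def zero_fun_def[symmetric])
  show ?thesis unfolding realizes_def
  proof (intro allI impI)
    fix j assume j: "j < hmod_dim (dsum_hmod G N1 N2)"
    show "?c j \<in> kn (hmod_dim M)
     \<and> opx M (?c j) = (\<Sum>i<hmod_dim (dsum_hmod G N1 N2). fscale (hmod_x (dsum_hmod G N1 N2) $$ (i, j)) (?c i))
     \<and> (\<forall>g\<in>carrier G. opg M g (?c j) = (\<Sum>i<hmod_dim (dsum_hmod G N1 N2). fscale (hmod_g (dsum_hmod G N1 N2) g $$ (i, j)) (?c i)))"
    proof -
      have j': "j < ?m + ?n" using j by simp
      have jn: "\<not> j < ?m \<Longrightarrow> j - ?m < ?n" using j' by simp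
      have 1: "(\<Sum>i<?m + ?n. fscale (hmod_x (dsum_hmod G N1 N2) $$ (i, j)) (?c i)) = opx M (?c j)"
        unfolding hmod_x_dsum blk[OF is_hmodD(2)[OF N1] is_hmodD(2)[OF N2] j']
        using r1 r2 jn by (simp add: realizes_def)
      have 2: "(\<Sum>i<?m + ?n. fscale (hmod_g (dsum_hmod G N1 N2) g $$ (i, j)) (?c i)) = opg M g (?c j)"
        if g: "g \<in> carrier G" for g
        unfolding hmod_g_dsum[OF g] blk[OF is_hmodD(1)[OF N1 g] is_hmodD(1)[OF N2 g] j']
        using r1 r2 jn g by (simp add: realizes_def)
      show ?thesis unfolding hmod_dim_dsum using 1 2 r1 r2 jn by (simp add: realizes_def)
    qed
  qed
qed

lemma mult_block_diag:
  assumes "A1 \<in> carrier_mat m m" "B1 \<in> carrier_mat n n" "A2 \<in> carrier_mat m m" "B2 \<in> carrier_mat n n"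
  shows "four_block_mat A1 (0\<^sub>m m n) (0\<^sub>m n m) B1 * four_block_mat A2 (0\<^sub>m m n) (0\<^sub>m n m) B2
    = four_block_mat (A1 * A2) (0\<^sub>m m n) (0\<^sub>m n m) (B1 * B2)"
  using assms by (subst mult_four_block_mat[of _ m m _ n _ n _ _ m _ n]) auto

lemma smult_block_diag:
  assumes "A \<in> carrier_mat m m" "B \<in> carrier_mat n n"
  shows "c \<cdot>\<^sub>m four_block_mat A (0\<^sub>m m n) (0\<^sub>m n m) B = four_block_mat (c \<cdot>\<^sub>m A) (0\<^sub>m m n) (0\<^sub>m n m) (c \<cdot>\<^sub>m (B :: 'k::field mat))"
  using assms by (intro eq_matI) auto

lemma is_hmod_dsum:
  assumes M: "is_hmod G chi M" and N: "is_hmod G chi N" and G: "group G"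
  shows "is_hmod G chi (dsum_hmod G M N)"
proof -
  interpret group G by (rule G)
  have sm: "inverse (chi g) \<cdot>\<^sub>m four_block_mat (hmod_g M g * hmod_x M) (0\<^sub>m (hmod_dim M) (hmod_dim N)) (0\<^sub>m (hmod_dim N) (hmod_dim M)) (hmod_g N g * hmod_x N)
    = four_block_mat (inverse (chi g) \<cdot>\<^sub>m (hmod_g M g * hmod_x M)) (0\<^sub>m (hmod_dim M) (hmod_dim N)) (0\<^sub>m (hmod_dim N) (hmod_dim M)) (inverse (chi g) \<cdot>\<^sub>m (hmod_g N g * hmod_x N))"
    if "g \<in> carrier G" for g
    using is_hmodD[OF M] is_hmodD[OF N] that by (intro smult_block_diag mult_carrier_mat)
  show ?thesis
    unfolding is_hmod_def Let_def hmod_dim_dsum hmod_x_dsum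
    using is_hmodD[OF M] is_hmodD[OF N] sm
    by (auto simp: hmod_g_dsum mult_block_diag four_block_one_mat)
qed

lemma is_weight_hmod_dsum:
  assumes M: "is_weight_hmod G chi M" and N: "is_weight_hmod G chi N" and G: "group G"
  shows "is_weight_hmod G chi (dsum_hmod G M N)"
proof -
  let ?m = "hmod_dim M" and ?n = "hmod_dim N"
  obtain P Q where P: "P \<in> carrier_mat ?m ?m" "Q \<in> carrier_mat ?m ?m" "P * Q = 1\<^sub>m ?m" "Q * P = 1\<^sub>m ?m"
    "\<And>g. g \<in> carrier G \<Longrightarrow> diagonal_mat (Q * hmod_g M g * P)" using M by (auto simp: is_weight_hmod_def)
  obtain P' Q' where P': "P' \<in> carrier_mat ?n ?n" "Q' \<in> carrier_mat ?n ?n" "P' * Q' = 1\<^sub>m ?n" "Q' * P' = 1\<^sub>m ?n"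
    "\<And>g. g \<in> carrier G \<Longrightarrow> diagonal_mat (Q' * hmod_g N g * P')" using N by (auto simp: is_weight_hmod_def)
  have hM: "is_hmod G chi M" and hN: "is_hmod G chi N" using M N by (auto simp: is_weight_hmod_def)
  let ?b = "\<lambda>A B. four_block_mat A (0\<^sub>m ?m ?n) (0\<^sub>m ?n ?m) B"
  have "diagonal_mat (?b Q Q' * hmod_g (dsum_hmod G M N) g * ?b P P')" if g: "g \<in> carrier G" for g
  proof -
    note c = is_hmodD(1)[OF hM g] is_hmodD(1)[OF hN g]
    have "?b Q Q' * hmod_g (dsum_hmod G M N) g * ?b P P' = ?b (Q * hmod_g M g * P) (Q' * hmod_g N g * P')"
      using c P P' g by (simp add: hmod_g_dsum mult_block_diag)
    moreover have "diagonal_mat (?b (Q * hmod_g M g * P) (Q' * hmod_g N g * P'))"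
      using P(5)[OF g] P'(5)[OF g] P(1,2) P'(1,2) c unfolding diagonal_mat_def by auto
    ultimately show ?thesis by simp
  qed
  moreover have "?b P P' * ?b Q Q' = 1\<^sub>m (?m + ?n)" "?b Q Q' * ?b P P' = 1\<^sub>m (?m + ?n)"
    using P P' by (simp_all add: mult_block_diag four_block_one_mat)
  moreover have "?b P P' \<in> carrier_mat (?m + ?n) (?m + ?n)" "?b Q Q' \<in> carrier_mat (?m + ?n) (?m + ?n)" using P P' by auto
  ultimately show ?thesis unfolding is_weight_hmod_def hmod_dim_dsum
    using is_hmod_dsum[OF hM hN G] by blast
qed

definition zero_hmod :: "('g, 'k::field) hmod" where "zero_hmod = (0, \<lambda>g. 0\<^sub>m 0 0, 0\<^sub>m 0 0)"

lemma dim_zero_hmod [simp]: "hmod_dim zero_hmod = 0" by (simp add: zero_hmod_def hmod_dim_def)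

lemma is_weight_zero_hmod [simp]: "is_weight_hmod G chi zero_hmod"
  by (auto simp: is_weight_hmod_def is_hmod_def zero_hmod_def hmod_dim_def hmod_g_def hmod_x_def Let_def diagonal_mat_def
      intro!: exI[of _ "1\<^sub>m 0"])

primrec dsum_list :: "('g, 'm) monoid_scheme \<Rightarrow> ('g, 'k::field) hmod list \<Rightarrow> ('g, 'k) hmod" where
  "dsum_list G [] = zero_hmod"
| "dsum_list G (N # Ns) = dsum_hmod G N (dsum_list G Ns)"

lemma dim_dsum_list: "hmod_dim (dsum_list G Ns) = (\<Sum>N\<leftarrow>Ns. hmod_dim N)"
  by (induction Ns) auto

lemma is_weight_dsum_list: "group G \<Longrightarrow> (\<And>N. N \<in> set Ns \<Longrightarrow> is_weight_hmod G chi N) \<Longrightarrow> is_weight_hmod G chi (dsum_list G Ns)"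
  by (induction Ns) (auto intro!: is_weight_hmod_dsum)

section \<open>Congruence modulo the Green ring relations\<close>

definition geq :: "('g, 'm) monoid_scheme \<Rightarrow> ('g \<Rightarrow> 'k::field) \<Rightarrow> ('g, 'k) formal \<Rightarrow> ('g, 'k) formal \<Rightarrow> bool" where
  "geq G chi u v \<longleftrightarrow> u - v \<in> green_rel G chi"

lemma geq_refl [simp]: "geq G chi u u" by (simp add: geq_def green_rel.zero)
lemma geq_sym: "geq G chi u v \<Longrightarrow> geq G chi v u"
  using green_rel.neg[of "u - v" G chi] by (simp add: geq_def)
lemma geq_trans [trans]: "geq G chi u v \<Longrightarrow> geq G chi v w \<Longrightarrow> geq G chi u w"
  using green_rel.add[of "u - v" G chi "v - w"] by (simp add: geq_def)
lemma geq_add: "geq G chi u v \<Longrightarrow> geq G chi u' v' \<Longrightarrow> geq G chi (u + u') (v + v')"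
  using green_rel.add[of "u - v" G chi "u' - v'"] by (simp add: geq_def algebra_simps)
lemma geq_minus: "geq G chi u v \<Longrightarrow> geq G chi (- u) (- v)"
  using green_rel.neg[of "u - v" G chi] by (simp add: geq_def)
lemma geq_diff: "geq G chi u v \<Longrightarrow> geq G chi u' v' \<Longrightarrow> geq G chi (u - u') (v - v')"
  using geq_add[OF _ geq_minus, of G chi u v u' v'] by simp
lemma geq_sum: "(\<And>i. i \<in> I \<Longrightarrow> geq G chi (f i) (g i)) \<Longrightarrow> geq G chi (\<Sum>i\<in>I. f i) (\<Sum>i\<in>I. g i)"
  by (induction I rule: infinite_finite_induct) (auto intro: geq_add)
lemma geq_cls_dsum_list:
  assumes G: "group G" and "\<And>N. N \<in> set Ns \<Longrightarrow> is_weight_hmod G chi N"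
  shows "geq G chi (cls (dsum_list G Ns)) (\<Sum>N\<leftarrow>Ns. cls N)"
  using assms(2)
proof (induction Ns)
  case Nil
  \<comment> \<open>The zero module has class zero because it is isomorphic to its own
    double.\<close>
  have "cls (dsum_hmod G zero_hmod zero_hmod) - cls zero_hmod - cls zero_hmod \<in> green_rel G chi"
    by (rule green_rel.dsum) auto
  moreover have "hmod_iso G (dsum_hmod G zero_hmod zero_hmod) (zero_hmod :: ('a, 'c) hmod)"
    unfolding hmod_iso_def
    by (auto intro!: exI[of _ "1\<^sub>m 0"] simp: hmod_g_dsum hmod_x_dsum) (auto simp: zero_hmod_def hmod_g_def hmod_x_def hmod_dim_def)
  then have "cls (dsum_hmod G zero_hmod zero_hmod) - cls (zero_hmod :: ('a, 'c) hmod) \<in> green_rel G chi"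
    by (intro green_rel.iso is_weight_hmod_dsum G) auto
  ultimately have "geq G chi (cls (dsum_hmod G zero_hmod zero_hmod) - cls zero_hmod - cls zero_hmod - (cls (dsum_hmod G zero_hmod zero_hmod) - cls (zero_hmod :: ('a, 'c) hmod))) 0"
    unfolding geq_def using green_rel.add green_rel.neg by (metis diff_conv_add_uminus diff_zero)
  from geq_minus[OF this] show ?case by (simp add: algebra_simps)
next
  case (Cons N Ns)
  have "geq G chi (cls (dsum_list G (N # Ns))) (cls N + cls (dsum_list G Ns))"
    unfolding geq_def using green_rel.dsum[of G chi N "dsum_list G Ns"] Cons.prems is_weight_dsum_list[OF G, of Ns chi]
    by (simp add: algebra_simps)
  also have "geq G chi \<dots> (cls N + (\<Sum>N\<leftarrow>Ns. cls N))" using Cons by (intro geq_add) auto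
  finally show ?case by simp
qed

text \<open>Each pair in the list is a copy of a quotient of \<open>N\<close> inside
  \<open>M\<close>. Spanning together with the dimension count forces the copies to be faithful and
  their sum to be direct, so injectivity never has to be checked.\<close>

theorem decomposition:
  assumes G: "group G" and M: "is_weight_hmod G chi M"
    and Bs: "\<And>N c. (N, c) \<in> set Bs \<Longrightarrow> is_weight_hmod G chi N \<and> realizes G M c N"
    and d: "(\<Sum>(N, c)\<leftarrow>Bs. hmod_dim N) = hmod_dim M"
    and sp: "\<And>i. i < hmod_dim M \<Longrightarrow> ev i \<in> fv.span (\<Union>(N, c)\<in>set Bs. c ` {..<hmod_dim N})"
  shows "geq G chi (cls M) (\<Sum>(N, c)\<leftarrow>Bs. cls N)"
proof -
  let ?D = "dsum_list G (map fst Bs)"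
  have wN: "is_weight_hmod G chi N" if "N \<in> set (map fst Bs)" for N using that Bs by fastforce
  have wD: "is_weight_hmod G chi ?D" by (rule is_weight_dsum_list[OF G wN])
  have dD: "hmod_dim ?D = hmod_dim M" using d by (simp add: dim_dsum_list o_def case_prod_unfold)
  have "\<exists>c. realizes G M c ?D \<and> c ` {..<hmod_dim ?D} = (\<Union>(N, c)\<in>set Bs. c ` {..<hmod_dim N})"
    using Bs
  proof (induction Bs)
    case Nil then show ?case by (auto simp: realizes_def)
  next
    case (Cons B Bs)
    obtain N c where B: "B = (N, c)" by (cases B)
    from Cons obtain c' where c': "realizes G M c' (dsum_list G (map fst Bs))"
      "c' ` {..<hmod_dim (dsum_list G (map fst Bs))} = (\<Union>(N, c)\<in>set Bs. c ` {..<hmod_dim N})" by force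
    have N: "is_hmod G chi N" "realizes G M c N" using Cons.prems[of N c] B by (auto simp: is_weight_hmodD)
    have "is_weight_hmod G chi N" if "N \<in> set (map fst Bs)" for N using that Cons.prems by fastforce
    then have D': "is_hmod G chi (dsum_list G (map fst Bs))"
      by (intro is_weight_hmodD is_weight_dsum_list[OF G])
    let ?m = "hmod_dim N" and ?n = "hmod_dim (dsum_list G (map fst Bs))"
    let ?c = "\<lambda>i. if i < ?m then c i else c' (i - ?m)"
    have "{..<?m + ?n} = {..<?m} \<union> (+) ?m ` {..<?n}"
      by (simp add: lessThan_atLeast0 ivl_disj_un_two(3) add.commute)
    then have "?c ` {..<?m + ?n} = ?c ` {..<?m} \<union> (\<lambda>x. ?c (?m + x)) ` {..<?n}" by (simp only: image_Un image_image)
    also have "?c ` {..<?m} = c ` {..<?m}" by (intro image_cong) auto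
    also have "(\<lambda>x. ?c (?m + x)) ` {..<?n} = c' ` {..<?n}" by (intro image_cong) auto
    finally show ?case using realizes_dsum[OF N(1) D' N(2) c'(1)] c'(2)
      by (intro exI[of _ ?c]) (simp add: B)
  qed
  then obtain c where c: "realizes G M c ?D" "c ` {..<hmod_dim M} = (\<Union>(N, c)\<in>set Bs. c ` {..<hmod_dim N})"
    using dD by auto
  have "hmod_iso G ?D M"
    using sp c(2) by (intro realizes_iso[OF is_weight_hmodD[OF M] is_weight_hmodD[OF wD] dD c(1)]) auto
  then have "geq G chi (cls ?D) (cls M)" unfolding geq_def by (rule green_rel.iso[OF wD M])
  then have "geq G chi (cls M) (cls ?D)" by (rule geq_sym)
  also have "geq G chi \<dots> (\<Sum>N\<leftarrow>map fst Bs. cls N)" by (rule geq_cls_dsum_list[OF G wN])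
  finally show ?thesis by (simp add: o_def case_prod_unfold)
qed

text \<open>Up to sign, the coefficients below the top are the entries of the last column of
  \<open>x\<close> on \<open>Vtb\<close>; that column therefore says that
  \<open>(x ^ sb - b) ^ t\<close> kills the generator.\<close>

lemma (in vspace) binomial_operator:
  assumes U: "linop U"
  shows "((\<lambda>v. U v - b *s v) ^^ t) v = (\<Sum>l\<le>t. (of_nat (t choose l) * (- b) ^ (t - l)) *s (U ^^ l) v)"
proof (induction t)
  case (Suc t)
  let ?U = "\<lambda>v. U v - b *s v" and ?F = "\<lambda>t l. of_nat (t choose l) * (- b) ^ (t - l)"
  have "(?U ^^ Suc t) v = U (\<Sum>l\<le>t. ?F t l *s (U ^^ l) v) - b *s (\<Sum>l\<le>t. ?F t l *s (U ^^ l) v)"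
    using Suc by simp
  also have "\<dots> = (\<Sum>l\<le>t. ?F t l *s (U ^^ Suc l) v) + (\<Sum>l\<le>t. (of_nat (t choose l) * (- b) ^ (Suc t - l)) *s (U ^^ l) v)"
    by (simp add: linop_comb[OF U] scale_sum_right sum_negf[symmetric] Suc_diff_le mult.left_commute flip: scale_minus_left)
  also have "(\<Sum>l\<le>t. (of_nat (t choose l) * (- b) ^ (Suc t - l)) *s (U ^^ l) v)
      = (\<Sum>l\<le>Suc t. (of_nat (t choose l) * (- b) ^ (Suc t - l)) *s (U ^^ l) v)" by (simp add: binomial_eq_0)
  also have "\<dots> = (- b) ^ Suc t *s v + (\<Sum>l\<le>t. (of_nat (t choose Suc l) * (- b) ^ (t - l)) *s (U ^^ Suc l) v)"
    by (subst sum.atMost_Suc_shift) simp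
  also have "(\<Sum>l\<le>t. ?F t l *s (U ^^ Suc l) v) + \<dots> = (- b) ^ Suc t *s v + (\<Sum>l\<le>t. ?F (Suc t) (Suc l) *s (U ^^ Suc l) v)"
  proof -
    have "?F (Suc t) (Suc l) *s (U ^^ Suc l) v = ?F t l *s (U ^^ Suc l) v + (of_nat (t choose Suc l) * (- b) ^ (t - l)) *s (U ^^ Suc l) v" for l
      unfolding scale_left_distrib[symmetric] by (simp add: distrib_right)
    then show ?thesis by (simp only: sum.distrib add.left_commute)
  qed
  also have "\<dots> = (\<Sum>l\<le>Suc t. ?F (Suc t) l *s (U ^^ l) v)"
    by (subst sum.atMost_Suc_shift) simp
  finally show ?case .
qed simp

section \<open>The indecomposable blocks\<close>

lemma elem_order_pos:
  assumes "elem_order (z :: 'k::field) = n" "n \<noteq> 0"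
  shows "z ^ m = 1 \<longleftrightarrow> n dvd m"
proof -
  have ex: "\<exists>n>0. z ^ n = 1" using assms by (auto simp: elem_order_def split: if_splits)
  then have n: "n = (LEAST n. n > 0 \<and> z ^ n = 1)" using assms by (auto simp: elem_order_def)
  have n1: "n > 0" "z ^ n = 1" using LeastI_ex[OF ex] unfolding n by auto
  have min: "z ^ k \<noteq> 1" if "0 < k" "k < n" for k using not_less_Least[of k "\<lambda>n. n > 0 \<and> z ^ n = 1"] that unfolding n[symmetric] by auto
  have "z ^ m = z ^ (n * (m div n) + m mod n)" by simp
  also have "\<dots> = z ^ (m mod n)" unfolding power_add power_mult n1(2) by simp
  finally have "z ^ m = z ^ (m mod n)" .
  then show ?thesis using min[of "m mod n"] n1 by (auto simp: dvd_eq_mod_eq_0)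
qed

section \<open>The standing data and the group of characters\<close>

locale hopf_ctx =
  fixes G :: "('g, 'm) monoid_scheme" and a :: 'g and chi :: "'g \<Rightarrow> 'k::field_char_0"
    and xi :: 'k and sb s sp :: nat
  assumes alg: "alg_closed TYPE('k)"
    and grp: "group G"
    and aG: "a \<in> carrier G" and central: "\<forall>g\<in>carrier G. a \<otimes>\<^bsub>G\<^esub> g = g \<otimes>\<^bsub>G\<^esub> a"
    and chi_char: "chi \<in> characters G" and chi_a: "chi a \<noteq> 1"
    and sb_def: "sb = char_order G chi" and sb0: "sb \<noteq> 0"
    and s_def: "s = elem_order (inverse (chi a))"
    and sb_eq: "sb = s * sp"
    and xi_order: "elem_order xi = sp"
begin

abbreviation "Ch \<equiv> (characters G :: ('g \<Rightarrow> 'k) set)"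
abbreviation cm (infixl "\<star>" 70) where "cm \<equiv> char_mult G"
abbreviation "e1 \<equiv> (char_one G :: 'g \<Rightarrow> 'k)"
abbreviation "cp n \<equiv> char_pow G chi n"
abbreviation eqv (infix "\<approx>" 50) where "u \<approx> v \<equiv> geq G chi u v"

lemma Ch_nz: "l \<in> Ch \<Longrightarrow> g \<in> carrier G \<Longrightarrow> l g \<noteq> 0" by (simp add: characters_def)
lemma Ch_mult: "l \<in> Ch \<Longrightarrow> g \<in> carrier G \<Longrightarrow> h \<in> carrier G \<Longrightarrow> l (g \<otimes>\<^bsub>G\<^esub> h) = l g * l h" by (simp add: characters_def)
lemma Ch_ext: "l \<in> Ch \<Longrightarrow> m \<in> Ch \<Longrightarrow> (\<And>g. g \<in> carrier G \<Longrightarrow> l g = m g) \<Longrightarrow> l = m"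
  unfolding characters_def by (auto intro: extensionalityI)
lemma Ch_one: assumes "l \<in> Ch" shows "l \<one>\<^bsub>G\<^esub> = 1"
proof -
  interpret group G by (rule grp)
  have "l \<one>\<^bsub>G\<^esub> = l \<one>\<^bsub>G\<^esub> * l \<one>\<^bsub>G\<^esub>" using Ch_mult[OF assms, of "\<one>\<^bsub>G\<^esub>" "\<one>\<^bsub>G\<^esub>"] by simp
  then show ?thesis using Ch_nz[OF assms, of "\<one>\<^bsub>G\<^esub>"] by simp
qed

lemma closedG: "g \<in> carrier G \<Longrightarrow> h \<in> carrier G \<Longrightarrow> g \<otimes>\<^bsub>G\<^esub> h \<in> carrier G"
  using grp by (simp add: group.is_monoid monoid.m_closed)

lemma cm_apply: "g \<in> carrier G \<Longrightarrow> (l \<star> m) g = l g * m g" by (simp add: char_mult_def)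
lemma cp_apply: "g \<in> carrier G \<Longrightarrow> cp n g = chi g ^ n" by (simp add: char_pow_def)
lemma e1_apply: "g \<in> carrier G \<Longrightarrow> e1 g = 1" by (simp add: char_one_def)

lemma cm_Ch [simp]: "l \<in> Ch \<Longrightarrow> m \<in> Ch \<Longrightarrow> l \<star> m \<in> Ch"
  by (auto simp: characters_def char_mult_def closedG)
lemma e1_Ch [simp]: "e1 \<in> Ch" by (auto simp: characters_def char_one_def closedG)
lemma cp_Ch [simp]: "cp n \<in> Ch"
  using chi_char by (auto simp: characters_def char_pow_def closedG power_mult_distrib)
lemma chi_Ch [simp]: "chi \<in> Ch" by (rule chi_char)

lemma cm_assoc: "l \<in> Ch \<Longrightarrow> m \<in> Ch \<Longrightarrow> n \<in> Ch \<Longrightarrow> l \<star> m \<star> n = l \<star> (m \<star> n)"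
  by (rule Ch_ext) (auto simp: cm_apply)
lemma cm_comm: "l \<in> Ch \<Longrightarrow> m \<in> Ch \<Longrightarrow> l \<star> m = m \<star> l"
  by (rule Ch_ext) (auto simp: cm_apply)
lemma cm_e1 [simp]: "l \<in> Ch \<Longrightarrow> e1 \<star> l = l" "l \<in> Ch \<Longrightarrow> l \<star> e1 = l"
  by (rule Ch_ext; auto simp: cm_apply e1_apply)+
lemma cp_0 [simp]: "cp 0 = e1" by (rule Ch_ext) (auto simp: cp_apply e1_apply)
lemma cp_1: "cp (Suc 0) = chi" by (rule Ch_ext) (auto simp: cp_apply)
lemma cp_add: "cp m \<star> cp n = cp (m + n)" by (rule Ch_ext) (auto simp: cp_apply cm_apply power_add)
lemma cp_Suc: "chi \<star> cp n = cp (Suc n)" by (rule Ch_ext) (auto simp: cp_apply cm_apply)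

lemma cp_order: "cp m = e1 \<longleftrightarrow> sb dvd m"
proof -
  let ?P = "\<lambda>n. n > 0 \<and> cp n = e1"
  have ex: "\<exists>n>0. cp n = e1" using sb_def sb0 by (auto simp: char_order_def split: if_splits)
  then have n: "sb = (LEAST n. ?P n)" using sb_def by (auto simp: char_order_def)
  have n1: "sb > 0" "cp sb = e1" using LeastI_ex[OF ex] unfolding n by auto
  have min: "cp k \<noteq> e1" if "0 < k" "k < sb" for k using not_less_Least[of k ?P] that unfolding n[symmetric] by auto
  have one: "chi g ^ sb = 1" if "g \<in> carrier G" for g using n1(2) that by (metis cp_apply e1_apply)
  have "cp m = cp (m mod sb)"
  proof (rule Ch_ext)
    fix g assume g: "g \<in> carrier G"
    have "chi g ^ m = chi g ^ (sb * (m div sb) + m mod sb)" by simp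
    also have "\<dots> = chi g ^ (m mod sb)" unfolding power_add power_mult one[OF g] by simp
    finally show "cp m g = cp (m mod sb) g" unfolding cp_apply[OF g] .
  qed auto
  then show ?thesis using min[of "m mod sb"] n1 by (auto simp: dvd_eq_mod_eq_0)
qed

lemma sb_pos: "sb > 0" and s_pos: "s > 0" and sp_pos: "sp > 0" using sb0 sb_eq by auto
lemma chi_sb: "g \<in> carrier G \<Longrightarrow> chi g ^ sb = 1"
  using cp_order[of sb] by (metis cp_apply e1_apply dvd_refl)

text \<open>The parameter of the \<open>q\<close>-binomial theorem. Its order is \<open>s\<close>,
  the order of its inverse.\<close>

definition zt :: 'k where "zt = chi a"

lemma zt_nz: "zt \<noteq> 0" using Ch_nz[OF chi_char aG] by (simp add: zt_def)
lemma zt_order: "zt ^ n = 1 \<longleftrightarrow> s dvd n"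
  using elem_order_pos[OF s_def[symmetric], of n] s_pos by (simp add: zt_def[symmetric] power_inverse)
lemma zt_s: "zt ^ s = 1" by (simp add: zt_order)
lemma zt_ne1: "zt \<noteq> 1" using chi_a by (simp add: zt_def)
lemma s_ge2: "s \<ge> 2"
proof -
  have "s \<noteq> 1" using zt_order[of 1] zt_ne1 by auto
  then show ?thesis using s_pos by simp
qed
lemma xi_pow: "xi ^ n = 1 \<longleftrightarrow> sp dvd n" using elem_order_pos[OF xi_order] sp_pos by simp
lemma xi_nz: "xi \<noteq> 0" using xi_pow[of sp] sp_pos by (metis dvd_refl power_0_left not_gr_zero zero_neq_one)

lemma root_exists: assumes "degree (p :: 'k poly) > 0" shows "\<exists>z. poly p z = 0"
proof -
  let ?n = "degree p" and ?l = "lead_coeff p"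
  have l: "?l \<noteq> 0" using assms by auto
  obtain z where z: "z ^ ?n + (\<Sum>i<?n. coeff p i / ?l * z ^ i) = 0"
    using alg assms unfolding alg_closed_def by (metis Suc_leI One_nat_def)
  have "poly p z = (\<Sum>i<?n. coeff p i * z ^ i) + ?l * z ^ ?n"
    unfolding poly_altdef by (simp add: lessThan_Suc_atMost[symmetric])
  also have "\<dots> = ?l * (z ^ ?n + (\<Sum>i<?n. coeff p i / ?l * z ^ i))"
    using l by (simp add: distrib_left sum_distrib_left add.commute)
  finally show ?thesis using z by auto
qed

text \<open>One notation for both families. At \<open>b = 0\<close> it denotes the nilpotent module
  of dimension \<open>t\<close>, so that in either case the dimension is \<open>t * per b\<close>
  and the generator is killed by the \<open>t\<close>-th power of
  \<open>x ^ per b - b\<close>.\<close>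

definition V :: "nat \<Rightarrow> ('g \<Rightarrow> 'k) \<Rightarrow> 'k \<Rightarrow> ('g, 'k) hmod" where
  "V t l b = (if b = 0 then Vt G chi t l else Vtb G chi t l b)"
definition per :: "'k \<Rightarrow> nat" where "per b = (if b = 0 then 1 else sb)"

lemma per_pos: "per b > 0" using sb_pos by (simp add: per_def)

lemma dim_V [simp]: "hmod_dim (V t l b) = t * per b"
  by (simp add: V_def per_def Vt_def Vtb_def hmod_dim_def Let_def sb_def[symmetric])

lemma V_g: "g \<in> carrier G \<Longrightarrow> hmod_g (V t l b) g = mat (t * per b) (t * per b) (\<lambda>(i, j). if i = j then chi g ^ i * l g else 0)"
  by (auto simp: V_def per_def Vt_def Vtb_def hmod_g_def Let_def sb_def[symmetric])

lemma V_x: "hmod_x (V t l b) = mat (t * per b) (t * per b) (\<lambda>(i, j). if i = j + 1 then 1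
   else if b \<noteq> 0 \<and> j = t * sb - 1 \<and> sb dvd i then - (of_nat (t choose (i div sb)) * (- b) ^ (t - i div sb)) else 0)"
  by (auto simp: V_def per_def Vt_def Vtb_def hmod_x_def Let_def sb_def[symmetric] intro!: cong_mat)

text \<open>Nonzero entries of \<open>x\<close> have to raise the weight by \<open>chi\<close>. The
  subdiagonal does so; the further entries of the last column stand in rows divisible by
  \<open>sb\<close>, where it follows from \<open>chi ^ sb = 1\<close>.\<close>

lemma is_hmod_V: assumes l: "l \<in> Ch" shows "is_hmod G chi (V t l b)"
  unfolding is_hmod_def Let_def dim_V
proof (intro conjI ballI)
  let ?n = "t * per b"
  interpret group G by (rule grp)
  fix g assume g: "g \<in> carrier G"
  show "hmod_g (V t l b) g \<in> carrier_mat ?n ?n" by (simp add: V_g[OF g])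
  show "hmod_x (V t l b) * hmod_g (V t l b) g = inverse (chi g) \<cdot>\<^sub>m (hmod_g (V t l b) g * hmod_x (V t l b))"
  proof (rule eq_matI)
    fix i j assume "i < dim_row (inverse (chi g) \<cdot>\<^sub>m (hmod_g (V t l b) g * hmod_x (V t l b)))"
      "j < dim_col (inverse (chi g) \<cdot>\<^sub>m (hmod_g (V t l b) g * hmod_x (V t l b)))"
    then have ij: "i < ?n" "j < ?n" by (auto simp: V_g[OF g] V_x)
    let ?X = "\<lambda>i j. hmod_x (V t l b) $$ (i, j)"
    have 1: "(hmod_x (V t l b) * hmod_g (V t l b) g) $$ (i, j) = ?X i j * (chi g ^ j * l g)"
      using ij by (auto simp: V_g[OF g] V_x scalar_prod_def if_distrib[of "\<lambda>z. _ * z"] sum.delta cong: if_cong)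
    have 2: "(hmod_g (V t l b) g * hmod_x (V t l b)) $$ (i, j) = (chi g ^ i * l g) * ?X i j"
      using ij by (auto simp: V_g[OF g] V_x scalar_prod_def if_distrib[of "\<lambda>z. z * _"] sum.delta' cong: if_cong)
    have "inverse (chi g) * chi g ^ i = chi g ^ j" if nz: "?X i j \<noteq> 0"
    proof -
      have c0: "chi g \<noteq> 0" using Ch_nz[OF chi_char g] .
      consider "i = j + 1" | "b \<noteq> 0" "j = t * sb - 1" "sb dvd i" using nz ij by (auto simp: V_x split: if_splits)
      then show ?thesis
      proof cases
        case 1 then show ?thesis using c0 by simp
      next
        case 2
        then have "Suc j = t * sb" using ij by (auto simp: per_def)
        then have "chi g ^ Suc j = 1" using chi_sb[OF g] by (metis mult.commute power_mult power_one)
        moreover have "chi g ^ i = 1" using 2(3) chi_sb[OF g] by (metis dvd_def power_mult power_one)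
        ultimately show ?thesis using c0 by (simp add: field_simps)
      qed
    qed
    then show "(hmod_x (V t l b) * hmod_g (V t l b) g) $$ (i, j) = (inverse (chi g) \<cdot>\<^sub>m (hmod_g (V t l b) g * hmod_x (V t l b))) $$ (i, j)"
      using ij 1 2 by (auto simp: V_g[OF g] V_x)
  qed (auto simp: V_g[OF g] V_x)
  fix h assume h: "h \<in> carrier G"
  show "hmod_g (V t l b) (g \<otimes>\<^bsub>G\<^esub> h) = hmod_g (V t l b) g * hmod_g (V t l b) h"
    using g h Ch_mult[OF l g h] Ch_mult[OF chi_char g h]
    by (auto intro!: eq_matI simp: V_g scalar_prod_def if_distrib[of "\<lambda>z. _ * z"] if_distrib[of "\<lambda>z. z * _"] sum.delta sum.delta' power_mult_distrib cong: if_cong)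
next
  interpret group G by (rule grp)
  show "hmod_x (V t l b) \<in> carrier_mat (t * per b) (t * per b)" by (simp add: V_x)
  show "hmod_g (V t l b) \<one>\<^bsub>G\<^esub> = 1\<^sub>m (t * per b)" by (auto intro!: eq_matI simp: V_g Ch_one l)
qed

text \<open>Weight modules written in a weight basis. Every weight module is isomorphic to one of
  these, and tensor products keep the form because Kronecker products of diagonal matrices are
  diagonal.\<close>

definition diag_hmod :: "('g, 'k) hmod \<Rightarrow> bool" where
  "diag_hmod M \<longleftrightarrow> is_hmod G chi M \<and> (\<forall>g\<in>carrier G. diagonal_mat (hmod_g M g))"

lemma diag_weight: assumes "diag_hmod M" shows "is_weight_hmod G chi M"
  unfolding is_weight_hmod_def
proof (intro conjI exI[of _ "1\<^sub>m (hmod_dim M)"])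
  show h: "is_hmod G chi M" using assms by (simp add: diag_hmod_def)
  show "\<forall>g\<in>carrier G. diagonal_mat (1\<^sub>m (hmod_dim M) * hmod_g M g * 1\<^sub>m (hmod_dim M))"
  proof
    fix g assume g: "g \<in> carrier G"
    have "1\<^sub>m (hmod_dim M) * hmod_g M g * 1\<^sub>m (hmod_dim M) = hmod_g M g" using is_hmodD(1)[OF h g] by simp
    then show "diagonal_mat (1\<^sub>m (hmod_dim M) * hmod_g M g * 1\<^sub>m (hmod_dim M))"
      using assms g by (simp add: diag_hmod_def)
  qed
qed auto

lemma diag_V [simp]: "l \<in> Ch \<Longrightarrow> diag_hmod (V t l b)"
  by (auto simp: diag_hmod_def is_hmod_V V_g diagonal_mat_def)
lemma weight_V [simp]: "l \<in> Ch \<Longrightarrow> is_weight_hmod G chi (V t l b)" by (simp add: diag_weight)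

definition T :: "('g, 'k) hmod \<Rightarrow> 'k \<Rightarrow> (nat \<Rightarrow> 'k) \<Rightarrow> nat \<Rightarrow> 'k" where
  "T M b v = (opx M ^^ per b) v - fscale b v"

lemma T_0: "T M 0 = opx M" by (auto simp: T_def per_def fun_eq_iff)
lemma linop_T [simp]: "fv.linop (T M b)"
  using linop_opx_pow[of "per b" M] by (auto simp: T_def fv.linop_def fv.scale_right_distrib fv.scale_right_diff_distrib fv.scale_left_commute)
lemma linop_T_pow [simp]: "fv.linop (T M b ^^ i)" by (rule fv.linop_funpow) simp

lemma g_x_comm:
  assumes M: "is_hmod G chi M" and g: "g \<in> carrier G" and v: "v \<in> kn (hmod_dim M)"
  shows "opg M g (opx M v) = fscale (chi g) (opx M (opg M g v))"
proof -
  note c = is_hmodD(1)[OF M g] is_hmodD(2)[OF M]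
  have "fscale (inverse (chi g)) (opg M g (opx M v)) = opx M (opg M g v)"
    unfolding opx_def opg_def matop_mult[OF c, symmetric] matop_mult[OF c(2,1), symmetric] is_hmodD(5)[OF M g]
    using c by (intro matop_smult[symmetric]) auto
  then have "fscale (chi g) (opx M (opg M g v)) = fscale (chi g * inverse (chi g)) (opg M g (opx M v))"
    by (metis fv.scale_scale)
  then show ?thesis using Ch_nz[OF chi_char g] by simp
qed

definition wvec :: "('g, 'k) hmod \<Rightarrow> ('g \<Rightarrow> 'k) \<Rightarrow> (nat \<Rightarrow> 'k) \<Rightarrow> bool" where
  "wvec M l v \<longleftrightarrow> v \<in> kn (hmod_dim M) \<and> (\<forall>g\<in>carrier G. opg M g v = fscale (l g) v)"

lemma wvec_x: assumes M: "is_hmod G chi M" and v: "wvec M l v" shows "wvec M (chi \<star> l) (opx M v)"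
  using v by (auto simp: wvec_def g_x_comm[OF M] fv.linop_scale cm_apply)

lemma wvec_x_pow: assumes M: "is_hmod G chi M" and v: "wvec M l v" and l: "l \<in> Ch" shows "wvec M (cp i \<star> l) ((opx M ^^ i) v)"
proof (induction i)
  case 0 then show ?case using v l by simp
next
  case (Suc i) then show ?case using wvec_x[OF M Suc] l by (simp add: cm_assoc[symmetric] cp_Suc)
qed

lemma T_pow_expand:
  "(T M b ^^ t) v = (\<Sum>l\<le>t. fscale (of_nat (t choose l) * (- b) ^ (t - l)) ((opx M ^^ (l * per b)) v))"
proof -
  have "T M b = (\<lambda>v. (opx M ^^ per b) v - fscale b v)" by (rule ext) (simp add: T_def)
  then show ?thesis
    using fv.binomial_operator[OF linop_opx_pow[of "per b" M], where b = b and t = t and v = v]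
    by (simp add: funpow_mult mult.commute cong: sum.cong)
qed

lemma opx_top:
  assumes "(T M b ^^ t) v = 0"
  shows "(opx M ^^ (t * per b)) v = (\<Sum>l<t. fscale (- (of_nat (t choose l) * (- b) ^ (t - l))) ((opx M ^^ (l * per b)) v))"
proof -
  have "0 = (\<Sum>l<t. fscale (of_nat (t choose l) * (- b) ^ (t - l)) ((opx M ^^ (l * per b)) v)) + (opx M ^^ (t * per b)) v"
    using assms unfolding T_pow_expand by (simp add: lessThan_Suc_atMost[symmetric])
  then show ?thesis by (simp add: sum_negf fv.scale_minus_left eq_neg_iff_add_eq_0 add.commute)
qed

text \<open>A weight vector killed by \<open>(x\<^sup>p - b)\<^sup>t\<close> generates a quotient of the block \<open>V t l b\<close>.\<close>

lemma realizes_V: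
  assumes M: "is_hmod G chi M" and l: "l \<in> Ch" and v: "wvec M l v" "(T M b ^^ t) v = 0"
  shows "realizes G M (\<lambda>i. (opx M ^^ i) v) (V t l b)"
  unfolding realizes_def dim_V
proof (intro allI impI conjI ballI)
  let ?n = "t * per b"
  fix j assume j: "j < ?n"
  show "(opx M ^^ j) v \<in> kn (hmod_dim M)" using v by (auto simp: wvec_def intro!: opx_pow_kn)
  have single: "(\<Sum>i<?n. fscale (if i = k then c else 0) (F i)) = fscale c (F k)" if "k < ?n" for k c and F :: "nat \<Rightarrow> nat \<Rightarrow> 'k"
    using that by (simp add: if_distrib[of "\<lambda>z. fscale z _"] sum.delta cong: if_cong)
  show "opx M ((opx M ^^ j) v) = (\<Sum>i<?n. fscale (hmod_x (V t l b) $$ (i, j)) ((opx M ^^ i) v))"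
  proof (cases "Suc j < ?n")
    case True
    have "(\<Sum>i<?n. fscale (hmod_x (V t l b) $$ (i, j)) ((opx M ^^ i) v)) = (\<Sum>i<?n. fscale (if i = Suc j then 1 else 0) ((opx M ^^ i) v))"
      using j True by (intro sum.cong) (auto simp: V_x per_def)
    also have "\<dots> = (opx M ^^ Suc j) v" using True by (subst single) auto
    finally show ?thesis by simp
  next
    case False
    then have jn: "Suc j = ?n" using j by simp
    have "opx M ((opx M ^^ j) v) = (opx M ^^ ?n) v" unfolding jn[symmetric] by simp
    also have "\<dots> = (\<Sum>l<t. fscale (- (of_nat (t choose l) * (- b) ^ (t - l))) ((opx M ^^ (l * per b)) v))"
      by (rule opx_top[OF v(2)])
    also have "\<dots> = (\<Sum>i<?n. fscale (if per b dvd i then - (of_nat (t choose (i div per b)) * (- b) ^ (t - i div per b)) else 0) ((opx M ^^ i) v))"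
    proof -
      have inj: "inj_on (\<lambda>l. l * per b) {..<t}" using per_pos[of b] by (auto simp: inj_on_def)
      have im: "(\<lambda>l. l * per b) ` {..<t} = {i. i < ?n \<and> per b dvd i}"
        using per_pos[of b] by (auto simp: dvd_def image_iff mult.commute)
      have "(\<Sum>i<?n. fscale (if per b dvd i then - (of_nat (t choose (i div per b)) * (- b) ^ (t - i div per b)) else 0) ((opx M ^^ i) v))
          = (\<Sum>i\<in>(\<lambda>l. l * per b) ` {..<t}. fscale (- (of_nat (t choose (i div per b)) * (- b) ^ (t - i div per b))) ((opx M ^^ i) v))"
        unfolding im by (intro sum.mono_neutral_cong_right) auto
      then show ?thesis using per_pos[of b] by (simp add: sum.reindex[OF inj] o_def)
    qed
    also have "\<dots> = (\<Sum>i<?n. fscale (hmod_x (V t l b) $$ (i, j)) ((opx M ^^ i) v))"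
    proof (rule sum.cong)
      fix i assume "i \<in> {..<?n}"
      then have i: "i < ?n" by simp
      have "(if per b dvd i then - (of_nat (t choose (i div per b)) * (- b) ^ (t - i div per b)) else 0) = hmod_x (V t l b) $$ (i, j)"
        using i j jn by (cases "b = 0") (auto simp: V_x per_def)
      then show "fscale (if per b dvd i then - (of_nat (t choose (i div per b)) * (- b) ^ (t - i div per b)) else 0) ((opx M ^^ i) v)
        = fscale (hmod_x (V t l b) $$ (i, j)) ((opx M ^^ i) v)" by simp
    qed simp
    finally show ?thesis .
  qed
  fix g assume g: "g \<in> carrier G"
  have "(\<Sum>i<?n. fscale (hmod_g (V t l b) g $$ (i, j)) ((opx M ^^ i) v)) = (\<Sum>i<?n. fscale (if i = j then chi g ^ j * l g else 0) ((opx M ^^ i) v))"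
    using j by (intro sum.cong) (auto simp: V_g[OF g])
  also have "\<dots> = fscale (chi g ^ j * l g) ((opx M ^^ j) v)" using j by (rule single)
  also have "\<dots> = opg M g ((opx M ^^ j) v)"
    using wvec_x_pow[OF M v(1) l, of j] g by (simp add: wvec_def cm_apply cp_apply)
  finally show "opg M g ((opx M ^^ j) v) = (\<Sum>i<?n. fscale (hmod_g (V t l b) g $$ (i, j)) ((opx M ^^ i) v))" by simp
qed

theorem block_decomposition:
  assumes M: "is_weight_hmod G chi M"
    and Bs: "\<And>v l t b. (v, l, t, b) \<in> set Bs \<Longrightarrow> l \<in> Ch \<and> wvec M l v \<and> (T M b ^^ t) v = 0"
    and d: "(\<Sum>(v, l, t, b)\<leftarrow>Bs. t * per b) = hmod_dim M"
    and sp: "\<And>i. i < hmod_dim M \<Longrightarrow> ev i \<in> fv.span (\<Union>(v, l, t, b)\<in>set Bs. (\<lambda>i. (opx M ^^ i) v) ` {..<t * per b})"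
  shows "cls M \<approx> (\<Sum>(v, l, t, b)\<leftarrow>Bs. cls (V t l b))"
proof -
  let ?f = "\<lambda>(v, l, t, b). (V t l b, \<lambda>i. (opx M ^^ i) v)"
  have "cls M \<approx> (\<Sum>(N, c)\<leftarrow>map ?f Bs. cls N)"
  proof (rule decomposition[OF grp M])
    fix N c assume "(N, c) \<in> set (map ?f Bs)"
    then obtain v l t b where "(v, l, t, b) \<in> set Bs" "N = V t l b" "c = (\<lambda>i. (opx M ^^ i) v)" by auto
    then show "is_weight_hmod G chi N \<and> realizes G M c N"
      using Bs realizes_V[OF is_weight_hmodD[OF M]] by auto
  next
    show "(\<Sum>(N, c)\<leftarrow>map ?f Bs. hmod_dim N) = hmod_dim M"
      using d by (simp add: o_def case_prod_unfold)
    have e: "(\<Union>(N, c)\<in>set (map ?f Bs). c ` {..<hmod_dim N}) = (\<Union>(v, l, t, b)\<in>set Bs. (\<lambda>i. (opx M ^^ i) v) ` {..<t * per b})"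
      by (auto simp: case_prod_unfold)
    show "ev i \<in> fv.span (\<Union>(N, c)\<in>set (map ?f Bs). c ` {..<hmod_dim N})" if "i < hmod_dim M" for i
      unfolding e by (rule sp[OF that])
  qed
  then show ?thesis by (simp add: o_def case_prod_unfold)
qed

subsection \<open>The grading of a diagonal module\<close>

text \<open>Indices beyond the dimension receive the weight \<open>e1\<close>. The projections then
  sum to the identity on all functions, not only on those in \<open>kn\<close>, and still only
  finitely many weights occur.\<close>

definition wt :: "('g, 'k) hmod \<Rightarrow> nat \<Rightarrow> 'g \<Rightarrow> 'k" where
  "wt M i = (if i < hmod_dim M then restrict (\<lambda>g. hmod_g M g $$ (i, i)) (carrier G) else e1)"
definition proj :: "('g, 'k) hmod \<Rightarrow> ('g \<Rightarrow> 'k) \<Rightarrow> (nat \<Rightarrow> 'k) \<Rightarrow> nat \<Rightarrow> 'k" where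
  "proj M l f = (\<lambda>i. if wt M i = l then f i else 0)"

lemma wt_Ch: assumes "diag_hmod M" shows "wt M i \<in> Ch"
proof (cases "i < hmod_dim M")
  case True
  let ?n = "hmod_dim M"
  interpret group G by (rule grp)
  have M: "is_hmod G chi M" and dg: "\<And>g. g \<in> carrier G \<Longrightarrow> diagonal_mat (hmod_g M g)" using assms by (auto simp: diag_hmod_def)
  have mult: "hmod_g M (g \<otimes>\<^bsub>G\<^esub> h) $$ (i, i) = hmod_g M g $$ (i, i) * hmod_g M h $$ (i, i)" if "g \<in> carrier G" "h \<in> carrier G" for g h
  proof -
    have "(hmod_g M g * hmod_g M h) $$ (i, i) = (\<Sum>j<?n. hmod_g M g $$ (i, j) * hmod_g M h $$ (j, i))"
      using is_hmodD(1)[OF M that(1)] is_hmodD(1)[OF M that(2)] True by (auto simp: scalar_prod_def atLeast0LessThan intro!: sum.cong)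
    also have "\<dots> = (\<Sum>j<?n. if j = i then hmod_g M g $$ (i, i) * hmod_g M h $$ (i, i) else 0)"
      using dg[OF that(1)] is_hmodD(1)[OF M that(1)] True unfolding diagonal_mat_def by (intro sum.cong) auto
    finally show ?thesis using is_hmodD(4)[OF M that] True by (simp add: sum.delta)
  qed
  have nz: "hmod_g M g $$ (i, i) \<noteq> 0" if g: "g \<in> carrier G" for g
    using mult[OF g inv_closed[OF g]] is_hmodD(3)[OF M] True g by auto
  show ?thesis using True nz mult by (auto simp: wt_def characters_def)
qed (simp add: wt_def)

lemma opg_diag: assumes "diag_hmod M" "f \<in> kn (hmod_dim M)" "g \<in> carrier G"
  shows "opg M g f = (\<lambda>i. wt M i g * f i)"
proof
  fix i
  have c: "hmod_g M g \<in> carrier_mat (hmod_dim M) (hmod_dim M)" "diagonal_mat (hmod_g M g)"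
    using assms is_hmodD(1)[of G chi M g] by (auto simp: diag_hmod_def)
  show "opg M g f i = wt M i g * f i"
  proof (cases "i < hmod_dim M")
    case True
    have "(\<Sum>j<hmod_dim M. hmod_g M g $$ (i, j) * f j) = (\<Sum>j<hmod_dim M. if j = i then hmod_g M g $$ (i, i) * f i else 0)"
      using c True by (intro sum.cong) (auto simp: diagonal_mat_def)
    then show ?thesis using True assms(3) by (simp add: opg_def matop_def wt_def sum.delta)
  qed (use assms in \<open>auto simp: opg_def matop_def kn_def\<close>)
qed

lemma cm_cancel: "l \<in> Ch \<Longrightarrow> m \<in> Ch \<Longrightarrow> n \<in> Ch \<Longrightarrow> n \<star> l = n \<star> m \<longleftrightarrow> l = m"
  by (metis Ch_ext Ch_nz cm_apply mult_cancel_left)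

lemma cm_pow: "m \<in> Ch \<Longrightarrow> (cm chi ^^ i) m = cp i \<star> m"
  by (induction i) (auto simp: cm_assoc[symmetric] cp_Suc)

text \<open>Comparing entries in the commutation rule shows that a nonzero entry
  \<open>(i, j)\<close> of \<open>x\<close> forces the weight of \<open>i\<close> to be
  \<open>chi\<close> times the weight of \<open>j\<close>. Hence \<open>x\<close> has degree one for
  the grading by characters, and multiplication by \<open>chi\<close> is a shift of order
  \<open>sb\<close>.\<close>

lemma graded: assumes dM: "diag_hmod M"
  shows "graded_op fscale (opx M) (proj M) (cm chi) Ch (range (wt M)) sb"
proof -
  have M: "is_hmod G chi M" and dg: "\<And>g. g \<in> carrier G \<Longrightarrow> diagonal_mat (hmod_g M g)" using dM by (auto simp: diag_hmod_def)
  let ?n = "hmod_dim M"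
  have shift: "wt M i = chi \<star> wt M j" if X: "hmod_x M $$ (i, j) \<noteq> 0" and ij: "i < ?n" "j < ?n" for i j
  proof (rule Ch_ext)
    fix g assume g: "g \<in> carrier G"
    note cg = is_hmodD(1)[OF M g] and cx = is_hmodD(2)[OF M]
    have "(hmod_x M * hmod_g M g) $$ (i, j) = hmod_x M $$ (i, j) * hmod_g M g $$ (j, j)"
    proof -
      have "(hmod_x M * hmod_g M g) $$ (i, j) = (\<Sum>k<?n. hmod_x M $$ (i, k) * hmod_g M g $$ (k, j))"
        using cg cx ij by (auto simp: scalar_prod_def atLeast0LessThan intro!: sum.cong)
      also have "\<dots> = (\<Sum>k<?n. if k = j then hmod_x M $$ (i, j) * hmod_g M g $$ (j, j) else 0)"
        using cg ij dg[OF g] by (intro sum.cong) (auto simp: diagonal_mat_def)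
      finally show ?thesis using ij by (simp add: sum.delta)
    qed
    moreover have "(hmod_g M g * hmod_x M) $$ (i, j) = hmod_g M g $$ (i, i) * hmod_x M $$ (i, j)"
    proof -
      have "(hmod_g M g * hmod_x M) $$ (i, j) = (\<Sum>k<?n. hmod_g M g $$ (i, k) * hmod_x M $$ (k, j))"
        using cg cx ij by (auto simp: scalar_prod_def atLeast0LessThan intro!: sum.cong)
      also have "\<dots> = (\<Sum>k<?n. if k = i then hmod_g M g $$ (i, i) * hmod_x M $$ (i, j) else 0)"
        using cg ij dg[OF g] by (intro sum.cong) (auto simp: diagonal_mat_def)
      finally show ?thesis using ij by (simp add: sum.delta)
    qed
    moreover have "(hmod_x M * hmod_g M g) $$ (i, j) = inverse (chi g) * (hmod_g M g * hmod_x M) $$ (i, j)"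
      unfolding is_hmodD(5)[OF M g] using cg cx ij by simp
    ultimately have "hmod_x M $$ (i, j) * hmod_g M g $$ (j, j) = inverse (chi g) * (hmod_g M g $$ (i, i) * hmod_x M $$ (i, j))"
      by metis
    then have "chi g * hmod_g M g $$ (j, j) = hmod_g M g $$ (i, i)"
      using X Ch_nz[OF chi_char g] by (simp add: field_simps)
    then show "wt M i g = (chi \<star> wt M j) g" using ij g by (simp add: wt_def cm_apply)
  qed (use wt_Ch[OF dM] in auto)
  show ?thesis
  proof unfold_locales
    show "fv.linop (opx M)" by simp
    show "fv.linop (proj M m)" for m by (auto simp: fv.linop_def proj_def fun_eq_iff)
    show "proj M m (proj M n v) = (if m = n then proj M n v else 0)" for m n v by (auto simp: proj_def fun_eq_iff)
    show "opx M (proj M m v) = proj M (chi \<star> m) (opx M v)" if "m \<in> Ch" for m v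
    proof
      fix i
      show "opx M (proj M m v) i = proj M (chi \<star> m) (opx M v) i"
      proof (cases "i < ?n")
        case True
        have "(\<Sum>j<?n. hmod_x M $$ (i, j) * proj M m v j) = (\<Sum>j<?n. if wt M i = chi \<star> m then hmod_x M $$ (i, j) * v j else 0)"
        proof (rule sum.cong)
          fix j assume j: "j \<in> {..<?n}"
          show "hmod_x M $$ (i, j) * proj M m v j = (if wt M i = chi \<star> m then hmod_x M $$ (i, j) * v j else 0)"
          proof (cases "hmod_x M $$ (i, j) = 0")
            case False
            then have "wt M i = chi \<star> wt M j" using shift True j by auto
            then have "wt M i = chi \<star> m \<longleftrightarrow> wt M j = m" using cm_cancel[of "wt M j" m chi] wt_Ch[OF dM] that by auto
            then show ?thesis by (simp add: proj_def)
          qed simp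
        qed simp
        then show ?thesis using True by (simp add: opx_def matop_def proj_def)
      qed (simp add: opx_def matop_def proj_def)
    qed
    show "inj_on (cm chi) Ch" by (rule inj_onI) (simp add: cm_cancel)
    have "range (wt M) \<subseteq> insert e1 (wt M ` {..<?n})" by (auto simp: wt_def)
    then show fin: "finite (range (wt M))" by (rule finite_subset) auto
    show "range (wt M) \<subseteq> Ch" using wt_Ch[OF dM] by auto
    show "v = (\<Sum>m\<in>range (wt M). proj M m v)" for v
    proof
      fix i
      have "(\<Sum>m\<in>range (wt M). proj M m v) i = (\<Sum>m\<in>range (wt M). if wt M i = m then v i else 0)"
        by (simp add: fsum_apply proj_def)
      also have "\<dots> = v i" using fin by (simp add: sum.delta)
      finally show "v i = (\<Sum>m\<in>range (wt M). proj M m v) i" by simp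
    qed
    show "0 < sb" by (rule sb_pos)
    show "(cm chi ^^ sb) m = m" if "m \<in> Ch" for m using that cp_order[of sb] by (simp add: cm_pow)
    show "(cm chi ^^ i) m \<noteq> m" if "m \<in> Ch" "0 < i" "i < sb" for m i
    proof
      assume "(cm chi ^^ i) m = m"
      then have "m \<star> cp i = m \<star> e1" using that by (simp add: cm_pow cm_comm)
      then have "cp i = e1" using cm_cancel[of "cp i" e1 m] that by (simp del: cm_e1)
      then show False using that by (auto simp: cp_order dest: dvd_imp_le)
    qed
  qed auto
qed

lemma wvec_proj: "diag_hmod M \<Longrightarrow> v \<in> kn (hmod_dim M) \<Longrightarrow> proj M l v = v \<Longrightarrow> wvec M l v"
  unfolding wvec_def by (auto simp: opg_diag proj_def fun_eq_iff split: if_splits)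

lemma proj_wvec: assumes "diag_hmod M" "wvec M l v" "l \<in> Ch" shows "proj M l v = v"
proof
  fix i
  have "wt M i g * v i = l g * v i" if "g \<in> carrier G" for g
    using assms that opg_diag[of M v g] by (auto simp: wvec_def fun_eq_iff)
  then have "v i = 0 \<or> wt M i = l" using Ch_ext[OF wt_Ch[OF assms(1)] assms(3)] by auto
  then show "proj M l v i = v i" by (auto simp: proj_def)
qed

lemma graded_T: assumes "diag_hmod M" shows "graded_op.T fscale (opx M) sb = T M"
proof -
  interpret gr: graded_op fscale "opx M" "proj M" "cm chi" Ch "range (wt M)" sb by (rule graded[OF assms])
  show ?thesis by (auto simp: fun_eq_iff gr.T_def T_def gr.per_def per_def)
qed

lemma graded_per: assumes "diag_hmod M" shows "graded_op.per sb = (per :: 'k \<Rightarrow> nat)"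
proof -
  interpret gr: graded_op fscale "opx M" "proj M" "cm chi" Ch "range (wt M)" sb by (rule graded[OF assms])
  show ?thesis by (auto simp: fun_eq_iff gr.per_def per_def)
qed

theorem subspace_blocks:
  assumes dM: "diag_hmod M" and S: "fv.subspace S" "S \<subseteq> kn (hmod_dim M)"
    and xS: "\<And>u. u \<in> S \<Longrightarrow> opx M u \<in> S" and prS: "\<And>u n. u \<in> S \<Longrightarrow> proj M n u \<in> S"
  shows "\<exists>Bs. (\<forall>(v, l, t, b)\<in>set Bs. v \<in> S \<and> l \<in> Ch \<and> wvec M l v \<and> t > 0 \<and> (T M b ^^ t) v = 0 \<and> (T M b ^^ (t - 1)) v \<noteq> 0)
    \<and> (\<Sum>(v, l, t, b)\<leftarrow>Bs. t * per b) \<le> fv.dim S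
    \<and> S \<subseteq> fv.span (\<Union>(v, l, t, b)\<in>set Bs. (\<lambda>i. (opx M ^^ i) v) ` {..<t * per b})"
proof -
  interpret gr: graded_op fscale "opx M" "proj M" "cm chi" Ch "range (wt M)" sb by (rule graded[OF dM])
  obtain Bs where Bs: "\<forall>B\<in>set Bs. gr.is_block S B" "(\<Sum>B\<leftarrow>Bs. gr.block_size B) \<le> fv.dim S"
    "S \<subseteq> fv.span (\<Union>B\<in>set Bs. gr.block_vecs B)"
    using gr.classification[OF root_exists S(1) _ _ xS prS, of "ev ` {..<hmod_dim M}"] S(2) unfolding kn_span by blast
  have 1: "\<forall>(v, l, t, b)\<in>set Bs. v \<in> S \<and> l \<in> Ch \<and> wvec M l v \<and> t > 0 \<and> (T M b ^^ t) v = 0 \<and> (T M b ^^ (t - 1)) v \<noteq> 0"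
  proof (intro ballI)
    fix B assume B: "B \<in> set Bs"
    obtain v l t b where e: "B = (v, l, t, b)" by (cases B) auto
    have "gr.is_block S (v, l, t, b)" using Bs(1) B e by blast
    then show "case B of (v, l, t, b) \<Rightarrow> v \<in> S \<and> l \<in> Ch \<and> wvec M l v \<and> t > 0 \<and> (T M b ^^ t) v = 0 \<and> (T M b ^^ (t - 1)) v \<noteq> 0"
      using S(2) e by (auto simp: gr.is_block_def graded_T[OF dM] intro!: wvec_proj[OF dM])
  qed
  have 2: "gr.block_size = (\<lambda>(v, l, t, b). t * per b)" by (auto simp: gr.block_size_def graded_per[OF dM])
  have 3: "gr.block_vecs = (\<lambda>(v, l, t, b). (\<lambda>i. (opx M ^^ i) v) ` {..<t * per b})"
    by (auto simp: gr.block_vecs_def graded_per[OF dM])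
  show ?thesis using 1 Bs(2,3) unfolding 2 3 by blast
qed

lemma card_UN_sum_list: "card (\<Union>B\<in>set Bs. f B ` {..<g B :: nat}) \<le> (\<Sum>B\<leftarrow>Bs. g B)"
proof (induction Bs)
  case (Cons B Bs)
  have "card (\<Union>B\<in>set (B # Bs). f B ` {..<g B}) \<le> card (f B ` {..<g B}) + card (\<Union>B\<in>set Bs. f B ` {..<g B})"
    by (simp add: card_Un_le)
  also have "\<dots> \<le> g B + (\<Sum>B\<leftarrow>Bs. g B)" using Cons card_image_le[of "{..<g B}" "f B"] by (intro add_mono) auto
  finally show ?case by simp
qed simp

text \<open>The vectors of all blocks span, so there are at least as many as the dimension; with the
  upper bound from the classification their number is exact, and the blocks give the class.\<close>

lemma diag_classification:
  assumes dM: "diag_hmod M"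
  shows "\<exists>Bs. (\<forall>(v, l, t, b)\<in>set Bs. v \<in> kn (hmod_dim M) \<and> l \<in> Ch \<and> wvec M l v \<and> t > 0 \<and> (T M b ^^ t) v = 0 \<and> (T M b ^^ (t - 1)) v \<noteq> 0)
    \<and> cls M \<approx> (\<Sum>(v, l, t, b)\<leftarrow>Bs. cls (V t l b))"
proof -
  let ?n = "hmod_dim M"
  obtain Bs where Bs: "\<forall>(v, l, t, b)\<in>set Bs. v \<in> kn ?n \<and> l \<in> Ch \<and> wvec M l v \<and> t > 0 \<and> (T M b ^^ t) v = 0 \<and> (T M b ^^ (t - 1)) v \<noteq> 0"
    "(\<Sum>(v, l, t, b)\<leftarrow>Bs. t * per b) \<le> ?n"
    "kn ?n \<subseteq> fv.span (\<Union>(v, l, t, b)\<in>set Bs. (\<lambda>i. (opx M ^^ i) v) ` {..<t * per b})"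
  proof -
    have pk: "proj M n u \<in> kn ?n" if "u \<in> kn ?n" for u n using that by (auto simp: proj_def kn_def)
    have "opx M u \<in> kn ?n" for u by simp
    from subspace_blocks[OF dM subspace_kn subset_refl this pk, unfolded dim_kn] show ?thesis
      using that by blast
  qed
  have "?n \<le> card (\<Union>(v, l, t, b)\<in>set Bs. (\<lambda>i. (opx M ^^ i) v) ` {..<t * per b})"
    using fv.dim_le_card[OF Bs(3)] by (simp add: dim_kn case_prod_unfold)
  also have "\<dots> \<le> (\<Sum>(v, l, t, b)\<leftarrow>Bs. t * per b)"
    using card_UN_sum_list[of "\<lambda>(v, l, t, b) i. (opx M ^^ i) v" "\<lambda>(v, l, t, b). t * per b" Bs] by (simp add: case_prod_unfold)
  finally have d: "(\<Sum>(v, l, t, b)\<leftarrow>Bs. t * per b) = ?n" using Bs(2) by simp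
  have "cls M \<approx> (\<Sum>(v, l, t, b)\<leftarrow>Bs. cls (V t l b))"
    using Bs(1,3) by (intro block_decomposition[OF diag_weight[OF dM] _ d]) (auto simp: subset_iff)
  then show ?thesis using Bs(1) by blast
qed

text \<open>Conjugating both actions by the matrices that diagonalise the group is a change to a
  weight basis.\<close>

lemma weight_diag_iso:
  assumes "is_weight_hmod G chi M"
  shows "\<exists>N. diag_hmod N \<and> hmod_iso G M N"
proof -
  let ?n = "hmod_dim M"
  have M: "is_hmod G chi M" using assms by (rule is_weight_hmodD)
  obtain P Q where P: "P \<in> carrier_mat ?n ?n" "Q \<in> carrier_mat ?n ?n" "P * Q = 1\<^sub>m ?n" "Q * P = 1\<^sub>m ?n"
    "\<And>g. g \<in> carrier G \<Longrightarrow> diagonal_mat (Q * hmod_g M g * P)" using assms by (auto simp: is_weight_hmod_def)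
  define N where "N = (?n, (\<lambda>g. Q * hmod_g M g * P), Q * hmod_x M * P)"
  have N: "hmod_dim N = ?n" "\<And>g. hmod_g N g = Q * hmod_g M g * P" "hmod_x N = Q * hmod_x M * P"
    by (auto simp: N_def hmod_dim_def hmod_g_def hmod_x_def)
  have conj: "Q * A * P * (Q * B * P) = Q * (A * B) * P" if A: "A \<in> carrier_mat ?n ?n" and B: "B \<in> carrier_mat ?n ?n" for A B
  proof -
    have "Q * A * P * (Q * B * P) = Q * (A * ((P * Q) * (B * P)))"
      using A B P(1,2) by (simp add: assoc_mult_mat[of _ ?n ?n _ ?n _ ?n])
    then show ?thesis using A B P by (simp add: assoc_mult_mat[of _ ?n ?n _ ?n _ ?n])
  qed
  note D = is_hmodD[OF M]
  have sm: "Q * (c \<cdot>\<^sub>m A) * P = c \<cdot>\<^sub>m (Q * A * P)" if "A \<in> carrier_mat ?n ?n" for A c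
    using that P(1,2) by (simp add: mult_smult_distrib[of _ ?n ?n _ ?n] mult_smult_assoc_mat[of _ ?n ?n _ ?n])
  have "is_hmod G chi N"
    unfolding is_hmod_def Let_def N
  proof (intro conjI ballI)
    fix g assume g: "g \<in> carrier G"
    show "Q * hmod_g M g * P \<in> carrier_mat ?n ?n" using P(1,2) D(1)[OF g] by simp
    have "Q * hmod_x M * P * (Q * hmod_g M g * P) = Q * (inverse (chi g) \<cdot>\<^sub>m (hmod_g M g * hmod_x M)) * P"
      using D(5)[OF g] conj[OF D(2) D(1)[OF g]] by simp
    also have "\<dots> = inverse (chi g) \<cdot>\<^sub>m (Q * (hmod_g M g * hmod_x M) * P)" using D(1)[OF g] D(2) by (intro sm) simp
    also have "\<dots> = inverse (chi g) \<cdot>\<^sub>m (Q * hmod_g M g * P * (Q * hmod_x M * P))" using conj[OF D(1)[OF g] D(2)] by simp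
    finally show "Q * hmod_x M * P * (Q * hmod_g M g * P) = inverse (chi g) \<cdot>\<^sub>m (Q * hmod_g M g * P * (Q * hmod_x M * P))" .
    fix h assume h: "h \<in> carrier G"
    show "Q * hmod_g M (g \<otimes>\<^bsub>G\<^esub> h) * P = Q * hmod_g M g * P * (Q * hmod_g M h * P)"
      using conj[OF D(1)[OF g] D(1)[OF h]] D(4)[OF g h] by simp
  next
    show "Q * hmod_x M * P \<in> carrier_mat ?n ?n" using P(1,2) D(2) by simp
    show "Q * hmod_g M \<one>\<^bsub>G\<^esub> * P = 1\<^sub>m ?n" using D(3) P by simp
  qed
  moreover have "hmod_iso G M N"
    unfolding hmod_iso_def N
  proof (rule conjI[OF refl], rule exI[of _ Q], rule exI[of _ P], intro conjI ballI)
    have QP: "Q * A = Q * A * P * Q" if "A \<in> carrier_mat ?n ?n" for A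
      using that P by (simp add: assoc_mult_mat[of _ ?n ?n _ ?n _ ?n])
    show "Q * hmod_x M = Q * hmod_x M * P * Q" using D(2) by (rule QP)
    fix g assume "g \<in> carrier G"
    then show "Q * hmod_g M g = Q * hmod_g M g * P * Q" using D(1) by (intro QP)
  qed (use P in auto)
  ultimately show ?thesis using P(5) N by (intro exI[of _ N]) (auto simp: diag_hmod_def)
qed

theorem weight_classification:
  assumes M: "is_weight_hmod G chi M"
  shows "\<exists>L. (\<forall>(t, l, b)\<in>set L. t > 0 \<and> l \<in> Ch) \<and> cls M \<approx> (\<Sum>(t, l, b)\<leftarrow>L. cls (V t l b))"
proof -
  obtain N where N: "diag_hmod N" "hmod_iso G M N" using weight_diag_iso[OF M] by blast
  have "cls M \<approx> cls N" unfolding geq_def by (rule green_rel.iso[OF M diag_weight[OF N(1)] N(2)])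
  also obtain Bs where Bs: "\<forall>(v, l, t, b)\<in>set Bs. v \<in> kn (hmod_dim N) \<and> l \<in> Ch \<and> wvec N l v \<and> t > 0 \<and> (T N b ^^ t) v = 0 \<and> (T N b ^^ (t - 1)) v \<noteq> 0"
    "cls N \<approx> (\<Sum>(v, l, t, b)\<leftarrow>Bs. cls (V t l b))"
    using diag_classification[OF N(1)] by blast
  note Bs(2)
  also have "(\<Sum>(v, l, t, b)\<leftarrow>Bs. cls (V t l b)) = (\<Sum>(t, l, b)\<leftarrow>map (\<lambda>(v, l, t, b). (t, l, b)) Bs. cls (V t l b))"
    by (simp add: o_def case_prod_unfold)
  finally show ?thesis using Bs(1)
    by (intro exI[of _ "map (\<lambda>(v, l, t, b). (t, l, b)) Bs"]) auto
qed

end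

section \<open>Tensor products\<close>

text \<open>The coordinates of a pure tensor, in the numbering of \<open>kron_mat\<close>;
  \<open>n\<close> is the dimension of the second factor.\<close>

definition ten :: "nat \<Rightarrow> (nat \<Rightarrow> 'k::field) \<Rightarrow> (nat \<Rightarrow> 'k) \<Rightarrow> nat \<Rightarrow> 'k" where
  "ten n f g = (\<lambda>k. f (k div n) * g (k mod n))"

lemma ten_kn: "f \<in> kn m \<Longrightarrow> g \<in> kn n \<Longrightarrow> ten n f g \<in> kn (m * n)"
  by (cases "n = 0") (auto simp: ten_def kn_def less_mult_imp_div_less not_less[symmetric] div_less_iff_less_mult)

lemma ten_add1: "ten n (f + f') g = ten n f g + ten n f' g"
  and ten_add2: "ten n f (g + g') = ten n f g + ten n f g'"
  and ten_scale1: "ten n (fscale c f) g = fscale c (ten n f g)"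
  and ten_scale2: "ten n f (fscale c g) = fscale c (ten n f g)"
  by (auto simp: ten_def fun_eq_iff algebra_simps)

lemma ten_zero1 [simp]: "ten n 0 g = 0" and ten_zero2 [simp]: "ten n f 0 = 0"
  by (auto simp: ten_def fun_eq_iff)

lemma ten_ev: "j < n \<Longrightarrow> ten n (ev i) (ev j) = ev (i * n + j)"
  by (auto simp: ten_def ev_def fun_eq_iff)

lemma ev_ten: "0 < n \<Longrightarrow> ev k = ten n (ev (k div n)) (ev (k mod n))"
  by (simp add: ten_ev)

lemma ten_assoc: "0 < p \<Longrightarrow> ten p (ten n f g) h = ten (n * p) f (ten p g h)"
  by (auto simp: ten_def fun_eq_iff div_mult2_eq mod_mult2_eq mult.assoc mult.commute[of n p])

lemma divmod_bounds: assumes "l < m * (n :: nat)" shows "0 < n \<and> l div n < m \<and> l mod n < n"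
proof -
  have "0 < n" using assms by (auto intro: gr0I)
  then show ?thesis using assms by (simp add: less_mult_imp_div_less)
qed

lemma sum_div_mod: "(\<Sum>l<m * n. F (l div n) (l mod n)) = (\<Sum>i<m. \<Sum>j<n. F i (j :: nat) :: 'a::comm_monoid_add)"
proof (cases "n = 0")
  case False
  have "(\<Sum>l<m * n. F (l div n) (l mod n)) = (\<Sum>i<m. \<Sum>l = i * n..<i * n + n. F (l div n) (l mod n))"
    by (rule sum.nat_group[symmetric])
  also have "\<dots> = (\<Sum>i<m. \<Sum>j<n. F i j)"
  proof (rule sum.cong)
    fix i
    have "(\<Sum>l = i * n..<i * n + n. F (l div n) (l mod n)) = (\<Sum>j = 0..<n. F ((j + i * n) div n) ((j + i * n) mod n))"
      using sum.shift_bounds_nat_ivl[of "\<lambda>l. F (l div n) (l mod n)" 0 "i * n" n] by (simp add: add.commute)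
    then show "(\<Sum>l = i * n..<i * n + n. F (l div n) (l mod n)) = (\<Sum>j<n. F i j)"
      using False by (simp add: atLeast0LessThan)
  qed simp
  finally show ?thesis .
qed simp

lemma kron_carrier: "A \<in> carrier_mat m m \<Longrightarrow> B \<in> carrier_mat n n \<Longrightarrow> kron_mat A B \<in> carrier_mat (m * n) (m * n)"
  by (simp add: kron_mat_def)

lemma matop_kron:
  assumes A: "A \<in> carrier_mat m m" and B: "B \<in> carrier_mat n n"
  shows "matop (m * n) (kron_mat A B) (ten n f g) = ten n (matop m A f) (matop n B g)"
proof
  fix k
  show "matop (m * n) (kron_mat A B) (ten n f g) k = ten n (matop m A f) (matop n B g) k"
  proof (cases "k < m * n")
    case True
    then have n: "n > 0" and k: "k div n < m" "k mod n < n" by (auto dest: divmod_bounds)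
    have "(\<Sum>l<m * n. kron_mat A B $$ (k, l) * ten n f g l)
        = (\<Sum>l<m * n. (\<lambda>i j. (A $$ (k div n, i) * f i) * (B $$ (k mod n, j) * g j)) (l div n) (l mod n))"
      using A B True by (intro sum.cong) (auto simp: kron_mat_def ten_def)
    also have "\<dots> = (\<Sum>i<m. A $$ (k div n, i) * f i) * (\<Sum>j<n. B $$ (k mod n, j) * g j)"
      by (subst sum_div_mod) (simp add: sum_product)
    finally show ?thesis using True k by (simp add: matop_def ten_def)
  next
    case False
    have "ten n (matop m A f) (matop n B g) \<in> kn (m * n)" by (intro ten_kn) auto
    then show ?thesis using False by (simp add: matop_def kn_def)
  qed
qed

lemma matop_add: "A \<in> carrier_mat n n \<Longrightarrow> B \<in> carrier_mat n n \<Longrightarrow> matop n (A + B) f = matop n A f + matop n B f"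
  by (auto simp: matop_def fun_eq_iff sum.distrib[symmetric] algebra_simps intro!: sum.cong)

lemma mat_eq_matop:
  assumes "A \<in> carrier_mat n n" "B \<in> carrier_mat n n" "\<And>l. l < n \<Longrightarrow> matop n A (ev l) = matop n B (ev l)"
  shows "A = B"
proof (rule eq_matI)
  fix i j assume "i < dim_row B" "j < dim_col B"
  then show "A $$ (i, j) = B $$ (i, j)"
    using assms(1,2) fun_cong[OF assms(3)[of j], of i] by (auto simp: matop_ev)
qed (use assms in auto)

lemma kron_mult:
  assumes A: "(A :: 'k::field mat) \<in> carrier_mat m m" "A' \<in> carrier_mat m m" and B: "B \<in> carrier_mat n n" "B' \<in> carrier_mat n n"
  shows "kron_mat A B * kron_mat A' B' = kron_mat (A * A') (B * B')"
proof (rule mat_eq_matop[of _ "m * n"])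
  note c = kron_carrier[OF A(1) B(1)] kron_carrier[OF A(2) B(2)]
  show "kron_mat A B * kron_mat A' B' \<in> carrier_mat (m * n) (m * n)" using c by simp
  show "kron_mat (A * A') (B * B') \<in> carrier_mat (m * n) (m * n)" using A B by (intro kron_carrier) auto
  fix l assume l: "l < m * n"
  then have n: "n > 0" by (auto intro: gr0I)
  show "matop (m * n) (kron_mat A B * kron_mat A' B') (ev l) = matop (m * n) (kron_mat (A * A') (B * B')) (ev l)"
    unfolding matop_mult[OF c] ev_ten[OF n, of l] matop_kron[OF A(2) B(2)] matop_kron[OF A(1) B(1)]
      matop_kron[OF mult_carrier_mat[OF A] mult_carrier_mat[OF B]] matop_mult[OF A] matop_mult[OF B] ..
qed

lemma kron_one: "kron_mat (1\<^sub>m m) (1\<^sub>m n) = (1\<^sub>m (m * n) :: 'k::field mat)"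
proof (rule mat_eq_matop[of _ "m * n"])
  fix l assume l: "l < m * n"
  then have n: "n > 0" and k: "l div n < m" "l mod n < n" by (auto dest: divmod_bounds)
  have "matop (m * n) (kron_mat (1\<^sub>m m) (1\<^sub>m n)) (ten n (ev (l div n)) (ev (l mod n))) = ten n (ev (l div n)) (ev (l mod n) :: nat \<Rightarrow> 'k)"
    using k by (subst matop_kron) (auto simp: matop_one)
  then show "matop (m * n) (kron_mat (1\<^sub>m m) (1\<^sub>m n)) (ev l) = matop (m * n) (1\<^sub>m (m * n)) (ev l :: nat \<Rightarrow> 'k)"
    using l by (simp add: ev_ten[OF n, symmetric] matop_one)
qed (auto intro: kron_carrier)

lemma kron_diagonal:
  assumes "A \<in> carrier_mat m m" "B \<in> carrier_mat n n" "diagonal_mat A" "diagonal_mat B"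
  shows "diagonal_mat (kron_mat A B)"
  unfolding diagonal_mat_def
proof (intro allI impI)
  fix i j assume ij: "i < dim_row (kron_mat A B)" "j < dim_col (kron_mat A B)" "i \<noteq> j"
  then have b: "i < m * n" "j < m * n" using assms by (auto simp: kron_mat_def)
  then have n: "n > 0" and k: "i div n < m" "i mod n < n" "j div n < m" "j mod n < n"
    by (auto dest: divmod_bounds)
  have "i div n \<noteq> j div n \<or> i mod n \<noteq> j mod n" using ij(3) by (metis div_mult_mod_eq)
  then show "kron_mat A B $$ (i, j) = 0"
    using assms b k by (auto simp: kron_mat_def diagonal_mat_def)
qed

lemma dim_tensor [simp]: "hmod_dim (tensor_hmod G a M N) = hmod_dim M * hmod_dim N"
  by (simp add: tensor_hmod_def hmod_dim_def)
lemma tensor_g: "g \<in> carrier G \<Longrightarrow> hmod_g (tensor_hmod G a M N) g = kron_mat (hmod_g M g) (hmod_g N g)"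
  by (simp add: tensor_hmod_def hmod_g_def)
lemma tensor_x: "hmod_x (tensor_hmod G a M N) = kron_mat (hmod_x M) (hmod_g N a) + kron_mat (1\<^sub>m (hmod_dim M)) (hmod_x N)"
  by (simp add: tensor_hmod_def hmod_x_def)

definition shf :: "nat \<Rightarrow> (nat \<Rightarrow> 'k::field) \<Rightarrow> nat \<Rightarrow> 'k" where
  "shf d f = (\<lambda>i. if i < d then 0 else f (i - d))"

lemma linop_shf: "fv.linop (shf d)" by (auto simp: fv.linop_def shf_def fun_eq_iff)
lemma shf_ev: "shf d (ev i) = ev (d + i)" by (auto simp: shf_def ev_def fun_eq_iff)
lemma shf_kn: "f \<in> kn n \<Longrightarrow> shf d f \<in> kn (d + n)" by (auto simp: shf_def kn_def)

text \<open>Embeddings into sums and products are given by linear maps on coordinates, and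
  commutation with the actions is tested on basis vectors, where tensors and shifts are
  explicit.\<close>

lemma realizes_intertwiner:
  fixes M N :: "('g, 'k::field) hmod"
  assumes N: "is_hmod G chi N" and J: "fv.linop J"
    and kn: "\<And>j. j < hmod_dim N \<Longrightarrow> J (ev j) \<in> kn (hmod_dim M)"
    and x: "\<And>j. j < hmod_dim N \<Longrightarrow> opx M (J (ev j)) = J (opx N (ev j))"
    and g: "\<And>j g. j < hmod_dim N \<Longrightarrow> g \<in> carrier G \<Longrightarrow> opg M g (J (ev j)) = J (opg N g (ev j))"
  shows "realizes G M (\<lambda>j. J (ev j)) N"
proof -
  have e: "matop (hmod_dim N) A (ev j) = (\<Sum>i<hmod_dim N. fscale (A $$ (i, j)) (ev i))" if "j < hmod_dim N" for A :: "'k mat" and j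
  proof -
    have "matop (hmod_dim N) A (ev j) = (\<Sum>i<hmod_dim N. fscale (matop (hmod_dim N) A (ev j) i) (ev i))"
      by (rule kn_expand[OF matop_kn])
    also have "\<dots> = (\<Sum>i<hmod_dim N. fscale (A $$ (i, j)) (ev i))"
      by (rule sum.cong) (auto simp: matop_ev[OF that])
    finally show ?thesis .
  qed
  show ?thesis unfolding realizes_def
    using kn x g by (auto simp: opx_def opg_def e fv.linop_comb[OF J])
qed

lemma matop_block:
  assumes A: "A \<in> carrier_mat m m" and B: "B \<in> carrier_mat n n"
  shows "f \<in> kn m \<Longrightarrow> matop (m + n) (four_block_mat A (0\<^sub>m m n) (0\<^sub>m n m) B) f = matop m A f"
    and "f \<in> kn n \<Longrightarrow> matop (m + n) (four_block_mat A (0\<^sub>m m n) (0\<^sub>m n m) B) (shf m f) = shf m (matop n B f)"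
proof -
  have split: "(\<Sum>i<m + n. h i) = (\<Sum>i<m. h i) + (\<Sum>i<n. h (m + i))" for h :: "nat \<Rightarrow> 'a"
    using sum.atLeastLessThan_concat[of 0 m "m + n" h] sum.shift_bounds_nat_ivl[of h 0 m n]
    by (simp add: atLeast0LessThan add.commute)
  show "matop (m + n) (four_block_mat A (0\<^sub>m m n) (0\<^sub>m n m) B) f = matop m A f" if "f \<in> kn m"
    using that A B by (auto simp: fun_eq_iff matop_def split kn_def)
  show "matop (m + n) (four_block_mat A (0\<^sub>m m n) (0\<^sub>m n m) B) (shf m f) = shf m (matop n B f)" if "f \<in> kn n"
    using that A B by (auto simp: fun_eq_iff matop_def split kn_def shf_def)
qed

lemma opx_dsum:
  assumes M: "is_hmod G chi M" and N: "is_hmod G chi N"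
  shows "f \<in> kn (hmod_dim M) \<Longrightarrow> opx (dsum_hmod G M N) f = opx M f"
    and "f \<in> kn (hmod_dim N) \<Longrightarrow> opx (dsum_hmod G M N) (shf (hmod_dim M) f) = shf (hmod_dim M) (opx N f)"
    and "g \<in> carrier G \<Longrightarrow> f \<in> kn (hmod_dim M) \<Longrightarrow> opg (dsum_hmod G M N) g f = opg M g f"
    and "g \<in> carrier G \<Longrightarrow> f \<in> kn (hmod_dim N) \<Longrightarrow> opg (dsum_hmod G M N) g (shf (hmod_dim M) f) = shf (hmod_dim M) (opg N g f)"
  unfolding opx_def opg_def hmod_dim_dsum hmod_x_dsum
  using matop_block[OF is_hmodD(2)[OF M] is_hmodD(2)[OF N]] matop_block[OF is_hmodD(1)[OF M] is_hmodD(1)[OF N]]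
  by (auto simp: hmod_g_dsum)

context hopf_ctx
begin

abbreviation tn (infixl "\<boxtimes>" 70) where "M \<boxtimes> N \<equiv> tensor_hmod G a M N"

lemma tensor_x_carrier:
  assumes M: "is_hmod G chi M" and N: "is_hmod G chi N"
  shows "kron_mat (hmod_x M) (hmod_g N a) \<in> carrier_mat (hmod_dim M * hmod_dim N) (hmod_dim M * hmod_dim N)"
    "kron_mat (1\<^sub>m (hmod_dim M)) (hmod_x N) \<in> carrier_mat (hmod_dim M * hmod_dim N) (hmod_dim M * hmod_dim N)"
  using is_hmodD[OF M] is_hmodD[OF N] aG by (auto intro!: kron_carrier)

lemma opx_ten:
  assumes M: "is_hmod G chi M" and N: "is_hmod G chi N" and f: "f \<in> kn (hmod_dim M)"
  shows "opx (M \<boxtimes> N) (ten (hmod_dim N) f g) = ten (hmod_dim N) (opx M f) (opg N a g) + ten (hmod_dim N) f (opx N g)"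
  unfolding opx_def dim_tensor tensor_x matop_add[OF tensor_x_carrier[OF M N]]
  using is_hmodD[OF M] is_hmodD[OF N] aG f by (auto simp: matop_kron opg_def matop_one)

lemma opg_ten:
  assumes M: "is_hmod G chi M" and N: "is_hmod G chi N" and h: "h \<in> carrier G"
  shows "opg (M \<boxtimes> N) h (ten (hmod_dim N) f g) = ten (hmod_dim N) (opg M h f) (opg N h g)"
  unfolding opg_def dim_tensor tensor_g[OF h]
  using is_hmodD[OF M] is_hmodD[OF N] h by (auto simp: matop_kron)

lemma opg_mult: "is_hmod G chi M \<Longrightarrow> g \<in> carrier G \<Longrightarrow> h \<in> carrier G \<Longrightarrow> opg M (g \<otimes>\<^bsub>G\<^esub> h) f = opg M g (opg M h f)"
  by (simp add: opg_def is_hmodD(4) matop_mult is_hmodD(1))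

text \<open>The element \<open>a\<close> acts on the second factor in the coproduct of
  \<open>x\<close>, so the rule for \<open>x g\<close> needs \<open>g\<close> and \<open>a\<close>
  to commute there. This is where the centrality of \<open>a\<close> enters.\<close>

lemma is_hmod_tensor:
  assumes M: "is_hmod G chi M" and N: "is_hmod G chi N"
  shows "is_hmod G chi (M \<boxtimes> N)"
  unfolding is_hmod_def Let_def dim_tensor
proof (intro conjI ballI)
  let ?m = "hmod_dim M" and ?n = "hmod_dim N"
  interpret group G by (rule grp)
  note DM = is_hmodD[OF M] and DN = is_hmodD[OF N]
  have cx: "hmod_x (M \<boxtimes> N) \<in> carrier_mat (?m * ?n) (?m * ?n)"
    unfolding tensor_x using tensor_x_carrier[OF M N] by simp
  then show "hmod_x (M \<boxtimes> N) \<in> carrier_mat (?m * ?n) (?m * ?n)" .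
  fix g assume g: "g \<in> carrier G"
  have cg: "hmod_g (M \<boxtimes> N) h \<in> carrier_mat (?m * ?n) (?m * ?n)" if "h \<in> carrier G" for h
    unfolding tensor_g[OF that] using DM(1)[OF that] DN(1)[OF that] by (rule kron_carrier)
  show "hmod_g (M \<boxtimes> N) g \<in> carrier_mat (?m * ?n) (?m * ?n)" by (rule cg[OF g])
  show "hmod_x (M \<boxtimes> N) * hmod_g (M \<boxtimes> N) g = inverse (chi g) \<cdot>\<^sub>m (hmod_g (M \<boxtimes> N) g * hmod_x (M \<boxtimes> N))"
  proof (rule mat_eq_matop[of _ "?m * ?n"])
    fix l assume l: "l < ?m * ?n"
    then have n: "?n > 0" and k: "l div ?n < ?m" "l mod ?n < ?n" by (auto dest: divmod_bounds)
    let ?e = "ten ?n (ev (l div ?n)) (ev (l mod ?n))"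
    have c0: "chi g \<noteq> 0" using Ch_nz[OF chi_char g] .
    have ga: "opg N g (opg N a f) = opg N a (opg N g f)" for f
      using opg_mult[OF N g aG] opg_mult[OF N aG g] central g by metis
    have "opg (M \<boxtimes> N) g (opx (M \<boxtimes> N) ?e) = fscale (chi g) (opx (M \<boxtimes> N) (opg (M \<boxtimes> N) g ?e))"
      using k by (simp add: opx_ten[OF M N] opg_ten[OF M N g] fv.linop_add ga g_x_comm[OF M g] g_x_comm[OF N g]
          ten_scale1 ten_scale2 fv.scale_right_distrib) (simp add: fun_eq_iff)
    then have "opx (M \<boxtimes> N) (opg (M \<boxtimes> N) g ?e) = fscale (inverse (chi g)) (opg (M \<boxtimes> N) g (opx (M \<boxtimes> N) ?e))"
      using c0 by simp
    then show "matop (?m * ?n) (hmod_x (M \<boxtimes> N) * hmod_g (M \<boxtimes> N) g) (ev l)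
      = matop (?m * ?n) (inverse (chi g) \<cdot>\<^sub>m (hmod_g (M \<boxtimes> N) g * hmod_x (M \<boxtimes> N))) (ev l)"
      using cx cg[OF g] unfolding ev_ten[OF n, of l] by (simp add: matop_smult matop_mult opx_def opg_def)
  qed (use cx cg g in \<open>auto intro!: smult_carrier_mat mult_carrier_mat\<close>)
  fix h assume h: "h \<in> carrier G"
  show "hmod_g (M \<boxtimes> N) (g \<otimes>\<^bsub>G\<^esub> h) = hmod_g (M \<boxtimes> N) g * hmod_g (M \<boxtimes> N) h"
    using kron_mult[OF DM(1)[OF g] DM(1)[OF h] DN(1)[OF g] DN(1)[OF h]] closedG[OF g h]
    by (simp add: tensor_g g h DM(4) DN(4))
next
  interpret group G by (rule grp)
  show "hmod_g (M \<boxtimes> N) \<one>\<^bsub>G\<^esub> = 1\<^sub>m (hmod_dim M * hmod_dim N)"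
    by (simp add: tensor_g is_hmodD(3)[OF M] is_hmodD(3)[OF N] kron_one)
qed

lemma diag_tensor [simp]: "diag_hmod M \<Longrightarrow> diag_hmod N \<Longrightarrow> diag_hmod (M \<boxtimes> N)"
  unfolding diag_hmod_def using is_hmodD(1)[of G chi M] is_hmodD(1)[of G chi N]
  by (auto simp: is_hmod_tensor tensor_g intro!: kron_diagonal[of _ "hmod_dim M" _ "hmod_dim N"])

lemma weight_tensor:
  assumes M: "is_weight_hmod G chi M" and N: "is_weight_hmod G chi N"
  shows "is_weight_hmod G chi (M \<boxtimes> N)"
proof -
  let ?m = "hmod_dim M" and ?n = "hmod_dim N"
  obtain P Q where P: "P \<in> carrier_mat ?m ?m" "Q \<in> carrier_mat ?m ?m" "P * Q = 1\<^sub>m ?m" "Q * P = 1\<^sub>m ?m"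
    "\<And>g. g \<in> carrier G \<Longrightarrow> diagonal_mat (Q * hmod_g M g * P)" using M by (auto simp: is_weight_hmod_def)
  obtain P' Q' where P': "P' \<in> carrier_mat ?n ?n" "Q' \<in> carrier_mat ?n ?n" "P' * Q' = 1\<^sub>m ?n" "Q' * P' = 1\<^sub>m ?n"
    "\<And>g. g \<in> carrier G \<Longrightarrow> diagonal_mat (Q' * hmod_g N g * P')" using N by (auto simp: is_weight_hmod_def)
  have hM: "is_hmod G chi M" and hN: "is_hmod G chi N" using M N by (auto simp: is_weight_hmod_def)
  have "diagonal_mat (kron_mat Q Q' * hmod_g (M \<boxtimes> N) g * kron_mat P P')" if g: "g \<in> carrier G" for g
  proof -
    note c = is_hmodD(1)[OF hM g] is_hmodD(1)[OF hN g]
    have "kron_mat Q Q' * hmod_g (M \<boxtimes> N) g * kron_mat P P' = kron_mat (Q * hmod_g M g * P) (Q' * hmod_g N g * P')"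
      unfolding tensor_g[OF g] using c P(1,2) P'(1,2) by (simp add: kron_mult[of _ ?m _ _ ?n])
    then show ?thesis using P(1,2) P(5)[OF g] P'(1,2) P'(5)[OF g] c
      by (auto intro!: kron_diagonal[of _ ?m _ ?n])
  qed
  moreover have "kron_mat P P' * kron_mat Q Q' = 1\<^sub>m (?m * ?n)" "kron_mat Q Q' * kron_mat P P' = 1\<^sub>m (?m * ?n)"
    using P P' by (simp_all add: kron_mult[of _ ?m _ _ ?n] kron_one)
  ultimately show ?thesis unfolding is_weight_hmod_def dim_tensor
    using is_hmod_tensor[OF hM hN] kron_carrier[OF P(1) P'(1)] kron_carrier[OF P(2) P'(2)] by blast
qed

lemma iso_tensor:
  assumes M: "is_hmod G chi M" and M': "is_hmod G chi M'" and N: "is_hmod G chi N" and iso: "hmod_iso G M M'"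
  shows "hmod_iso G (M \<boxtimes> N) (M' \<boxtimes> N)" "hmod_iso G (N \<boxtimes> M) (N \<boxtimes> M')"
proof -
  let ?m = "hmod_dim M" and ?n = "hmod_dim N"
  obtain P Q where d: "hmod_dim M' = ?m" and P: "P \<in> carrier_mat ?m ?m" "Q \<in> carrier_mat ?m ?m" "P * Q = 1\<^sub>m ?m" "Q * P = 1\<^sub>m ?m"
    "\<And>g. g \<in> carrier G \<Longrightarrow> P * hmod_g M g = hmod_g M' g * P" "P * hmod_x M = hmod_x M' * P"
    using iso by (auto simp: hmod_iso_def)
  note D = is_hmodD(1,2)[OF M] is_hmodD(1,2)[OF M', unfolded d] is_hmodD(1,2)[OF N]
  have one: "1\<^sub>m ?n * hmod_g N a = hmod_g N a" "hmod_g N a * 1\<^sub>m ?n = hmod_g N a" "1\<^sub>m ?n * hmod_x N = hmod_x N" "hmod_x N * 1\<^sub>m ?n = hmod_x N"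
    using D(5)[OF aG] D(6) by auto
  have i: "1\<^sub>m ?n \<in> carrier_mat ?n ?n" and im: "1\<^sub>m ?m \<in> carrier_mat ?m ?m" by auto
  have dist: "(A + B) * C = A * C + B * C" "C * (A + B) = C * A + C * B"
    if "A \<in> carrier_mat k k" "B \<in> carrier_mat k k" "C \<in> carrier_mat k k" for A B C :: "'k mat" and k
    using that by (simp_all add: add_mult_distrib_mat[of _ k k] mult_add_distrib_mat[of _ k k])
  show "hmod_iso G (M \<boxtimes> N) (M' \<boxtimes> N)"
    unfolding hmod_iso_def dim_tensor d
  proof (rule conjI[OF refl], rule exI[of _ "kron_mat P (1\<^sub>m ?n)"], rule exI[of _ "kron_mat Q (1\<^sub>m ?n)"], intro conjI ballI)
    show "kron_mat P (1\<^sub>m ?n) * hmod_x (M \<boxtimes> N) = hmod_x (M' \<boxtimes> N) * kron_mat P (1\<^sub>m ?n)"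
      unfolding tensor_x d using D P aG
      by (simp add: one dist[of _ "?m * ?n"] kron_carrier kron_mult[of _ ?m _ _ ?n])
    fix g assume g: "g \<in> carrier G"
    show "kron_mat P (1\<^sub>m ?n) * hmod_g (M \<boxtimes> N) g = hmod_g (M' \<boxtimes> N) g * kron_mat P (1\<^sub>m ?n)"
      unfolding tensor_g[OF g] using D(1,3,5)[OF g] P(1,5) g by (simp add: kron_mult[of _ ?m _ _ ?n])
  qed (use P in \<open>auto simp: kron_mult[of _ ?m _ _ ?n] kron_one intro: kron_carrier\<close>)
  show "hmod_iso G (N \<boxtimes> M) (N \<boxtimes> M')"
    unfolding hmod_iso_def dim_tensor d
  proof (rule conjI[OF refl], rule exI[of _ "kron_mat (1\<^sub>m ?n) P"], rule exI[of _ "kron_mat (1\<^sub>m ?n) Q"], intro conjI ballI)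
    show "kron_mat (1\<^sub>m ?n) P * hmod_x (N \<boxtimes> M) = hmod_x (N \<boxtimes> M') * kron_mat (1\<^sub>m ?n) P"
      unfolding tensor_x using D P aG
      by (simp add: dist[of _ "?n * ?m"] kron_carrier kron_mult[of _ ?n _ _ ?m])
    fix g assume g: "g \<in> carrier G"
    show "kron_mat (1\<^sub>m ?n) P * hmod_g (N \<boxtimes> M) g = hmod_g (N \<boxtimes> M') g * kron_mat (1\<^sub>m ?n) P"
      unfolding tensor_g[OF g] using D(1,3,5)[OF g] P(1,5) g by (simp add: kron_mult[of _ ?n _ _ ?m])
  qed (use P in \<open>auto simp: kron_mult[of _ ?n _ _ ?m] kron_one intro: kron_carrier\<close>)
qed

text \<open>In the lexicographic numbering both bracketings have the same matrices, so the identity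
  is an isomorphism. For \<open>x\<close> this is coassociativity: \<open>a\<close> acts on
  \<open>M \<boxtimes> N\<close> as \<open>a\<close> on both factors.\<close>

lemma tensor_assoc:
  assumes L: "is_hmod G chi L" and M: "is_hmod G chi M" and N: "is_hmod G chi N"
  shows "hmod_iso G (L \<boxtimes> M \<boxtimes> N) (L \<boxtimes> (M \<boxtimes> N))"
proof -
  let ?d = "hmod_dim L * hmod_dim M * hmod_dim N"
  let ?A = "L \<boxtimes> M \<boxtimes> N" and ?B = "L \<boxtimes> (M \<boxtimes> N)"
  have hA: "is_hmod G chi ?A" and hB: "is_hmod G chi ?B" using assms by (auto intro!: is_hmod_tensor)
  have dA: "hmod_dim ?A = ?d" and dB: "hmod_dim ?B = ?d" by auto
  note D = is_hmodD(1,2)[OF hA, unfolded dA] is_hmodD(1,2)[OF hB, unfolded dB]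
  have ev3: "l < ?d \<Longrightarrow> \<exists>i j k. i < hmod_dim L \<and> j < hmod_dim M \<and> k < hmod_dim N \<and> hmod_dim N > 0
     \<and> (ev l :: nat \<Rightarrow> 'k) = ten (hmod_dim N) (ten (hmod_dim M) (ev i) (ev j)) (ev k)
     \<and> (ev l :: nat \<Rightarrow> 'k) = ten (hmod_dim M * hmod_dim N) (ev i) (ten (hmod_dim N) (ev j) (ev k))" for l
  proof -
    let ?m = "hmod_dim M" and ?n = "hmod_dim N"
    assume l: "l < ?d"
    then have p: "?m > 0" "?n > 0" by (auto intro: gr0I)
    have 1: "l div ?n < hmod_dim L * ?m" "l mod ?n < ?n" using l p by (auto simp: less_mult_imp_div_less)
    then have 2: "l div ?n div ?m < hmod_dim L" "l div ?n mod ?m < ?m" using p by (auto simp: less_mult_imp_div_less)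
    have "(ev l :: nat \<Rightarrow> 'k) = ten ?n (ten ?m (ev (l div ?n div ?m)) (ev (l div ?n mod ?m))) (ev (l mod ?n))"
      by (simp add: ev_ten[OF p(1), symmetric] ev_ten[OF p(2), symmetric])
    note e1 = this
    note e2 = e1[unfolded ten_assoc[OF p(2)]]
    show ?thesis
      by (rule exI[of _ "l div ?n div ?m"], rule exI[of _ "l div ?n mod ?m"], rule exI[of _ "l mod ?n"])
        (intro conjI 1 2 p e1 e2)
  qed
  have X: "hmod_x ?A = hmod_x ?B"
  proof (rule mat_eq_matop[OF D(2) D(4)])
    fix l assume lt: "l < ?d"
    obtain i j k where l: "i < hmod_dim L" "j < hmod_dim M" "k < hmod_dim N" "hmod_dim N > 0"
      and e: "(ev l :: nat \<Rightarrow> 'k) = ten (hmod_dim N) (ten (hmod_dim M) (ev i) (ev j)) (ev k)" "(ev l :: nat \<Rightarrow> 'k) = ten (hmod_dim M * hmod_dim N) (ev i) (ten (hmod_dim N) (ev j) (ev k))"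
      using ev3[OF lt] by (elim exE conjE) (rule that)
    have "opx ?A (ev l) = ten (hmod_dim N) (opx (L \<boxtimes> M) (ten (hmod_dim M) (ev i) (ev j))) (opg N a (ev k))
        + ten (hmod_dim N) (ten (hmod_dim M) (ev i) (ev j)) (opx N (ev k))"
      unfolding e(1) by (rule opx_ten[OF is_hmod_tensor[OF L M] N]) (use l in \<open>auto intro: ten_kn\<close>)
    also have "\<dots> = opx ?B (ev l)"
      unfolding e(2) using l opx_ten[OF L is_hmod_tensor[OF M N], of "ev i" "ten (hmod_dim N) (ev j) (ev k)"]
      by (simp add: opx_ten[OF L M] opx_ten[OF M N] opg_ten[OF M N aG] ten_add1 ten_add2 ten_assoc add.assoc)
    finally show "matop ?d (hmod_x ?A) (ev l) = matop ?d (hmod_x ?B) (ev l)" unfolding opx_def dA dB .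
  qed
  have Gm: "hmod_g ?A g = hmod_g ?B g" if g: "g \<in> carrier G" for g
  proof (rule mat_eq_matop[OF D(1)[OF g] D(3)[OF g]])
    fix l assume lt: "l < ?d"
    obtain i j k where l: "i < hmod_dim L" "j < hmod_dim M" "k < hmod_dim N" "hmod_dim N > 0"
      and e: "(ev l :: nat \<Rightarrow> 'k) = ten (hmod_dim N) (ten (hmod_dim M) (ev i) (ev j)) (ev k)" "(ev l :: nat \<Rightarrow> 'k) = ten (hmod_dim M * hmod_dim N) (ev i) (ten (hmod_dim N) (ev j) (ev k))"
      using ev3[OF lt] by (elim exE conjE) (rule that)
    have "opg ?A g (ev l) = ten (hmod_dim N) (opg (L \<boxtimes> M) g (ten (hmod_dim M) (ev i) (ev j))) (opg N g (ev k))"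
      unfolding e(1) by (rule opg_ten[OF is_hmod_tensor[OF L M] N g])
    also have "\<dots> = opg ?B g (ev l)"
      unfolding e(2) using l opg_ten[OF L is_hmod_tensor[OF M N] g, of "ev i" "ten (hmod_dim N) (ev j) (ev k)"]
      by (simp add: opg_ten[OF L M g] opg_ten[OF M N g] ten_assoc)
    finally have "opg ?A g (ev l) = opg ?B g (ev l)" .
    then show "matop ?d (hmod_g ?A g) (ev l) = matop ?d (hmod_g ?B g) (ev l)" unfolding opg_def dA dB .
  qed
  show ?thesis unfolding hmod_iso_def dA dB
    using left_mult_one_mat[OF D(4)] right_mult_one_mat[OF D(4)] left_mult_one_mat[OF D(3)] right_mult_one_mat[OF D(3)]
    by (intro conjI exI[of _ "1\<^sub>m ?d"] ballI) (simp_all only: X Gm one_carrier_mat left_mult_one_mat[OF one_carrier_mat])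
qed

lemma cls_iso: "is_weight_hmod G chi M \<Longrightarrow> is_weight_hmod G chi N \<Longrightarrow> hmod_iso G M N \<Longrightarrow> cls M \<approx> cls N"
  unfolding geq_def by (rule green_rel.iso)

text \<open>In the numbering of the product the copy of \<open>M \<boxtimes> P\<close> comes first,
  and that of \<open>N \<boxtimes> P\<close> is shifted by the product of the dimensions of
  \<open>M\<close> and \<open>P\<close>.\<close>

lemma tensor_dsum_left:
  assumes M: "is_weight_hmod G chi M" and N: "is_weight_hmod G chi N" and P: "is_weight_hmod G chi P"
  shows "cls (dsum_hmod G M N \<boxtimes> P) \<approx> cls (M \<boxtimes> P) + cls (N \<boxtimes> P)"
proof -
  let ?m = "hmod_dim M" and ?n = "hmod_dim N" and ?p = "hmod_dim P"
  let ?S = "dsum_hmod G M N"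
  note h = is_weight_hmodD[OF M] is_weight_hmodD[OF N] is_weight_hmodD[OF P]
  note hS = is_hmod_dsum[OF h(1,2) grp]
  have sh: "shf (?m * ?p) (ten ?p f g) = ten ?p (shf ?m f) g" if "?p > 0" for f g :: "nat \<Rightarrow> 'k"
  proof
    fix k
    show "shf (?m * ?p) (ten ?p f g) k = ten ?p (shf ?m f) g k"
    proof (cases "k < ?m * ?p")
      case True then show ?thesis by (auto simp: shf_def ten_def dest: divmod_bounds)
    next
      case False
      then obtain r where r: "k = r + ?m * ?p" by (metis add.commute le_Suc_ex not_less)
      have "k div ?p = r div ?p + ?m" "k mod ?p = r mod ?p" using that by (simp_all add: r)
      then show ?thesis using r by (simp add: shf_def ten_def)
    qed
  qed
  let ?Bs = "[(M \<boxtimes> P, \<lambda>k. ev k :: nat \<Rightarrow> 'k), (N \<boxtimes> P, \<lambda>k. shf (?m * ?p) (ev k))]"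
  have r1: "realizes G (?S \<boxtimes> P) (\<lambda>k. ev k) (M \<boxtimes> P)"
  proof (rule realizes_intertwiner[OF is_hmod_tensor[OF h(1,3)], of "\<lambda>f. f"])
    fix j assume j: "j < hmod_dim (M \<boxtimes> P)"
    then have p: "?p > 0" and k: "j div ?p < ?m" "j mod ?p < ?p" by (auto dest: divmod_bounds)
    show "ev j \<in> kn (hmod_dim (?S \<boxtimes> P))" using j by (auto simp: algebra_simps)
    show "opx (?S \<boxtimes> P) (ev j) = opx (M \<boxtimes> P) (ev j)"
      unfolding ev_ten[OF p, of j] using k by (simp add: opx_ten[OF hS h(3)] opx_ten[OF h(1,3)] opx_dsum[OF h(1,2)])
    fix g assume g: "g \<in> carrier G"
    show "opg (?S \<boxtimes> P) g (ev j) = opg (M \<boxtimes> P) g (ev j)"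
      unfolding ev_ten[OF p, of j] using k g by (simp add: opg_ten[OF hS h(3)] opg_ten[OF h(1,3)] opx_dsum[OF h(1,2)])
  qed (rule fv.linop_id)
  have r2: "realizes G (?S \<boxtimes> P) (\<lambda>k. shf (?m * ?p) (ev k)) (N \<boxtimes> P)"
  proof (rule realizes_intertwiner[OF is_hmod_tensor[OF h(2,3)] linop_shf])
    fix j assume j: "j < hmod_dim (N \<boxtimes> P)"
    then have p: "?p > 0" and k: "j div ?p < ?n" "j mod ?p < ?p" by (auto dest: divmod_bounds)
    have kk: "shf ?m (ev (j div ?p) :: nat \<Rightarrow> 'k) \<in> kn (?m + ?n)" using k by (intro shf_kn) simp
    show "shf (?m * ?p) (ev j) \<in> kn (hmod_dim (?S \<boxtimes> P))" using j by (auto simp: shf_ev algebra_simps)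
    show "opx (?S \<boxtimes> P) (shf (?m * ?p) (ev j)) = shf (?m * ?p) (opx (N \<boxtimes> P) (ev j))"
      unfolding ev_ten[OF p, of j] sh[OF p] using k kk
      by (simp add: opx_ten[OF hS h(3)] opx_ten[OF h(2,3)] opx_dsum[OF h(1,2)] sh[OF p] fv.linop_add[OF linop_shf])
    fix g assume g: "g \<in> carrier G"
    show "opg (?S \<boxtimes> P) g (shf (?m * ?p) (ev j)) = shf (?m * ?p) (opg (N \<boxtimes> P) g (ev j))"
      unfolding ev_ten[OF p, of j] sh[OF p] using k g
      by (simp add: opg_ten[OF hS h(3)] opg_ten[OF h(2,3)] opx_dsum[OF h(1,2)] sh[OF p])
  qed
  have "cls (?S \<boxtimes> P) \<approx> (\<Sum>(N, c)\<leftarrow>?Bs. cls N)"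
  proof (rule decomposition[OF grp weight_tensor[OF is_weight_hmod_dsum[OF M N grp] P]])
    fix i assume i: "i < hmod_dim (?S \<boxtimes> P)"
    show "ev i \<in> fv.span (\<Union>(N, c)\<in>set ?Bs. c ` {..<hmod_dim N})"
    proof (cases "i < ?m * ?p")
      case True then show ?thesis by (intro fv.span_base) auto
    next
      case False
      then have "ev i = shf (?m * ?p) (ev (i - ?m * ?p))" "i - ?m * ?p < ?n * ?p" using i by (auto simp: shf_ev algebra_simps)
      then show ?thesis by (intro fv.span_base) auto
    qed
  qed (use r1 r2 weight_tensor[OF M P] weight_tensor[OF N P] in \<open>auto simp: algebra_simps\<close>)
  then show ?thesis by simp
qed

text \<open>Here the summands are interleaved: the coordinates over each basis vector of
  \<open>P\<close> contain a piece of both, and \<open>J1\<close>, \<open>J2\<close> spread the two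
  products over these pieces.\<close>

lemma tensor_dsum_right:
  assumes M: "is_weight_hmod G chi M" and N: "is_weight_hmod G chi N" and P: "is_weight_hmod G chi P"
  shows "cls (P \<boxtimes> dsum_hmod G M N) \<approx> cls (P \<boxtimes> M) + cls (P \<boxtimes> N)"
proof -
  let ?m = "hmod_dim M" and ?n = "hmod_dim N" and ?p = "hmod_dim P"
  let ?S = "dsum_hmod G M N"
  note h = is_weight_hmodD[OF M] is_weight_hmodD[OF N] is_weight_hmodD[OF P]
  note hS = is_hmod_dsum[OF h(1,2) grp]
  define J1 where "J1 h = (\<lambda>k. if k mod (?m + ?n) < ?m then h (k div (?m + ?n) * ?m + k mod (?m + ?n)) else 0)" for h :: "nat \<Rightarrow> 'k"
  define J2 where "J2 h = (\<lambda>k. if ?m \<le> k mod (?m + ?n) then h (k div (?m + ?n) * ?n + (k mod (?m + ?n) - ?m)) else 0)" for h :: "nat \<Rightarrow> 'k"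
  have l1: "fv.linop J1" and l2: "fv.linop J2" by (auto simp: fv.linop_def J1_def J2_def fun_eq_iff)
  have J1: "J1 (ten ?m f g) = ten (?m + ?n) f g" if "g \<in> kn ?m" for f g
    using that by (auto simp: J1_def ten_def fun_eq_iff kn_def)
  have J2: "J2 (ten ?n f g) = ten (?m + ?n) f (shf ?m g)" if "g \<in> kn ?n" "?n > 0" for f g
  proof
    fix k
    let ?r = "k mod (?m + ?n)"
    show "J2 (ten ?n f g) k = ten (?m + ?n) f (shf ?m g) k"
    proof (cases "?m \<le> ?r")
      case True
      then obtain u where u: "?r = ?m + u" by (auto simp: le_iff_add)
      have "?r < ?m + ?n" using that(2) by simp
      then have "u < ?n" using u by simp
      then show ?thesis by (simp add: J2_def ten_def shf_def u)
    qed (simp add: J2_def ten_def shf_def)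
  qed
  let ?Bs = "[(P \<boxtimes> M, \<lambda>k. J1 (ev k)), (P \<boxtimes> N, \<lambda>k. J2 (ev k))]"
  have r1: "realizes G (P \<boxtimes> ?S) (\<lambda>k. J1 (ev k)) (P \<boxtimes> M)"
  proof (rule realizes_intertwiner[OF is_hmod_tensor[OF h(3,1)] l1])
    fix j assume j: "j < hmod_dim (P \<boxtimes> M)"
    then have p: "?m > 0" and k: "j div ?m < ?p" "j mod ?m < ?m" by (auto dest: divmod_bounds)
    have kk: "ten (?m + ?n) (ev (j div ?m)) (ev (j mod ?m)) \<in> kn (?p * (?m + ?n))" using k by (intro ten_kn) auto
    then show "J1 (ev j) \<in> kn (hmod_dim (P \<boxtimes> ?S))" unfolding ev_ten[OF p, of j] using k by (simp add: J1)
    show "opx (P \<boxtimes> ?S) (J1 (ev j)) = J1 (opx (P \<boxtimes> M) (ev j))"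
      unfolding ev_ten[OF p, of j] using k aG
      by (simp add: J1 opx_ten[OF h(3) hS, unfolded hmod_dim_dsum] opx_ten[OF h(3,1)] opx_dsum[OF h(1,2)] fv.linop_add[OF l1])
    fix g assume g: "g \<in> carrier G"
    show "opg (P \<boxtimes> ?S) g (J1 (ev j)) = J1 (opg (P \<boxtimes> M) g (ev j))"
      unfolding ev_ten[OF p, of j] using k g
      by (simp add: J1 opg_ten[OF h(3) hS, unfolded hmod_dim_dsum] opg_ten[OF h(3,1)] opx_dsum[OF h(1,2)])
  qed
  have r2: "realizes G (P \<boxtimes> ?S) (\<lambda>k. J2 (ev k)) (P \<boxtimes> N)"
  proof (rule realizes_intertwiner[OF is_hmod_tensor[OF h(3,2)] l2])
    fix j assume j: "j < hmod_dim (P \<boxtimes> N)"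
    then have p: "?n > 0" and k: "j div ?n < ?p" "j mod ?n < ?n" by (auto dest: divmod_bounds)
    have kk: "ten (?m + ?n) (ev (j div ?n)) (shf ?m (ev (j mod ?n))) \<in> kn (?p * (?m + ?n))" using k by (intro ten_kn shf_kn) auto
    then show "J2 (ev j) \<in> kn (hmod_dim (P \<boxtimes> ?S))" unfolding ev_ten[OF p, of j] using k p by (simp add: J2)
    show "opx (P \<boxtimes> ?S) (J2 (ev j)) = J2 (opx (P \<boxtimes> N) (ev j))"
      unfolding ev_ten[OF p, of j] using k aG p
      by (simp add: J2 opx_ten[OF h(3) hS, unfolded hmod_dim_dsum] opx_ten[OF h(3,2)] opx_dsum[OF h(1,2)] fv.linop_add[OF l2])
    fix g assume g: "g \<in> carrier G"
    show "opg (P \<boxtimes> ?S) g (J2 (ev j)) = J2 (opg (P \<boxtimes> N) g (ev j))"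
      unfolding ev_ten[OF p, of j] using k g p
      by (simp add: J2 opg_ten[OF h(3) hS, unfolded hmod_dim_dsum] opg_ten[OF h(3,2)] opx_dsum[OF h(1,2)])
  qed
  have "cls (P \<boxtimes> ?S) \<approx> (\<Sum>(N, c)\<leftarrow>?Bs. cls N)"
  proof (rule decomposition[OF grp weight_tensor[OF P is_weight_hmod_dsum[OF M N grp]]])
    fix i assume i: "i < hmod_dim (P \<boxtimes> ?S)"
    let ?q = "i div (?m + ?n)" and ?r = "i mod (?m + ?n)"
    have mn: "?m + ?n > 0" using i by (auto intro: gr0I)
    have q: "?q < ?p" "?r < ?m + ?n" using i mn by (auto simp: less_mult_imp_div_less)
    have e: "ev i = ten (?m + ?n) (ev ?q) (ev ?r)" by (rule ev_ten[OF mn])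
    show "ev i \<in> fv.span (\<Union>(N, c)\<in>set ?Bs. c ` {..<hmod_dim N})"
    proof (cases "?r < ?m")
      case True
      then have "ev i = J1 (ev (?q * ?m + ?r))" unfolding ten_ev[OF True, symmetric] using e by (simp add: J1)
      moreover have "?q * ?m + ?r < ?p * ?m"
      proof -
        have "?q * ?m + ?r < Suc ?q * ?m" using True by simp
        also have "\<dots> \<le> ?p * ?m" using q by (intro mult_right_mono) auto
        finally show ?thesis .
      qed
      ultimately show ?thesis by (intro fv.span_base) auto
    next
      case False
      then have r: "?r - ?m < ?n" using q by linarith
      then have "ev i = J2 (ev (?q * ?n + (?r - ?m)))"
        unfolding ten_ev[OF r, symmetric] using e False by (simp add: J2 shf_ev)
      moreover have "?q * ?n + (?r - ?m) < ?p * ?n"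
      proof -
        have "?q * ?n + (?r - ?m) < Suc ?q * ?n" using r by simp
        also have "\<dots> \<le> ?p * ?n" using q by (intro mult_right_mono) auto
        finally show ?thesis .
      qed
      ultimately show ?thesis by (intro fv.span_base) auto
    qed
  qed (use r1 r2 weight_tensor[OF P M] weight_tensor[OF P N] in \<open>auto simp: algebra_simps\<close>)
  then show ?thesis by simp
qed

subsection \<open>The multiplication of the Green ring\<close>

abbreviation fm where "fm \<equiv> formal_mult G a"

lemma frag_cmul_single: "frag_cmul c (Poly_Mapping.single x d) = Poly_Mapping.single x (c * d)"
  by (rule poly_mapping_eqI) (simp add: lookup_single when_def)

text \<open>Written as a double linear extension, the product is bilinear for general reasons, and
  claims about it reduce to classes of modules by induction over formal sums.\<close>

lemma fm_frag: "fm u v = frag_extend (\<lambda>M. frag_extend (\<lambda>N. cls (M \<boxtimes> N)) v) u"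
proof -
  show ?thesis
    unfolding formal_mult_def frag_extend_def frag_cmul_sum cls_def frag_cmul_cmul
    by (intro sum.cong refl) (simp add: frag_cmul_single)
qed

lemma fm_cls: "fm (cls M) (cls N) = cls (M \<boxtimes> N)"
  unfolding fm_frag by (simp add: cls_def)
lemma fm_add1: "fm (u + u') v = fm u v + fm u' v"
  by (simp add: fm_frag frag_extend_add)
lemma fm_diff1: "fm (u - u') v = fm u v - fm u' v"
  by (simp add: fm_frag frag_extend_diff)
lemma fm_neg1: "fm (- u) v = - fm u v"
  by (simp add: fm_frag frag_extend_minus)
lemma fm_zero [simp]: "fm 0 v = 0" "fm u 0 = 0"
  by (simp_all add: fm_frag frag_extend_def)
lemma fm_diff2: "fm u (v - v') = fm u v - fm u v'"
proof (induction u rule: frag_induction[OF subset_UNIV, case_names zero one diff])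
  case (one x)
  then show ?case by (simp add: fm_frag frag_extend_diff)
next
  case (diff a b)
  then show ?case by (simp add: fm_diff1 algebra_simps)
qed simp
lemma fm_neg2: "fm u (- v) = - fm u v" using fm_diff2[of u 0 v] by simp
lemma fm_add2: "fm u (v + v') = fm u v + fm u v'" using fm_diff2[of u v "- v'"] by (simp add: fm_neg2)
lemma fm_sum2: "fm v (\<Sum>i\<in>I. f i) = (\<Sum>i\<in>I. fm v (f i))"
  by (induction I rule: infinite_finite_induct) (auto simp: fm_add2)
lemma fm_cmul1: "fm (frag_cmul c u) v = frag_cmul c (fm u v)"
  by (simp add: fm_frag frag_extend_cmul)
lemma fm_cmul2: "fm u (frag_cmul c v) = frag_cmul c (fm u v)"
proof (induction u rule: frag_induction[OF subset_UNIV, case_names zero one diff])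
  case (one x)
  then show ?case by (simp add: fm_frag frag_extend_cmul)
next
  case (diff a b)
  have "frag_cmul c (fm a v - fm b v) = frag_cmul c (fm a v) - frag_cmul c (fm b v)"
    by (rule poly_mapping_eqI) (simp add: lookup_minus right_diff_distrib)
  then show ?case using diff by (simp add: fm_diff1)
qed simp

abbreviation "fW \<equiv> formal_W G chi"

lemma fW_cls [simp]: "cls M \<in> fW \<longleftrightarrow> is_weight_hmod G chi M" by (simp add: formal_W_def cls_def)
lemma fW_0 [simp]: "0 \<in> fW" by (simp add: formal_W_def)
lemma fW_add [simp]: "u \<in> fW \<Longrightarrow> v \<in> fW \<Longrightarrow> u + v \<in> fW"
  using Poly_Mapping.keys_add[of u v] unfolding formal_W_def by blast
lemma fW_neg [simp]: "u \<in> fW \<Longrightarrow> - u \<in> fW" by (simp add: formal_W_def)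
lemma fW_diff [simp]: "u \<in> fW \<Longrightarrow> v \<in> fW \<Longrightarrow> u - v \<in> fW"
  using fW_add[of u "- v"] by simp
lemma fW_sum [simp]: "(\<And>i. i \<in> I \<Longrightarrow> f i \<in> fW) \<Longrightarrow> (\<Sum>i\<in>I. f i) \<in> fW"
  by (induction I rule: infinite_finite_induct) auto
lemma fW_cmul [simp]: "u \<in> fW \<Longrightarrow> frag_cmul c u \<in> fW"
  using keys_cmul[of c u] unfolding formal_W_def by blast

lemma fW_induct [consumes 1, case_names zero cls diff]:
  assumes "u \<in> fW" "P 0" "\<And>M. is_weight_hmod G chi M \<Longrightarrow> P (cls M)" "\<And>u v. u \<in> fW \<Longrightarrow> v \<in> fW \<Longrightarrow> P u \<Longrightarrow> P v \<Longrightarrow> P (u - v)"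
  shows "P u"
proof -
  have "P u \<and> u \<in> fW"
  proof (rule frag_induction[of u "Collect (is_weight_hmod G chi)" "\<lambda>u. P u \<and> u \<in> fW"])
    show "Poly_Mapping.keys u \<subseteq> Collect (is_weight_hmod G chi)" using assms(1) by (auto simp: formal_W_def)
  qed (use assms in \<open>auto simp: cls_def[symmetric]\<close>)
  then show ?thesis by simp
qed

lemma geq_cmul: "u \<approx> v \<Longrightarrow> frag_cmul c u \<approx> frag_cmul c v"
proof (induction c rule: int_induct[where k = 0, case_names base step1 step2])
  case base then show ?case by simp
next
  case (step1 i) then show ?case by (auto simp: frag_cmul_distrib intro: geq_add)
next
  case (step2 i) then show ?case by (auto simp: frag_cmul_diff_distrib intro: geq_diff)
qed

lemma fm_green1: assumes "w \<in> green_rel G chi" "is_weight_hmod G chi P" shows "fm w (cls P) \<approx> 0"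
  using assms(1)
proof (induction rule: green_rel.induct)
  case (iso M N)
  have "cls (M \<boxtimes> P) \<approx> cls (N \<boxtimes> P)"
    using iso assms(2) by (intro cls_iso weight_tensor iso_tensor is_weight_hmodD)
  from geq_diff[OF this geq_refl[of _ _ "cls (N \<boxtimes> P)"]] show ?case by (simp add: fm_diff1 fm_cls)
next
  case (dsum M N)
  have "cls (dsum_hmod G M N \<boxtimes> P) \<approx> cls (M \<boxtimes> P) + cls (N \<boxtimes> P)" using dsum assms(2) by (intro tensor_dsum_left)
  from geq_diff[OF this geq_refl[of _ _ "cls (M \<boxtimes> P) + cls (N \<boxtimes> P)"]] show ?case
    by (simp add: fm_diff1 fm_add1 fm_cls algebra_simps)
next
  case (add u v) then show ?case using geq_add by (fastforce simp: fm_add1)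
next
  case (neg u) then show ?case using geq_minus by (fastforce simp: fm_neg1)
qed simp

lemma fm_green2: assumes "w \<in> green_rel G chi" "is_weight_hmod G chi P" shows "fm (cls P) w \<approx> 0"
  using assms(1)
proof (induction rule: green_rel.induct)
  case (iso M N)
  have "cls (P \<boxtimes> M) \<approx> cls (P \<boxtimes> N)"
    using iso assms(2) by (intro cls_iso weight_tensor iso_tensor is_weight_hmodD)
  from geq_diff[OF this geq_refl[of _ _ "cls (P \<boxtimes> N)"]] show ?case by (simp add: fm_diff2 fm_cls)
next
  case (dsum M N)
  have "cls (P \<boxtimes> dsum_hmod G M N) \<approx> cls (P \<boxtimes> M) + cls (P \<boxtimes> N)" using dsum assms(2) by (intro tensor_dsum_right)
  from geq_diff[OF this geq_refl[of _ _ "cls (P \<boxtimes> M) + cls (P \<boxtimes> N)"]] show ?case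
    by (simp add: fm_diff2 fm_add2 fm_cls algebra_simps)
next
  case (add u v) then show ?case using geq_add by (fastforce simp: fm_add2)
next
  case (neg u) then show ?case using geq_minus by (fastforce simp: fm_neg2)
qed simp

text \<open>The other factor ranges over \<open>fW\<close>, because a relation multiplied by a class
  is again a relation when the class is that of a weight module.\<close>

lemma fm_cong1: assumes "u \<approx> u'" "v \<in> fW" shows "fm u v \<approx> fm u' v"
proof -
  have "fm (u - u') v \<approx> 0" using assms(2)
  proof (induction rule: fW_induct)
    case (cls M) then show ?case using assms(1) by (intro fm_green1) (auto simp: geq_def)
  next
    case (diff u v) then show ?case using geq_diff by (fastforce simp: fm_diff2)
  qed simp
  then show ?thesis by (simp add: geq_def fm_diff1)
qed

lemma fm_cong2: assumes "u \<approx> u'" "v \<in> fW" shows "fm v u \<approx> fm v u'"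
proof -
  have "fm v (u - u') \<approx> 0" using assms(2)
  proof (induction rule: fW_induct)
    case (cls M) then show ?case using assms(1) by (intro fm_green2) (auto simp: geq_def)
  next
    case (diff u v) then show ?case using geq_diff by (fastforce simp: fm_diff1)
  qed simp
  then show ?thesis by (simp add: geq_def fm_diff2)
qed

lemma fm_fW [simp]: assumes "u \<in> fW" "v \<in> fW" shows "fm u v \<in> fW"
  using assms(1)
proof (induction rule: fW_induct)
  case (cls M)
  show ?case using assms(2)
  proof (induction rule: fW_induct)
    case (cls N) then show ?case using \<open>is_weight_hmod G chi M\<close> by (simp add: fm_cls weight_tensor)
  qed (auto simp: fm_diff2)
qed (auto simp: fm_diff1)

lemma fm_assoc: assumes "u \<in> fW" "v \<in> fW" "w \<in> fW" shows "fm (fm u v) w \<approx> fm u (fm v w)"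
  using assms(1)
proof (induction rule: fW_induct)
  case (cls L)
  show ?case using assms(2)
  proof (induction rule: fW_induct)
    case (cls M)
    show ?case using assms(3)
    proof (induction rule: fW_induct)
      case (cls N)
      then show ?case using \<open>is_weight_hmod G chi L\<close> \<open>is_weight_hmod G chi M\<close>
        unfolding fm_cls by (intro cls_iso weight_tensor tensor_assoc is_weight_hmodD)
    next
      case (diff u v) then show ?case unfolding fm_diff2 by (intro geq_diff)
    qed simp
  next
    case (diff u v) then show ?case unfolding fm_diff1 fm_diff2 by (intro geq_diff)
  qed simp
next
  case (diff u v) then show ?case unfolding fm_diff1 by (intro geq_diff)
qed simp

end

section \<open>Decompositions of tensor products\<close>

declare fscale_apply [simp del] plus_fun_apply [simp del] zero_fun_apply [simp del] minus_apply [simp del] uminus_apply [simp del]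
lemmas fun_apply = fscale_apply plus_fun_apply zero_fun_apply minus_apply uminus_apply

section \<open>Gaussian binomial coefficients and powers of \<open>x\<close> at a root of
  unity\<close>

fun qbin :: "'a::field \<Rightarrow> nat \<Rightarrow> nat \<Rightarrow> 'a" where
  "qbin z n 0 = 1"
| "qbin z 0 (Suc l) = 0"
| "qbin z (Suc n) (Suc l) = qbin z n (Suc l) + z ^ (n - l) * qbin z n l"

lemma qbin_zero: "l > n \<Longrightarrow> qbin z n l = 0"
proof (induction n arbitrary: l)
  case 0 then show ?case by (cases l) auto
next
  case (Suc n) then show ?case by (cases l) auto
qed

lemma qbin_self: "qbin z n n = 1"
  by (induction n) (auto simp: qbin_zero)

text \<open>The Gaussian form of the absorption identity
  \<open>(l + 1) C(n + 1, l + 1) = (n + 1) C(n, l)\<close>, kept free of division since the factors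
  \<open>1 - z ^ l\<close> may vanish at a root of unity.\<close>

lemma qbin_absorb: "(1 - z ^ Suc l) * qbin z (Suc n) (Suc l) = (1 - z ^ Suc n) * qbin z n l"
proof (induction n arbitrary: l)
  case 0 show ?case by (cases l) auto
next
  case (Suc n)
  show ?case
  proof (cases l)
    case 0
    define B where "B = qbin z (Suc n) (Suc 0)"
    have "(1 - z) * B = 1 - z ^ Suc n" using Suc[of 0] by (simp add: B_def del: qbin.simps(3))
    then have "(1 - z) * (B + z ^ Suc n) = 1 - z ^ Suc (Suc n)" by (simp add: distrib_left left_diff_distrib)
    moreover have "qbin z (Suc (Suc n)) (Suc 0) = B + z ^ Suc n" by (simp add: B_def)
    ultimately show ?thesis using 0 by (simp del: qbin.simps(3))
  next
    case (Suc m)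
    show ?thesis
    proof (cases "m \<le> n")
      case True
      define w where "w = z ^ (n - m)"
      have w: "w * z ^ Suc m = z ^ Suc n" using True by (simp add: w_def power_add[symmetric])
      let ?B = "qbin z (Suc n) (Suc m)"
      have q: "qbin z n (Suc m) = ?B - w * qbin z n m" by (simp add: w_def)
      have "(1 - z ^ Suc (Suc m)) * qbin z (Suc (Suc n)) (Suc (Suc m))
          = (1 - z ^ Suc (Suc m)) * qbin z (Suc n) (Suc (Suc m)) + w * (1 - z ^ Suc (Suc m)) * ?B"
        using True by (simp add: w_def distrib_left mult.left_commute)
      also have "\<dots> = (1 - z ^ Suc n) * ?B - w * ((1 - z ^ Suc n) * qbin z n m) + w * (1 - z ^ Suc (Suc m)) * ?B"
        unfolding Suc.IH[of "Suc m"] q by (simp add: right_diff_distrib mult.left_commute)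
      also have "(1 - z ^ Suc n) * qbin z n m = (1 - z ^ Suc m) * ?B" by (rule Suc.IH[symmetric])
      also have "(1 - z ^ Suc n) * ?B - w * ((1 - z ^ Suc m) * ?B) + w * (1 - z ^ Suc (Suc m)) * ?B
          = ((1 - z ^ Suc n) + w * z ^ Suc m - w * z ^ Suc m * z) * ?B"
        by (simp add: algebra_simps)
      also have "\<dots> = (1 - z ^ Suc (Suc n)) * ?B" unfolding w by (simp add: algebra_simps)
      finally show ?thesis using Suc by simp
    qed (use Suc in \<open>simp add: qbin_zero\<close>)
  qed
qed

text \<open>The two terms of \<open>x\<close> commute up to the factor \<open>z\<close>, which is
  the setting of the \<open>q\<close>-binomial theorem; the power \<open>z ^ (j * l)\<close>
  accounts for starting in column \<open>j\<close>.\<close>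

lemma (in vspace) q_binomial:
  assumes x: "linop x" and E: "\<And>i j. x (E i j) = z ^ j *s E (Suc i) j + E i (Suc j)"
  shows "(x ^^ n) (E i j) = (\<Sum>l\<le>n. (z ^ (j * l) * qbin z n l) *s E (i + l) (j + n - l))"
proof (induction n)
  case (Suc n)
  have "(x ^^ Suc n) (E i j) = (\<Sum>l\<le>n. (z ^ (j * l) * qbin z n l) *s x (E (i + l) (j + n - l)))"
    by (simp add: Suc linop_comb[OF x])
  also have "\<dots> = (\<Sum>l\<le>n. (z ^ (j * Suc l) * (z ^ (n - l) * qbin z n l)) *s E (i + Suc l) (j + n - l))
      + (\<Sum>l\<le>n. (z ^ (j * l) * qbin z n l) *s E (i + l) (j + Suc n - l))"
    unfolding sum.distrib[symmetric]
  proof (rule sum.cong)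
    fix l assume "l \<in> {..n}"
    then have l: "j + n - l = j + (n - l)" "Suc (j + n - l) = j + Suc n - l" by auto
    show "(z ^ (j * l) * qbin z n l) *s x (E (i + l) (j + n - l)) = (z ^ (j * Suc l) * (z ^ (n - l) * qbin z n l)) *s E (i + Suc l) (j + n - l)
       + (z ^ (j * l) * qbin z n l) *s E (i + l) (j + Suc n - l)"
      unfolding E scale_right_distrib l(2) scale_scale by (simp add: l(1) power_add mult_ac)
  qed simp
  also have "(\<Sum>l\<le>n. (z ^ (j * l) * qbin z n l) *s E (i + l) (j + Suc n - l))
      = (\<Sum>l\<le>Suc n. (z ^ (j * l) * qbin z n l) *s E (i + l) (j + Suc n - l))" by (simp add: qbin_zero)
  also have "\<dots> = E i (j + Suc n) + (\<Sum>l\<le>n. (z ^ (j * Suc l) * qbin z n (Suc l)) *s E (i + Suc l) (j + n - l))"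
    by (subst sum.atMost_Suc_shift) simp
  also have "(\<Sum>l\<le>n. (z ^ (j * Suc l) * (z ^ (n - l) * qbin z n l)) *s E (i + Suc l) (j + n - l)) + \<dots>
      = E i (j + Suc n) + (\<Sum>l\<le>n. (z ^ (j * Suc l) * qbin z (Suc n) (Suc l)) *s E (i + Suc l) (j + n - l))"
  proof -
    have "(z ^ (j * Suc l) * qbin z (Suc n) (Suc l)) *s E (i + Suc l) (j + n - l)
       = (z ^ (j * Suc l) * (z ^ (n - l) * qbin z n l)) *s E (i + Suc l) (j + n - l)
         + (z ^ (j * Suc l) * qbin z n (Suc l)) *s E (i + Suc l) (j + n - l)" for l
      unfolding scale_left_distrib[symmetric] by (simp add: distrib_left add.commute)
    then show ?thesis by (simp only: sum.distrib add.left_commute)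
  qed
  also have "\<dots> = (\<Sum>l\<le>Suc n. (z ^ (j * l) * qbin z (Suc n) l) *s E (i + l) (j + Suc n - l))"
    by (subst sum.atMost_Suc_shift) simp
  finally show ?case .
qed simp

text \<open>For \<open>0 < l < s\<close> absorption gives
  \<open>(1 - z ^ l) * qbin z s l = 0\<close>, since \<open>z ^ s = 1\<close>, while
  \<open>z ^ l\<close> is not 1. Only the extreme terms remain: \<open>x ^ s\<close> acts on the
  grid as a sum of two untwisted shifts.\<close>

lemma (in vspace) q_binomial_root:
  assumes x: "linop x" and E: "\<And>i j. x (E i j) = z ^ j *s E (Suc i) j + E i (Suc j)"
    and z: "\<And>n. z ^ n = 1 \<longleftrightarrow> s dvd n" and s: "s > 0"
  shows "(x ^^ s) (E i j) = E (i + s) j + E i (j + s)"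
proof -
  have zs: "z ^ s = 1" using z by simp
  have zj: "z ^ (j * s) = 1" by (metis mult.commute power_mult power_one zs)
  obtain s' where s': "s = Suc s'" using s by (cases s) auto
  have q0: "qbin z s l = 0" if l: "0 < l" "l < s" for l
  proof -
    obtain m where m: "l = Suc m" using l by (cases l) auto
    have "(1 - z ^ l) * qbin z s l = 0"
      using qbin_absorb[of z m s'] zs by (simp add: m s' del: qbin.simps power_Suc)
    moreover have "z ^ l \<noteq> 1" using z l by (auto dest: dvd_imp_le)
    ultimately show ?thesis by simp
  qed
  have "(x ^^ s) (E i j) = (\<Sum>l\<le>s. (z ^ (j * l) * qbin z s l) *s E (i + l) (j + s - l))"
    by (rule q_binomial[where E = E and z = z, OF x E])
  also have "\<dots> = (\<Sum>l\<in>{0, s}. (z ^ (j * l) * qbin z s l) *s E (i + l) (j + s - l))"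
    using q0 by (intro sum.mono_neutral_right) auto
  also have "\<dots> = E (i + s) j + E i (j + s)"
    using s by (simp add: qbin_self zj add.commute)
  finally show ?thesis .
qed

context hopf_ctx
begin

section \<open>Decompositions from generators\<close>

lemma span_all_powers:
  assumes "(T M b ^^ t) v = 0"
  shows "(opx M ^^ i) v \<in> fv.span ((\<lambda>i. (opx M ^^ i) v) ` {..<t * per b})"
proof (induction i rule: less_induct)
  case (less i)
  show ?case
  proof (cases "i < t * per b")
    case False
    then obtain d where d: "i = d + t * per b" by (metis add.commute le_Suc_ex not_less)
    have "(opx M ^^ i) v = (opx M ^^ d) ((opx M ^^ (t * per b)) v)" by (simp add: d funpow_add)
    also have "\<dots> = (\<Sum>l<t. fscale (- (of_nat (t choose l) * (- b) ^ (t - l))) ((opx M ^^ (d + l * per b)) v))"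
      unfolding opx_top[OF assms] fv.linop_comb[OF linop_opx_pow] by (simp add: funpow_plus)
    also have "\<dots> \<in> fv.span ((\<lambda>i. (opx M ^^ i) v) ` {..<t * per b})"
      using per_pos[of b] by (intro fv.span_sum fv.span_scale less) (auto simp: d)
    finally show ?thesis .
  qed (auto intro: fv.span_base)
qed

definition cyc :: "('g, 'k) hmod \<Rightarrow> (nat \<Rightarrow> 'k) \<Rightarrow> (nat \<Rightarrow> 'k) set" where
  "cyc M v = range (\<lambda>i. (opx M ^^ i) v)"

lemma cyc_self: "v \<in> cyc M v" unfolding cyc_def by (rule range_eqI[of _ _ 0]) simp

lemma span_cyc_x: assumes "w \<in> fv.span (\<Union>i\<in>I. cyc M (v i))" shows "opx M w \<in> fv.span (\<Union>i\<in>I. cyc M (v i))"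
proof (rule fv.linop_span[OF linop_opx assms])
  fix u assume "u \<in> (\<Union>i\<in>I. cyc M (v i))"
  then obtain i k where i: "i \<in> I" "u = (opx M ^^ k) (v i)" by (auto simp: cyc_def)
  then have "opx M u = (opx M ^^ Suc k) (v i)" by simp
  then have "opx M u \<in> cyc M (v i)" unfolding cyc_def by blast
  then show "opx M u \<in> fv.span (\<Union>i\<in>I. cyc M (v i))" using i by (intro fv.span_base) auto
qed simp

text \<open>Spans of complete orbits are visibly stable under \<open>x\<close>, which makes
  generation easy to verify; the annihilating power then cuts each orbit down to the size of its
  block.\<close>

theorem cyclic_decomposition:
  assumes M: "is_weight_hmod G chi M" and I: "finite I"
    and Bs: "\<And>i. i \<in> I \<Longrightarrow> l i \<in> Ch \<and> wvec M (l i) (v i) \<and> (T M (b i) ^^ t i) (v i) = 0"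
    and d: "(\<Sum>i\<in>I. t i * per (b i)) = hmod_dim M"
    and sp: "\<And>k. k < hmod_dim M \<Longrightarrow> ev k \<in> fv.span (\<Union>i\<in>I. cyc M (v i))"
  shows "cls M \<approx> (\<Sum>i\<in>I. cls (V (t i) (l i) (b i)))"
proof -
  obtain xs where xs: "set xs = I" "distinct xs" using finite_distinct_list[OF I] by blast
  let ?Bs = "map (\<lambda>i. (v i, l i, t i, b i)) xs"
  have conv: "(\<Sum>i\<leftarrow>xs. f i) = (\<Sum>i\<in>I. f i)" for f :: "_ \<Rightarrow> 'z::comm_monoid_add"
    using sum_list_distinct_conv_sum_set[OF xs(2), of f] xs(1) by simp
  have "cls M \<approx> (\<Sum>(v, l, t, b)\<leftarrow>?Bs. cls (V t l b))"
  proof (rule block_decomposition[OF M])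
    show "l' \<in> Ch \<and> wvec M l' v' \<and> (T M b' ^^ t') v' = 0" if "(v', l', t', b') \<in> set ?Bs" for v' l' t' b'
      using that Bs xs by auto
    show "(\<Sum>(v, l, t, b)\<leftarrow>?Bs. t * per b) = hmod_dim M" using d by (simp add: o_def conv)
    fix k assume k: "k < hmod_dim M"
    let ?W = "fv.span (\<Union>(v, l, t, b)\<in>set ?Bs. (\<lambda>i. (opx M ^^ i) v) ` {..<t * per b})"
    have "(\<Union>i\<in>I. cyc M (v i)) \<subseteq> ?W"
    proof safe
      fix i u assume i: "i \<in> I" "u \<in> cyc M (v i)"
      then have "u \<in> fv.span ((\<lambda>k. (opx M ^^ k) (v i)) ` {..<t i * per (b i)})"
        using Bs[OF i(1)] by (auto simp: cyc_def intro: span_all_powers)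
      also have "\<dots> \<subseteq> ?W" using i xs by (intro fv.span_mono) auto
      finally show "u \<in> ?W" .
    qed
    then have "fv.span (\<Union>i\<in>I. cyc M (v i)) \<subseteq> ?W" by (rule fv.span_minimal) simp
    then show "ev k \<in> ?W" using sp[OF k] by blast
  qed
  then show ?thesis by (simp add: o_def conv)
qed

text \<open>Covers the empty summand \<open>V (t - 1)\<close> at \<open>t = 1\<close>, and terms
  whose truncated length is zero.\<close>

lemma cls_V_0: "l \<in> Ch \<Longrightarrow> cls (V 0 l b) \<approx> 0"
  using decomposition[OF grp, of chi "V 0 l b" "[]"] by simp

text \<open>The basis of a block continued past its dimension. With all powers available the rule
  for \<open>x\<close> on a product holds for all indices, without a special case at the
  top.\<close>

definition ux :: "('g, 'k) hmod \<Rightarrow> nat \<Rightarrow> nat \<Rightarrow> 'k" where "ux M i = (opx M ^^ i) (ev 0)"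

lemma opx_ux: "opx M (ux M i) = ux M (Suc i)" by (simp add: ux_def)

lemma ux_V: "i < t * per b \<Longrightarrow> ux (V t l b) i = ev i"
proof (induction i)
  case (Suc i)
  then have "ux (V t l b) (Suc i) = opx (V t l b) (ev i)" by (simp add: ux_def)
  also have "\<dots> = ev (Suc i)"
  proof
    fix j
    show "opx (V t l b) (ev i) j = ev (Suc i) j"
      using Suc.prems by (cases "b = 0") (auto simp: opx_def matop_ev V_x ev_def[of "Suc i"] per_def)
  qed
  finally show ?case .
qed (simp add: ux_def)

text \<open>The last column of \<open>x\<close> is made for this: it expresses
  \<open>x ^ (t * per b)\<close> of the generator by lower powers in the way that
  \<open>(x ^ per b - b) ^ t = 0\<close> prescribes.\<close>

lemma T_V_zero: assumes t: "t > 0" shows "(T (V t l b) b ^^ t) (ev 0) = 0"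
proof -
  let ?M = "V t l b" and ?n = "t * per b"
  have n: "?n > 0" using t per_pos by simp
  have "ux ?M ?n = opx ?M (ux ?M (?n - 1))" using n by (simp add: opx_ux)
  also have "\<dots> = opx ?M (ev (?n - 1))" using n by (simp add: ux_V)
  also have "\<dots> = (\<lambda>i. if i < ?n then hmod_x ?M $$ (i, ?n - 1) else 0)"
    using n by (simp add: opx_def matop_ev del: One_nat_def)
  also have "\<dots> = (\<Sum>l<t. fscale (- (of_nat (t choose l) * (- b) ^ (t - l))) (ev (l * per b)))"
  proof
    fix i
    have 1: "(if i < ?n then hmod_x ?M $$ (i, ?n - 1) else 0)
        = (if i < ?n \<and> per b dvd i then - (of_nat (t choose (i div per b)) * (- b) ^ (t - i div per b)) else 0)"
      using n by (cases "b = 0") (auto simp: V_x per_def)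
    have "(\<Sum>l<t. fscale (- (of_nat (t choose l) * (- b) ^ (t - l))) (ev (l * per b))) i
        = (\<Sum>l<t. if i = l * per b then - (of_nat (t choose l) * (- b) ^ (t - l)) else 0)"
      by (auto simp: fsum_apply ev_def fun_apply intro!: sum.cong)
    also have "\<dots> = (if i < ?n \<and> per b dvd i then - (of_nat (t choose (i div per b)) * (- b) ^ (t - i div per b)) else 0)"
    proof (cases "i < ?n \<and> per b dvd i")
      case True
      then obtain k where k: "i = k * per b" by (metis dvd_def mult.commute)
      then have kt: "k < t" using True by simp
      have "(\<Sum>l<t. if i = l * per b then - (of_nat (t choose l) * (- b) ^ (t - l)) else 0)
          = (\<Sum>l<t. if l = k then - (of_nat (t choose k) * (- b) ^ (t - k)) else 0 :: 'k)"
        using per_pos[of b] by (intro sum.cong) (auto simp: k)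
      then show ?thesis using True kt per_pos[of b] by (simp add: k sum.delta)
    next
      case False
      have "i \<noteq> l * per b" if "l < t" for l using False that per_pos[of b] by auto
      then show ?thesis using False by (auto intro!: sum.neutral)
    qed
    finally show "(if i < ?n then hmod_x ?M $$ (i, ?n - 1) else 0)
      = (\<Sum>l<t. fscale (- (of_nat (t choose l) * (- b) ^ (t - l))) (ev (l * per b))) i" using 1 by simp
  qed
  also have "\<dots> = (\<Sum>l<t. fscale (- (of_nat (t choose l) * (- b) ^ (t - l))) (ux ?M (l * per b)))"
    using per_pos[of b] by (intro sum.cong) (auto simp: ux_V)
  finally have top: "ux ?M ?n = - (\<Sum>l<t. fscale (of_nat (t choose l) * (- b) ^ (t - l)) (ux ?M (l * per b)))"
    by (simp add: fv.scale_minus_left sum_negf)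
  have "(T ?M b ^^ t) (ev 0) = (\<Sum>l<t. fscale (of_nat (t choose l) * (- b) ^ (t - l)) (ux ?M (l * per b))) + ux ?M ?n"
    unfolding T_pow_expand ux_def by (simp add: lessThan_Suc_atMost[symmetric])
  then show ?thesis unfolding top by simp
qed

lemma wvec_V: assumes l: "l \<in> Ch" and t: "t > 0" shows "wvec (V t l b) l (ev 0)"
  unfolding wvec_def
proof (intro conjI ballI)
  have n: "t * per b > 0" using t per_pos by simp
  then show "ev 0 \<in> kn (hmod_dim (V t l b))" by simp
  fix g assume g: "g \<in> carrier G"
  show "opg (V t l b) g (ev 0) = fscale (l g) (ev 0)"
  proof
    fix i
    show "opg (V t l b) g (ev 0) i = fscale (l g) (ev 0) i"
      unfolding opg_def dim_V matop_ev[OF n] using n by (auto simp: V_g[OF g] fscale_apply ev_def)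
  qed
qed

lemma wvec_ux: "l \<in> Ch \<Longrightarrow> t > 0 \<Longrightarrow> wvec (V t l b) (cp i \<star> l) (ux (V t l b) i)"
  unfolding ux_def by (rule wvec_x_pow[OF is_hmod_V wvec_V])

lemma wvec_scale: "wvec M l v \<Longrightarrow> wvec M l (fscale c v)"
  unfolding wvec_def using subspace_kn[of "hmod_dim M"] by (auto simp: fv.linop_scale fv.scale_left_commute fv.subspace_scale)
lemma wvec_add: "wvec M l v \<Longrightarrow> wvec M l w \<Longrightarrow> wvec M l (v + w)"
  unfolding wvec_def using subspace_kn[of "hmod_dim M"] by (simp add: fv.linop_add fv.scale_right_distrib fv.subspace_add)
lemma wvec_0 [simp]: "wvec M l 0"
  unfolding wvec_def using subspace_kn[of "hmod_dim M"] by (simp add: fv.linop_0 fv.subspace_0)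
lemma wvec_sum: "(\<And>i. i \<in> I \<Longrightarrow> wvec M l (f i)) \<Longrightarrow> wvec M l (\<Sum>i\<in>I. f i)"
  by (induction I rule: infinite_finite_induct) (auto intro: wvec_add)
lemma wvec_diff: "wvec M l v \<Longrightarrow> wvec M l w \<Longrightarrow> wvec M l (v - w)"
  using wvec_add[of M l v "fscale (- 1) w"] wvec_scale[of M l w "- 1"] by (simp add: fv.scale_minus_left)

lemma wvec_ten:
  assumes M: "is_hmod G chi M" and N: "is_hmod G chi N" and v: "wvec M l v" and w: "wvec N m w"
  shows "wvec (M \<boxtimes> N) (l \<star> m) (ten (hmod_dim N) v w)"
  using v w by (auto simp: wvec_def opg_ten[OF M N] ten_scale1 ten_scale2 cm_apply intro: ten_kn)

text \<open>The scaling by powers of \<open>m a\<close> removes the weight of the second factor from the action of \<open>x\<close>.\<close>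

lemma zl1: "0 < (1 :: nat)" by simp

definition gr :: "nat \<Rightarrow> ('g \<Rightarrow> 'k) \<Rightarrow> 'k \<Rightarrow> nat \<Rightarrow> ('g \<Rightarrow> 'k) \<Rightarrow> 'k \<Rightarrow> nat \<Rightarrow> nat \<Rightarrow> nat \<Rightarrow> 'k" where
  "gr t l b u m c i j = fscale (m a ^ i) (ten (u * per c) (ux (V t l b) i) (ux (V u m c) j))"

text \<open>On \<open>x ^ j n_0\<close> the element \<open>a\<close> acts by
  \<open>zt ^ j * m a\<close>. The scaling in \<open>gr\<close> absorbs the factor
  \<open>m a\<close>, and what remains is the hypothesis of the \<open>q\<close>-binomial theorem at
  \<open>zt\<close>.\<close>

lemma gr_x:
  assumes "l \<in> Ch" "m \<in> Ch" "t > 0" "u > 0"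
  shows "opx (V t l b \<boxtimes> V u m c) (gr t l b u m c i j) = fscale (zt ^ j) (gr t l b u m c (Suc i) j) + gr t l b u m c i (Suc j)"
proof -
  have "opg (V u m c) a (ux (V u m c) j) = fscale ((cp j \<star> m) a) (ux (V u m c) j)"
    using wvec_ux[of m u c j] assms aG by (simp add: wvec_def)
  then have g: "opg (V u m c) a (ux (V u m c) j) = fscale (zt ^ j * m a) (ux (V u m c) j)"
    by (simp add: cm_apply[OF aG] cp_apply[OF aG] zt_def)
  have k: "ux (V t l b) i \<in> kn (hmod_dim (V t l b))" using wvec_ux[of l t b i] assms by (simp add: wvec_def)
  show ?thesis
    unfolding gr_def fv.linop_scale[OF linop_opx] dim_V[symmetric, of u c m] opx_ten[OF is_hmod_V[OF assms(1)] is_hmod_V[OF assms(2)] k] g opx_ux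
    by (simp add: fv.scale_right_distrib ten_scale2 mult_ac)
qed

lemma gr_wvec:
  assumes "l \<in> Ch" "m \<in> Ch" "t > 0" "u > 0"
  shows "wvec (V t l b \<boxtimes> V u m c) (cp (i + j) \<star> (l \<star> m)) (gr t l b u m c i j)"
proof -
  have e: "cp (i + j) \<star> (l \<star> m) = (cp i \<star> l) \<star> (cp j \<star> m)"
    by (rule Ch_ext) (use assms in \<open>auto simp: cm_apply cp_apply power_add\<close>)
  show ?thesis unfolding e gr_def dim_V[symmetric, of u c m]
    by (intro wvec_scale wvec_ten is_hmod_V wvec_ux assms)
qed

text \<open>Inside the rectangle of the two dimensions the grid vectors are nonzero multiples of the
  standard basis.\<close>

lemma gr_span:
  assumes m: "m \<in> Ch" and S: "fv.subspace S" "\<And>i j. i < t * per b \<Longrightarrow> j < u * per c \<Longrightarrow> gr t l b u m c i j \<in> S"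
    and k: "k < hmod_dim (V t l b \<boxtimes> V u m c)"
  shows "ev k \<in> S"
proof -
  let ?n = "u * per c"
  have b: "0 < ?n" "k div ?n < t * per b" "k mod ?n < ?n" using divmod_bounds[of k "t * per b" ?n] k by auto
  have ma: "m a \<noteq> 0" using Ch_nz[OF m aG] .
  have "fscale (inverse (m a ^ (k div ?n))) (gr t l b u m c (k div ?n) (k mod ?n)) = ev k"
    using b ma by (simp add: gr_def ux_V ev_ten[OF b(1), symmetric])
  then show ?thesis using S b by (metis fv.subspace_scale)
qed

text \<open>Past the first factor the rows vanish in the nilpotent case and repeat with the factor
  \<open>b\<close> for \<open>V 1 l b\<close>. The additional \<open>m a ^ sb\<close> is due to the
  scaling by the row index; the corresponding rule for columns has no such factor.\<close>

lemma gr_first: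
  assumes "t > 0"
  shows "b = 0 \<Longrightarrow> i \<ge> t \<Longrightarrow> gr t l b u m c i j = 0"
    and "b \<noteq> 0 \<Longrightarrow> t = 1 \<Longrightarrow> gr t l b u m c (i + sb) j = fscale (b * m a ^ sb) (gr t l b u m c i j)"
proof -
  show "gr t l b u m c i j = 0" if "b = 0" "i \<ge> t"
  proof -
    have "ux (V t l b) i = (opx (V t l b) ^^ (i - t)) ((opx (V t l b) ^^ t) (ev 0))"
      using that by (simp add: ux_def funpow_plus)
    also have "(opx (V t l b) ^^ t) (ev 0) = 0" using T_V_zero[OF assms, of l b] that by (simp add: T_0)
    finally show ?thesis by (simp add: gr_def fv.linop_0)
  qed
  show "gr t l b u m c (i + sb) j = fscale (b * m a ^ sb) (gr t l b u m c i j)" if "b \<noteq> 0" "t = 1"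
  proof -
    have "(opx (V t l b) ^^ sb) (ev 0) = fscale b (ev 0)" using T_V_zero[OF assms, of l b] that by (simp add: T_def per_def)
    then have "ux (V t l b) (i + sb) = fscale b (ux (V t l b) i)"
      unfolding ux_def funpow_add comp_apply by (simp add: fv.linop_scale)
    then show ?thesis by (simp add: gr_def ten_scale1 power_add mult_ac)
  qed
qed

lemma gr_second:
  assumes "u > 0"
  shows "c = 0 \<Longrightarrow> j \<ge> u \<Longrightarrow> gr t l b u m c i j = 0"
    and "c \<noteq> 0 \<Longrightarrow> u = 1 \<Longrightarrow> gr t l b u m c i (j + sb) = fscale c (gr t l b u m c i j)"
proof -
  show "gr t l b u m c i j = 0" if "c = 0" "j \<ge> u"
  proof -
    have "ux (V u m c) j = (opx (V u m c) ^^ (j - u)) ((opx (V u m c) ^^ u) (ev 0))"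
      using that by (simp add: ux_def funpow_plus)
    also have "(opx (V u m c) ^^ u) (ev 0) = 0" using T_V_zero[OF assms, of m c] that by (simp add: T_0)
    finally show ?thesis by (simp add: gr_def fv.linop_0)
  qed
  show "gr t l b u m c i (j + sb) = fscale c (gr t l b u m c i j)" if "c \<noteq> 0" "u = 1"
  proof -
    have "(opx (V u m c) ^^ sb) (ev 0) = fscale c (ev 0)" using T_V_zero[OF assms, of m c] that by (simp add: T_def per_def)
    then have "ux (V u m c) (j + sb) = fscale c (ux (V u m c) j)"
      unfolding ux_def funpow_add comp_apply by (simp add: fv.linop_scale)
    then show ?thesis by (simp add: gr_def ten_scale2 mult_ac)
  qed
qed

lemma gr_s:
  assumes "l \<in> Ch" "m \<in> Ch" "t > 0" "u > 0"
  shows "(opx (V t l b \<boxtimes> V u m c) ^^ s) (gr t l b u m c i j) = gr t l b u m c (i + s) j + gr t l b u m c i (j + s)"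
  by (rule fv.q_binomial_root[where E = "gr t l b u m c" and z = zt, OF linop_opx gr_x[OF assms] zt_order s_pos])

lemma weight_VV: "l \<in> Ch \<Longrightarrow> m \<in> Ch \<Longrightarrow> is_weight_hmod G chi (V t l b \<boxtimes> V u m c)"
  by (simp add: weight_tensor)

subsection \<open>Products with one-dimensional modules\<close>

text \<open>Since \<open>x\<close> kills the one-dimensional factor, it acts through the second
  factor alone and without \<open>a\<close>; hence \<open>b\<close> does not change.\<close>

lemma V1_tensor:
  assumes l: "l \<in> Ch" and m: "m \<in> Ch" and t: "t > 0"
  shows "cls (V 1 l 0 \<boxtimes> V t m b) \<approx> cls (V t (l \<star> m) b)"
proof -
  let ?M = "V 1 l 0 \<boxtimes> V t m b" and ?N = "V t m b" and ?E = "gr 1 l 0 t m b"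
  have x: "opx ?M (ten (hmod_dim ?N) (ev 0) g) = ten (hmod_dim ?N) (ev 0) (opx ?N g)" for g
  proof -
    have "opx (V 1 l 0) (ev 0) = 0" using T_V_zero[of 1 l 0] by (simp add: T_0)
    then show ?thesis by (subst opx_ten[OF is_hmod_V[OF l] is_hmod_V[OF m]]) (auto simp: per_def)
  qed
  have xp: "(opx ?M ^^ i) (ten (hmod_dim ?N) (ev 0) g) = ten (hmod_dim ?N) (ev 0) ((opx ?N ^^ i) g)" for g i
    by (induction i) (simp_all add: x del: One_nat_def dim_V)
  have "T ?M b (ten (hmod_dim ?N) (ev 0) g) = ten (hmod_dim ?N) (ev 0) (T ?N b g)" for g
    unfolding T_def xp using ten_add2[of "hmod_dim ?N" "ev 0" "(opx ?N ^^ per b) g" "fscale (- b) g"] ten_scale2[of "hmod_dim ?N" "ev 0" "- b" g]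
    by (simp add: fv.scale_minus_left)
  then have Tp: "(T ?M b ^^ i) (ten (hmod_dim ?N) (ev 0) g) = ten (hmod_dim ?N) (ev 0) ((T ?N b ^^ i) g)" for g i
    by (induction i) auto
  have e: "?E 0 j = ten (hmod_dim ?N) (ev 0) (ux ?N j)" for j
    by (simp add: gr_def ux_def)
  have "cls ?M \<approx> (\<Sum>i\<in>{()}. cls (V t (l \<star> m) b))"
  proof (rule cyclic_decomposition[OF weight_VV[OF l m], where v = "\<lambda>_. ?E 0 0"])
    show "l \<star> m \<in> Ch \<and> wvec ?M (l \<star> m) (?E 0 0) \<and> (T ?M b ^^ t) (?E 0 0) = 0"
      using gr_wvec[OF l m zl1 t, of 0 b 0 0] l m T_V_zero[OF t, of m b] unfolding e Tp by (simp add: ux_def)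
    fix k assume k: "k < hmod_dim ?M"
    show "ev k \<in> fv.span (\<Union>i\<in>{()}. cyc ?M (?E 0 0))"
    proof (rule gr_span[OF m _ _ k])
      fix i j assume "i < 1 * per 0" "j < t * per b"
      then have "i = 0" by (simp add: per_def)
      moreover have "?E 0 j = (opx ?M ^^ j) (?E 0 0)" unfolding e xp by (simp add: ux_def)
      ultimately show "?E i j \<in> fv.span (\<Union>i\<in>{()}. cyc ?M (?E 0 0))" by (auto simp: cyc_def intro!: fv.span_base)
    qed simp
  qed (auto simp: per_def)
  then show ?thesis by simp
qed

text \<open>Now \<open>x\<close> sends \<open>v \<otimes> n\<close> to
  \<open>x v \<otimes> a n\<close>, so each application brings in a factor \<open>m a\<close>, and
  \<open>b\<close> becomes \<open>b * m a ^ sb\<close>. This difference between left and right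
  multiplication is what the action of the characters on the variables records.\<close>

lemma tensor_V1:
  assumes l: "l \<in> Ch" and m: "m \<in> Ch" and t: "t > 0" and b: "b = 0 \<or> t = 1"
  shows "cls (V t l b \<boxtimes> V 1 m 0) \<approx> cls (V t (l \<star> m) (b * m a ^ sb))"
proof -
  let ?M = "V t l b \<boxtimes> V 1 m 0" and ?E = "gr t l b 1 m 0" and ?c = "b * m a ^ sb"
  have ma: "m a \<noteq> 0" using Ch_nz[OF m aG] .
  have per: "per ?c = per b" using ma by (simp add: per_def)
  have x: "(opx ?M ^^ i) (?E 0 0) = ?E i 0" for i
    by (induction i) (simp_all add: gr_x[OF l m t zl1] gr_second(1)[OF zl1] del: One_nat_def)
  have "(T ?M ?c ^^ t) (?E 0 0) = 0"
  proof (cases "b = 0")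
    case True
    then have c: "?c = 0" by simp
    show ?thesis unfolding c T_0 x using gr_first(1)[OF t True] by simp
  next
    case False
    then have t1: "t = 1" using b by simp
    have "?E sb 0 = fscale ?c (?E 0 0)" using gr_first(2)[OF t False t1, of l 1 m 0 0 0] by simp
    moreover have "per ?c = sb" using False ma by (simp add: per_def)
    ultimately have "T ?M ?c (?E 0 0) = 0" unfolding T_def by (simp only: x diff_self)
    then show ?thesis unfolding t1 by simp
  qed
  have "cls ?M \<approx> (\<Sum>i\<in>{()}. cls (V t (l \<star> m) ?c))"
  proof (rule cyclic_decomposition[OF weight_VV[OF l m], where v = "\<lambda>_. ?E 0 0"])
    show "l \<star> m \<in> Ch \<and> wvec ?M (l \<star> m) (?E 0 0) \<and> (T ?M ?c ^^ t) (?E 0 0) = 0"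
      using gr_wvec[OF l m t zl1, of b 0 0 0] l m \<open>(T ?M ?c ^^ t) (?E 0 0) = 0\<close> by simp
    fix k assume k: "k < hmod_dim ?M"
    show "ev k \<in> fv.span (\<Union>i\<in>{()}. cyc ?M (?E 0 0))"
    proof (rule gr_span[OF m _ _ k])
      fix i j assume "i < t * per b" "j < 1 * per 0"
      then have "j = 0" by (simp add: per_def)
      moreover have "?E i 0 \<in> cyc ?M (?E 0 0)" unfolding cyc_def by (rule range_eqI[of _ _ i]) (rule x[symmetric])
      ultimately show "?E i j \<in> fv.span (\<Union>i\<in>{()}. cyc ?M (?E 0 0))" by (intro fv.span_base) simp
    qed simp
  qed (auto simp: per per_def[of 0])
  then show ?thesis by simp
qed

text \<open>For nonzero \<open>b\<close> the expansion of \<open>(x ^ per b - b) ^ t v = 0\<close>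
  has the invertible constant term \<open>(- b) ^ t\<close>, so it expresses each power of
  \<open>x\<close> by higher ones and a tail of the orbit determines the rest. The map
  \<open>J\<close> carries this to a row of a grid.\<close>

lemma span_tail:
  assumes b: "b \<noteq> 0" and z: "(T M b ^^ t) v = 0" and S: "fv.subspace S" and J: "fv.linop J"
    and tail: "\<And>i. i \<ge> n \<Longrightarrow> J ((opx M ^^ i) v) \<in> S"
  shows "J ((opx M ^^ i) v) \<in> S"
proof (induction "n - i" arbitrary: i rule: less_induct)
  case less
  show ?case
  proof (cases "i < n")
    case False then show ?thesis using tail by simp
  next
    case True
  have "0 = (opx M ^^ i) ((T M b ^^ t) v)" using z by (simp add: fv.linop_0)
  also have "\<dots> = (\<Sum>l\<le>t. fscale (of_nat (t choose l) * (- b) ^ (t - l)) ((opx M ^^ (i + l * per b)) v))"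
    unfolding T_pow_expand fv.linop_comb[OF linop_opx_pow] by (simp add: funpow_plus)
  also have "\<dots> = fscale ((- b) ^ t) ((opx M ^^ i) v) + (\<Sum>l\<in>{1..t}. fscale (of_nat (t choose l) * (- b) ^ (t - l)) ((opx M ^^ (i + l * per b)) v))"
    by (simp add: atMost_atLeast0 sum.atLeast_Suc_atMost)
  finally have "J 0 = J (fscale ((- b) ^ t) ((opx M ^^ i) v) + (\<Sum>l\<in>{1..t}. fscale (of_nat (t choose l) * (- b) ^ (t - l)) ((opx M ^^ (i + l * per b)) v)))"
    by (rule arg_cong)
  then have "0 = fscale ((- b) ^ t) (J ((opx M ^^ i) v)) + (\<Sum>l\<in>{1..t}. fscale (of_nat (t choose l) * (- b) ^ (t - l)) (J ((opx M ^^ (i + l * per b)) v)))"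
    by (simp add: fv.linop_0[OF J] fv.linop_add[OF J] fv.linop_scale[OF J] fv.linop_sum[OF J])
  then have e: "fscale ((- b) ^ t) (J ((opx M ^^ i) v)) = - (\<Sum>l\<in>{1..t}. fscale (of_nat (t choose l) * (- b) ^ (t - l)) (J ((opx M ^^ (i + l * per b)) v)))"
    unfolding eq_neg_iff_add_eq_0 by (rule sym)
  have "(\<Sum>l\<in>{1..t}. fscale (of_nat (t choose l) * (- b) ^ (t - l)) (J ((opx M ^^ (i + l * per b)) v))) \<in> S"
  proof (intro fv.subspace_sum fv.subspace_scale S)
    fix l assume "l \<in> {1..t}"
    then have "i + l * per b > i" using per_pos[of b] by simp
    then show "J ((opx M ^^ (i + l * per b)) v) \<in> S" using True by (intro less) linarith
  qed
  then have "fscale (inverse ((- b) ^ t)) (fscale ((- b) ^ t) (J ((opx M ^^ i) v))) \<in> S"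
    unfolding e by (intro fv.subspace_scale fv.subspace_neg S)
  then show ?thesis using b by simp
  qed
qed

text \<open>For nonzero \<open>b\<close> the operator \<open>x\<close> is invertible on the block,
  so \<open>x m_0\<close> is a generator as well, of weight \<open>chi \<star> l\<close>. This is
  the source of the relation between \<open>chi x_al\<close> and \<open>x_al\<close>.\<close>

lemma V_shift:
  assumes l: "l \<in> Ch" and t: "t > 0" and b: "b \<noteq> 0"
  shows "cls (V t l b) \<approx> cls (V t (chi \<star> l) b)"
proof -
  let ?M = "V t l b"
  have "cls ?M \<approx> (\<Sum>i\<in>{()}. cls (V t (chi \<star> l) b))"
  proof (rule cyclic_decomposition[OF weight_V[OF l], where v = "\<lambda>_. opx ?M (ev 0)"])
    have "T ?M b (opx ?M v) = opx ?M (T ?M b v)" for v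
      by (simp add: T_def fv.linop_diff fv.linop_scale funpow_swap1)
    then have "(T ?M b ^^ t) (opx ?M (ev 0)) = opx ?M ((T ?M b ^^ t) (ev 0))"
      using funpow_commute[of "T ?M b" "opx ?M" t 1 "ev 0"] by simp
    then show "chi \<star> l \<in> Ch \<and> wvec ?M (chi \<star> l) (opx ?M (ev 0)) \<and> (T ?M b ^^ t) (opx ?M (ev 0)) = 0"
      using wvec_x[OF is_hmod_V[OF l] wvec_V[OF l t]] l T_V_zero[OF t] by (simp add: fv.linop_0)
    fix k assume k: "k < hmod_dim ?M"
    have "(\<lambda>v. v) ((opx ?M ^^ k) (ev 0)) \<in> fv.span (\<Union>i\<in>{()}. cyc ?M (opx ?M (ev 0)))"
    proof (rule span_tail[OF b T_V_zero[OF t] _ fv.linop_id, where n = 1])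
      fix i :: nat assume "i \<ge> 1"
      then obtain j where "i = Suc j" by (cases i) auto
      then show "(opx ?M ^^ i) (ev 0) \<in> fv.span (\<Union>i\<in>{()}. cyc ?M (opx ?M (ev 0)))"
        by (auto simp: cyc_def funpow_swap1 intro!: fv.span_base)
    qed simp
    then show "ev k \<in> fv.span (\<Union>i\<in>{()}. cyc ?M (opx ?M (ev 0)))" using k ux_V[of k t b l] by (simp add: ux_def)
  qed auto
  then show ?thesis by simp
qed

lemma V_shift_cp:
  assumes l: "l \<in> Ch" and t: "t > 0" and b: "b \<noteq> 0"
  shows "cls (V t (cp k \<star> l) b) \<approx> cls (V t l b)"
proof (induction k)
  case 0 show ?case using l by simp
next
  case (Suc k)
  have e: "chi \<star> (cp k \<star> l) = cp (Suc k) \<star> l"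
    unfolding cp_Suc[symmetric] by (rule cm_assoc[symmetric]) (use l in auto)
  have "cp k \<star> l \<in> Ch" using l by simp
  from geq_sym[OF V_shift[OF this t b, unfolded e]] Suc show ?case by (rule geq_trans)
qed

end

declare One_nat_def [simp del]

context hopf_ctx
begin

subsection \<open>Products with \<open>V 2\<close>\<close>

lemma per_eq: assumes "b \<noteq> 0" shows "per b = sp * s"
proof -
  have "per b = sb" using assms by (simp add: per_def)
  also have "sb = sp * s" unfolding sb_eq by (rule mult.commute)
  finally show ?thesis .
qed
lemma zt_sb: "zt ^ sb = 1" unfolding zt_order sb_eq by simp

lemma cp_1': "cp 1 = chi" using cp_1 by (simp add: One_nat_def)

text \<open>A common scheme for \<open>V 2\<close> on either side. From
  \<open>x p_n = p_(n+1) + z ^ n r_n\<close> follows \<open>x ^ n p_0 = p_n + c_n r_(n-1)\<close>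
  for \<open>n > 0\<close>, where \<open>c_n\<close> vanishes exactly for \<open>s dvd n\<close>. If
  \<open>c_t\<close> vanishes, both rows have length \<open>t\<close>; otherwise \<open>p_0\<close>
  generates a chain of length \<open>t + 1\<close> and a correction of \<open>x p_0\<close> one of
  length \<open>t - 1\<close>.\<close>

lemma two_rows:
  assumes M: "is_weight_hmod G chi M" and l: "l \<in> Ch"
    and w: "wvec M l (p 0)" "wvec M (chi \<star> l) (r 0)"
    and p: "\<And>n. opx M (p n) = p (Suc n) + fscale (z ^ n) (r n)" and r: "\<And>n. opx M (r n) = r (Suc n)"
    and z: "\<And>n. z ^ n = 1 \<longleftrightarrow> s dvd n" and t: "t > 0"
    and sp: "\<And>k S. k < hmod_dim M \<Longrightarrow> fv.subspace S \<Longrightarrow> (\<And>n. p n \<in> S) \<Longrightarrow> (\<And>n. r n \<in> S) \<Longrightarrow> ev k \<in> S"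
  shows "(\<And>n. n \<ge> t \<Longrightarrow> p n = 0 \<and> r n = 0) \<Longrightarrow> hmod_dim M = 2 * t \<Longrightarrow>
      cls M \<approx> (if s dvd t then cls (V t l 0) + cls (V t (chi \<star> l) 0) else cls (V (t + 1) l 0) + cls (V (t - 1) (chi \<star> l) 0))"
    and "b \<noteq> 0 \<Longrightarrow> p sb = fscale b (p 0) \<Longrightarrow> r sb = fscale b (r 0) \<Longrightarrow> hmod_dim M = 2 * sb \<Longrightarrow>
      cls M \<approx> cls (V 1 l b) + cls (V 1 (chi \<star> l) b)"
proof -
  have hM: "is_hmod G chi M" using M by (rule is_weight_hmodD)
  have cl: "chi \<star> l \<in> Ch" using l by simp
  \<comment> \<open>The quantum integer of \<open>n\<close> at \<open>z\<close>, which counts what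
    has passed from the row \<open>p\<close> to the row \<open>r\<close> after \<open>n\<close>
    steps.\<close>
  define c where "c n = (\<Sum>k<n. z ^ k)" for n
  have c0: "c n = 0 \<longleftrightarrow> s dvd n" for n
  proof -
    have "z \<noteq> 1" using z[of 1] s_ge2 by auto
    then have "c n = (z ^ n - 1) / (z - 1)" unfolding c_def by (rule geometric_sum)
    then show ?thesis using \<open>z \<noteq> 1\<close> z by simp
  qed
  have rn: "(opx M ^^ n) (r k) = r (k + n)" for n k by (induction n) (auto simp: r)
  have pn: "(opx M ^^ Suc n) (p 0) = p (Suc n) + fscale (c (Suc n)) (r n)" for n
  proof (induction n)
    case 0 show ?case using p[of 0] by (simp add: c_def)
  next
    case (Suc n)
    have "(opx M ^^ Suc (Suc n)) (p 0) = p (Suc (Suc n)) + (fscale (z ^ Suc n) (r (Suc n)) + fscale (c (Suc n)) (r (Suc n)))"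
      unfolding funpow.simps(2)[of "Suc n"] comp_apply Suc by (simp add: fv.linop_add fv.linop_scale p r add.assoc)
    also have "fscale (z ^ Suc n) (r (Suc n)) + fscale (c (Suc n)) (r (Suc n)) = fscale (c (Suc (Suc n))) (r (Suc n))"
      unfolding fv.scale_left_distrib[symmetric] by (simp add: c_def add_ac)
    finally show ?case .
  qed
  have two: "(\<Sum>i\<in>UNIV. f i) = f False + f True" for f :: "bool \<Rightarrow> 'z::comm_monoid_add"
    by (simp add: UNIV_bool add.commute)
  have powz: "(opx M ^^ n) v = 0" if "(opx M ^^ m) v = 0" "m \<le> n" for m n v
  proof -
    have "(opx M ^^ n) v = (opx M ^^ (n - m)) ((opx M ^^ m) v)" using that(2) by (simp add: funpow_plus)
    then show ?thesis using that by (simp add: fv.linop_0[OF linop_opx_pow])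
  qed
  obtain t' where t': "t = Suc t'" using t by (cases t) auto
  {
    assume van: "\<And>n. n \<ge> t \<Longrightarrow> p n = 0 \<and> r n = 0" and d: "hmod_dim M = 2 * t"
    show "cls M \<approx> (if s dvd t then cls (V t l 0) + cls (V t (chi \<star> l) 0) else cls (V (t + 1) l 0) + cls (V (t - 1) (chi \<star> l) 0))"
    proof (cases "s dvd t")
      case True
      let ?v = "\<lambda>i. if i then r 0 else p 0"
      have "cls M \<approx> (\<Sum>i\<in>(UNIV :: bool set). cls (V t (if i then chi \<star> l else l) 0))"
      proof (rule cyclic_decomposition[OF M, where v = ?v])
        have "(opx M ^^ t) (p 0) = 0" using pn[of t'] van[of t] c0[of t] True unfolding t' by simp
        moreover have "(opx M ^^ t) (r 0) = 0" using van[of t] by (simp add: rn)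
        ultimately show "(if i then chi \<star> l else l) \<in> Ch \<and> wvec M (if i then chi \<star> l else l) (?v i) \<and> (T M 0 ^^ t) (?v i) = 0" for i :: bool
          using w l by (simp add: T_0)
        show "(\<Sum>i\<in>(UNIV :: bool set). t * per 0) = hmod_dim M" using d by (simp add: per_def UNIV_bool)
        fix k assume k: "k < hmod_dim M"
        let ?S = "fv.span (\<Union>i. cyc M (?v i))"
        have cS: "u \<in> cyc M (?v i) \<Longrightarrow> u \<in> ?S" for u i by (intro fv.span_base) blast
        have rS: "r n \<in> ?S" for n using cS[of "r n" True] rn[of n 0] by (metis cyc_def add_0 rangeI)
        have "p n \<in> ?S" for n
        proof (cases n)
          case 0 then show ?thesis using cS[of "p 0" False] cyc_self by simp
        next
          case (Suc m)
          have "p n = (opx M ^^ Suc m) (p 0) - fscale (c (Suc m)) (r m)" unfolding pn Suc by simp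
          moreover have "(opx M ^^ Suc m) (p 0) \<in> ?S" using cS[of _ False] unfolding cyc_def by fastforce
          ultimately show ?thesis using rS by (simp add: fv.span_diff fv.span_scale)
        qed
        then show "ev k \<in> ?S" using sp[OF k] rS by simp
      qed simp
      then show ?thesis using True by (simp add: two)
    next
      case False
      \<comment> \<open>This is \<open>x p_0 - c_t r_0\<close>: applying \<open>x ^ (t - 1)\<close>
        cancels the one vector \<open>c_t r_(t-1)\<close> that is left of
        \<open>x ^ t p_0\<close>.\<close>
      define w2 where "w2 = p 1 - fscale (c t - 1) (r 0)"
      have w2n: "(opx M ^^ n) w2 = (opx M ^^ Suc n) (p 0) - fscale (c t) (r n)" for n
      proof -
        have "p 1 = opx M (p 0) - r 0" using p[of 0] by (simp add: One_nat_def)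
        then have "w2 = opx M (p 0) - fscale (c t) (r 0)" by (simp add: w2_def fv.scale_left_diff_distrib)
        then show ?thesis by (simp add: fv.linop_diff[OF linop_opx_pow] fv.linop_scale[OF linop_opx_pow] rn funpow_swap1)
      qed
      have ct: "c t \<noteq> 0" using False c0 by simp
      let ?v = "\<lambda>i. if i then w2 else p 0"
      have "cls M \<approx> (\<Sum>i\<in>(UNIV :: bool set). cls (V (if i then t - 1 else t + 1) (if i then chi \<star> l else l) 0))"
      proof (rule cyclic_decomposition[OF M, where v = ?v])
        have "(opx M ^^ Suc t) (p 0) = 0" using van[of "Suc t"] van[of t] unfolding pn by simp
        then have z1: "(opx M ^^ (t + 1)) (p 0) = 0" by (simp only: Suc_eq_plus1)
        have z2: "(opx M ^^ (t - 1)) w2 = 0" using w2n[of t'] pn[of t'] van[of t] by (simp add: t')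
        have "p 1 = opx M (p 0) - r 0" using p[of 0] by (simp add: One_nat_def)
        then have "wvec M (chi \<star> l) (p 1)" using wvec_diff[OF wvec_x[OF hM w(1)] w(2)] by simp
        then have "wvec M (chi \<star> l) w2" unfolding w2_def by (intro wvec_diff wvec_scale w(2))
        then show "(if i then chi \<star> l else l) \<in> Ch \<and> wvec M (if i then chi \<star> l else l) (?v i) \<and> (T M 0 ^^ (if i then t - 1 else t + 1)) (?v i) = 0" for i :: bool
          using w l z1 z2 by (simp add: T_0)
        show "(\<Sum>i\<in>(UNIV :: bool set). (if i then t - 1 else t + 1) * per 0) = hmod_dim M" using d t by (simp add: per_def UNIV_bool)
        fix k assume k: "k < hmod_dim M"
        let ?S = "fv.span (\<Union>i. cyc M (?v i))"
        have cS: "u \<in> cyc M (?v i) \<Longrightarrow> u \<in> ?S" for u i by (intro fv.span_base) blast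
        have p0S: "(opx M ^^ n) (p 0) \<in> ?S" for n using cS[of _ False] unfolding cyc_def by fastforce
        have w2S: "(opx M ^^ n) w2 \<in> ?S" for n using cS[of _ True] unfolding cyc_def by fastforce
        have rS: "r n \<in> ?S" for n
        proof -
          have "fscale (inverse (c t)) ((opx M ^^ Suc n) (p 0) - (opx M ^^ n) w2) = r n" unfolding w2n using ct by simp
          then show ?thesis using p0S w2S by (metis fv.span_diff fv.span_scale)
        qed
        have "p n \<in> ?S" for n
        proof (cases n)
          case 0 then show ?thesis using p0S[of 0] by simp
        next
          case (Suc m)
          have "p n = (opx M ^^ Suc m) (p 0) - fscale (c (Suc m)) (r m)" unfolding pn Suc by simp
          then show ?thesis using rS p0S[of "Suc m"] by (simp add: fv.span_diff fv.span_scale)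
        qed
        then show "ev k \<in> ?S" using sp[OF k] rS by simp
      qed simp
      then show ?thesis using False by (simp add: two)
    qed
  }
  assume b: "b \<noteq> 0" and per: "p sb = fscale b (p 0)" "r sb = fscale b (r 0)" and d: "hmod_dim M = 2 * sb"
  let ?v = "\<lambda>i. if i then r 0 else p 0"
  have "cls M \<approx> (\<Sum>i\<in>(UNIV :: bool set). cls (V 1 (if i then chi \<star> l else l) b))"
  proof (rule cyclic_decomposition[OF M, where v = ?v])
    obtain sb' where sb': "sb = Suc sb'" using sb_pos by (cases sb) auto
    \<comment> \<open>As \<open>s\<close> divides \<open>sb\<close>, the row \<open>r\<close> has
      dropped out after \<open>sb\<close> steps.\<close>
    have "(opx M ^^ sb) (p 0) = fscale b (p 0)" using pn[of sb'] per(1) c0[of sb] sb_eq unfolding sb' by simp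
    moreover have "(opx M ^^ sb) (r 0) = fscale b (r 0)" using per by (simp add: rn)
    ultimately show "(if i then chi \<star> l else l) \<in> Ch \<and> wvec M (if i then chi \<star> l else l) (?v i) \<and> (T M b ^^ 1) (?v i) = 0" for i :: bool
      using w l b by (simp add: T_def per_def One_nat_def)
    show "(\<Sum>i\<in>(UNIV :: bool set). 1 * per b) = hmod_dim M" using d b by (simp add: per_def UNIV_bool)
    fix k assume k: "k < hmod_dim M"
    let ?S = "fv.span (\<Union>i. cyc M (?v i))"
    have cS: "u \<in> cyc M (?v i) \<Longrightarrow> u \<in> ?S" for u i by (intro fv.span_base) blast
    have rS: "r n \<in> ?S" for n using cS[of "r n" True] rn[of n 0] by (metis cyc_def add_0 rangeI)
    have "p n \<in> ?S" for n
    proof (cases n)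
      case 0 then show ?thesis using cS[of "p 0" False] cyc_self by simp
    next
      case (Suc m)
      have "p n = (opx M ^^ Suc m) (p 0) - fscale (c (Suc m)) (r m)" unfolding pn Suc by simp
      moreover have "(opx M ^^ Suc m) (p 0) \<in> ?S" using cS[of _ False] unfolding cyc_def by fastforce
      ultimately show ?thesis using rS by (simp add: fv.span_diff fv.span_scale)
    qed
    then show "ev k \<in> ?S" using sp[OF k] rS by simp
  qed simp
  then show "cls M \<approx> cls (V 1 l b) + cls (V 1 (chi \<star> l) b)" by (simp add: two)
qed

lemma zt_inv_order: "inverse zt ^ n = 1 \<longleftrightarrow> s dvd n"
  using zt_order[of n] zt_nz by (simp add: power_inverse)

lemma z2: "0 < (2 :: nat)" by simp

lemma V2_tensor:
  assumes l: "l \<in> Ch" and t: "t > 0"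
  shows "cls (V 2 e1 0 \<boxtimes> V t l 0) \<approx> (if s dvd t then cls (V t l 0) + cls (V t (chi \<star> l) 0) else cls (V (t + 1) l 0) + cls (V (t - 1) (chi \<star> l) 0))"
    and "b \<noteq> 0 \<Longrightarrow> cls (V 2 e1 0 \<boxtimes> V 1 l b) \<approx> cls (V 1 l b) + cls (V 1 (chi \<star> l) b)"
proof -
  have w: "wvec (V 2 e1 0 \<boxtimes> V u l b) l (gr 2 e1 0 u l b 0 0)" "wvec (V 2 e1 0 \<boxtimes> V u l b) (chi \<star> l) (gr 2 e1 0 u l b 1 0)" if "u > 0" for u b
    using gr_wvec[OF e1_Ch l z2 that, of 0 b 0 0] gr_wvec[OF e1_Ch l z2 that, of 0 b 1 0] l by (simp_all add: cp_1')
  have x: "opx (V 2 e1 0 \<boxtimes> V u l b) (gr 2 e1 0 u l b 0 n) = gr 2 e1 0 u l b 0 (Suc n) + fscale (zt ^ n) (gr 2 e1 0 u l b 1 n)"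
    "opx (V 2 e1 0 \<boxtimes> V u l b) (gr 2 e1 0 u l b 1 n) = gr 2 e1 0 u l b 1 (Suc n)" if "u > 0" for u b n
    using gr_first(1)[OF z2, of 0 2 e1 u l b n] by (simp_all add: gr_x[OF e1_Ch l z2 that] add.commute One_nat_def[symmetric] del: One_nat_def)
  have sp: "ev k \<in> S" if "k < hmod_dim (V 2 e1 0 \<boxtimes> V u l b)" "fv.subspace S" "\<And>n. gr 2 e1 0 u l b 0 n \<in> S" "\<And>n. gr 2 e1 0 u l b 1 n \<in> S" for k S u b
  proof (rule gr_span[OF l that(2) _ that(1)])
    fix i j assume "i < 2 * per (0 :: 'k)"
    then have "i = 0 \<or> i = 1" by (auto simp: per_def)
    then show "gr 2 e1 0 u l b i j \<in> S" using that by auto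
  qed
  show "cls (V 2 e1 0 \<boxtimes> V t l 0) \<approx> (if s dvd t then cls (V t l 0) + cls (V t (chi \<star> l) 0) else cls (V (t + 1) l 0) + cls (V (t - 1) (chi \<star> l) 0))"
    by (rule two_rows(1)[OF weight_VV[OF e1_Ch l] l w[OF t] x[OF t] zt_order t sp[of _ t 0]])
      (auto simp: gr_second(1)[OF t] per_def)
  show "cls (V 2 e1 0 \<boxtimes> V 1 l b) \<approx> cls (V 1 l b) + cls (V 1 (chi \<star> l) b)" if b: "b \<noteq> 0"
    by (rule two_rows(2)[OF weight_VV[OF e1_Ch l] l w[OF zl1] x[OF zl1] zt_order zl1 sp[of _ 1 b] b])
      (use gr_second(2)[OF zl1 b refl, of 2 e1 0 l _ 0] b in \<open>auto simp: per_def\<close>)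
qed

text \<open>Rescaling the second column by \<open>zt ^ n\<close> lets \<open>x\<close> move along it
  without factors; the coupling becomes \<open>inverse zt ^ n\<close>. As \<open>inverse zt\<close>
  also has order \<open>s\<close>, the same scheme applies, and it was stated for any such
  \<open>z\<close>.\<close>

lemma tensor_V2:
  assumes t: "t > 0"
  shows "cls (V t e1 0 \<boxtimes> V 2 e1 0) \<approx> (if s dvd t then cls (V t e1 0) + cls (V t chi 0) else cls (V (t + 1) e1 0) + cls (V (t - 1) chi 0))"
    and "b \<noteq> 0 \<Longrightarrow> cls (V 1 e1 b \<boxtimes> V 2 e1 0) \<approx> cls (V 1 e1 b) + cls (V 1 chi b)"
proof -
  let ?E = "\<lambda>u b. gr u e1 b 2 e1 0" and ?M = "\<lambda>u b. V u e1 b \<boxtimes> V 2 e1 0"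
  let ?r = "\<lambda>u b n. fscale (zt ^ n) (?E u b n 1)"
  have w: "wvec (?M u b) e1 (?E u b 0 0)" "wvec (?M u b) (chi \<star> e1) (?r u b 0)" if "u > 0" for u b
    using gr_wvec[OF e1_Ch e1_Ch that z2, of b 0 0 0] gr_wvec[OF e1_Ch e1_Ch that z2, of b 0 0 1] by (simp_all add: cp_1')
  have x: "opx (?M u b) (?E u b n 0) = ?E u b (Suc n) 0 + fscale (inverse zt ^ n) (?r u b n)"
    "opx (?M u b) (?r u b n) = ?r u b (Suc n)" if "u > 0" for u b n
    using gr_second(1)[OF z2, of 0 2 u e1 b e1 n] zt_nz
    by (simp_all add: gr_x[OF e1_Ch e1_Ch that z2] fv.linop_scale power_inverse mult.commute One_nat_def[symmetric] del: One_nat_def)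
  have sp: "ev k \<in> S" if "k < hmod_dim (?M u b)" "fv.subspace S" "\<And>n. ?E u b n 0 \<in> S" "\<And>n. ?r u b n \<in> S" for k S u b
  proof (rule gr_span[OF e1_Ch that(2) _ that(1)])
    fix i j assume "j < 2 * per (0 :: 'k)"
    then have j: "j = 0 \<or> j = 1" by (auto simp: per_def)
    have "fscale (inverse (zt ^ i)) (?r u b i) = ?E u b i 1" using zt_nz by simp
    then have "?E u b i 1 \<in> S" using that by (metis fv.subspace_scale)
    then show "?E u b i j \<in> S" using j that by auto
  qed
  have "cls (?M t 0) \<approx> (if s dvd t then cls (V t e1 0) + cls (V t (chi \<star> e1) 0) else cls (V (t + 1) e1 0) + cls (V (t - 1) (chi \<star> e1) 0))"
    by (rule two_rows(1)[OF weight_VV[OF e1_Ch e1_Ch] e1_Ch w[OF t] x[OF t] zt_inv_order t sp[of _ t 0]])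
      (auto simp: gr_first(1)[OF t] per_def)
  then show "cls (?M t 0) \<approx> (if s dvd t then cls (V t e1 0) + cls (V t chi 0) else cls (V (t + 1) e1 0) + cls (V (t - 1) chi 0))"
    by (simp only: cm_e1(2)[OF chi_Ch])
  assume b: "b \<noteq> 0"
  have "cls (?M 1 b) \<approx> cls (V 1 e1 b) + cls (V 1 (chi \<star> e1) b)"
    by (rule two_rows(2)[OF weight_VV[OF e1_Ch e1_Ch] e1_Ch w[OF zl1] x[OF zl1] zt_inv_order zl1 sp[of _ 1 b] b])
      (use gr_first(2)[OF zl1 b refl, of e1 2 e1 0 0] b zt_sb in \<open>auto simp: per_def e1_apply[OF aG]\<close>)
  then show "cls (?M 1 b) \<approx> cls (V 1 e1 b) + cls (V 1 chi b)" by simp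
qed

subsection \<open>Products with \<open>V (s + 1)\<close>\<close>

lemma Suc_s_pos: "0 < s + 1" by simp

lemma cp_sb [simp]: "cp sb = e1" using cp_order[of sb] by simp

text \<open>Of the rows \<open>0, ..., s\<close> the operator \<open>x ^ s\<close> links only row
  \<open>0\<close> to row \<open>s\<close>. So \<open>T\<close> acts as on \<open>V t l b\<close> in
  all rows except for a term from row \<open>0\<close> into row \<open>s\<close>, with coefficient
  \<open>k * sp\<close> after \<open>k\<close> steps. This lengthens the chain of row
  \<open>0\<close> by one and leaves one of length \<open>t - 1\<close> for row \<open>s\<close>;
  the rows strictly between keep length \<open>t\<close>.\<close>

lemma Vs1_tensor:
  assumes l: "l \<in> Ch" and t: "t > 0" and b: "b \<noteq> 0"
  shows "cls (V (s + 1) e1 0 \<boxtimes> V t l b) \<approx> cls (V (t + 1) l b) + cls (V (t - 1) l b) + (\<Sum>k\<in>{1..<s}. cls (V t (cp k \<star> l) b))"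
proof -
  let ?N = "V t l b" and ?M = "V (s + 1) e1 0 \<boxtimes> V t l b"
  let ?n = "hmod_dim ?N"
  have M: "is_hmod G chi ?M" using is_weight_hmodD[OF weight_VV[OF e1_Ch l]] .
  \<comment> \<open>Row \<open>i\<close> of the grid with an arbitrary vector of the second factor
    in place of a power of its generator, so that the operator \<open>T\<close> of that factor can
    act inside the row.\<close>
  define Fi where "Fi i g = fscale (l a ^ i) (ten ?n (ux (V (s + 1) e1 0) i) g)" for i g
  have linF: "fv.linop (Fi i)" for i
    by (simp add: Fi_def fv.linop_def ten_add2 ten_scale2 fv.scale_right_distrib mult_ac)
  let ?E = "gr (s + 1) e1 0 t l b"
  have EF: "?E i j = Fi i (ux ?N j)" for i j by (simp add: gr_def Fi_def)
  note x = gr_x[OF e1_Ch l Suc_s_pos t, of 0 b]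
  have Ez: "?E i j = 0" if "i > s" for i j using gr_first(1)[OF Suc_s_pos, of 0 i] that by simp
  have knN: "kn ?n = fv.span (ux ?N ` {..<?n})"
  proof -
    have "ux ?N ` {..<?n} = ev ` {..<?n}" by (intro image_cong) (auto simp: ux_V)
    then show ?thesis by (simp add: kn_span)
  qed
  have us: "(opx ?M ^^ s) (Fi i g) = Fi (i + s) g + Fi i ((opx ?N ^^ s) g)" if g: "g \<in> kn ?n" for i g
  proof -
    have lin: "fv.linop (\<lambda>g. (opx ?M ^^ s) (Fi i g) - (Fi (i + s) g + Fi i ((opx ?N ^^ s) g)))"
      using fv.linop_comp[OF linop_opx_pow linF[of i], of s ?M] fv.linop_comp[OF linF[of i] linop_opx_pow, of s ?N] linF[of "i + s"]
      by (simp add: fv.linop_def algebra_simps fv.scale_right_diff_distrib fv.scale_right_distrib)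
    have "(opx ?M ^^ s) (Fi i g) - (Fi (i + s) g + Fi i ((opx ?N ^^ s) g)) \<in> {0}"
    proof (rule fv.linop_span[OF lin g[unfolded knN]])
      fix u assume "u \<in> ux ?N ` {..<?n}"
      then obtain j where "u = ux ?N j" by auto
      moreover have "(opx ?N ^^ s) (ux ?N j) = ux ?N (j + s)" by (simp add: ux_def funpow_plus add.commute)
      ultimately show "(opx ?M ^^ s) (Fi i u) - (Fi (i + s) u + Fi i ((opx ?N ^^ s) u)) \<in> {0}"
        using gr_s[OF e1_Ch l Suc_s_pos t, of 0 b i j, unfolded EF] by simp
    qed (simp add: fv.subspace_0)
    then show ?thesis by simp
  qed
  have Fz: "Fi i g = 0" if "i > s" "g \<in> kn ?n" for i g
  proof -
    have "Fi i g \<in> {0}"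
      using that(2)[unfolded knN] by (rule fv.linop_span[OF linF]) (use that(1) Ez in \<open>auto simp: EF[symmetric] fv.subspace_0\<close>)
    then show ?thesis by simp
  qed
  have kk: "(opx ?N ^^ i) g \<in> kn ?n" if "g \<in> kn ?n" for g i using that by (rule opx_pow_kn)
  have usk: "(opx ?M ^^ (k * s)) (Fi 0 g) = Fi 0 ((opx ?N ^^ (k * s)) g) + fscale (of_nat k) (Fi s ((opx ?N ^^ (k * s - s)) g))" if g: "g \<in> kn ?n" for k g
  proof (induction k)
    case (Suc k)
    have "(opx ?M ^^ (Suc k * s)) (Fi 0 g) = (opx ?M ^^ s) ((opx ?M ^^ (k * s)) (Fi 0 g))" by (simp add: funpow_plus)
    also have "\<dots> = Fi s ((opx ?N ^^ (k * s)) g) + Fi 0 ((opx ?N ^^ s) ((opx ?N ^^ (k * s)) g))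
        + fscale (of_nat k) (Fi (s + s) ((opx ?N ^^ (k * s - s)) g) + Fi s ((opx ?N ^^ s) ((opx ?N ^^ (k * s - s)) g)))"
      unfolding Suc fv.linop_add[OF linop_opx_pow] fv.linop_scale[OF linop_opx_pow] us[OF kk[OF g]] by simp
    also have "Fi (s + s) ((opx ?N ^^ (k * s - s)) g) = 0" using s_pos by (intro Fz kk g) simp
    also have "fscale (of_nat k) (0 + Fi s ((opx ?N ^^ s) ((opx ?N ^^ (k * s - s)) g))) = fscale (of_nat k) (Fi s ((opx ?N ^^ (k * s)) g))"
      by (cases k) (simp_all add: funpow_plus)
    also have "Fi s ((opx ?N ^^ (k * s)) g) + Fi 0 ((opx ?N ^^ s) ((opx ?N ^^ (k * s)) g)) + fscale (of_nat k) (Fi s ((opx ?N ^^ (k * s)) g))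
        = Fi 0 ((opx ?N ^^ (Suc k * s)) g) + fscale (of_nat (Suc k)) (Fi s ((opx ?N ^^ (Suc k * s - s)) g))"
      by (simp add: funpow_plus fv.scale_left_distrib add_ac)
    finally show ?case .
  qed simp
  have usi: "(opx ?M ^^ (k * s)) (Fi i g) = Fi i ((opx ?N ^^ (k * s)) g)" if "i > 0" and g: "g \<in> kn ?n" for k i g
  proof (induction k)
    case (Suc k)
    have "(opx ?M ^^ (Suc k * s)) (Fi i g) = (opx ?M ^^ s) ((opx ?M ^^ (k * s)) (Fi i g))" by (simp add: funpow_plus)
    also have "\<dots> = Fi (i + s) ((opx ?N ^^ (k * s)) g) + Fi i ((opx ?N ^^ s) ((opx ?N ^^ (k * s)) g))"
      unfolding Suc us[OF kk[OF g]] ..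
    also have "\<dots> = Fi i ((opx ?N ^^ (Suc k * s)) g)" using that(1) by (simp add: Fz[OF _ kk[OF g]] funpow_plus)
    finally show ?case .
  qed simp
  \<comment> \<open>Of the \<open>sp\<close> steps by \<open>x ^ s\<close> that make up
    \<open>x ^ sb\<close>, one may lead from row \<open>0\<close> to row \<open>s\<close>; the
    others leave \<open>x ^ (sb - s)\<close> on the second factor, and the choice of that step gives
    the coefficient \<open>sp\<close>.\<close>
  define h where "h g = (opx ?N ^^ (sb - s)) g" for g
  have per: "per b = sp * s" by (rule per_eq[OF b])
  have hk: "h g \<in> kn ?n" if "g \<in> kn ?n" for g unfolding h_def using that by (rule kk)
  have Tk: "T ?N b g \<in> kn ?n" if "g \<in> kn ?n" for g
    unfolding T_def using that subspace_kn[of ?n] by (intro fv.subspace_diff fv.subspace_scale kk)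
  have Tpk: "(T ?N b ^^ i) g \<in> kn ?n" if "g \<in> kn ?n" for g i using that by (induction i) (auto intro: Tk simp del: dim_V)
  have T0: "T ?M b (Fi 0 g) = Fi 0 (T ?N b g) + fscale (of_nat sp) (Fi s (h g))" if g: "g \<in> kn ?n" for g
    unfolding T_def per usk[OF g] fv.linop_diff[OF linF] fv.linop_scale[OF linF]
    by (simp add: h_def sb_eq mult.commute)
  have Ti: "T ?M b (Fi i g) = Fi i (T ?N b g)" if "i > 0" "g \<in> kn ?n" for i g
    unfolding T_def per usi[OF that] fv.linop_diff[OF linF] fv.linop_scale[OF linF] by simp
  have Tih: "(T ?M b ^^ k) (Fi i g) = Fi i ((T ?N b ^^ k) g)" if "i > 0" "g \<in> kn ?n" for i g k
    by (induction k) (simp_all add: Ti[OF that(1) Tpk[OF that(2)]])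
  have hT: "h (T ?N b g) = T ?N b (h g)" for g
  proof -
    have "opx ?N (T ?N b g) = T ?N b (opx ?N g)" for g by (simp add: T_def fv.linop_diff fv.linop_scale funpow_swap1)
    from funpow_commute[of "opx ?N" "T ?N b" "sb - s" 1 g, OF this] show ?thesis by (simp add: h_def One_nat_def)
  qed
  have hTp: "h ((T ?N b ^^ k) g) = (T ?N b ^^ k) (h g)" for k g by (induction k) (auto simp: hT)
  have T0k: "(T ?M b ^^ Suc k) (Fi 0 g) = Fi 0 ((T ?N b ^^ Suc k) g) + fscale (of_nat (Suc k) * of_nat sp) (Fi s ((T ?N b ^^ k) (h g)))" if g: "g \<in> kn ?n" for k g
  proof (induction k)
    case 0 show ?case by (simp add: T0[OF g])
  next
    case (Suc k)
    have "(T ?M b ^^ Suc (Suc k)) (Fi 0 g) = T ?M b (Fi 0 ((T ?N b ^^ Suc k) g)) + fscale (of_nat (Suc k) * of_nat sp) (T ?M b (Fi s ((T ?N b ^^ k) (h g))))"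
      unfolding funpow.simps(2)[of "Suc k"] comp_apply Suc by (simp add: fv.linop_add fv.linop_scale)
    also have "\<dots> = Fi 0 ((T ?N b ^^ Suc (Suc k)) g) + fscale (of_nat sp) (Fi s ((T ?N b ^^ Suc k) (h g)))
        + fscale (of_nat (Suc k) * of_nat sp) (Fi s ((T ?N b ^^ Suc k) (h g)))"
      unfolding T0[OF Tpk[OF g]] Ti[OF s_pos Tpk[OF hk[OF g]]] hTp by simp
    also have "\<dots> = Fi 0 ((T ?N b ^^ Suc (Suc k)) g) + fscale (of_nat (Suc (Suc k)) * of_nat sp) (Fi s ((T ?N b ^^ Suc k) (h g)))"
      unfolding add.assoc fv.scale_left_distrib[symmetric] by (simp add: distrib_right)
    finally show ?case .
  qed
  let ?g = "ev 0 :: nat \<Rightarrow> 'k"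
  have g: "?g \<in> kn ?n" using t per_pos[of b] by simp
  have Tg: "(T ?N b ^^ t) ?g = 0" by (rule T_V_zero[OF t])
  have E0: "?E k 0 = Fi k ?g" for k by (simp add: EF ux_def)
  have hE: "Fi s (h ?g) = ?E s (sb - s)" by (simp add: EF h_def ux_def)
  \<comment> \<open>A correction of \<open>T\<close> applied to the generator by a multiple of row
    \<open>s\<close>, fixed by the requirement that \<open>T ^ (t - 1)\<close> kills it; the factor
    \<open>t - 1\<close> is the coefficient that \<open>T ^ (t - 1)\<close> produces from row
    \<open>0\<close>.\<close>
  define w where "w = Fi 0 (T ?N b ?g) - fscale (of_nat (t - 1) * of_nat sp) (Fi s (h ?g))"
  have tsp: "of_nat t * of_nat sp = of_nat sp + of_nat (t - 1) * (of_nat sp :: 'k)"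
    using t by (cases t) (simp_all add: distrib_right)
  have eq: "w = T ?M b (?E 0 0) - fscale (of_nat t * of_nat sp) (?E s (sb - s))"
    unfolding tsp fv.scale_left_distrib w_def hE E0 T0[OF g] by (simp add: algebra_simps)
  define v where "v k = (if k = 0 then ?E 0 0 else if k = s then w else ?E k 0)" for k
  define tt where "tt k = (if k = 0 then t + 1 else if k = s then t - 1 else t)" for k
  define ll where "ll k = (if k = s then l else cp k \<star> l)" for k
  obtain t' where t': "t = Suc t'" using t by (cases t) auto
  have "cls ?M \<approx> (\<Sum>k\<in>{..s}. cls (V (tt k) (ll k) b))"
  proof (rule cyclic_decomposition[OF weight_VV[OF e1_Ch l], where v = v])
    fix k assume "k \<in> {..s}"
    then consider "k = 0" | "k = s" "k \<noteq> 0" | "0 < k" "k < s" by fastforce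
    then show "ll k \<in> Ch \<and> wvec ?M (ll k) (v k) \<and> (T ?M b ^^ tt k) (v k) = 0"
    proof cases
      case 1
      have h0: "(T ?N b ^^ t) (h ?g) = 0"
        unfolding hTp[symmetric] Tg by (simp add: h_def fv.linop_0[OF linop_opx_pow])
      have "(T ?M b ^^ Suc t) (?E 0 0) = 0" unfolding E0 T0k[OF g] h0
        using Tg by (simp add: fv.linop_0[OF linF] fv.linop_0[OF linop_T])
      note this[unfolded Suc_eq_plus1]
      then show ?thesis using 1 s_pos gr_wvec[OF e1_Ch l Suc_s_pos t, of 0 b 0 0] l
        by (simp add: ll_def v_def tt_def del: funpow.simps)
    next
      case 2
      have le: "s + (sb - s) = sb" using sb_eq sp_pos by (cases sp) auto
      have w1: "wvec ?M l (?E s (sb - s))" using gr_wvec[OF e1_Ch l Suc_s_pos t, of 0 b s "sb - s"] l by (simp add: le)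
      have w2: "wvec ?M l (?E 0 0)" using gr_wvec[OF e1_Ch l Suc_s_pos t, of 0 b 0 0] l by simp
      have "wvec ?M l ((opx ?M ^^ sb) (?E 0 0))" using wvec_x_pow[OF M w2 l, of sb] l by simp
      then have "wvec ?M l (T ?M b (?E 0 0))" using w2 b by (auto simp: T_def per_def intro!: wvec_diff wvec_scale)
      then have "wvec ?M l w" unfolding eq using w1 by (intro wvec_diff wvec_scale)
      moreover have "(T ?M b ^^ (t - 1)) w = 0"
      proof (cases t')
        case 0 then show ?thesis using Tg by (simp add: w_def t' fv.linop_0[OF linF])
      next
        case (Suc t'')
        have "(T ?M b ^^ Suc t'') w = Fi 0 ((T ?N b ^^ Suc t'') (T ?N b ?g)) + fscale (of_nat (Suc t'') * of_nat sp) (Fi s ((T ?N b ^^ t'') (h (T ?N b ?g))))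
            - fscale (of_nat (Suc t'') * of_nat sp) (Fi s ((T ?N b ^^ Suc t'') (h ?g)))"
          unfolding w_def fv.linop_diff[OF linop_T_pow] fv.linop_scale[OF linop_T_pow] T0k[OF Tk[OF g]] Tih[OF s_pos hk[OF g]]
          by (simp add: t' Suc del: funpow.simps)
        also have "(T ?N b ^^ Suc t'') (T ?N b ?g) = 0" using Tg by (simp add: t' Suc funpow_swap1)
        also have "(T ?N b ^^ t'') (h (T ?N b ?g)) = (T ?N b ^^ Suc t'') (h ?g)" by (simp add: hT funpow_swap1)
        finally show ?thesis by (simp add: t' Suc fv.linop_0[OF linF] del: funpow.simps)
      qed
      ultimately show ?thesis using 2 l by (simp add: ll_def v_def tt_def)
    next
      case 3
      have "(T ?M b ^^ t) (?E k 0) = 0" unfolding E0 Tih[OF 3(1) g] Tg by (rule fv.linop_0[OF linF])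
      then show ?thesis using 3 gr_wvec[OF e1_Ch l Suc_s_pos t, of 0 b k 0] l by (simp add: ll_def v_def tt_def)
    qed
  next
    have "{..s} = insert 0 (insert s {1..<s})" using s_pos by auto
    then have "(\<Sum>k\<in>{..s}. tt k * per b) = tt 0 * per b + (tt s * per b + (\<Sum>k\<in>{1..<s}. tt k * per b))"
      using s_pos by simp
    also have "(\<Sum>k\<in>{1..<s}. tt k * per b) = (s - 1) * (t * per b)" by (simp add: tt_def)
    also have "tt 0 * per b + (tt s * per b + (s - 1) * (t * per b)) = (t + 1 + (t - 1) + (s - 1) * t) * per b"
      using s_pos by (simp add: tt_def algebra_simps)
    also have "t + 1 + (t - 1) + (s - 1) * t = (s + 1) * t" using s_pos t by (cases s) (auto simp: algebra_simps)
    finally show "(\<Sum>k\<in>{..s}. tt k * per b) = hmod_dim ?M" by (simp add: per_def mult_ac)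
  next
    fix k assume k: "k < hmod_dim ?M"
    let ?S = "fv.span (\<Union>i\<in>{..s}. cyc ?M (v i))"
    have sub: "fv.subspace ?S" by simp
    have vS: "v i \<in> ?S" if "i \<le> s" for i using that cyc_self by (intro fv.span_base UN_I[of i]) auto
    have xS: "opx ?M u \<in> ?S" if "u \<in> ?S" for u using that by (rule span_cyc_x)
    have xpS: "(opx ?M ^^ i) u \<in> ?S" if "u \<in> ?S" for u i using that by (induction i) (auto intro: xS)
    have v0: "?E 0 0 \<in> ?S" using vS[of 0] by (simp add: v_def)
    have "w \<in> ?S" using vS[of s] s_pos by (simp add: v_def)
    moreover have "T ?M b (?E 0 0) \<in> ?S" unfolding T_def using v0 xpS by (intro fv.span_diff fv.span_scale)
    ultimately have "T ?M b (?E 0 0) - w \<in> ?S" by (intro fv.span_diff)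
    also have "T ?M b (?E 0 0) - w = fscale (of_nat t * of_nat sp) (?E s (sb - s))"
      unfolding eq by simp
    finally have "fscale (inverse (of_nat t * of_nat sp)) (fscale (of_nat t * of_nat sp) (?E s (sb - s))) \<in> ?S"
      by (rule fv.span_scale)
    \<comment> \<open>Characteristic zero makes the integer \<open>t * sp\<close> invertible, which
      puts a vector of row \<open>s\<close> into the span.\<close>
    moreover have "inverse (of_nat t * of_nat sp) * (of_nat t * of_nat sp) = (1 :: 'k)" using t sp_pos by (intro left_inverse) simp
    ultimately have top: "?E s (sb - s) \<in> ?S" unfolding fv.scale_scale by (simp only: fv.scale_one)
    have tail: "?E s (sb - s + d) \<in> ?S" for d
    proof (induction d)
      case (Suc d)
      have "opx ?M (?E s (sb - s + d)) = ?E s (sb - s + Suc d)" using Ez[of "Suc s"] by (simp add: x)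
      then show ?case using xS[OF Suc] by simp
    qed (use top in simp)
    have Es: "?E s j \<in> ?S" for j
      unfolding EF ux_def
    proof (rule span_tail[OF b Tg sub linF, where n = "sb - s"])
      fix i assume "sb - s \<le> i"
      then show "Fi s ((opx ?N ^^ i) ?g) \<in> ?S" using tail[of "i - (sb - s)"] by (simp add: EF ux_def)
    qed
    \<comment> \<open>Each row is generated from its first vector by \<open>x\<close> once the
      contribution of the next row is subtracted, hence the descent from row
      \<open>s\<close>.\<close>
    have Ek: "\<forall>j. ?E (s - d) j \<in> ?S" if "d \<le> s" for d
      using that
    proof (induction d)
      case (Suc d)
      let ?k = "s - Suc d"
      have k1: "Suc ?k = s - d" using Suc.prems by simp
      have "?E ?k 0 \<in> ?S" using vS[of ?k] v0 Suc.prems by (simp add: v_def split: if_splits)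
      have "?E ?k j \<in> ?S" for j
      proof (induction j)
        case (Suc j)
        have "?E ?k (Suc j) = opx ?M (?E ?k j) - fscale (zt ^ j) (?E (s - d) j)" unfolding x k1 by simp
        then show ?case using xS[OF Suc] Suc.prems \<open>Suc d \<le> s\<close> \<open>d \<le> s \<Longrightarrow> \<forall>j. ?E (s - d) j \<in> ?S\<close> by (simp add: fv.span_diff fv.span_scale)
      qed fact
      then show ?case by blast
    qed (use Es in simp)
    show "ev k \<in> ?S"
    proof (rule gr_span[OF l sub _ k])
      fix i j assume "i < (s + 1) * per (0 :: 'k)"
      then have "i \<le> s" by (simp add: per_def)
      then show "?E i j \<in> ?S" using Ek[of "s - i"] by simp
    qed
  qed simp
  also have "(\<Sum>k\<in>{..s}. cls (V (tt k) (ll k) b)) = cls (V (t + 1) l b) + cls (V (t - 1) l b) + (\<Sum>k\<in>{1..<s}. cls (V t (cp k \<star> l) b))"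
  proof -
    have "{..s} = insert 0 (insert s {1..<s})" using s_pos by auto
    then have "(\<Sum>k\<in>{..s}. cls (V (tt k) (ll k) b)) = cls (V (tt 0) (ll 0) b) + (cls (V (tt s) (ll s) b) + (\<Sum>k\<in>{1..<s}. cls (V (tt k) (ll k) b)))"
      using s_pos by simp
    then show ?thesis using s_pos l by (simp add: tt_def ll_def add.assoc)
  qed
  finally show ?thesis .
qed

text \<open>Seen from the other side, only column \<open>0\<close> is coupled to column
  \<open>s\<close>, again with the coefficient \<open>sp\<close>. Blocks with \<open>t = 1\<close>
  suffice, since the purpose is that \<open>z\<close> commutes with the variables
  \<open>x_al\<close>.\<close>

lemma tensor_Vs1:
  assumes b: "b \<noteq> 0"
  shows "cls (V 1 e1 b \<boxtimes> V (s + 1) e1 0) \<approx> cls (V 2 e1 b) + (\<Sum>k\<in>{1..<s}. cls (V 1 (cp k) b))"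
proof -
  let ?M = "V 1 e1 b \<boxtimes> V (s + 1) e1 0" and ?E = "gr 1 e1 b (s + 1) e1 0"
  have M: "is_hmod G chi ?M" using is_weight_hmodD[OF weight_VV[OF e1_Ch e1_Ch]] .
  note x = gr_x[OF e1_Ch e1_Ch zl1 Suc_s_pos, of b 0]
  note us = gr_s[OF e1_Ch e1_Ch zl1 Suc_s_pos, of b 0]
  have Ez: "?E i j = 0" if "j > s" for i j using gr_second(1)[OF Suc_s_pos refl, of j] that by simp
  have wrap: "?E (i + sb) j = fscale b (?E i j)" for i j using gr_first(2)[OF zl1 b refl, of e1 "s + 1" e1 0 i j] by (simp add: e1_apply[OF aG])
  have uj: "(opx ?M ^^ (k * s)) (?E i j) = ?E (i + k * s) j" if "j > 0" for i j k
  proof (induction k)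
    case (Suc k)
    have "(opx ?M ^^ (Suc k * s)) (?E i j) = (opx ?M ^^ s) ((opx ?M ^^ (k * s)) (?E i j))" by (simp add: funpow_plus)
    also have "\<dots> = ?E (i + k * s + s) j" unfolding Suc us using that by (simp add: Ez)
    also have "i + k * s + s = i + Suc k * s" by simp
    finally show ?case .
  qed simp
  have u0: "(opx ?M ^^ (k * s)) (?E 0 0) = ?E (k * s) 0 + fscale (of_nat k) (?E (k * s - s) s)" for k
  proof (induction k)
    case (Suc k)
    have "(opx ?M ^^ (Suc k * s)) (?E 0 0) = (opx ?M ^^ s) ((opx ?M ^^ (k * s)) (?E 0 0))" by (simp add: funpow_plus)
    also have "\<dots> = ?E (Suc k * s) 0 + ?E (k * s) s + fscale (of_nat k) (?E (k * s - s + s) s + ?E (k * s - s) (s + s))"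
      unfolding Suc fv.linop_add[OF linop_opx_pow] fv.linop_scale[OF linop_opx_pow] us by (simp add: add_ac)
    also have "?E (k * s - s) (s + s) = 0" using s_pos by (intro Ez) simp
    also have "fscale (of_nat k) (?E (k * s - s + s) s + 0) = fscale (of_nat k) (?E (k * s) s)" by (cases k) (simp_all add: add.commute)
    also have "?E (Suc k * s) 0 + ?E (k * s) s + fscale (of_nat k) (?E (k * s) s) = ?E (Suc k * s) 0 + fscale (of_nat (Suc k)) (?E (Suc k * s - s) s)"
      by (simp add: fv.scale_left_distrib add_ac)
    finally show ?case .
  qed simp
  have per: "per b = sp * s" by (rule per_eq[OF b])
  have Tj: "T ?M b (?E i j) = 0" if "j > 0" for i j
    unfolding T_def per uj[OF that] using wrap[of i j] sb_eq by (simp add: mult.commute)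
  have T0: "T ?M b (?E 0 0) = fscale (of_nat sp) (?E (sb - s) s)"
    unfolding T_def per u0 using wrap[of 0 0] sb_eq by (simp add: mult.commute)
  define tt where "tt k = (if k = 0 then 2 else 1 :: nat)" for k :: nat
  have "cls ?M \<approx> (\<Sum>k\<in>{..<s}. cls (V (tt k) (cp k) b))"
  proof (rule cyclic_decomposition[OF weight_VV[OF e1_Ch e1_Ch], where v = "\<lambda>k. ?E 0 k"])
    fix k
    have "(T ?M b ^^ tt k) (?E 0 k) = 0"
      using Tj[of k 0] T0 Tj[OF s_pos] by (cases "k = 0") (simp_all add: tt_def numeral_2_eq_2 One_nat_def fv.linop_scale)
    then show "cp k \<in> Ch \<and> wvec ?M (cp k) (?E 0 k) \<and> (T ?M b ^^ tt k) (?E 0 k) = 0"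
      using gr_wvec[OF e1_Ch e1_Ch zl1 Suc_s_pos, of b 0 0 k] by simp
  next
    have "{..<s} = insert 0 {1..<s}" using s_pos by auto
    then have "(\<Sum>k\<in>{..<s}. tt k * per b) = 2 * per b + (s - 1) * per b" by (simp add: tt_def)
    also have "\<dots> = (2 + (s - 1)) * per b" by (rule distrib_right[symmetric])
    also have "2 + (s - 1) = s + 1" using s_pos by simp
    finally show "(\<Sum>k\<in>{..<s}. tt k * per b) = hmod_dim ?M" by (simp add: per_def)
  next
    fix k assume k: "k < hmod_dim ?M"
    let ?S = "fv.span (\<Union>i\<in>{..<s}. cyc ?M (?E 0 i))"
    have sub: "fv.subspace ?S" by simp
    have vS: "?E 0 i \<in> ?S" if "i < s" for i using that cyc_self by (intro fv.span_base UN_I[of i]) auto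
    have xS: "opx ?M u \<in> ?S" if "u \<in> ?S" for u using that by (rule span_cyc_x)
    have xpS: "(opx ?M ^^ i) u \<in> ?S" if "u \<in> ?S" for u i using that by (induction i) (auto intro: xS)
    have "T ?M b (?E 0 0) \<in> ?S" unfolding T_def using vS[OF s_pos] xpS by (intro fv.span_diff fv.span_scale)
    then have "fscale (inverse (of_nat sp)) (T ?M b (?E 0 0)) \<in> ?S" by (rule fv.span_scale)
    then have top: "?E (sb - s) s \<in> ?S" unfolding T0 using sp_pos by simp
    have tail: "?E (sb - s + d) s \<in> ?S" for d
    proof (induction d)
      case (Suc d)
      have "opx ?M (?E (sb - s + d) s) = ?E (sb - s + Suc d) s" using Ez[of "Suc s"] zt_s by (simp add: x)
      then show ?case using xS[OF Suc] by simp
    qed (use top in simp)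
    have Es: "?E i s \<in> ?S" for i
    \<comment> \<open>The tail reaches a full period further, where the columns repeat with the
      invertible factor \<open>b\<close>.\<close>
    proof -
      have "sb - s + (i + s) = i + sb" using sb_eq sp_pos by (cases sp) auto
      then have "fscale (inverse b) (fscale b (?E i s)) \<in> ?S" using tail[of "i + s"] by (simp only: wrap fv.span_scale)
      then show ?thesis using b by simp
    qed
    have Ek: "\<forall>i. ?E i (s - d) \<in> ?S" if "d \<le> s" for d
      using that
    proof (induction d)
      case (Suc d)
      let ?k = "s - Suc d"
      have k1: "Suc ?k = s - d" using Suc.prems by simp
      have d: "\<forall>i. ?E i (s - d) \<in> ?S" using Suc by simp
      have "?E i ?k \<in> ?S" for i
      proof (induction i)
        case 0 show ?case using vS[of ?k] Suc.prems by simp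
      next
        case (Suc i)
        have "fscale (inverse (zt ^ ?k)) (opx ?M (?E i ?k) - ?E i (s - d)) = ?E (Suc i) ?k" unfolding x k1 using zt_nz by simp
        moreover have "fscale (inverse (zt ^ ?k)) (opx ?M (?E i ?k) - ?E i (s - d)) \<in> ?S"
          using xS[OF Suc] d by (intro fv.span_scale fv.span_diff) auto
        ultimately show ?case by simp
      qed
      then show ?case by blast
    qed (use Es in simp)
    show "ev k \<in> ?S"
    proof (rule gr_span[OF e1_Ch sub _ k])
      fix i j assume "j < (s + 1) * per (0 :: 'k)"
      then have "j \<le> s" by (simp add: per_def)
      then show "?E i j \<in> ?S" using Ek[of "s - j"] by simp
    qed
  qed simp
  also have "(\<Sum>k\<in>{..<s}. cls (V (tt k) (cp k) b)) = cls (V 2 e1 b) + (\<Sum>k\<in>{1..<s}. cls (V 1 (cp k) b))"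
  proof -
    have "{..<s} = insert 0 {1..<s}" using s_pos by auto
    then show ?thesis by (simp add: tt_def)
  qed
  finally show ?thesis .
qed

subsection \<open>Products of modules with invertible action of \<open>x\<close>\<close>

lemma T_kn: assumes "u \<in> kn (hmod_dim M)" shows "(T M b ^^ i) u \<in> kn (hmod_dim M)"
proof (induction i)
  case (Suc i)
  have "T M b ((T M b ^^ i) u) \<in> kn (hmod_dim M)" unfolding T_def[of M b "(T M b ^^ i) u"]
    by (rule fv.subspace_diff[OF subspace_kn opx_pow_kn[OF Suc] fv.subspace_scale[OF subspace_kn Suc]])
  then show ?case by simp
qed (use assms in simp)

lemma proj_coord: "proj M l v = v \<Longrightarrow> v i \<noteq> 0 \<Longrightarrow> wt M i = l"
  by (drule fun_cong[of _ _ i]) (auto simp: proj_def split: if_splits)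

lemma cp_period: "cp (n + sb) = cp n" by (simp add: cp_add[symmetric])

lemma sum_frag_const: "(\<Sum>r<n. u) = frag_cmul (int n) u" for u :: "('b \<Rightarrow>\<^sub>0 int)"
  by (induction n) (simp_all add: frag_cmul_distrib add.commute)

text \<open>On the grid \<open>x ^ s\<close> is the sum of two commuting shifts whose
  \<open>sp\<close>-th powers are \<open>al ^ sp\<close> and \<open>be ^ sp\<close>, that is, of
  \<open>al\<close> and \<open>be\<close> times shifts of period \<open>sp\<close>. A discrete
  Fourier transform over the powers of \<open>xi\<close> splits it into components with factor
  \<open>al + be * xi ^ i\<close>. A nonzero factor gives invertible blocks with its
  \<open>sp\<close>-th power as eigenvalue; a zero factor makes \<open>x ^ s\<close> vanish and
  gives nilpotent blocks of length \<open>s\<close>.\<close>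

lemma Vb_tensor_Vb:
  assumes al: "al \<noteq> 0" and be: "be \<noteq> 0"
  shows "cls (V 1 e1 (al ^ sp) \<boxtimes> V 1 e1 (be ^ sp)) \<approx>
    (\<Sum>i<sp. if al + be * xi ^ i = 0 then \<Sum>m<sb. cls (V s (cp m) 0) else frag_cmul (int s) (cls (V 1 e1 ((al + be * xi ^ i) ^ sp))))"
proof -
  let ?A = "al ^ sp" and ?B = "be ^ sp"
  let ?M = "V 1 e1 ?A \<boxtimes> V 1 e1 ?B" and ?E = "gr 1 e1 ?A 1 e1 ?B"
  have A: "?A \<noteq> 0" and B: "?B \<noteq> 0" using al be by auto
  note x = gr_x[OF e1_Ch e1_Ch zl1 zl1, of ?A ?B]
  note us = gr_s[OF e1_Ch e1_Ch zl1 zl1, of ?A ?B]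
  have wA: "?E (i + sb) j = fscale ?A (?E i j)" for i j using gr_first(2)[OF zl1 A refl, of e1 1 e1 ?B i j] by (simp add: e1_apply[OF aG])
  have wB: "?E i (j + sb) = fscale ?B (?E i j)" for i j using gr_second(2)[OF zl1 B refl] .
  define th where "th = inverse xi"
  have xth: "xi * th = 1" using xi_nz by (simp add: th_def)
  have th_sp: "th ^ sp = 1" using xi_pow[of sp] by (simp add: th_def power_inverse)
  define d where "d i = al + be * xi ^ i" for i
  \<comment> \<open>Dividing by powers of \<open>al\<close> and \<open>be\<close> makes both indices
    periodic with period \<open>sp\<close>; \<open>r\<close> is the offset of the column modulo
    \<open>s\<close>.\<close>
  define Nn where "Nn r k k' = fscale (inverse al ^ k * inverse be ^ k') (?E (k * s) (k' * s + r))" for r k k'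
  have N1: "Nn r (k + sp) k' = Nn r k k'" for r k k'
  proof -
    have "?E ((k + sp) * s) (k' * s + r) = fscale ?A (?E (k * s) (k' * s + r))"
      unfolding wA[symmetric] by (simp add: sb_eq algebra_simps)
    moreover have "inverse al ^ (k + sp) * inverse be ^ k' * ?A = inverse al ^ k * inverse be ^ k'"
      using al by (simp add: power_add power_inverse)
    ultimately show ?thesis by (simp add: Nn_def)
  qed
  have N2: "Nn r k (k' + sp) = Nn r k k'" for r k k'
  proof -
    have "?E (k * s) ((k' + sp) * s + r) = fscale ?B (?E (k * s) (k' * s + r))"
      unfolding wB[symmetric] by (simp add: sb_eq algebra_simps)
    moreover have "inverse al ^ k * inverse be ^ (k' + sp) * ?B = inverse al ^ k * inverse be ^ k'"
      using be by (simp add: power_add power_inverse)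
    ultimately show ?thesis by (simp add: Nn_def)
  qed
  have uN: "(opx ?M ^^ s) (Nn r k k') = fscale al (Nn r (Suc k) k') + fscale be (Nn r k (Suc k'))" for r k k'
  proof -
    have e: "k * s + s = Suc k * s" "k' * s + r + s = Suc k' * s + r" by simp_all
    have "al * (inverse al ^ Suc k * inverse be ^ k') = inverse al ^ k * inverse be ^ k'"
      "be * (inverse al ^ k * inverse be ^ Suc k') = inverse al ^ k * inverse be ^ k'" using al be by simp_all
    then show ?thesis unfolding Nn_def fv.linop_scale[OF linop_opx_pow] us e fv.scale_scale fv.scale_right_distrib by (simp only:)
  qed
  \<comment> \<open>The Fourier sum over the pairs of indices with sum \<open>l\<close> modulo
    \<open>sp\<close>; \<open>sp - k\<close> replaces \<open>- k\<close>. All its terms have the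
    same weight.\<close>
  define w where "w r i l = (\<Sum>k<sp. fscale (th ^ (i * k)) (Nn r (l + (sp - k)) k))" for r i l
  have uw: "(opx ?M ^^ s) (w r i l) = fscale (d i) (w r i (Suc l))" for r i l
  proof -
    define F where "F k = fscale (th ^ (i * k) * xi ^ i) (Nn r (Suc l + (sp - k)) k)" for k
    have "(opx ?M ^^ s) (w r i l) = (\<Sum>k<sp. fscale al (fscale (th ^ (i * k)) (Nn r (Suc l + (sp - k)) k)) + fscale be (F (Suc k)))"
      unfolding w_def fv.linop_comb[OF linop_opx_pow]
    proof (rule sum.cong)
      fix k assume k: "k \<in> {..<sp}"
      then have e: "Suc (l + (sp - k)) = Suc l + (sp - k)" "Suc l + (sp - Suc k) = l + (sp - k)" by auto
      have "th ^ (i * Suc k) * xi ^ i = th ^ (i * k) * (xi * th) ^ i" by (simp add: power_add power_mult_distrib mult_ac)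
      then have "F (Suc k) = fscale (th ^ (i * k)) (Nn r (l + (sp - k)) (Suc k))" unfolding F_def e(2) by (simp add: xth)
      then show "fscale (th ^ (i * k)) ((opx ?M ^^ s) (Nn r (l + (sp - k)) k))
        = fscale al (fscale (th ^ (i * k)) (Nn r (Suc l + (sp - k)) k)) + fscale be (F (Suc k))"
        unfolding uN e(1) by (simp add: fv.scale_right_distrib mult.commute)
    qed simp
    also have "\<dots> = fscale al (w r i (Suc l)) + fscale be (\<Sum>k<sp. F (Suc k))"
      unfolding sum.distrib fv.scale_sum_right[symmetric] w_def ..
    also have "(\<Sum>k<sp. F (Suc k)) = (\<Sum>k<sp. F k)"
    proof -
      have "F 0 + (\<Sum>k<sp. F (Suc k)) = (\<Sum>k<sp. F k) + F sp"
        using sum.lessThan_Suc_shift[of F sp] by simp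
      moreover have "F sp = F 0"
      proof -
        have "th ^ (i * sp) = 1" by (metis mult.commute power_mult power_one th_sp)
        then show ?thesis unfolding F_def using N2[of r "Suc l" 0] N1[of r "Suc l" 0] by simp
      qed
      ultimately show ?thesis by simp
    qed
    also have "(\<Sum>k<sp. F k) = fscale (xi ^ i) (w r i (Suc l))"
      unfolding F_def w_def fv.scale_sum_right by (simp add: mult.commute)
    finally show ?thesis by (simp add: d_def fv.scale_left_distrib)
  qed
  have uwn: "(opx ?M ^^ (n * s)) (w r i l) = fscale (d i ^ n) (w r i (l + n))" for r i l n
  proof (induction n)
    case (Suc n)
    have "(opx ?M ^^ (Suc n * s)) (w r i l) = (opx ?M ^^ s) ((opx ?M ^^ (n * s)) (w r i l))" by (simp add: funpow_plus)
    also have "\<dots> = fscale (d i ^ Suc n) (w r i (l + Suc n))" unfolding Suc fv.linop_scale[OF linop_opx_pow] uw by (simp add: mult.commute)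
    finally show ?case .
  qed simp
  have wl: "w r i (l + sp) = w r i l" for r i l
    unfolding w_def by (intro sum.cong refl) (metis N1 add.assoc add.commute)
  have ww: "wvec ?M (cp (l * s + r)) (w r i l)" for r i l
    unfolding w_def
  proof (intro wvec_sum wvec_scale)
    fix k assume "k \<in> {..<sp}"
    then obtain q where q: "sp = k + q" by (metis lessThan_iff less_imp_add_positive)
    have "(l + (sp - k)) * s + (k * s + r) = (l * s + r) + sb" by (simp add: q sb_eq algebra_simps)
    then have "cp ((l + (sp - k)) * s + (k * s + r)) = cp (l * s + r)" by (simp only: cp_period)
    then show "wvec ?M (cp (l * s + r)) (Nn r (l + (sp - k)) k)"
      unfolding Nn_def using gr_wvec[OF e1_Ch e1_Ch zl1 zl1, of ?A ?B "(l + (sp - k)) * s" "k * s + r"] by (intro wvec_scale) simp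
  qed
  \<comment> \<open>For nonzero \<open>d i\<close> the vectors with different \<open>l\<close> arise
    from one another by \<open>x ^ s\<close> up to scalars, so one generator suffices; for
    \<open>d i = 0\<close> all \<open>sp\<close> of them are needed.\<close>
  define n where "n i = (if d i = 0 then sp else 1)" for i
  define I where "I = Sigma ({..<s} \<times> {..<sp}) (\<lambda>(r, i). {..<n i})"
  have sumI: "(\<Sum>q\<in>I. h (fst (fst q)) (snd (fst q)) (snd q)) = (\<Sum>r<s. \<Sum>i<sp. \<Sum>l<n i. h r i l)" for h :: "nat \<Rightarrow> nat \<Rightarrow> nat \<Rightarrow> 'z::comm_monoid_add"
  proof -
    have "(\<Sum>q\<in>I. h (fst (fst q)) (snd (fst q)) (snd q)) = (\<Sum>p\<in>{..<s} \<times> {..<sp}. \<Sum>l\<in>(case p of (r, i) \<Rightarrow> {..<n i}). h (fst p) (snd p) l)"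
      unfolding I_def by (subst sum.Sigma) (auto simp: case_prod_unfold)
    also have "\<dots> = (\<Sum>r<s. \<Sum>i<sp. \<Sum>l<n i. h r i l)"
      by (simp add: sum.cartesian_product case_prod_unfold)
    finally show ?thesis .
  qed
  define tt where "tt i = (if d i = 0 then s else 1)" for i
  have "cls ?M \<approx> (\<Sum>q\<in>I. cls (V (tt (snd (fst q))) (cp (snd q * s + fst (fst q))) (d (snd (fst q)) ^ sp)))"
  proof (rule cyclic_decomposition[OF weight_VV[OF e1_Ch e1_Ch], where v = "\<lambda>q. w (fst (fst q)) (snd (fst q)) (snd q)"])
    show "finite I" unfolding I_def by auto
    fix q :: "(nat \<times> nat) \<times> nat"
    obtain r i l where q: "q = ((r, i), l)" by (cases q) auto
    have "(T ?M (d i ^ sp) ^^ tt i) (w r i l) = 0"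
    proof (cases "d i = 0")
      case True
      then have z: "d i ^ sp = 0" using sp_pos by simp
      show ?thesis unfolding z T_0 using True by (simp add: tt_def uw)
    next
      case False
      then have "per (d i ^ sp) = sp * s" by (intro per_eq) simp
      then have "T ?M (d i ^ sp) (w r i l) = 0" unfolding T_def by (simp add: uwn wl)
      then show ?thesis using False by (simp add: tt_def One_nat_def)
    qed
    then show "cp (snd q * s + fst (fst q)) \<in> Ch \<and> wvec ?M (cp (snd q * s + fst (fst q))) (w (fst (fst q)) (snd (fst q)) (snd q))
       \<and> (T ?M (d (snd (fst q)) ^ sp) ^^ tt (snd (fst q))) (w (fst (fst q)) (snd (fst q)) (snd q)) = 0"
      using ww[of l r i] by (simp add: q)
  next
    have "(\<Sum>l<n i. tt i * per (d i ^ sp)) = sb" for i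
    proof (cases "d i = 0")
      case True
      then have z: "d i ^ sp = 0" using sp_pos by simp
      have "(\<Sum>l<n i. tt i * per (d i ^ sp)) = sp * s" unfolding z using True by (simp add: n_def tt_def per_def)
      also have "\<dots> = sb" unfolding sb_eq by (rule mult.commute)
      finally show ?thesis .
    next
      case False
      then show ?thesis by (simp add: n_def tt_def per_def One_nat_def)
    qed
    then have "(\<Sum>r<s. \<Sum>i<sp. \<Sum>l<n i. tt i * per (d i ^ sp)) = s * (sp * sb)" by simp
    then have "(\<Sum>q\<in>I. tt (snd (fst q)) * per (d (snd (fst q)) ^ sp)) = s * (sp * sb)"
      using sumI[of "\<lambda>r i l. tt i * per (d i ^ sp)"] by simp
    also have "\<dots> = sb * sb" unfolding mult.assoc[symmetric] sb_eq[symmetric] ..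
    also have "sb * sb = hmod_dim ?M"
    proof -
      have "per ?A = sb" "per ?B = sb" unfolding per_def using A B by (simp_all only: if_False)
      then show ?thesis by simp
    qed
    finally show "(\<Sum>q\<in>I. tt (snd (fst q)) * per (d (snd (fst q)) ^ sp)) = hmod_dim ?M" .
  next
    fix k assume k: "k < hmod_dim ?M"
    let ?S = "fv.span (\<Union>q\<in>I. cyc ?M (w (fst (fst q)) (snd (fst q)) (snd q)))"
    have sub: "fv.subspace ?S" by simp
    have xS: "opx ?M u \<in> ?S" if "u \<in> ?S" for u using that by (rule span_cyc_x)
    have xpS: "(opx ?M ^^ i) u \<in> ?S" if "u \<in> ?S" for u i using that by (induction i) (auto intro: xS)
    have vS: "w r i l \<in> ?S" if "r < s" "i < sp" "l < n i" for r i l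
    proof (intro fv.span_base UN_I[of "((r, i), l)"])
      show "((r, i), l) \<in> I" using that by (simp add: I_def)
    qed (use cyc_self in simp)
    have wS: "w r i l \<in> ?S" if "r < s" "i < sp" "l < sp" for r i l
    proof (cases "d i = 0")
      case True then show ?thesis using that by (intro vS) (auto simp: n_def)
    next
      case False
      have "(opx ?M ^^ (l * s)) (w r i 0) \<in> ?S" using that False by (intro xpS vS) (auto simp: n_def)
      then have "fscale (inverse (d i ^ l)) (fscale (d i ^ l) (w r i (0 + l))) \<in> ?S" unfolding uwn by (rule fv.span_scale)
      moreover have "inverse (d i ^ l) * d i ^ l = 1" using False by (intro left_inverse) simp
      ultimately show ?thesis unfolding fv.scale_scale by (simp only: fv.scale_one add_0)
    qed
    have NS: "Nn r 0 k \<in> ?S" if r: "r < s" and k: "k < sp" for r k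
    proof -
      \<comment> \<open>Orthogonality of the powers of \<open>xi\<close> inverts the transform; here
        the order of \<open>xi\<close> has to be exactly \<open>sp\<close>.\<close>
      have dft: "(\<Sum>i<sp. xi ^ (i * k) * th ^ (i * k')) = (if k' = k then of_nat sp else 0)" if k': "k' < sp" for k'
      proof -
        define y where "y = xi ^ k * th ^ k'"
        have y: "xi ^ (i * k) * th ^ (i * k') = y ^ i" for i
          by (simp add: y_def power_mult_distrib power_mult[symmetric] mult.commute)
        show ?thesis
        proof (cases "k' = k")
          case True
          then have y1: "y = 1" by (simp add: y_def power_mult_distrib[symmetric] xth)
          show ?thesis unfolding y y1 using True by simp
        next
          case False
          have "y \<noteq> 1"
          proof
            assume "y = 1"
            then have eq: "xi ^ k = xi ^ k'" using xi_nz by (simp add: y_def th_def power_inverse field_simps)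
            have gen: "a = b" if "xi ^ a = xi ^ b" "a \<le> b" "b < sp" for a b
            proof -
              have "xi ^ (b - a) * xi ^ a = xi ^ b" unfolding power_add[symmetric] using that by simp
              then have "xi ^ (b - a) = 1" using that xi_nz by simp
              then have "sp dvd b - a" by (simp add: xi_pow)
              then show ?thesis using that by (auto dest: dvd_imp_le)
            qed
            show False using gen[of k k'] gen[of k' k] eq k k' False by (cases "k \<le> k'") auto
          qed
          moreover have "y ^ sp = 1"
          proof -
            have "y ^ sp = (xi ^ sp) ^ k * (th ^ sp) ^ k'" by (simp add: y_def power_mult_distrib power_mult[symmetric] mult.commute)
            then show ?thesis using th_sp xi_pow[of sp] by simp
          qed
          ultimately show ?thesis using False by (simp add: y geometric_sum)
        qed
      qed
      have "(\<Sum>i<sp. fscale (xi ^ (i * k)) (w r i k)) = (\<Sum>i<sp. \<Sum>k'<sp. fscale (xi ^ (i * k) * th ^ (i * k')) (Nn r (k + (sp - k')) k'))"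
        unfolding w_def fv.scale_sum_right by simp
      also have "\<dots> = (\<Sum>k'<sp. fscale (\<Sum>i<sp. xi ^ (i * k) * th ^ (i * k')) (Nn r (k + (sp - k')) k'))"
        by (subst sum.swap) (simp add: fv.scale_sum_left)
      also have "\<dots> = (\<Sum>k'<sp. if k' = k then fscale (of_nat sp) (Nn r sp k) else 0)"
        using k by (intro sum.cong) (auto simp: dft)
      also have "\<dots> = fscale (of_nat sp) (Nn r sp k)" using k by (simp add: sum.delta)
      also have "Nn r sp k = Nn r 0 k" using N1[of r 0 k] by simp
      finally have "fscale (of_nat sp) (Nn r 0 k) \<in> ?S" using wS[OF r _ k] by (metis (no_types, lifting) fv.span_scale fv.span_sum lessThan_iff)
      then have "fscale (inverse (of_nat sp)) (fscale (of_nat sp) (Nn r 0 k)) \<in> ?S" by (rule fv.span_scale)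
      then show ?thesis using sp_pos by simp
    qed
    have E0: "?E 0 j \<in> ?S" for j
    proof (induction j rule: less_induct)
      case (less j)
      show ?case
      proof (cases "j < sb")
        case True
        have "j div s < sp" "j mod s < s" using True divmod_bounds[of j sp s] by (auto simp: sb_eq mult.commute)
        from NS[OF this(2,1)] have "fscale (be ^ (j div s)) (Nn (j mod s) 0 (j div s)) \<in> ?S" by (rule fv.span_scale)
        then show ?thesis using be by (simp add: Nn_def power_inverse)
      next
        case False
        then have j: "(j - sb) + sb = j" "j - sb < j" using sb_pos by auto
        have "?E 0 (j - sb) \<in> ?S" by (rule less[OF j(2)])
        then have "?E 0 ((j - sb) + sb) \<in> ?S" unfolding wB by (rule fv.span_scale)
        then show ?thesis unfolding j(1) .
      qed
    qed
    \<comment> \<open>The coefficient \<open>zt ^ j\<close> is invertible, so \<open>x\<close>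
      produces row \<open>i + 1\<close> from row \<open>i\<close>.\<close>
    have EE: "\<forall>j. ?E i j \<in> ?S" for i
    proof (induction i)
      case (Suc i)
      have "fscale (inverse (zt ^ j)) (opx ?M (?E i j) - ?E i (Suc j)) = ?E (Suc i) j" for j unfolding x using zt_nz by simp
      moreover have "fscale (inverse (zt ^ j)) (opx ?M (?E i j) - ?E i (Suc j)) \<in> ?S" for j
        using Suc xS by (intro fv.span_scale fv.span_diff) auto
      ultimately show ?case by simp
    qed (use E0 in simp)
    show "ev k \<in> ?S" by (rule gr_span[OF e1_Ch sub _ k]) (use EE in blast)
  qed
  also have "(\<Sum>q\<in>I. cls (V (tt (snd (fst q))) (cp (snd q * s + fst (fst q))) (d (snd (fst q)) ^ sp)))
      = (\<Sum>i<sp. \<Sum>r<s. \<Sum>l<n i. cls (V (tt i) (cp (l * s + r)) (d i ^ sp)))"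
    unfolding sumI[of "\<lambda>r i l. cls (V (tt i) (cp (l * s + r)) (d i ^ sp))"] by (rule sum.swap)
  also have "\<dots> \<approx> (\<Sum>i<sp. if d i = 0 then \<Sum>m<sb. cls (V s (cp m) 0) else frag_cmul (int s) (cls (V 1 e1 (d i ^ sp))))"
  proof (rule geq_sum)
    fix i :: nat
    show "(\<Sum>r<s. \<Sum>l<n i. cls (V (tt i) (cp (l * s + r)) (d i ^ sp))) \<approx> (if d i = 0 then \<Sum>m<sb. cls (V s (cp m) 0) else frag_cmul (int s) (cls (V 1 e1 (d i ^ sp))))"
    proof (cases "d i = 0")
      case True
      have "(\<Sum>r<s. \<Sum>l<n i. cls (V (tt i) (cp (l * s + r)) (d i ^ sp))) = (\<Sum>l<sp. \<Sum>r<s. cls (V s (cp (l * s + r)) 0))"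
        using True sp_pos by (subst sum.swap) (simp add: n_def tt_def zero_power)
      also have "\<dots> = (\<Sum>m<sp * s. cls (V s (cp (m div s * s + m mod s)) 0))" by (rule sum_div_mod[symmetric])
      also have "\<dots> = (\<Sum>m<sb. cls (V s (cp m) 0))" by (simp add: sb_eq mult.commute)
      finally show ?thesis using True by simp
    next
      case False
      have "(\<Sum>r<s. \<Sum>l<n i. cls (V (tt i) (cp (l * s + r)) (d i ^ sp))) = (\<Sum>r<s. cls (V 1 (cp r) (d i ^ sp)))"
        using False by (simp add: n_def tt_def One_nat_def)
      \<comment> \<open>The \<open>s\<close> offsets give blocks whose weights differ by powers of
        \<open>chi\<close>; they are isomorphic, hence the multiplicity \<open>s\<close>.\<close>
      also have "\<dots> \<approx> (\<Sum>r<s. cls (V 1 e1 (d i ^ sp)))"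
      proof (rule geq_sum)
        fix r :: nat
        show "cls (V 1 (cp r) (d i ^ sp)) \<approx> cls (V 1 e1 (d i ^ sp))" using V_shift_cp[OF e1_Ch zl1, of "d i ^ sp" r] False by simp
      qed
      finally show ?thesis using False by (simp add: sum_frag_const)
    qed
  qed
  finally show ?thesis unfolding d_def .
qed

lemma exact_blocks:
  assumes dM: "diag_hmod M"
    and Bs: "\<And>v l t b. (v, l, t, b) \<in> set Bs \<Longrightarrow> l \<in> Ch \<and> wvec M l v \<and> (T M b ^^ t) v = 0"
    and d: "(\<Sum>(v, l, t, b)\<leftarrow>Bs. t * per b) \<le> hmod_dim M"
    and sp: "kn (hmod_dim M) \<subseteq> fv.span (\<Union>(v, l, t, b)\<in>set Bs. (\<lambda>i. (opx M ^^ i) v) ` {..<t * per b})"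
  shows "cls M \<approx> (\<Sum>(v, l, t, b)\<leftarrow>Bs. cls (V t l b))"
proof -
  have "hmod_dim M \<le> card (\<Union>(v, l, t, b)\<in>set Bs. (\<lambda>i. (opx M ^^ i) v) ` {..<t * per b})"
    using fv.dim_le_card[OF sp] by (simp add: dim_kn case_prod_unfold)
  also have "\<dots> \<le> (\<Sum>(v, l, t, b)\<leftarrow>Bs. t * per b)"
    using card_UN_sum_list[of "\<lambda>(v, l, t, b) i. (opx M ^^ i) v" "\<lambda>(v, l, t, b). t * per b" Bs] by (simp add: case_prod_unfold)
  finally have e: "(\<Sum>(v, l, t, b)\<leftarrow>Bs. t * per b) = hmod_dim M" using d by simp
  show ?thesis
  proof (rule block_decomposition[OF diag_weight[OF dM] Bs e])
    fix i assume "i < hmod_dim M"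
    then have "(ev i :: nat \<Rightarrow> 'k) \<in> kn (hmod_dim M)" by simp
    then show "(ev i :: nat \<Rightarrow> 'k) \<in> fv.span (\<Union>(v, l, t, b)\<in>set Bs. (\<lambda>i. (opx M ^^ i) v) ` {..<t * per b})" using sp by blast
  qed
qed

text \<open>The top degree \<open>t + s - 1\<close> of the product is reached from the generator only, so exactly one
  block has size \<open>t + s\<close>.\<close>

lemma Vs1_tensor_nil:
  assumes l: "l \<in> Ch" and t: "t > 0"
  shows "\<exists>L. (\<forall>(t', l')\<in>set L. 0 < t' \<and> t' < t + s \<and> (\<exists>k. l' = cp k \<star> l))
    \<and> cls (V (s + 1) e1 0 \<boxtimes> V t l 0) \<approx> cls (V (t + s) l 0) + (\<Sum>(t', l')\<leftarrow>L. cls (V t' l' 0))"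
proof -
  let ?M = "V (s + 1) e1 0 \<boxtimes> V t l 0" and ?E = "gr (s + 1) e1 0 t l 0"
  let ?n = "hmod_dim ?M" and ?N = "t - 1 + s"
  have dM: "diag_hmod ?M" using l by simp
  have M: "is_hmod G chi ?M" using is_weight_hmodD[OF weight_VV[OF e1_Ch l]] .
  note x = gr_x[OF e1_Ch l Suc_s_pos t, of 0 0]
  note us = gr_s[OF e1_Ch l Suc_s_pos t, of 0 0]
  have Ez1: "?E i j = 0" if "i > s" for i j using gr_first(1)[OF Suc_s_pos refl, of i] that by simp
  have Ez2: "?E i j = 0" if "j \<ge> t" for i j using gr_second(1)[OF t refl that] .
  let ?P = "?E s (t - 1)"
  have gen: "kn ?n = fv.span (\<Union>i\<in>{..s}. ?E i ` {..<t})"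
  proof
    have "ev ` {..<?n} \<subseteq> fv.span (\<Union>i\<in>{..s}. ?E i ` {..<t})"
    proof safe
      fix k assume k: "k < ?n"
      show "ev k \<in> fv.span (\<Union>i\<in>{..s}. ?E i ` {..<t})"
      proof (rule gr_span[OF l _ _ k])
        fix i j assume "i < (s + 1) * per (0 :: 'k)" "j < t * per (0 :: 'k)"
        then have "i \<in> {..s}" "j \<in> {..<t}" by (simp_all add: per_def)
        then show "?E i j \<in> fv.span (\<Union>i\<in>{..s}. ?E i ` {..<t})" by (intro fv.span_base UN_I[of i "{..s}"] imageI)
      qed simp
    qed
    then show "kn ?n \<subseteq> fv.span (\<Union>i\<in>{..s}. ?E i ` {..<t})" unfolding kn_span by (rule fv.span_minimal) simp
    have "?E i j \<in> kn ?n" for i j using gr_wvec[OF e1_Ch l Suc_s_pos t, of 0 0 i j] by (simp add: wvec_def)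
    then show "fv.span (\<Union>i\<in>{..s}. ?E i ` {..<t}) \<subseteq> kn ?n" by (intro fv.span_minimal) auto
  qed
  have xn: "(opx ?M ^^ n) (?E i j) = (\<Sum>k\<le>n. fscale (zt ^ (j * k) * qbin zt n k) (?E (i + k) (j + n - k)))" for n i j
    by (rule fv.q_binomial[where E = ?E and z = zt, OF linop_opx x])
  have vanish: "?E i j = 0" if "i + j > t - 1 + s" for i j using that Ez1[of i j] Ez2[of j i] t by (cases "i > s") auto
  \<comment> \<open>By total degree every grid vector except \<open>E 0 0\<close> is killed, and
    from \<open>E 0 0\<close> only the corner \<open>E s (t - 1)\<close> can be reached.\<close>
  have topE: "(opx ?M ^^ ?N) (?E i j) \<in> fv.span {?P}" for i j
    unfolding xn
  proof (intro fv.span_sum fv.span_scale)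
    fix k assume k: "k \<in> {..?N}"
    show "?E (i + k) (j + ?N - k) \<in> fv.span {?P}"
    proof (cases "i = 0 \<and> j = 0 \<and> k = s")
      case True then show ?thesis by (auto intro: fv.span_base)
    next
      case False
      have "?E (i + k) (j + ?N - k) = 0"
      proof (cases "i + j = 0")
        case True
        then show ?thesis using False k Ez1[of k "?N - k"] Ez2[of "?N - k" k] t by (cases "k > s") auto
      next
        case False then show ?thesis using k by (intro vanish) auto
      qed
      then show ?thesis by (simp add: fv.span_zero)
    qed
  qed
  have top: "(opx ?M ^^ ?N) f \<in> fv.span {?P}" if f: "f \<in> kn ?n" for f
    by (rule fv.linop_span[OF linop_opx_pow f[unfolded gen]]) (use topE in auto)
  have xP: "opx ?M ?P = 0" using Ez1[of "Suc s"] Ez2[of t] t by (simp add: x)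
  have nil: "(opx ?M ^^ Suc ?N) f = 0" if f: "f \<in> kn ?n" for f
  proof -
    have "opx ?M ((opx ?M ^^ ?N) f) \<in> {0}"
      by (rule fv.linop_span[OF linop_opx top[OF f]]) (use xP in \<open>auto simp: fv.subspace_0\<close>)
    then show ?thesis by simp
  qed
  have u0: "(opx ?M ^^ (k * s)) (?E 0 0) = ?E 0 (k * s) + fscale (of_nat k) (?E s (k * s - s))" for k
  proof (induction k)
    case (Suc k)
    have "(opx ?M ^^ (Suc k * s)) (?E 0 0) = (opx ?M ^^ s) ((opx ?M ^^ (k * s)) (?E 0 0))" by (simp add: funpow_plus)
    also have "\<dots> = ?E s (k * s) + ?E 0 (k * s + s) + fscale (of_nat k) (?E (s + s) (k * s - s) + ?E s (k * s - s + s))"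
      unfolding Suc fv.linop_add[OF linop_opx_pow] fv.linop_scale[OF linop_opx_pow] us by simp
    also have "?E (s + s) (k * s - s) = 0" using s_pos by (intro Ez1) simp
    also have "fscale (of_nat k) (0 + ?E s (k * s - s + s)) = fscale (of_nat k) (?E s (k * s))" by (cases k) (simp_all add: add.commute)
    also have "?E s (k * s) + ?E 0 (k * s + s) + fscale (of_nat k) (?E s (k * s)) = ?E 0 (Suc k * s) + fscale (of_nat (Suc k)) (?E s (Suc k * s - s))"
      by (simp add: fv.scale_left_distrib add_ac)
    finally show ?case .
  qed simp
  have usj: "(opx ?M ^^ k) (?E s j) = ?E s (j + k)" for k j
    by (induction k) (use Ez1[of "Suc s"] in \<open>simp_all add: x\<close>)
  \<comment> \<open>With \<open>t - 1 = j * s + r\<close> the top power contains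
    \<open>j + 1\<close> steps by \<open>x ^ s\<close>, one of which must lead to row
    \<open>s\<close>. This gives the coefficient \<open>j + 1\<close> of the corner, nonzero in
    characteristic zero.\<close>
  define j where "j = (t - 1) div s"
  have jt: "t \<le> Suc j * s"
  proof -
    have "t - 1 < Suc j * s" unfolding j_def using s_pos by (metis dividend_less_div_times mult_Suc add.commute)
    then show ?thesis by simp
  qed
  have topv: "(opx ?M ^^ ?N) (?E 0 0) = fscale (of_nat (Suc j)) ?P"
  proof -
    have N: "?N = (t - 1) mod s + Suc j * s" unfolding j_def by simp
    have "(opx ?M ^^ ?N) (?E 0 0) = (opx ?M ^^ ((t - 1) mod s)) ((opx ?M ^^ (Suc j * s)) (?E 0 0))"
      unfolding N by (simp only: funpow_plus)
    also have "\<dots> = fscale (of_nat (Suc j)) (?E s (j * s + (t - 1) mod s))"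
      unfolding u0 Ez2[OF jt] by (simp add: fv.linop_scale[OF linop_opx_pow] usj)
    also have "j * s + (t - 1) mod s = t - 1" unfolding j_def by simp
    finally show ?thesis .
  qed
  have P0: "?P \<noteq> 0"
  proof
    assume P: "?P = 0"
    have eq: "?P = fscale (l a ^ s) (ev (s * t + (t - 1)))"
      using t by (simp add: gr_def ux_V per_def ten_ev)
    have "?P (s * t + (t - 1)) = l a ^ s" by (simp add: eq fscale_apply ev_def)
    then have "l a ^ s = 0" by (simp only: P zero_fun_apply)
    then show False using Ch_nz[OF l aG] by simp
  qed
  have j0: "of_nat (Suc j) \<noteq> (0 :: 'k)" unfolding of_nat_eq_0_iff by simp
  let ?v = "?E 0 0"
  have wv: "wvec ?M l ?v" using gr_wvec[OF e1_Ch l Suc_s_pos t, of 0 0 0 0] l by simp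
  interpret G0: graded_op fscale "opx ?M" "proj ?M" "cm chi" Ch "range (wt ?M)" sb by (rule graded[OF dM])
  have T0: "G0.T 0 = opx ?M" unfolding graded_T[OF dM] by (rule T_0)
  have per0: "G0.per 0 = 1" unfolding graded_per[OF dM] by (simp add: per_def)
  have pk: "proj ?M n u \<in> kn ?n" if "u \<in> kn ?n" for u n using that by (auto simp: proj_def kn_def)
  have v1: "?v \<in> kn ?n" using wv by (simp add: wvec_def)
  have v2: "proj ?M l ?v = ?v" by (rule proj_wvec[OF dM wv l])
  have v3: "(G0.T 0 ^^ Suc ?N) ?v = 0" unfolding T0 by (rule nil[OF v1])
  have v4: "(G0.T 0 ^^ ?N) ?v \<notin> (G0.T 0 ^^ Suc ?N) ` kn ?n"
  proof
    assume "(G0.T 0 ^^ ?N) ?v \<in> (G0.T 0 ^^ Suc ?N) ` kn ?n"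
    then have "fscale (of_nat (Suc j)) ?P = 0" using nil unfolding T0 topv by auto
    then show False using P0 j0 by (simp del: of_nat_Suc)
  qed
  have xk: "opx ?M u \<in> kn ?n" for u by (rule opx_kn)
  obtain N where N: "fv.subspace N" "N \<subseteq> kn ?n" "\<And>u. u \<in> N \<Longrightarrow> opx ?M u \<in> N" "\<And>n u. u \<in> N \<Longrightarrow> proj ?M n u \<in> N"
    "\<And>u. u \<in> kn ?n \<Longrightarrow> \<exists>y\<in>fv.span ((\<lambda>i. (opx ?M ^^ i) ?v) ` {..<Suc ?N}). u - y \<in> N"
    "fv.dim N + Suc ?N \<le> ?n" "\<And>c. fscale c ((opx ?M ^^ ?N) ?v) \<in> N \<Longrightarrow> c = 0"
    using G0.split_block[of "kn ?n" "ev ` {..<?n}", OF subspace_kn _ _ xk pk v1 l v2 v3 v4]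
    unfolding T0 per0 kn_span[symmetric] dim_kn by auto
  obtain Bs where Bs: "\<forall>(v, l, t, b)\<in>set Bs. v \<in> N \<and> l \<in> Ch \<and> wvec ?M l v \<and> t > 0 \<and> (T ?M b ^^ t) v = 0 \<and> (T ?M b ^^ (t - 1)) v \<noteq> 0"
    "(\<Sum>(v, l, t, b)\<leftarrow>Bs. t * per b) \<le> fv.dim N"
    "N \<subseteq> fv.span (\<Union>(v, l, t, b)\<in>set Bs. (\<lambda>i. (opx ?M ^^ i) v) ` {..<t * per b})"
    using subspace_blocks[OF dM N(1,2,3,4)] by blast
  have prp: "b' = 0 \<and> 0 < t' \<and> t' < t + s \<and> (\<exists>k. l' = cp k \<star> l)" if mem: "(v', l', t', b') \<in> set Bs" for v' l' t' b'
  proof -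
    have B: "v' \<in> N" "l' \<in> Ch" "wvec ?M l' v'" "t' > 0" "(T ?M b' ^^ t') v' = 0" "(T ?M b' ^^ (t' - 1)) v' \<noteq> 0"
      using bspec[OF Bs(1) mem] by simp_all
    have kn': "v' \<in> kn ?n" using B(1) N(2) by auto
    have Tkn: "(T ?M b' ^^ i) v' \<in> kn ?n" for i using kn' by (rule T_kn)
    \<comment> \<open>The action of \<open>x\<close> on the product is nilpotent, which excludes
      nonzero eigenvalues.\<close>
    have b0: "b' = 0"
    proof (rule ccontr)
      assume b': "b' \<noteq> 0"
      let ?w = "(T ?M b' ^^ (t' - 1)) v'"
      have "T ?M b' ?w = (T ?M b' ^^ t') v'" using B(4) by (cases t') (simp_all add: One_nat_def)
      then have "(opx ?M ^^ sb) ?w = fscale b' ?w" using B(5) b' by (simp add: T_def per_def)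
      then have pw: "(opx ?M ^^ (k * sb)) ?w = fscale (b' ^ k) ?w" for k
      proof (induction k)
        case (Suc k)
        have "(opx ?M ^^ (Suc k * sb)) ?w = (opx ?M ^^ sb) ((opx ?M ^^ (k * sb)) ?w)" by (simp add: funpow_plus)
        then show ?case using Suc by (simp add: fv.linop_scale[OF linop_opx_pow] mult.commute)
      qed simp
      have "Suc ?N \<le> Suc ?N * sb" using sb_pos by (cases sb) auto
      then have "Suc ?N * sb = (Suc ?N * sb - Suc ?N) + Suc ?N" by simp
      then have "(opx ?M ^^ (Suc ?N * sb)) ?w = (opx ?M ^^ (Suc ?N * sb - Suc ?N)) ((opx ?M ^^ Suc ?N) ?w)" by (metis funpow_plus)
      also have "\<dots> = 0" unfolding nil[OF Tkn] by (rule fv.linop_0[OF linop_opx_pow])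
      finally show False unfolding pw using B(6) b' by simp
    qed
    have xt: "(opx ?M ^^ (t' - 1)) v' \<noteq> 0" using B(6) by (simp add: b0 T_0)
    \<comment> \<open>A block of full length in \<open>N\<close> would put a nonzero multiple of the
      corner into \<open>N\<close>, although \<open>N\<close> meets the socle of the split block
      only in zero.\<close>
    have "t' - 1 \<noteq> ?N"
    proof
      assume e: "t' - 1 = ?N"
      obtain c where c: "(opx ?M ^^ ?N) v' = fscale c ?P" using top[OF kn'] by (auto simp: fv.span_singleton)
      then have "fscale (c * inverse (of_nat (Suc j))) ((opx ?M ^^ ?N) ?v) = (opx ?M ^^ ?N) v'"
        unfolding topv using j0 by (simp del: of_nat_Suc)
      also have "\<dots> \<in> N" using B(1) N(3) by (rule funpow_invariant)
      finally have "c * inverse (of_nat (Suc j)) = 0" by (rule N(7))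
      then have "c = 0" using j0 by (simp del: of_nat_Suc)
      then show False using xt c e by simp
    qed
    moreover have "t' - 1 < Suc ?N"
    proof (rule ccontr)
      assume "\<not> t' - 1 < Suc ?N"
      then have "t' - 1 = (t' - 1 - Suc ?N) + Suc ?N" by simp
      then have "(opx ?M ^^ (t' - 1)) v' = (opx ?M ^^ (t' - 1 - Suc ?N)) ((opx ?M ^^ Suc ?N) v')" by (metis funpow_plus)
      also have "\<dots> = 0" unfolding nil[OF kn'] by (rule fv.linop_0[OF linop_opx_pow])
      finally show False using xt by simp
    qed
    ultimately have lt: "t' < t + s" using t by linarith
    \<comment> \<open>A coordinate where \<open>v'\<close> does not vanish reveals its weight, and
      the weights of the grid are the twists of \<open>l\<close> by powers of
      \<open>chi\<close>.\<close>
    have "v' \<noteq> 0" using B(6) fv.linop_0[OF linop_T_pow] by metis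
    then obtain m where m: "v' m \<noteq> 0" by (auto simp: fun_eq_iff zero_fun_apply)
    then have mn: "m < ?n" using kn' by (auto simp: kn_def not_le)
    have "proj ?M l' v' = v'" by (rule proj_wvec[OF dM B(3,2)])
    then have wm: "wt ?M m = l'" using m by (rule proj_coord)
    have bnd: "0 < t" "m div t < s + 1" "m mod t < t" using divmod_bounds[of m "s + 1" t] mn by (auto simp: per_def)
    let ?k = "m div t + m mod t"
    have "?E (m div t) (m mod t) = fscale (l a ^ (m div t)) (ev m)"
      using bnd by (simp add: gr_def ux_V per_def ev_ten[OF bnd(1), symmetric])
    then have "wvec ?M (cp ?k \<star> l) (fscale (l a ^ (m div t)) (ev m))"
      using gr_wvec[OF e1_Ch l Suc_s_pos t, of 0 0 "m div t" "m mod t"] l by simp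
    then have "wvec ?M (cp ?k \<star> l) (fscale (inverse (l a ^ (m div t))) (fscale (l a ^ (m div t)) (ev m)))" by (rule wvec_scale)
    then have "wvec ?M (cp ?k \<star> l) (ev m)" using Ch_nz[OF l aG] by simp
    then have "proj ?M (cp ?k \<star> l) (ev m) = ev m" using l by (intro proj_wvec[OF dM]) auto
    then have "wt ?M m = cp ?k \<star> l" by (rule proj_coord) (simp add: ev_def)
    then have "l' = cp ?k \<star> l" using wm by simp
    then show ?thesis using b0 lt B(4) by blast
  qed
  let ?Bs = "(?v, l, t + s, 0) # Bs"
  have SN: "Suc ?N = t + s" using t by simp
  have "cls ?M \<approx> (\<Sum>(v, l, t, b)\<leftarrow>?Bs. cls (V t l b))"
  proof (rule exact_blocks[OF dM])
    fix v' l' t' b' assume "(v', l', t', b') \<in> set ?Bs"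
    then show "l' \<in> Ch \<and> wvec ?M l' v' \<and> (T ?M b' ^^ t') v' = 0"
      using Bs(1) l wv nil[OF v1] unfolding SN by (auto simp: T_0)
  next
    show "(\<Sum>(v, l, t, b)\<leftarrow>?Bs. t * per b) \<le> ?n" using Bs(2) N(6) unfolding SN by (simp add: per_def)
    show "kn ?n \<subseteq> fv.span (\<Union>(v, l, t, b)\<in>set ?Bs. (\<lambda>i. (opx ?M ^^ i) v) ` {..<t * per b})" (is "_ \<subseteq> ?W")
    proof
      fix u :: "nat \<Rightarrow> 'k" assume "u \<in> kn ?n"
      then have "\<exists>y\<in>fv.span ((\<lambda>i. (opx ?M ^^ i) ?v) ` {..<t + s}). u - y \<in> N" unfolding SN[symmetric] by (rule N(5))
      then obtain y where y: "y \<in> fv.span ((\<lambda>i. (opx ?M ^^ i) ?v) ` {..<t + s})" "u - y \<in> N" by (rule bexE)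
      have "y \<in> ?W" by (rule subsetD[OF fv.span_mono y(1)]) (auto simp: per_def)
      moreover have "u - y \<in> fv.span (\<Union>(v, l, t, b)\<in>set Bs. (\<lambda>i. (opx ?M ^^ i) v) ` {..<t * per b})" by (rule subsetD[OF Bs(3) y(2)])
      then have "u - y \<in> ?W" by (rule subsetD[OF fv.span_mono, rotated]) auto
      ultimately have "(u - y) + y \<in> ?W" by (intro fv.span_add)
      then show "u \<in> ?W" by simp
    qed
  qed
  also have "(\<Sum>(v, l, t, b)\<leftarrow>?Bs. cls (V t l b)) = cls (V (t + s) l 0) + (\<Sum>(v, l, t, b)\<leftarrow>Bs. cls (V t l b))" by simp
  also have "(\<Sum>(v, l, t, b)\<leftarrow>Bs. cls (V t l b)) = (\<Sum>(t', l')\<leftarrow>map (\<lambda>(v, l, t, b). (t, l)) Bs. cls (V t' l' 0))"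
  proof -
    have "map (\<lambda>(v, l, t, b). cls (V t l b)) Bs = map (\<lambda>(v, l, t, b). cls (V t l 0)) Bs" using prp by (auto intro!: map_cong)
    also have "\<dots> = map (\<lambda>(t, l). cls (V t l 0)) (map (\<lambda>(v, l, t, b). (t, l)) Bs)" by (simp add: o_def case_prod_unfold)
    finally show ?thesis by (simp only:)
  qed
  finally have F: "cls ?M \<approx> cls (V (t + s) l 0) + (\<Sum>(t', l')\<leftarrow>map (\<lambda>(v, l, t, b). (t, l)) Bs. cls (V t' l' 0))" .
  have A: "\<forall>(t', l')\<in>set (map (\<lambda>(v, l, t, b). (t, l)) Bs). 0 < t' \<and> t' < t + s \<and> (\<exists>k. l' = cp k \<star> l)"
  proof
    fix q assume "q \<in> set (map (\<lambda>(v, l, t, b). (t, l)) Bs)"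
    then obtain v' l' t' b' where q: "(v', l', t', b') \<in> set Bs" "q = (t', l')" by auto
    show "case q of (t', l') \<Rightarrow> 0 < t' \<and> t' < t + s \<and> (\<exists>k. l' = cp k \<star> l)"
      unfolding q(2) case_prod_conv by (rule conjunct2[OF prp[OF q(1)]])
  qed
  show ?thesis by (rule exI[of _ "map (\<lambda>(v, l, t, b). (t, l)) Bs"]) (rule conjI[OF A F])
qed

end

subsection \<open>Numerical invariants of modules\<close>

context vspace
begin

lemma dim_image_le:
  assumes "linop f" "S \<subseteq> span B0" "finite B0"
  shows "dim (f ` S) \<le> dim S"
proof -
  obtain B where B: "B \<subseteq> S" "independent B" "S \<subseteq> span B" "card B = dim S" using basis_exists by blast
  have "B \<subseteq> span B0" using B assms by auto
  then have fin: "finite B" using independent_span_bound[OF assms(3) B(2)] by blast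
  have "f v \<in> span (f ` B)" if "v \<in> S" for v
    by (rule linop_span[OF assms(1), of v B]) (use that B in \<open>auto intro: span_base\<close>)
  then have "dim (f ` S) \<le> card (f ` B)" by (intro dim_le_card) (auto simp: fin)
  also have "\<dots> \<le> card B" using fin by (rule card_image_le)
  finally show ?thesis using B by simp
qed

lemma dim_image_eq':
  assumes "linop f" "linop g" "S \<subseteq> span B0" "finite B0" "\<And>v. v \<in> S \<Longrightarrow> g (f v) = v"
  shows "dim (f ` S) = dim S"
proof -
  have "f ` S \<subseteq> span (f ` B0)"
  proof safe
    fix v assume "v \<in> S"
    then show "f v \<in> span (f ` B0)" by (intro linop_span[OF assms(1), of v B0]) (use assms(3) in \<open>auto intro: span_base\<close>)
  qed
  then have "dim (g ` f ` S) \<le> dim (f ` S)" using assms by (intro dim_image_le[where ?B0.0 = "f ` B0"]) auto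
  moreover have "g ` f ` S = S" using assms(5) by (force simp: image_image)
  ultimately show ?thesis using dim_image_le[OF assms(1,3,4)] by simp
qed

text \<open>The upper bound comes from the union of two bases, the lower one from the independence
  of a basis of \<open>B\<close> modulo \<open>A\<close>.\<close>

lemma dim_direct_sum:
  assumes A: "subspace A" "A \<subseteq> span B0" and B: "subspace B" "B \<subseteq> span B0" and fin: "finite B0" and AB: "A \<inter> B \<subseteq> {0}"
  shows "dim (span (A \<union> B)) = dim A + dim B"
proof -
  obtain BA where BA: "BA \<subseteq> A" "independent BA" "A \<subseteq> span BA" "card BA = dim A" using basis_exists by blast
  obtain BB where BB: "BB \<subseteq> B" "independent BB" "B \<subseteq> span BB" "card BB = dim B" using basis_exists by blast
  have "BA \<subseteq> span B0" "BB \<subseteq> span B0" using A BA B BB by auto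
  then have fA: "finite BA" and fB: "finite BB" using independent_span_bound[OF fin] BA(2) BB(2) by blast+
  have "span (A \<union> B) \<subseteq> span (BA \<union> BB)"
    using BA(3) BB(3) span_mono[of BA "BA \<union> BB"] span_mono[of BB "BA \<union> BB"] by (intro span_minimal) auto
  then have "dim (span (A \<union> B)) \<le> card (BA \<union> BB)" using fA fB by (intro dim_le_card) auto
  also have "\<dots> \<le> dim A + dim B" using card_Un_le[of BA BB] BA BB by simp
  finally have 1: "dim (span (A \<union> B)) \<le> dim A + dim B" .
  have "dim A + card BB \<le> dim (span (A \<union> B))"
  proof (rule dim_add_independent[OF fB fin, where c = "\<lambda>v. v"])
    show "span (A \<union> B) \<subseteq> span B0" using A B by (intro span_minimal) auto
    show "\<And>i. i \<in> BB \<Longrightarrow> i \<in> span (A \<union> B)" using BB by (auto intro: span_base)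
    fix u assume u: "(\<Sum>i\<in>BB. u i *s i) \<in> A"
    moreover have "(\<Sum>i\<in>BB. u i *s i) \<in> B" using BB B by (intro subspace_sum subspace_scale) auto
    ultimately have "(\<Sum>i\<in>BB. u i *s i) = 0" using AB by auto
    then show "\<forall>i\<in>BB. u i = 0" using BB(2) fB independentD by blast
  qed (use A in \<open>auto intro: span_base\<close>)
  then show ?thesis using 1 BB by simp
qed

end

lemma matop_block_diag:
  assumes "A \<in> carrier_mat m m" "D \<in> carrier_mat n n"
  shows "matop (m + n) (four_block_mat A (0\<^sub>m m n) (0\<^sub>m n m) D) w
    = (\<lambda>i. if i < m then matop m A w i else matop n D (\<lambda>j. w (j + m)) (i - m))"
proof
  fix i
  have split: "(\<Sum>j<m + n. h j) = (\<Sum>j<m. h j) + (\<Sum>j<n. h (j + m))" for h :: "nat \<Rightarrow> 'a"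
    using sum.atLeastLessThan_concat[of 0 m "m + n" h] sum.shift_bounds_nat_ivl[of h 0 m n]
    by (simp add: atLeast0LessThan add.commute)
  show "matop (m + n) (four_block_mat A (0\<^sub>m m n) (0\<^sub>m n m) D) w i
    = (if i < m then matop m A w i else matop n D (\<lambda>j. w (j + m)) (i - m))"
    using assms by (auto simp: matop_def split)
qed

context hopf_ctx
begin

definition ker_wt :: "'k \<Rightarrow> nat \<Rightarrow> ('g \<Rightarrow> 'k) \<Rightarrow> ('g, 'k) hmod \<Rightarrow> (nat \<Rightarrow> 'k) set" where
  "ker_wt b n m M = {v. wvec M m v \<and> (T M b ^^ n) v = 0}"

lemma subspace_ker_wt [simp]: "fv.subspace (ker_wt b n m M)"
  by (auto simp: ker_wt_def fv.subspace_def wvec_add wvec_scale fv.linop_0[OF linop_T_pow] fv.linop_add[OF linop_T_pow] fv.linop_scale[OF linop_T_pow])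

lemma ker_wt_kn: "ker_wt b n m M \<subseteq> kn (hmod_dim M)" by (auto simp: ker_wt_def wvec_def)

lemma ker_wt_fin: "ker_wt b n m M \<subseteq> fv.span (ev ` {..<hmod_dim M})" using ker_wt_kn kn_span by metis

lemma intertwine:
  assumes F: "fv.linop F" "\<And>u. u \<in> kn (hmod_dim N) \<Longrightarrow> F u \<in> kn (hmod_dim M)"
    "\<And>u. u \<in> kn (hmod_dim N) \<Longrightarrow> F (opx N u) = opx M (F u)"
    "\<And>g u. g \<in> carrier G \<Longrightarrow> u \<in> kn (hmod_dim N) \<Longrightarrow> F (opg N g u) = opg M g (F u)"
  shows "u \<in> ker_wt b n m N \<Longrightarrow> F u \<in> ker_wt b n m M"
    and "u \<in> kn (hmod_dim N) \<Longrightarrow> F ((T N b ^^ n) u) = (T M b ^^ n) (F u)"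
proof -
  have xp: "F ((opx N ^^ i) u) = (opx M ^^ i) (F u)" if "u \<in> kn (hmod_dim N)" for u i
    by (induction i) (simp_all add: F(3) opx_pow_kn[OF that])
  have Tk: "T N b u \<in> kn (hmod_dim N)" if "u \<in> kn (hmod_dim N)" for u
    unfolding T_def by (rule fv.subspace_diff[OF subspace_kn opx_pow_kn[OF that] fv.subspace_scale[OF subspace_kn that]])
  have T1: "F (T N b u) = T M b (F u)" if "u \<in> kn (hmod_dim N)" for u
    unfolding T_def by (simp add: fv.linop_diff[OF F(1)] fv.linop_scale[OF F(1)] xp[OF that])
  have Tp: "(T N b ^^ n) u \<in> kn (hmod_dim N) \<and> F ((T N b ^^ n) u) = (T M b ^^ n) (F u)" if "u \<in> kn (hmod_dim N)" for u
    by (induction n) (simp_all add: that T1 Tk)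
  then show "F ((T N b ^^ n) u) = (T M b ^^ n) (F u)" if "u \<in> kn (hmod_dim N)" using that by blast
  assume u: "u \<in> ker_wt b n m N"
  then have k: "u \<in> kn (hmod_dim N)" and w: "\<And>g. g \<in> carrier G \<Longrightarrow> opg N g u = fscale (m g) u" and t: "(T N b ^^ n) u = 0"
    by (auto simp: ker_wt_def wvec_def)
  have "opg M g (F u) = fscale (m g) (F u)" if "g \<in> carrier G" for g
    using F(4)[OF that k] w[OF that] by (simp add: fv.linop_scale[OF F(1)])
  moreover have "(T M b ^^ n) (F u) = 0" using Tp[OF k] t fv.linop_0[OF F(1)] by simp
  ultimately show "F u \<in> ker_wt b n m M" unfolding ker_wt_def wvec_def using F(2)[OF k] by simp
qed

text \<open>An intertwiner maps kernels on weight spaces into each other, and its inverse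
  intertwines in the opposite direction.\<close>

lemma dim_ker_wt_iso:
  assumes M: "is_hmod G chi M" and N: "is_hmod G chi N" and i: "hmod_iso G M N"
  shows "fv.dim (ker_wt b n m M) = fv.dim (ker_wt b n m N)"
proof -
  let ?d = "hmod_dim M"
  obtain P Q where d: "hmod_dim N = ?d" and P: "P \<in> carrier_mat ?d ?d" and Q: "Q \<in> carrier_mat ?d ?d"
    and PQ: "P * Q = 1\<^sub>m ?d" and QP: "Q * P = 1\<^sub>m ?d"
    and g: "\<And>g. g \<in> carrier G \<Longrightarrow> P * hmod_g M g = hmod_g N g * P" and x: "P * hmod_x M = hmod_x N * P"
    using i unfolding hmod_iso_def by auto
  note cM = is_hmodD(1,2)[OF M] and cN = is_hmodD(1,2)[OF N, unfolded d]
  have Qi: "Q * B = A * Q" if A: "A \<in> carrier_mat ?d ?d" and B: "B \<in> carrier_mat ?d ?d" and e: "P * A = B * P" for A B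
  proof -
    have "Q * B = Q * B * (P * Q)" using PQ B Q by simp
    also have "\<dots> = Q * (B * P) * Q" using B P Q by (simp add: assoc_mult_mat[of _ ?d ?d _ ?d _ ?d])
    also have "\<dots> = (Q * P) * A * Q" unfolding e[symmetric] using A P Q by (simp add: assoc_mult_mat[of _ ?d ?d _ ?d _ ?d])
    finally show ?thesis using QP A by simp
  qed
  have le: "R \<in> carrier_mat ?d ?d \<Longrightarrow> hmod_dim M' = ?d \<Longrightarrow> hmod_dim N' = ?d \<Longrightarrow> is_hmod G chi M' \<Longrightarrow> is_hmod G chi N' \<Longrightarrow>
     (\<And>g. g \<in> carrier G \<Longrightarrow> R * hmod_g M' g = hmod_g N' g * R) \<Longrightarrow> R * hmod_x M' = hmod_x N' * R \<Longrightarrow>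
     matop ?d R ` ker_wt b n m M' \<subseteq> ker_wt b n m N'" for R M' N'
  proof safe
    fix u assume R: "R \<in> carrier_mat ?d ?d" and d: "hmod_dim M' = ?d" "hmod_dim N' = ?d" and h: "is_hmod G chi M'" "is_hmod G chi N'"
      and e: "\<And>g. g \<in> carrier G \<Longrightarrow> R * hmod_g M' g = hmod_g N' g * R" "R * hmod_x M' = hmod_x N' * R"
      and u: "u \<in> ker_wt b n m M'"
    note c = is_hmodD(1,2)[OF h(1), unfolded d] is_hmodD(1,2)[OF h(2), unfolded d]
    show "matop ?d R u \<in> ker_wt b n m N'"
      by (rule intertwine(1)[OF _ _ _ _ u]) (simp_all add: d opx_def opg_def matop_mult[OF R c(2), symmetric] matop_mult[OF c(4) R, symmetric]
        matop_mult[OF R c(1), symmetric] matop_mult[OF c(3) R, symmetric] e)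
  qed
  have PM: "matop ?d P ` ker_wt b n m M \<subseteq> ker_wt b n m N" using le[OF P _ d M N] g x by simp
  have QN: "matop ?d Q ` ker_wt b n m N \<subseteq> ker_wt b n m M" using le[OF Q d _ N M] Qi[OF cM(1) cN(1) g] Qi[OF cM(2) cN(2) x] by simp
  have QPu: "matop ?d Q (matop ?d P u) = u" if "u \<in> kn ?d" for u using matop_mult[OF Q P, of u] matop_one[OF that] QP by simp
  have PQu: "matop ?d P (matop ?d Q u) = u" if "u \<in> kn ?d" for u using matop_mult[OF P Q, of u] matop_one[OF that] PQ by simp
  have "matop ?d P ` ker_wt b n m M = ker_wt b n m N"
  proof
    show "ker_wt b n m N \<subseteq> matop ?d P ` ker_wt b n m M"
    proof
      fix u assume u: "u \<in> ker_wt b n m N"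
      then have "u = matop ?d P (matop ?d Q u)" using PQu ker_wt_kn[of b n m N] d by auto
      then show "u \<in> matop ?d P ` ker_wt b n m M" using QN u by blast
    qed
  qed (rule PM)
  moreover have "fv.dim (matop ?d P ` ker_wt b n m M) = fv.dim (ker_wt b n m M)"
    by (rule fv.dim_image_eq'[where g = "matop ?d Q", OF _ _ ker_wt_fin]) (use QPu ker_wt_kn[of b n m M] in auto)
  ultimately show ?thesis by simp
qed

text \<open>The two inclusions and the two coordinate projections all intertwine the actions, so the
  kernel of the sum is the direct sum of the kernels.\<close>

lemma dim_ker_wt_dsum:
  assumes M: "is_hmod G chi M" and N: "is_hmod G chi N"
  shows "fv.dim (ker_wt b n m (dsum_hmod G M N)) = fv.dim (ker_wt b n m M) + fv.dim (ker_wt b n m N)"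
proof -
  let ?D = "dsum_hmod G M N" and ?m = "hmod_dim M" and ?n = "hmod_dim N"
  note cM = is_hmodD(1,2)[OF M] and cN = is_hmodD(1,2)[OF N]
  define sh where "sh w i = (if i < ?m then 0 else w (i - ?m))" for w :: "nat \<Rightarrow> 'k" and i
  define p1 where "p1 w i = (if i < ?m then w i else 0)" for w :: "nat \<Rightarrow> 'k" and i
  define p2 where "p2 w i = w (i + ?m)" for w :: "nat \<Rightarrow> 'k" and i
  note app = fscale_apply plus_fun_apply zero_fun_apply minus_apply
  have lin: "fv.linop sh" "fv.linop p1" "fv.linop p2" unfolding fv.linop_def sh_def p1_def p2_def by (auto simp: fun_eq_iff app)
  have op: "matop (?m + ?n) (four_block_mat A (0\<^sub>m ?m ?n) (0\<^sub>m ?n ?m) B) w = (\<lambda>i. if i < ?m then matop ?m A w i else matop ?n B (\<lambda>j. w (j + ?m)) (i - ?m))"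
    if "A \<in> carrier_mat ?m ?m" "B \<in> carrier_mat ?n ?n" for A B :: "'k mat" and w using matop_block_diag[OF that] .
  have z: "matop k A (\<lambda>j. 0) i = (0 :: 'k)" for k A i by (simp add: matop_def)
  have loc: "matop k A w = matop k A w'" if "\<And>j. j < k \<Longrightarrow> w j = w' j" for k A and w w' :: "nat \<Rightarrow> 'k"
    using that by (auto simp: matop_def fun_eq_iff intro!: sum.cong)
  have sh2: "sh w (j + ?m) = w j" for w j by (simp add: sh_def)
  have kn_out: "u i = 0" if "u \<in> kn k" "k \<le> i" for u :: "nat \<Rightarrow> 'k" and k i using that by (simp add: kn_def)
  have i1: "u \<in> ker_wt b n m M \<Longrightarrow> u \<in> ker_wt b n m ?D" for u
  proof (rule intertwine(1)[where F = "\<lambda>u. u"])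
    fix u :: "nat \<Rightarrow> 'k" and g assume u: "u \<in> kn ?m"
    have e: "(\<lambda>j. u (j + ?m)) = (\<lambda>j. 0)" using kn_out[OF u] by simp
    have *: "matop ?m A u = matop (?m + ?n) (four_block_mat A (0\<^sub>m ?m ?n) (0\<^sub>m ?n ?m) B) u"
      if "A \<in> carrier_mat ?m ?m" "B \<in> carrier_mat ?n ?n" for A B :: "'k mat"
      unfolding op[OF that] e z using kn_out[OF matop_kn, of ?m _ A u] by (auto simp: fun_eq_iff)
    show "opx M u = opx ?D u" unfolding opx_def hmod_dim_dsum hmod_x_dsum by (rule *[OF cM(2) cN(2)])
    show "g \<in> carrier G \<Longrightarrow> opg M g u = opg ?D g u" unfolding opg_def hmod_dim_dsum by (simp add: hmod_g_dsum *[OF cM(1) cN(1)])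
    show "u \<in> kn (hmod_dim ?D)" using u by (simp add: kn_def)
  qed (simp_all add: fv.linop_id)
  have i2: "u \<in> ker_wt b n m N \<Longrightarrow> sh u \<in> ker_wt b n m ?D" for u
  proof (rule intertwine(1)[where F = sh])
    fix u :: "nat \<Rightarrow> 'k" and g assume u: "u \<in> kn ?n"
    have *: "sh (matop ?n B u) = matop (?m + ?n) (four_block_mat A (0\<^sub>m ?m ?n) (0\<^sub>m ?n ?m) B) (sh u)"
      if "A \<in> carrier_mat ?m ?m" "B \<in> carrier_mat ?n ?n" for A B :: "'k mat"
    proof -
      have "matop ?m A (sh u) = matop ?m A (\<lambda>j. 0)" by (rule loc) (simp add: sh_def)
      then show ?thesis unfolding op[OF that] sh2 by (simp add: z fun_eq_iff sh_def)
    qed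
    show "sh (opx N u) = opx ?D (sh u)" unfolding opx_def hmod_dim_dsum hmod_x_dsum by (rule *[OF cM(2) cN(2)])
    show "g \<in> carrier G \<Longrightarrow> sh (opg N g u) = opg ?D g (sh u)" unfolding opg_def hmod_dim_dsum by (simp add: hmod_g_dsum *[OF cM(1) cN(1)])
    show "sh u \<in> kn (hmod_dim ?D)" using u by (auto simp: kn_def sh_def)
  qed (simp_all add: lin)
  have j1: "u \<in> ker_wt b n m ?D \<Longrightarrow> p1 u \<in> ker_wt b n m M" for u
  proof (rule intertwine(1)[where F = p1])
    fix u :: "nat \<Rightarrow> 'k" and g
    have *: "p1 (matop (?m + ?n) (four_block_mat A (0\<^sub>m ?m ?n) (0\<^sub>m ?n ?m) B) u) = matop ?m A (p1 u)"
      if "A \<in> carrier_mat ?m ?m" "B \<in> carrier_mat ?n ?n" for A B :: "'k mat"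
    proof -
      have "matop ?m A (p1 u) = matop ?m A u" by (rule loc) (simp add: p1_def)
      then show ?thesis unfolding op[OF that] using kn_out[OF matop_kn, of ?m _ A u] by (auto simp: p1_def fun_eq_iff)
    qed
    show "p1 (opx ?D u) = opx M (p1 u)" unfolding opx_def hmod_dim_dsum hmod_x_dsum by (rule *[OF cM(2) cN(2)])
    show "g \<in> carrier G \<Longrightarrow> p1 (opg ?D g u) = opg M g (p1 u)" unfolding opg_def hmod_dim_dsum by (simp add: hmod_g_dsum *[OF cM(1) cN(1)])
    show "p1 u \<in> kn ?m" by (simp add: kn_def p1_def)
  qed (simp_all add: lin)
  have j2: "u \<in> ker_wt b n m ?D \<Longrightarrow> p2 u \<in> ker_wt b n m N" for u
  proof (rule intertwine(1)[where F = p2])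
    fix u :: "nat \<Rightarrow> 'k" and g
    have *: "p2 (matop (?m + ?n) (four_block_mat A (0\<^sub>m ?m ?n) (0\<^sub>m ?n ?m) B) u) = matop ?n B (p2 u)"
      if "A \<in> carrier_mat ?m ?m" "B \<in> carrier_mat ?n ?n" for A B :: "'k mat"
      unfolding op[OF that] by (simp add: p2_def[abs_def])
    show "p2 (opx ?D u) = opx N (p2 u)" unfolding opx_def hmod_dim_dsum hmod_x_dsum by (rule *[OF cM(2) cN(2)])
    show "g \<in> carrier G \<Longrightarrow> p2 (opg ?D g u) = opg N g (p2 u)" unfolding opg_def hmod_dim_dsum by (simp add: hmod_g_dsum *[OF cM(1) cN(1)])
    show "u \<in> kn (hmod_dim ?D) \<Longrightarrow> p2 u \<in> kn ?n" by (simp add: kn_def p2_def)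
  qed (simp_all add: lin)
  let ?A = "ker_wt b n m M" and ?B = "sh ` ker_wt b n m N"
  have sB: "fv.subspace ?B" using lin by (intro fv.linop_image_subspace) auto
  have fB: "?B \<subseteq> fv.span (ev ` {..<?m + ?n})" using i2 ker_wt_fin[of b n m ?D] by auto
  have fA: "?A \<subseteq> fv.span (ev ` {..<?m + ?n})" using i1 ker_wt_fin[of b n m ?D] by auto
  have AB: "?A \<inter> ?B \<subseteq> {0}"
  proof
    fix u assume u: "u \<in> ?A \<inter> ?B"
    then obtain w where "u = sh w" by auto
    then have "u i = 0" for i using kn_out[of u ?m i] u ker_wt_kn[of b n m M] by (cases "i < ?m") (auto simp: sh_def)
    then show "u \<in> {0}" by (auto simp: fun_eq_iff app)
  qed
  have sp: "fv.span (?A \<union> ?B) = ker_wt b n m ?D"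
  proof
    show "fv.span (?A \<union> ?B) \<subseteq> ker_wt b n m ?D" using i1 i2 by (intro fv.span_minimal) auto
    show "ker_wt b n m ?D \<subseteq> fv.span (?A \<union> ?B)"
    proof
      fix u assume u: "u \<in> ker_wt b n m ?D"
      have "u = p1 u + sh (p2 u)" by (auto simp: fun_eq_iff app p1_def sh_def p2_def)
      moreover have "p1 u \<in> fv.span (?A \<union> ?B)" "sh (p2 u) \<in> fv.span (?A \<union> ?B)" using j1[OF u] j2[OF u] by (auto intro: fv.span_base)
      ultimately show "u \<in> fv.span (?A \<union> ?B)" by (metis fv.span_add)
    qed
  qed
  have dB: "fv.dim ?B = fv.dim (ker_wt b n m N)"
    by (rule fv.dim_image_eq'[where g = p2, OF lin(1,3) ker_wt_fin]) (auto simp: p2_def sh_def)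
  have "fv.dim (fv.span (?A \<union> ?B)) = fv.dim ?A + fv.dim ?B"
    by (rule fv.dim_direct_sum[OF subspace_ker_wt fA sB fB _ AB]) (rule finite_imageI[OF finite_lessThan])
  then show ?thesis unfolding sp dB .
qed

definition int_ext :: "(('g, 'k) hmod \<Rightarrow> int) \<Rightarrow> ('g, 'k) formal \<Rightarrow> int" where
  "int_ext f u = (\<Sum>M\<in>Poly_Mapping.keys u. Poly_Mapping.lookup u M * f M)"

lemma int_ext_add: "int_ext f (u + v) = int_ext f u + int_ext f v"
  unfolding int_ext_def by (rule setsum_keys_plus_distrib) (simp_all add: distrib_right)

text \<open>The growth of the kernel from \<open>T ^ (n - 1)\<close> to \<open>T ^ n\<close> on the
  weight space of \<open>m\<close>, extended additively. It sees only blocks of eigenvalue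
  \<open>b\<close> and length at least \<open>n\<close>, so that at the largest length present it
  isolates leading blocks.\<close>

definition minv :: "'k \<Rightarrow> nat \<Rightarrow> ('g \<Rightarrow> 'k) \<Rightarrow> ('g, 'k) formal \<Rightarrow> int" where
  "minv b n m = int_ext (\<lambda>M. int (fv.dim (ker_wt b n m M)) - int (fv.dim (ker_wt b (n - 1) m M)))"

lemma minv_add: "minv b n m (u + v) = minv b n m u + minv b n m v" by (simp add: minv_def int_ext_add)
lemma minv_0 [simp]: "minv b n m 0 = 0" by (simp add: minv_def int_ext_def)
lemma minv_minus: "minv b n m (- u) = - minv b n m u" using minv_add[of b n m u "- u"] by simp
lemma minv_diff: "minv b n m (u - v) = minv b n m u - minv b n m v" using minv_add[of b n m u "- v"] by (simp add: minv_minus)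
lemma minv_sum: "minv b n m (\<Sum>i\<in>I. f i) = (\<Sum>i\<in>I. minv b n m (f i))"
  by (induction I rule: infinite_finite_induct) (auto simp: minv_add)
lemma minv_cmul: "minv b n m (frag_cmul c u) = c * minv b n m u"
proof -
  have nat: "minv b n m (frag_cmul (int k) u) = int k * minv b n m u" for k
    by (induction k) (simp_all add: frag_cmul_distrib minv_add distrib_right)
  show ?thesis
  proof (cases "c \<ge> 0")
    case True then show ?thesis using nat[of "nat c"] by simp
  next
    case False
    then have e: "frag_cmul c u = - frag_cmul (int (nat (- c))) u" by (intro poly_mapping_eqI) simp
    have "minv b n m (frag_cmul c u) = - minv b n m (frag_cmul (int (nat (- c))) u)" unfolding e by (rule minv_minus)
    then show ?thesis unfolding nat using False by simp
  qed
qed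

lemma minv_cls: "minv b n m (cls M) = int (fv.dim (ker_wt b n m M)) - int (fv.dim (ker_wt b (n - 1) m M))"
  by (simp add: minv_def int_ext_def cls_def)

lemma minv_rel: "u \<in> green_rel G chi \<Longrightarrow> minv b n m u = 0"
proof (induction rule: green_rel.induct)
  case (iso M N)
  then show ?case using dim_ker_wt_iso[OF is_weight_hmodD is_weight_hmodD] by (simp add: minv_diff minv_cls)
next
  case (dsum M N)
  then show ?case using dim_ker_wt_dsum[OF is_weight_hmodD is_weight_hmodD, OF dsum] by (simp add: minv_diff minv_cls)
qed (simp_all add: minv_add minv_minus)

lemma minv_geq: "u \<approx> v \<Longrightarrow> minv b n m u = minv b n m v"
  using minv_rel[of "u - v" b n m] by (simp add: geq_def minv_diff)

lemma kn_V_expand: assumes "u \<in> kn (t * per b)" shows "u = (\<Sum>i<t * per b. fscale (u i) (ux (V t l b) i))"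
  using kn_expand[OF assms] by (simp add: ux_V)

lemma T_pow_x: "(T M b ^^ n) ((opx M ^^ i) u) = (opx M ^^ i) ((T M b ^^ n) u)"
proof (rule funpow_commute)
  show "T M b (opx M v) = opx M (T M b v)" for v
    unfolding T_def by (simp add: fv.linop_diff[OF linop_opx] fv.linop_scale[OF linop_opx] funpow_swap1)
qed

lemma T_V_nilpotent:
  assumes t: "t > 0" "t \<le> n" and u: "u \<in> kn (t * per b)"
  shows "(T (V t l b) b ^^ n) u = 0"
proof -
  let ?M = "V t l b"
  have "(T ?M b ^^ n) (ux ?M i) = 0" for i
  proof -
    have "(T ?M b ^^ n) (ev 0) = (T ?M b ^^ (n - t)) ((T ?M b ^^ t) (ev 0))" unfolding funpow_plus using t by simp
    then have "(T ?M b ^^ n) (ev 0) = 0" unfolding T_V_zero[OF t(1)] fv.linop_0[OF linop_T_pow] .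
    then show ?thesis unfolding ux_def T_pow_x by (simp add: fv.linop_0[OF linop_opx_pow])
  qed
  then show ?thesis
    by (subst kn_V_expand[OF u, of l]) (simp add: fv.linop_comb[OF linop_T_pow])
qed

lemma V_weight_coord:
  assumes l: "l \<in> Ch" and m: "m \<in> Ch" and t: "t > 0" and u: "wvec (V t l b) m u" "u i \<noteq> 0"
  shows "m = cp i \<star> l"
proof -
  let ?M = "V t l b"
  have dM: "diag_hmod ?M" using l by (rule diag_V)
  have "u \<in> kn (t * per b)" using u by (simp add: wvec_def)
  then have i: "i < t * per b" using u by (auto simp: kn_def not_le)
  have "wvec ?M (cp i \<star> l) (ev i)" using wvec_ux[OF l t, of b i] ux_V[OF i] by simp
  then have "proj ?M (cp i \<star> l) (ev i) = ev i" using l by (intro proj_wvec[OF dM]) auto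
  then have "wt ?M i = cp i \<star> l" by (rule proj_coord) (simp add: ev_def)
  moreover have "proj ?M m u = u" using dM u(1) m by (rule proj_wvec)
  then have "wt ?M i = m" using u(2) by (rule proj_coord)
  ultimately show ?thesis by simp
qed

lemma eigen_pow: "fv.linop f \<Longrightarrow> f u = fscale c u \<Longrightarrow> (f ^^ n) u = fscale (c ^ n) u"
  by (induction n) (simp_all add: fv.linop_scale mult.commute)

lemma minv_smaller:
  assumes "0 < t" "t < n"
  shows "minv b n m (cls (V t l b)) = 0"
proof -
  have "t \<le> n" "t \<le> n - 1" using assms by simp_all
  then have "ker_wt b n m (V t l b) = ker_wt b (n - 1) m (V t l b)"
    using T_V_nilpotent[OF assms(1)] by (auto simp: ker_wt_def wvec_def)
  then show ?thesis by (simp add: minv_cls)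
qed

text \<open>A kernel vector of \<open>T b\<close> is an eigenvector of \<open>x ^ per b\<close>. On
  the block of eigenvalue \<open>c\<close> it would then be an eigenvector of the nilpotent operator
  \<open>T c\<close> with nonzero eigenvalue \<open>b - c\<close>. When only \<open>c\<close> is
  zero the periods differ, and the nilpotency of \<open>x\<close> itself is used instead.\<close>

lemma T_V_injective:
  assumes t: "0 < t" and b: "b \<noteq> c" and u: "u \<in> kn (t * per c)" "T (V t l c) b u = 0"
  shows "u = 0"
proof (rule ccontr)
  assume nz: "u \<noteq> 0"
  let ?M = "V t l c"
  have bu: "(opx ?M ^^ per b) u = fscale b u" using u(2) by (simp add: T_def)
  have z: "(T ?M c ^^ t) u = 0" by (rule T_V_nilpotent[OF t order_refl u(1)])
  show False
  proof (cases "b \<noteq> 0 \<and> c = 0")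
    case True
    then have "(opx ?M ^^ t) u = 0" using z by (simp add: T_0)
    then have "((opx ?M ^^ t) ^^ per b) u = 0"
      by (cases "per b") (use per_pos[of b] in \<open>auto simp: funpow_swap1 fv.linop_0[OF fv.linop_funpow[OF linop_opx_pow]]\<close>)
    then have "((opx ?M ^^ per b) ^^ t) u = 0" by (simp add: funpow_mult mult.commute)
    then show False unfolding eigen_pow[OF linop_opx_pow bu] using True nz by simp
  next
    case False
    have "\<exists>d. d \<noteq> 0 \<and> T ?M c u = fscale d u"
    proof (cases "b = 0")
      case True
      then have "opx ?M u = 0" using bu by (simp add: per_def One_nat_def)
      then have "(opx ?M ^^ k) u = 0" if "k > 0" for k
        using that by (cases k) (simp_all add: funpow_swap1 fv.linop_0[OF linop_opx_pow])
      then have "T ?M c u = fscale (- c) u" unfolding T_def using per_pos[of c] by (simp add: fv.scale_minus_left)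
      then show ?thesis using b True by (intro exI[of _ "- c"]) simp
    next
      case b0: False
      then have "per c = per b" using False by (simp add: per_def)
      then have "T ?M c u = fscale (b - c) u" unfolding T_def using bu by (simp add: fv.scale_left_diff_distrib)
      then show ?thesis using b by (intro exI[of _ "b - c"]) simp
    qed
    then obtain d where d: "d \<noteq> 0" "T ?M c u = fscale d u" by blast
    show False using z nz d(1) unfolding eigen_pow[OF linop_T d(2)] by simp
  qed
qed

lemma minv_other_eigenvalue:
  assumes t: "0 < t" and b: "b \<noteq> c"
  shows "minv b n m (cls (V t l c)) = 0"
proof -
  have *: "(T (V t l c) b ^^ k) u = 0 \<Longrightarrow> u \<in> kn (hmod_dim (V t l c)) \<Longrightarrow> u = 0" for u k
  proof (induction k)
    case (Suc k)
    have "(T (V t l c) b ^^ k) u \<in> kn (hmod_dim (V t l c))" using Suc.prems(2) by (rule T_kn)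
    then have "(T (V t l c) b ^^ k) u \<in> kn (t * per c)" by simp
    moreover have "T (V t l c) b ((T (V t l c) b ^^ k) u) = 0" using Suc.prems(1) by simp
    ultimately have "(T (V t l c) b ^^ k) u = 0" by (rule T_V_injective[OF t b])
    then show ?case using Suc.prems(2) by (rule Suc.IH)
  qed simp
  have "ker_wt b k m (V t l c) = {0}" for k
  proof
    show "ker_wt b k m (V t l c) \<subseteq> {0}" using *[of k] unfolding ker_wt_def wvec_def by blast
  qed (simp add: fv.subspace_0)
  then show ?thesis by (simp add: minv_cls)
qed

lemma minv_other_coset:
  assumes t: "0 < t" and l: "l \<in> Ch" and m: "m \<in> Ch" and ne: "\<And>i. m \<noteq> cp i \<star> l"
  shows "minv b n m (cls (V t l b)) = 0"
proof -
  have "u = 0" if "wvec (V t l b) m u" for u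
  proof
    fix i show "u i = 0 i" using V_weight_coord[OF l m t that, of i] ne[of i] by (cases "u i = 0") (simp_all add: zero_fun_apply)
  qed
  then have "ker_wt b k m (V t l b) = {0}" for k
    by (auto simp: ker_wt_def fv.linop_0[OF linop_T_pow])
  then show ?thesis by (simp add: minv_cls)
qed

text \<open>Only the generator survives \<open>x ^ (t - 1)\<close>, and its weight is
  \<open>l\<close>, so at its exact length a nilpotent block is seen in its own weight alone. Blocks
  of nonzero eigenvalue are unchanged by \<open>chi\<close> up to isomorphism, so for them only the
  coset of the weight can be distinguished.\<close>

lemma minv_other_weight:
  assumes t: "0 < t" and l: "l \<in> Ch" and m: "m \<in> Ch" and ne: "m \<noteq> l"
  shows "minv 0 t m (cls (V t l 0)) = 0"
proof -
  let ?M = "V t l 0"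
  have "(T ?M 0 ^^ (t - 1)) u = 0" if u: "wvec ?M m u" for u
  proof -
    have "u 0 = 0" using V_weight_coord[OF l m t u, of 0] ne l by auto
    moreover have "(opx ?M ^^ (t - 1)) (ux ?M i) = 0" if "i > 0" for i
    proof -
      have "(opx ?M ^^ (t - 1)) (ux ?M i) = (opx ?M ^^ (i - 1)) ((opx ?M ^^ t) (ev 0))"
        unfolding ux_def funpow_plus using that t by (simp add: add.commute)
      then show ?thesis using T_V_zero[OF t, of l 0] by (simp add: T_0 fv.linop_0[OF linop_opx_pow])
    qed
    ultimately have "fscale (u i) ((opx ?M ^^ (t - 1)) (ux ?M i)) = 0" for i by (cases "i = 0") simp_all
    moreover have "u \<in> kn (t * per 0)" using u by (simp add: wvec_def)
    ultimately show ?thesis unfolding T_0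
      by (subst kn_V_expand[of u t 0 l]) (simp_all add: fv.linop_comb[OF linop_opx_pow] del: fv.scale_eq_0_iff)
  qed
  moreover have "(T ?M 0 ^^ t) u = 0" if "wvec ?M m u" for u
    using that by (intro T_V_nilpotent[OF t order_refl]) (simp add: wvec_def)
  ultimately have "ker_wt 0 t m ?M = ker_wt 0 (t - 1) m ?M" by (auto simp: ker_wt_def)
  then show ?thesis by (simp add: minv_cls)
qed

text \<open>The basis vectors of weight \<open>l\<close> are the \<open>x ^ i m_0\<close> with
  \<open>sb dvd i\<close>, and \<open>x ^ per b\<close> acts on \<open>w = T ^ (t - 1) m_0\<close>
  by \<open>b\<close>. So \<open>T ^ (t - 1)\<close> maps this weight space onto the line of
  \<open>w\<close>, and its kernel there has codimension one.\<close>

lemma minv_self: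
  assumes t: "0 < t" and l: "l \<in> Ch"
  shows "minv b t l (cls (V t l b)) = 1"
proof -
  let ?M = "V t l b"
  define w where "w = (T ?M b ^^ (t - 1)) (ev 0)"
  have Tw: "T ?M b w = 0"
  proof -
    have "T ?M b w = (T ?M b ^^ t) (ev 0)" unfolding w_def using t by (cases t) (simp_all add: One_nat_def)
    then show ?thesis unfolding T_V_zero[OF t] .
  qed
  have pw: "(opx ?M ^^ per b) w = fscale b w" using Tw by (simp add: T_def)
  have w0: "w \<noteq> 0"
  proof
    assume w: "w = 0"
    \<comment> \<open>At this basis vector the binomial expansion of \<open>w\<close> has its top
      coefficient, which is 1.\<close>
    let ?k = "(t - 1) * per b"
    have lt: "j * per b < t * per b" if "j \<le> t - 1" for j using that t per_pos[of b] by simp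
    have "w = (\<Sum>j\<le>t - 1. fscale (of_nat (t - 1 choose j) * (- b) ^ (t - 1 - j)) (ev (j * per b)))"
      unfolding w_def T_pow_expand using ux_V[OF lt] by (intro sum.cong) (simp_all add: ux_def)
    then have "w ?k = (\<Sum>j\<le>t - 1. fscale (of_nat (t - 1 choose j) * (- b) ^ (t - 1 - j)) (ev (j * per b)) ?k)"
      by (simp only: fsum_apply)
    also have "\<dots> = (\<Sum>j\<le>t - 1. if j = t - 1 then 1 else 0)"
      using per_pos[of b] by (intro sum.cong) (auto simp: fscale_apply ev_def)
    finally show False unfolding w zero_fun_apply by (simp add: sum.delta)
  qed
  let ?K = "ker_wt b t l ?M" and ?K' = "ker_wt b (t - 1) l ?M"
  have img: "(T ?M b ^^ (t - 1)) u \<in> fv.span {w}" if u: "u \<in> ?K" for u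
  proof -
    have uw: "wvec ?M l u" and k: "u \<in> kn (t * per b)" using u by (auto simp: ker_wt_def wvec_def)
    have "fscale (u i) ((T ?M b ^^ (t - 1)) (ux ?M i)) \<in> fv.span {w}" for i
    proof (cases "u i = 0")
      case False
      then have "l = cp i \<star> l" using V_weight_coord[OF l l t uw] by simp
      then have "l \<star> cp i = l \<star> e1" using l by (simp add: cm_comm)
      then have "cp i = e1" using cm_cancel[of "cp i" e1 l] l by simp
      then have "sb dvd i" by (simp add: cp_order)
      then have "per b dvd i" by (auto simp: per_def)
      then obtain j where "i = per b * j" by (rule dvdE)
      then have i: "i = j * per b" by (simp add: mult.commute)
      have "(T ?M b ^^ (t - 1)) (ux ?M i) = ((opx ?M ^^ per b) ^^ j) w"
        unfolding ux_def T_pow_x w_def i by (simp add: funpow_mult mult.commute)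
      also have "\<dots> = fscale (b ^ j) w" by (rule eigen_pow[OF linop_opx_pow pw])
      finally show ?thesis by (auto intro!: fv.span_scale intro: fv.span_base)
    qed (simp add: fv.span_zero)
    then have "(\<Sum>i<t * per b. fscale (u i) ((T ?M b ^^ (t - 1)) (ux ?M i))) \<in> fv.span {w}" by (intro fv.span_sum)
    then show ?thesis unfolding fv.linop_comb[OF linop_T_pow, symmetric] kn_V_expand[OF k, of l, symmetric] .
  qed
  have v: "ev 0 \<in> ?K" using wvec_V[OF l t] T_V_zero[OF t] by (simp add: ker_wt_def)
  have v': "ev 0 \<notin> ?K'" using w0 by (simp add: ker_wt_def w_def)
  have sub: "?K' \<subseteq> ?K"
    using T_V_nilpotent[OF t order_refl] by (auto simp: ker_wt_def wvec_def)
  have sp: "fv.span (insert (ev 0) ?K') = ?K"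
  proof
    show "fv.span (insert (ev 0) ?K') \<subseteq> ?K" using sub v by (intro fv.span_minimal) auto
    show "?K \<subseteq> fv.span (insert (ev 0) ?K')"
    proof
      fix u assume u: "u \<in> ?K"
      obtain c where c: "(T ?M b ^^ (t - 1)) u = fscale c w" using img[OF u] by (auto simp: fv.span_singleton)
      have "(T ?M b ^^ (t - 1)) (u - fscale c (ev 0)) = 0"
        using c by (simp add: fv.linop_diff[OF linop_T_pow] fv.linop_scale[OF linop_T_pow] w_def)
      moreover have "wvec ?M l (u - fscale c (ev 0))" using u v by (auto simp: ker_wt_def intro!: wvec_diff wvec_scale)
      ultimately have "u - fscale c (ev 0) \<in> ?K'" by (simp add: ker_wt_def)
      then have "u - fscale c (ev 0) \<in> fv.span ?K'" by (rule fv.span_base)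
      then show "u \<in> fv.span (insert (ev 0) ?K')" unfolding fv.span_breakdown_eq by (rule exI)
    qed
  qed
  have "fv.dim (fv.span (insert (ev 0) ?K')) = Suc (fv.dim ?K')"
    by (rule fv.dim_insert_notin[OF subspace_ker_wt ker_wt_fin _ v']) (rule finite_imageI[OF finite_lessThan])
  then show ?thesis unfolding minv_cls sp by simp
qed

end

section \<open>The skew group ring\<close>

abbreviation "pm_single \<equiv> Poly_Mapping.single"
abbreviation "pm_lookup \<equiv> Poly_Mapping.lookup"
abbreviation "pm_keys \<equiv> Poly_Mapping.keys"

lemma single_sum: "pm_single k (\<Sum>i\<in>I. f i) = (\<Sum>i\<in>I. pm_single k (f i :: 'b::comm_monoid_add))"
  by (induction I rule: infinite_finite_induct) (simp_all add: single_add)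

lemma pm_sum_singles: "(\<Sum>k\<in>pm_keys p. pm_single k (pm_lookup p k)) = p"
proof (rule poly_mapping_eqI)
  fix k
  have "pm_lookup (\<Sum>j\<in>pm_keys p. pm_single j (pm_lookup p j)) k = (\<Sum>j\<in>pm_keys p. if j = k then pm_lookup p j else 0)"
    unfolding lookup_sum by (intro sum.cong) (simp_all add: lookup_single when_def)
  then show "pm_lookup (\<Sum>j\<in>pm_keys p. pm_single j (pm_lookup p j)) k = pm_lookup p k"
    by (simp add: sum.delta in_keys_iff)
qed

lemma of_int_single: "(of_int c :: ('b::comm_monoid_add \<Rightarrow>\<^sub>0 int)) = pm_single 0 c"
proof (induction c rule: int_induct[where k = 0, case_names base step1 step2])
  case base then show ?case by simp
next
  case (step1 i) then show ?case by (simp add: single_add)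
next
  case (step2 i) then show ?case by (simp add: single_diff)
qed

text \<open>Monomials are represented by lists because a product in the Green ring is evaluated one
  factor at a time and therefore needs an order of the factors.\<close>

definition vars :: "'v list \<Rightarrow> 'v \<Rightarrow>\<^sub>0 nat" where "vars xs = (\<Sum>v\<leftarrow>xs. pm_single v 1)"

lemma vars_simps [simp]: "vars [] = 0" "vars (v # xs) = pm_single v 1 + vars xs" "vars (xs @ ys) = vars xs + vars ys"
  by (simp_all add: vars_def)

lemma lookup_vars: "pm_lookup (vars xs) v = count (mset xs) v"
  by (induction xs) (auto simp: lookup_add lookup_single when_def)

lemma vars_replicate: "vars (replicate n v) = pm_single v n"
proof (induction n)
  case (Suc n)
  have "vars (replicate (Suc n) v) = pm_single v (1 + n)" unfolding replicate_Suc vars_simps Suc by (rule single_add[symmetric])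
  then show ?case by (simp only: plus_1_eq_Suc)
qed simp

lemma vars_exists: "\<exists>xs. vars xs = m"
proof -
  obtain ks where ks: "set ks = pm_keys m" "distinct ks" using finite_distinct_list[of "pm_keys m"] finite_keys[of m] by metis
  have gen: "vars (concat (map (\<lambda>v. replicate (pm_lookup m v) v) zs)) = (\<Sum>v\<leftarrow>zs. pm_single v (pm_lookup m v))" for zs
    by (induction zs) (simp_all add: vars_replicate)
  have "(\<Sum>v\<leftarrow>ks. pm_single v (pm_lookup m v)) = (\<Sum>v\<in>set ks. pm_single v (pm_lookup m v))"
    by (rule sum_list_distinct_conv_sum_set[OF ks(2)])
  also have "\<dots> = m" unfolding ks(1) by (rule pm_sum_singles)
  finally show ?thesis using gen[of ks] by (intro exI) (rule trans)
qed

text \<open>An arbitrary order of the factors; \<open>mon_perm\<close> shows that the choice is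
  immaterial.\<close>

definition lst :: "('v \<Rightarrow>\<^sub>0 nat) \<Rightarrow> 'v list" where "lst m = (SOME xs. vars xs = m)"

lemma vars_lst [simp]: "vars (lst m) = m" unfolding lst_def by (rule someI_ex[OF vars_exists])

lemma vars_mset: "vars xs = vars ys \<Longrightarrow> mset xs = mset ys"
  by (rule multiset_eqI) (simp add: lookup_vars[symmetric])

lemma keys_vars: "pm_keys (vars xs) = set xs"
  by (auto simp: in_keys_iff lookup_vars)

context hopf_ctx
begin

abbreviation "SC \<equiv> skew_carrier G xi"
abbreviation "AV \<equiv> allowed_vars xi"
abbreviation sm (infixl "\<odot>" 70) where "u \<odot> v \<equiv> skew_mult G a s u v"
abbreviation E :: "('g \<Rightarrow> 'k) \<Rightarrow> ('k var \<Rightarrow>\<^sub>0 nat) \<Rightarrow> int \<Rightarrow> ('g, 'k) skew" where "E l m c \<equiv> skel l (pm_single m c)"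

text \<open>The action of a character on monomials, of which \<open>zact\<close> is the additive
  extension.\<close>

definition ren :: "('g \<Rightarrow> 'k) \<Rightarrow> ('k var \<Rightarrow>\<^sub>0 nat) \<Rightarrow> ('k var \<Rightarrow>\<^sub>0 nat)" where
  "ren l m = (\<Sum>v\<in>pm_keys m. pm_single (ren_var a s l v) (pm_lookup m v))"

lemma ren_0 [simp]: "ren l 0 = 0" by (simp add: ren_def)
lemma ren_add: "ren l (m + m') = ren l m + ren l m'"
  unfolding ren_def by (rule setsum_keys_plus_distrib) (simp_all add: single_add)
lemma ren_single: "ren l (pm_single v n) = pm_single (ren_var a s l v) n"
  by (cases "n = 0") (simp_all add: ren_def)
lemma ren_vars: "ren l (vars xs) = vars (map (ren_var a s l) xs)"
  by (induction xs) (simp_all add: ren_add ren_single)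

lemma ren_var_e1: "ren_var a s e1 v = v"
  using aG by (cases v) (simp_all add: ren_var_def e1_apply)
lemma ren_var_cm: "l \<in> Ch \<Longrightarrow> m \<in> Ch \<Longrightarrow> ren_var a s m (ren_var a s l v) = ren_var a s (l \<star> m) v"
  using aG by (cases v) (auto simp: ren_var_def cm_apply image_image power_mult_distrib mult_ac)
lemma ren_e1 [simp]: "ren e1 m = m"
proof -
  have "ren_var a s e1 = id" by (rule HOL.ext) (simp add: ren_var_e1)
  then have "ren e1 (vars (lst m)) = vars (lst m)" unfolding ren_vars by simp
  then show ?thesis by simp
qed
lemma ren_cm: assumes "l \<in> Ch" "l' \<in> Ch" shows "ren l' (ren l m) = ren (l \<star> l') m"
proof -
  have "ren l' (ren l (vars (lst m))) = ren (l \<star> l') (vars (lst m))" unfolding ren_vars by (simp add: ren_var_cm[OF assms] o_def)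
  then show ?thesis by simp
qed

lemma ren_var_coset: "l \<in> Ch \<Longrightarrow> ren_var a s l (VX (coset xi al)) = VX (coset xi (l a ^ s * al))"
  unfolding ren_var_def coset_def var.case var.inject by (simp add: full_SetCompr_eq image_image mult.assoc)

lemma ren_var_AV: assumes "l \<in> Ch" "v \<in> AV" shows "ren_var a s l v \<in> AV"
proof (cases v)
  case (VX S)
  then obtain al where "S = coset xi al" "al \<noteq> 0" using assms(2) by (auto simp: allowed_vars_def)
  then show ?thesis using VX ren_var_coset[OF assms(1), of al] Ch_nz[OF assms(1) aG] by (auto simp: allowed_vars_def)
qed (simp_all add: ren_var_def allowed_vars_def)

lemma ren_AV: assumes "l \<in> Ch" "pm_keys m \<subseteq> AV" shows "pm_keys (ren l m) \<subseteq> AV"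
proof -
  have "pm_keys (ren l (vars (lst m))) \<subseteq> AV"
    unfolding ren_vars keys_vars using ren_var_AV[OF assms(1)] assms(2) keys_vars[of "lst m"] by auto
  then show ?thesis by simp
qed

lemma zact_0 [simp]: "zact a s l 0 = 0" by (simp add: zact_def)
lemma zact_add: "zact a s l (p + q) = zact a s l p + zact a s l q"
  unfolding zact_def ren_def[symmetric] by (rule setsum_keys_plus_distrib) (simp_all add: single_add)
lemma zact_single: "zact a s l (pm_single m c) = pm_single (ren l m) c"
  by (cases "c = 0") (simp_all add: zact_def ren_def)

lemma skel_0 [simp]: "skel l 0 = 0" by (simp add: skel_def)
lemma skel_diff: "skel l (p - q) = skel l p - skel l q" by (simp add: skel_def single_diff)
lemma skel_sum: "skel l (\<Sum>i\<in>I. p i) = (\<Sum>i\<in>I. skel l (p i))" by (simp add: skel_def single_sum)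

lemma sm_0 [simp]: "0 \<odot> v = 0" "u \<odot> 0 = 0" by (simp_all add: skew_mult_def)

lemma sm_add1: "(u + u') \<odot> v = u \<odot> v + u' \<odot> v"
  unfolding skew_mult_def
  by (rule setsum_keys_plus_distrib[where f = "\<lambda>l p. \<Sum>sg\<in>pm_keys v. pm_single (l \<star> sg) (zact a s sg p * pm_lookup v sg)"])
    (simp_all add: zact_add distrib_right single_add sum.distrib)

lemma sm_add2: "u \<odot> (v + v') = u \<odot> v + u \<odot> v'"
  unfolding skew_mult_def sum.swap[of _ _ "pm_keys u"]
  by (rule setsum_keys_plus_distrib[where f = "\<lambda>sg q. \<Sum>l\<in>pm_keys u. pm_single (l \<star> sg) (zact a s sg (pm_lookup u l) * q)"])
    (simp_all add: distrib_left single_add sum.distrib)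

lemma sm_neg1: "(- u) \<odot> v = - (u \<odot> v)" using sm_add1[of u "- u" v] by (simp add: eq_neg_iff_add_eq_0 add.commute)
lemma sm_neg2: "u \<odot> (- v) = - (u \<odot> v)" using sm_add2[of u v "- v"] by (simp add: eq_neg_iff_add_eq_0 add.commute)
lemma sm_diff1: "(u - u') \<odot> v = u \<odot> v - u' \<odot> v" using sm_add1[of u "- u'" v] by (simp add: sm_neg1)
lemma sm_diff2: "u \<odot> (v - v') = u \<odot> v - u \<odot> v'" using sm_add2[of u v "- v'"] by (simp add: sm_neg2)
lemma sm_sum1: "(\<Sum>i\<in>I. f i) \<odot> v = (\<Sum>i\<in>I. f i \<odot> v)"
  by (induction I rule: infinite_finite_induct) (simp_all add: sm_add1)
lemma sm_sum2: "v \<odot> (\<Sum>i\<in>I. f i) = (\<Sum>i\<in>I. v \<odot> f i)"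
  by (induction I rule: infinite_finite_induct) (simp_all add: sm_add2)

lemma sm_skel: "skel l p \<odot> skel l' q = skel (l \<star> l') (zact a s l' p * q)"
  by (cases "p = 0"; cases "q = 0") (simp_all add: skew_mult_def skel_def)

lemma sm_E: "E l m c \<odot> E l' m' c' = E (l \<star> l') (ren l' m + m') (c * c')"
  by (simp add: sm_skel zact_single mult_single)

lemma SC_0 [simp]: "0 \<in> SC" by (simp add: skew_carrier_def zpoly_in_def)
lemma SC_add [simp]: "u \<in> SC \<Longrightarrow> v \<in> SC \<Longrightarrow> u + v \<in> SC"
proof -
  assume u: "u \<in> SC" and v: "v \<in> SC"
  have "pm_keys (u + v) \<subseteq> Ch" using u v Poly_Mapping.keys_add[of u v] unfolding skew_carrier_def by blast
  moreover have "zpoly_in xi (pm_lookup (u + v) l)" for l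
    using u v Poly_Mapping.keys_add[of "pm_lookup u l" "pm_lookup v l"] unfolding skew_carrier_def zpoly_in_def lookup_add by blast
  ultimately show ?thesis by (simp add: skew_carrier_def)
qed
lemma SC_neg [simp]: "u \<in> SC \<Longrightarrow> - u \<in> SC" by (simp add: skew_carrier_def zpoly_in_def)
lemma SC_diff [simp]: "u \<in> SC \<Longrightarrow> v \<in> SC \<Longrightarrow> u - v \<in> SC" using SC_add[of u "- v"] by simp
lemma SC_sum [simp]: "(\<And>i. i \<in> I \<Longrightarrow> f i \<in> SC) \<Longrightarrow> (\<Sum>i\<in>I. f i) \<in> SC"
  by (induction I rule: infinite_finite_induct) simp_all
lemma SC_E [simp]: "l \<in> Ch \<Longrightarrow> pm_keys m \<subseteq> AV \<Longrightarrow> E l m c \<in> SC"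
  by (auto simp: skew_carrier_def zpoly_in_def skel_def lookup_single when_def split: if_splits)

lemma skew_expand: "u = (\<Sum>l\<in>pm_keys u. \<Sum>m\<in>pm_keys (pm_lookup u l). E l m (pm_lookup (pm_lookup u l) m))"
proof -
  have "u = (\<Sum>l\<in>pm_keys u. skel l (pm_lookup u l))" by (simp add: skel_def pm_sum_singles)
  also have "\<dots> = (\<Sum>l\<in>pm_keys u. \<Sum>m\<in>pm_keys (pm_lookup u l). E l m (pm_lookup (pm_lookup u l) m))"
    by (intro sum.cong refl) (simp add: skel_sum[symmetric] pm_sum_singles)
  finally show ?thesis .
qed

lemma SC_induct [consumes 1, case_names zero E add]:
  assumes u: "u \<in> SC" and 0: "P 0" and E: "\<And>l m c. l \<in> Ch \<Longrightarrow> pm_keys m \<subseteq> AV \<Longrightarrow> P (E l m c)"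
    and add: "\<And>u v. u \<in> SC \<Longrightarrow> v \<in> SC \<Longrightarrow> P u \<Longrightarrow> P v \<Longrightarrow> P (u + v)"
  shows "P u"
proof -
  have S: "(\<Sum>i\<in>I. f i) \<in> SC \<and> P (\<Sum>i\<in>I. f i)" if "\<And>i. i \<in> I \<Longrightarrow> f i \<in> SC \<and> P (f i)" for f :: "'i \<Rightarrow> ('g, 'k) skew" and I
    using that by (induction I rule: infinite_finite_induct) (auto simp: 0 add)
  have "P (\<Sum>l\<in>pm_keys u. \<Sum>m\<in>pm_keys (pm_lookup u l). E l m (pm_lookup (pm_lookup u l) m))"
  proof (rule conjunct2[OF S], rule S, rule conjI)
    fix l m assume "l \<in> pm_keys u" "m \<in> pm_keys (pm_lookup u l)"
    then have lm: "l \<in> Ch" "pm_keys m \<subseteq> AV" using u by (auto simp: skew_carrier_def zpoly_in_def)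
    show "E l m (pm_lookup (pm_lookup u l) m) \<in> SC" using lm by (rule SC_E)
    show "P (E l m (pm_lookup (pm_lookup u l) m))" using lm by (rule E)
  qed
  then show ?thesis unfolding skew_expand[symmetric] .
qed

lemma keys_add_AV: "pm_keys m \<subseteq> AV \<Longrightarrow> pm_keys m' \<subseteq> AV \<Longrightarrow> pm_keys (m + m' :: 'k var \<Rightarrow>\<^sub>0 nat) \<subseteq> AV"
  using Poly_Mapping.keys_add[of m m'] by blast

lemma SC_mult [simp]: assumes u: "u \<in> SC" and v: "v \<in> SC" shows "u \<odot> v \<in> SC"
  using u
proof (induction rule: SC_induct)
  case (E l m c)
  then show ?case using v
  proof (induction rule: SC_induct[OF v, case_names zero E add])
    case (E l' m' c')
    then show ?case unfolding sm_E by (intro SC_E keys_add_AV ren_AV) simp_all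
  qed (simp_all add: sm_add2)
qed (simp_all add: sm_add1)

lemma sm_assoc: assumes u: "u \<in> SC" and v: "v \<in> SC" and w: "w \<in> SC" shows "(u \<odot> v) \<odot> w = u \<odot> (v \<odot> w)"
  using u
proof (induction rule: SC_induct)
  case (E l m c)
  note u = E
  show ?case using v
  proof (induction rule: SC_induct)
    case (E l' m' c')
    note v = E
    show ?case using w
    proof (induction rule: SC_induct)
      case (E l'' m'' c'')
      then show ?case unfolding sm_E using u v by (simp add: cm_assoc ren_add ren_cm add.assoc mult.assoc)
    qed (simp_all add: sm_add2)
  qed (simp_all add: sm_add1 sm_add2)
qed (simp_all add: sm_add1)

abbreviation "uE \<equiv> E e1 0 1"

lemma uE_SC [simp]: "uE \<in> SC" by (rule SC_E) simp_all
lemma sm_one1: "u \<in> SC \<Longrightarrow> uE \<odot> u = u"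
  by (induction rule: SC_induct) (simp_all add: sm_E sm_add2 del: single_one)
lemma sm_one2: "u \<in> SC \<Longrightarrow> u \<odot> uE = u"
  by (induction rule: SC_induct) (simp_all add: sm_E sm_add1 del: single_one)

abbreviation J where "J \<equiv> skew_ideal G a s xi"

context
  fixes gens assumes gens: "gens \<subseteq> SC"
begin

lemma J_SC: "u \<in> J gens \<Longrightarrow> u \<in> SC"
proof (induction rule: skew_ideal.induct)
  case (gen g u v) then show ?case using gens by (intro SC_mult) auto
qed simp_all

text \<open>The ideal is closed under sums by definition; a sign can be moved into the left
  multiplier of a generator.\<close>

lemma J_neg: "u \<in> J gens \<Longrightarrow> - u \<in> J gens"
proof (induction rule: skew_ideal.induct)
  case (gen g u v)
  have "- (u \<odot> g \<odot> v) = (- u) \<odot> g \<odot> v" by (simp add: sm_neg1)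
  then show ?case using skew_ideal.gen[OF gen(1) SC_neg[OF gen(2)] gen(3)] by simp
next
  case (add u v) show ?case unfolding minus_add_distrib by (rule skew_ideal.add[OF add.IH])
qed (simp add: skew_ideal.zero)

lemma J_diff: assumes "u \<in> J gens" "v \<in> J gens" shows "u - v \<in> J gens"
  using skew_ideal.add[OF assms(1) J_neg[OF assms(2)]] by simp

lemma J_sum: "(\<And>i. i \<in> I \<Longrightarrow> f i \<in> J gens) \<Longrightarrow> (\<Sum>i\<in>I. f i) \<in> J gens"
  by (induction I rule: infinite_finite_induct) (auto intro: skew_ideal.zero skew_ideal.add)

lemma J_right: "u \<in> J gens \<Longrightarrow> w \<in> SC \<Longrightarrow> u \<odot> w \<in> J gens"
proof (induction rule: skew_ideal.induct)
  case (gen g u v)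
  have g: "g \<in> SC" using gens gen(1) by blast
  show ?case unfolding sm_assoc[OF SC_mult[OF gen(2) g] gen(3,4)]
    by (rule skew_ideal.gen[OF gen(1,2) SC_mult[OF gen(3,4)]])
qed (simp_all add: skew_ideal.zero skew_ideal.add sm_add1)

lemma J_left: "u \<in> J gens \<Longrightarrow> w \<in> SC \<Longrightarrow> w \<odot> u \<in> J gens"
proof (induction rule: skew_ideal.induct)
  case (gen g u v)
  have g: "g \<in> SC" using gens gen(1) by blast
  show ?case unfolding sm_assoc[OF gen(4) SC_mult[OF gen(2) g] gen(3), symmetric] sm_assoc[OF gen(4,2) g, symmetric]
    by (rule skew_ideal.gen[OF gen(1) SC_mult[OF gen(4,2)] gen(3)])
qed (simp_all add: skew_ideal.zero skew_ideal.add sm_add2)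

lemma J_gen: assumes "g \<in> gens" shows "g \<in> J gens"
proof -
  have g: "g \<in> SC" using gens assms by blast
  have "uE \<odot> g \<odot> uE \<in> J gens" by (rule skew_ideal.gen[OF assms uE_SC uE_SC])
  then show ?thesis unfolding sm_one1[OF g] sm_one2[OF g] .
qed

end

subsection \<open>Normal forms modulo the ideal\<close>

abbreviation "Js \<equiv> J_gens G chi s sp sb xi"
abbreviation JJ where "JJ \<equiv> J Js"
abbreviation y1 :: "'k var \<Rightarrow>\<^sub>0 nat" where "y1 \<equiv> pm_single VY 1"
abbreviation x1 :: "'k \<Rightarrow> 'k var \<Rightarrow>\<^sub>0 nat" where "x1 al \<equiv> pm_single (VX (coset xi al)) 1"
abbreviation yn :: "nat \<Rightarrow> 'k var \<Rightarrow>\<^sub>0 nat" where "yn n \<equiv> pm_single VY n"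
abbreviation zn :: "nat \<Rightarrow> 'k var \<Rightarrow>\<^sub>0 nat" where "zn n \<equiv> pm_single VZ n"

lemma zvar_power: "zvar v ^ n = pm_single (pm_single v n) (1 :: int)"
proof (induction n)
  case (Suc n)
  have "pm_single v (1 :: nat) + pm_single v n = pm_single v (Suc n)" unfolding single_add[symmetric] by (simp only: plus_1_eq_Suc)
  then show ?case unfolding power_Suc Suc unfolding zvar_def mult_single by simp
qed simp

lemma cy_E: "skel l (of_int c * zvar VY ^ n) = E l (yn n) c"
  by (simp add: of_int_single zvar_power mult_single)

lemma x_E: "skel l (zvar (VX (coset xi al))) = E l (x1 al) 1" by (simp add: zvar_def)

lemma yx_E: "skel l (zvar VY * zvar (VX (coset xi al)) - 2 * zvar (VX (coset xi al))) = E l (y1 + x1 al) 1 - E l (x1 al) 2"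
proof -
  have "(2 :: 'k zpoly) = pm_single 0 2" by (rule single_numeral[symmetric])
  then have "2 * zvar (VX (coset xi al)) = pm_single (x1 al) 2" unfolding zvar_def by (simp only: mult_single) simp
  then show ?thesis by (simp add: skel_diff zvar_def mult_single)
qed

lemma nx_E: "of_nat n * zvar (VX (coset xi al)) = pm_single (x1 al) (int n)"
proof -
  have "(of_nat n :: 'k zpoly) = pm_single 0 (int n)" using of_int_single[of "int n"] by simp
  then show ?thesis unfolding zvar_def by (simp only: mult_single) simp
qed

lemma xx_E: "skel l (zvar (VX (coset xi al)) * zvar (VX (coset xi be)) - (\<Sum>i\<in>I. of_nat s * zvar (VX (coset xi (f i)))))
    = E l (x1 al + x1 be) 1 - (\<Sum>i\<in>I. E l (x1 (f i)) (int s))"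
  unfolding nx_E skel_diff skel_sum by (simp add: zvar_def mult_single)

text \<open>The image in the Green ring is \<open>[V_s(e1)] + [V_s(chi)]\<close>: both halves are
  Chebyshev polynomials of the second kind in \<open>y\<close>, twisted by powers of
  \<open>chi\<close>.\<close>

definition gyA :: "('g, 'k) skew" where
  "gyA = (\<Sum>i\<in>{0..(s - 1) div 2}. E (cp i) (yn (s - 1 - 2 * i)) ((-1) ^ i * int ((s - 1 - i) choose i))
                                  + E (cp (i + 1)) (yn (s - 1 - 2 * i)) ((-1) ^ i * int ((s - 1 - i) choose i)))"

text \<open>The image is \<open>y\<close> times the shorter modules \<open>V (s - 2 * i)\<close>,
  \<open>i > 0\<close>, in the expansion of \<open>y ^ (s - 1)\<close>, with their
  multiplicities.\<close>

definition gyB :: "('g, 'k) skew" where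
  "gyB = (\<Sum>i\<in>{1..(s - 1) div 2}. \<Sum>j\<in>{0..(s - 2 * i - 1) div 2}.
           E (cp (i + j)) (yn (s - 2 * i - 2 * j)) ((-1) ^ j * ((int (s - 2 * i) * int ((s - 1) choose i)) div int (s - i))
                   * int ((s - 2 * i - 1 - j) choose j)))"

text \<open>The image is the sum of the classes of \<open>V_s(chi ^ i)\<close> over one period of
  \<open>chi\<close>, the contribution of a vanishing factor in a product of two \<open>x\<close>
  variables.\<close>

definition gx :: "('g, 'k) skew" where
  "gx = (\<Sum>i<sb. \<Sum>j\<in>{0..(s - 1) div 2}. E (cp i) (yn (s - 1 - 2 * j)) ((-1) ^ j * int ((s - 1 - j) choose j)))"

lemma Js_eq: "Js = {E e1 (yn s) 1 - gyA - gyB}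
    \<union> {E chi (x1 al) 1 - E e1 (x1 al) 1 | al. al \<noteq> 0}
    \<union> {E e1 (y1 + x1 al) 1 - E e1 (x1 al) 2 | al. al \<noteq> 0}
    \<union> {E e1 (x1 al + x1 be) 1 - (\<Sum>i<sp. E e1 (x1 (al + be * xi ^ i)) (int s)) | al be.
          al \<noteq> 0 \<and> be \<noteq> 0 \<and> coset xi be \<noteq> coset xi (- al)}
    \<union> {E e1 (x1 al + x1 (- al)) 1 - (\<Sum>i\<in>{1..<sp}. E e1 (x1 ((1 - xi ^ i) * al)) (int s)) - gx | al. al \<noteq> 0}"
  unfolding J_gens_def Let_def gyA_def gyB_def gx_def unfolding cy_E x_E yx_E xx_E unfolding zvar_power ..

lemma VY_AV [simp]: "VY \<in> AV" and VZ_AV [simp]: "VZ \<in> AV" and VX_AV [simp]: "al \<noteq> 0 \<Longrightarrow> VX (coset xi al) \<in> AV"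
  by (auto simp: allowed_vars_def)

lemma keys_single_AV: "v \<in> AV \<Longrightarrow> pm_keys (pm_single v (n :: nat)) \<subseteq> AV" by auto

lemmas AVs = keys_single_AV keys_add_AV VY_AV VZ_AV VX_AV

lemma gyA_SC: "gyA \<in> SC" unfolding gyA_def by (intro SC_add SC_sum SC_E AVs) simp_all
lemma gyB_SC: "gyB \<in> SC" unfolding gyB_def by (intro SC_add SC_sum SC_E AVs) simp_all
lemma gx_SC: "gx \<in> SC" unfolding gx_def by (intro SC_add SC_sum SC_E AVs) simp_all

text \<open>Only nonnegative powers occur in \<open>coset\<close>. As \<open>xi\<close> has finite
  order they already form a group, the inverse of \<open>xi\<close> being
  \<open>xi ^ (sp - 1)\<close>.\<close>

lemma xi_coset: "coset xi (al * xi ^ i) = coset xi al"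
proof -
  have sub: "coset xi (b * xi ^ j) \<subseteq> coset xi b" for b j
    by (auto simp: coset_def mult.assoc power_add[symmetric])
  have "al * xi ^ i * xi ^ (i * (sp - 1)) = al * (xi ^ sp) ^ i"
  proof -
    have "i + i * (sp - 1) = sp * i" using sp_pos by (cases sp) simp_all
    then show ?thesis by (simp add: mult.assoc power_add[symmetric] power_mult[symmetric])
  qed
  also have "\<dots> = al" using xi_pow[of sp] by simp
  finally have "coset xi al \<subseteq> coset xi (al * xi ^ i)" using sub[of "al * xi ^ i" "i * (sp - 1)"] by (simp only:)
  then show ?thesis using sub by blast
qed

lemma coset_self: "al \<in> coset xi al" by (auto simp: coset_def intro: exI[of _ 0])

lemma one_minus_xi: assumes "0 < i" "i < sp" shows "1 - xi ^ i \<noteq> 0"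
proof
  assume "1 - xi ^ i = 0"
  then have "sp dvd i" using xi_pow[of i] by simp
  then show False using assms by (auto dest: dvd_imp_le)
qed

lemma sum_nonzero: assumes "coset xi be \<noteq> coset xi (- al)" shows "al + be * xi ^ i \<noteq> 0"
proof
  assume "al + be * xi ^ i = 0"
  then have "be * xi ^ i = - al" by (simp add: eq_neg_iff_add_eq_0 add.commute)
  then show False using xi_coset[of be i] assms by simp
qed

lemma Js_SC: "Js \<subseteq> SC"
proof -
  have "E e1 (yn s) 1 - gyA - gyB \<in> SC" by (intro SC_diff gyA_SC gyB_SC SC_E AVs) simp
  moreover have "E chi (x1 al) 1 - E e1 (x1 al) 1 \<in> SC" "E e1 (y1 + x1 al) 1 - E e1 (x1 al) 2 \<in> SC" if "al \<noteq> 0" for al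
    using that by (intro SC_diff SC_E AVs; simp add: chi_char)+
  moreover have "E e1 (x1 al + x1 be) 1 - (\<Sum>i<sp. E e1 (x1 (al + be * xi ^ i)) (int s)) \<in> SC"
    if "al \<noteq> 0" "be \<noteq> 0" "coset xi be \<noteq> coset xi (- al)" for al be
    using that sum_nonzero[OF that(3)] by (intro SC_diff SC_sum SC_E AVs) simp_all
  moreover have "E e1 (x1 al + x1 (- al)) 1 - (\<Sum>i\<in>{1..<sp}. E e1 (x1 ((1 - xi ^ i) * al)) (int s)) - gx \<in> SC" if "al \<noteq> 0" for al
    using that one_minus_xi by (intro SC_diff SC_sum gx_SC SC_E AVs) auto
  ultimately show ?thesis unfolding Js_eq by blast
qed

lemmas JJ_right = J_right[OF Js_SC] and JJ_left = J_left[OF Js_SC] and JJ_gen = J_gen[OF Js_SC]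
  and JJ_neg = J_neg[OF Js_SC] and JJ_diff = J_diff[OF Js_SC] and JJ_sum = J_sum[OF Js_SC] and JJ_SC = J_SC[OF Js_SC]

lemma rel_y: "E e1 (yn s) 1 - gyA - gyB \<in> JJ" by (rule JJ_gen) (simp add: Js_eq)
lemma rel_chi: "al \<noteq> 0 \<Longrightarrow> E chi (x1 al) 1 - E e1 (x1 al) 1 \<in> JJ" by (rule JJ_gen) (auto simp: Js_eq)
lemma rel_yx: "al \<noteq> 0 \<Longrightarrow> E e1 (y1 + x1 al) 1 - E e1 (x1 al) 2 \<in> JJ" by (rule JJ_gen) (auto simp: Js_eq)
lemma rel_xx: "al \<noteq> 0 \<Longrightarrow> be \<noteq> 0 \<Longrightarrow> coset xi be \<noteq> coset xi (- al) \<Longrightarrow>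
    E e1 (x1 al + x1 be) 1 - (\<Sum>i<sp. E e1 (x1 (al + be * xi ^ i)) (int s)) \<in> JJ"
  by (rule JJ_gen) (unfold Js_eq, blast)
lemma rel_xx': "al \<noteq> 0 \<Longrightarrow> E e1 (x1 al + x1 (- al)) 1 - (\<Sum>i\<in>{1..<sp}. E e1 (x1 ((1 - xi ^ i) * al)) (int s)) - gx \<in> JJ"
  by (rule JJ_gen) (unfold Js_eq, blast)

text \<open>The element is chosen from the coset as a set, so that it depends on the coset of
  \<open>l\<close> modulo the powers of \<open>chi\<close> and on nothing else.\<close>

definition rep :: "('g \<Rightarrow> 'k) \<Rightarrow> 'g \<Rightarrow> 'k" where "rep l = (SOME l'. l' \<in> {cp k \<star> l | k. True})"

lemma rep: assumes l: "l \<in> Ch" shows "\<exists>k. rep l = cp k \<star> l" "rep l \<in> Ch" "\<exists>k. l = cp k \<star> rep l"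
proof -
  have "l \<in> {cp k \<star> l | k. True}" using l by (auto intro: exI[of _ 0])
  then have "rep l \<in> {cp k \<star> l | k. True}" unfolding rep_def by (rule someI[of "\<lambda>l'. l' \<in> {cp k \<star> l | k. True}"])
  then show 1: "\<exists>k. rep l = cp k \<star> l" by blast
  then obtain k where k: "rep l = cp k \<star> l" by blast
  then show "rep l \<in> Ch" using l by simp
  have "k + (sb - 1) * k = k * sb" using sb_pos by (cases sb) (simp_all add: mult.commute)
  then have "cp ((sb - 1) * k + k) = e1" by (simp add: cp_order add.commute)
  then have "cp ((sb - 1) * k) \<star> rep l = l" unfolding k using l by (simp add: cm_assoc[symmetric] cp_add)
  then show "\<exists>k. l = cp k \<star> rep l" by metis
qed

lemma rep_cong: assumes l: "l \<in> Ch" and e: "l = cp k \<star> l'" and l': "l' \<in> Ch" shows "rep l = rep l'"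
proof -
  have "{cp i \<star> l | i. True} = {cp i \<star> l' | i. True}"
  proof (intro equalityI subsetI)
    fix m assume "m \<in> {cp i \<star> l | i. True}"
    then obtain i where m: "m = cp i \<star> (cp k \<star> l')" unfolding e by blast
    have "m = cp (i + k) \<star> l'" unfolding m cp_add[symmetric] using l' by (simp add: cm_assoc)
    then show "m \<in> {cp i \<star> l' | i. True}" by blast
  next
    fix m assume "m \<in> {cp i \<star> l' | i. True}"
    then obtain i where m: "m = cp i \<star> l'" by blast
    have "k + (sb - 1) * k = k * sb" using sb_pos by (cases sb) (simp_all add: mult.commute)
    then have "cp ((sb - 1) * k + k) = e1" by (simp add: cp_order add.commute)
    then have "cp ((sb - 1) * k) \<star> cp k = e1" by (simp add: cp_add)
    then have "cp i \<star> cp ((sb - 1) * k) \<star> l = m" unfolding e m using l' by (simp add: cm_assoc) (simp add: cm_assoc[symmetric])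
    then have "cp (i + (sb - 1) * k) \<star> l = m" by (simp add: cp_add)
    then show "m \<in> {cp i \<star> l | i. True}" by blast
  qed
  then show ?thesis by (simp add: rep_def)
qed

lemma rep_rep: assumes "l \<in> Ch" shows "rep (rep l) = rep l"
proof -
  obtain k where "rep l = cp k \<star> l" using rep(1)[OF assms] by blast
  then show ?thesis by (intro rep_cong[OF rep(2)[OF assms] _ assms])
qed

text \<open>The relation of degree \<open>s\<close> bounds the exponent of \<open>y\<close>. Next to
  some \<open>x_al\<close> all factors \<open>y\<close> become integers and all powers of
  \<open>chi\<close> disappear, and a product of two \<open>x\<close> variables is rewritten by
  terms with at most one.\<close>

definition NI :: "(('g \<Rightarrow> 'k) \<times> ('k var \<Rightarrow>\<^sub>0 nat)) set" where
  "NI = {(l, yn i + zn j) | l i j. l \<in> Ch \<and> i < s} \<union> {(l, zn j + x1 al) | l j al. l \<in> Ch \<and> rep l = l \<and> al \<noteq> 0}"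

definition nrm :: "('g, 'k) skew \<Rightarrow> bool" where
  "nrm w \<longleftrightarrow> w \<in> SC \<and> (\<forall>l m. pm_lookup (pm_lookup w l) m \<noteq> 0 \<longrightarrow> (l, m) \<in> NI)"

definition nf :: "('g, 'k) skew \<Rightarrow> bool" where "nf u \<longleftrightarrow> (\<exists>w. nrm w \<and> u - w \<in> JJ)"

lemma NI_SC: "(l, m) \<in> NI \<Longrightarrow> l \<in> Ch \<and> pm_keys m \<subseteq> AV"
proof -
  assume "(l, m) \<in> NI"
  then consider i j where "l \<in> Ch" "m = yn i + zn j" | j al where "l \<in> Ch" "al \<noteq> 0" "m = zn j + x1 al" unfolding NI_def by blast
  then show ?thesis
  proof cases
    case 1 then show ?thesis unfolding 1(2) by (intro conjI AVs) simp_all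
  next
    case 2 then show ?thesis unfolding 2(3) by (intro conjI AVs) simp_all
  qed
qed

lemma nrm_add: "nrm u \<Longrightarrow> nrm v \<Longrightarrow> nrm (u + v)"
  by (auto simp: nrm_def lookup_add) (metis add_0)
lemma nrm_0: "nrm 0" by (simp add: nrm_def)
lemma nrm_E: "(l, m) \<in> NI \<Longrightarrow> nrm (E l m c)"
  using NI_SC[of l m] SC_E[of l m c] unfolding nrm_def by (auto simp: skel_def lookup_single when_def split: if_splits)

lemma nf_add: assumes "nf u" "nf v" shows "nf (u + v)"
proof -
  obtain w z where w: "nrm w" "u - w \<in> JJ" and z: "nrm z" "v - z \<in> JJ" using assms unfolding nf_def by blast
  have "(u - w) + (v - z) \<in> JJ" using w(2) z(2) by (rule skew_ideal.add)
  then have "(u + v) - (w + z) \<in> JJ" by (simp add: algebra_simps)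
  then show ?thesis unfolding nf_def using nrm_add[OF w(1) z(1)] by blast
qed
lemma nf_J: "u \<in> JJ \<Longrightarrow> nf u" unfolding nf_def using nrm_0 by (intro exI[of _ 0]) simp
lemma nf_cong: "u - v \<in> JJ \<Longrightarrow> nf v \<Longrightarrow> nf u" using nf_add[OF nf_J, of "u - v" v] by simp
lemma nf_sum: "(\<And>i. i \<in> I \<Longrightarrow> nf (f i)) \<Longrightarrow> nf (\<Sum>i\<in>I. f i)"
  by (induction I rule: infinite_finite_induct) (auto intro: nf_add nf_J skew_ideal.zero)
lemma nf_NI: "(l, m) \<in> NI \<Longrightarrow> nf (E l m c)"
  unfolding nf_def using nrm_E by (intro exI[of _ "E l m c"]) (simp add: skew_ideal.zero)

text \<open>Because \<open>JJ\<close> is an ideal, closure of the reducible elements under a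
  multiplication only has to be checked on normal monomials. No termination argument for a rewriting
  system is required.\<close>

lemma nf_mult:
  assumes u: "nf u" and v: "v \<in> SC" and t: "\<And>l m c. (l, m) \<in> NI \<Longrightarrow> nf (E l m c \<odot> v)"
  shows "nf (u \<odot> v)"
proof -
  obtain w where w: "nrm w" "u - w \<in> JJ" using u unfolding nf_def by blast
  have "nf (\<Sum>l\<in>pm_keys w. \<Sum>m\<in>pm_keys (pm_lookup w l). E l m (pm_lookup (pm_lookup w l) m) \<odot> v)"
    using w(1) by (intro nf_sum t) (simp add: nrm_def in_keys_iff)
  then have "nf (w \<odot> v)" unfolding sm_sum1[symmetric] skew_expand[symmetric] .
  moreover have "u \<odot> v - w \<odot> v \<in> JJ" unfolding sm_diff1[symmetric] using w(2) v by (rule JJ_right)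
  ultimately show ?thesis by (rule nf_cong[rotated])
qed

lemma nf_mult_left:
  assumes u: "nf u" and v: "v \<in> SC" and t: "\<And>l m c. (l, m) \<in> NI \<Longrightarrow> nf (v \<odot> E l m c)"
  shows "nf (v \<odot> u)"
proof -
  obtain w where w: "nrm w" "u - w \<in> JJ" using u unfolding nf_def by blast
  have "nf (\<Sum>l\<in>pm_keys w. \<Sum>m\<in>pm_keys (pm_lookup w l). v \<odot> E l m (pm_lookup (pm_lookup w l) m))"
    using w(1) by (intro nf_sum t) (simp add: nrm_def in_keys_iff)
  then have "nf (v \<odot> w)" unfolding sm_sum2[symmetric] skew_expand[symmetric] .
  moreover have "v \<odot> u - v \<odot> w \<in> JJ" unfolding sm_diff2[symmetric] using w(2) v by (rule JJ_left)
  ultimately show ?thesis by (rule nf_cong[rotated])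
qed

lemma ren_yz [simp]: "ren l (yn i) = yn i" "ren l (zn i) = zn i" by (simp_all add: ren_single ren_var_def)

lemma E_right: "l \<in> Ch \<Longrightarrow> E l m c \<odot> E e1 m' d = E l (m + m') (c * d)" by (simp add: sm_E)
lemma E_left: "l' \<in> Ch \<Longrightarrow> E l 0 c \<odot> E l' m d = E (l \<star> l') m (c * d)" by (simp add: sm_E)

lemma chi_x: assumes l: "l \<in> Ch" and al: "al \<noteq> 0" shows "E (cp k \<star> l) (zn j + x1 al) c - E l (zn j + x1 al) c \<in> JJ"
proof (induction k)
  case 0 show ?case using l by (simp add: skew_ideal.zero)
next
  case (Suc k)
  let ?l = "cp k \<star> l"
  have "E ?l 0 c \<odot> (E chi (x1 al) 1 - E e1 (x1 al) 1) \<odot> E e1 (zn j) 1 \<in> JJ"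
    using l by (intro JJ_right JJ_left rel_chi al SC_E AVs) simp_all
  moreover have "E ?l 0 c \<odot> (E chi (x1 al) 1 - E e1 (x1 al) 1) \<odot> E e1 (zn j) 1 = E (?l \<star> chi) (zn j + x1 al) c - E ?l (zn j + x1 al) c"
    using l by (simp add: sm_diff1 sm_diff2 E_left E_right chi_char add.commute del: single_one)
  moreover have "?l \<star> chi = cp (Suc k) \<star> l"
  proof -
    have "?l \<star> chi = chi \<star> ?l" using l by (intro cm_comm) (simp_all add: chi_char)
    also have "\<dots> = chi \<star> cp k \<star> l" using l by (intro cm_assoc[symmetric]) (simp_all add: chi_char)
    finally show ?thesis unfolding cp_Suc .
  qed
  ultimately have "E (cp (Suc k) \<star> l) (zn j + x1 al) c - E ?l (zn j + x1 al) c \<in> JJ" by simp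
  from skew_ideal.add[OF this Suc] show ?case by simp
qed

lemma nf_x: assumes l: "l \<in> Ch" and al: "al \<noteq> 0" shows "nf (E l (zn j + x1 al) c)"
proof -
  obtain k where k: "l = cp k \<star> rep l" using rep(3)[OF l] by blast
  have "E l (zn j + x1 al) c - E (rep l) (zn j + x1 al) c \<in> JJ" using chi_x[OF rep(2)[OF l] al, of k j c] k by simp
  moreover have "nf (E (rep l) (zn j + x1 al) c)" using rep(2)[OF l] rep_rep[OF l] al by (intro nf_NI) (auto simp: NI_def)
  ultimately show ?thesis by (rule nf_cong)
qed

lemma nf_yz: "l \<in> Ch \<Longrightarrow> i < s \<Longrightarrow> nf (E l (yn i + zn j) c)" by (intro nf_NI) (auto simp: NI_def)

lemma NI_cases:
  assumes "(l, m) \<in> NI"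
  obtains i j where "l \<in> Ch" "i < s" "m = yn i + zn j" | j al where "l \<in> Ch" "al \<noteq> 0" "m = zn j + x1 al"
  using assms unfolding NI_def by blast

lemma nf_zmul: assumes "nf u" shows "nf (u \<odot> E e1 (zn n) 1)"
proof (rule nf_mult[OF assms])
  fix l m c assume "(l, m) \<in> NI"
  then show "nf (E l m c \<odot> E e1 (zn n) 1)"
  proof (cases rule: NI_cases)
    case (1 i j)
    then have "E l m c \<odot> E e1 (zn n) 1 = E l (yn i + zn (j + n)) c" by (simp add: E_right single_add add.assoc)
    then show ?thesis using nf_yz[OF 1(1,2)] by simp
  next
    case (2 j al)
    then have "E l m c \<odot> E e1 (zn n) 1 = E l (zn (j + n) + x1 al) c" by (simp add: E_right single_add add_ac)
    then show ?thesis using nf_x[OF 2(1,2)] by simp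
  qed
qed (intro SC_E AVs; simp)

lemma nf_lmul: assumes "nf u" "l' \<in> Ch" shows "nf (E l' 0 d \<odot> u)"
proof (rule nf_mult_left[OF assms(1)])
  fix l m c assume "(l, m) \<in> NI"
  then show "nf (E l' 0 d \<odot> E l m c)"
    by (cases rule: NI_cases) (use assms(2) in \<open>simp_all add: E_left nf_yz nf_x del: single_one\<close>)
qed (use assms(2) in \<open>simp del: single_one\<close>)

lemma nf_yn: assumes "l \<in> Ch" "n < s" shows "nf (E l (yn n) c)" using nf_yz[OF assms, of 0 c] by simp
lemma nf_x0: assumes "l \<in> Ch" "al \<noteq> 0" shows "nf (E l (x1 al) c)" using nf_x[OF assms, of 0 c] by simp

text \<open>All exponents of \<open>y\<close> in \<open>gyA\<close> and \<open>gyB\<close> are below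
  \<open>s\<close>.\<close>

lemma nf_ys: "nf (E e1 (yn s) 1)"
proof (rule nf_cong)
  show "E e1 (yn s) 1 - (gyA + gyB) \<in> JJ" using rel_y by (simp only: diff_diff_add)
  show "nf (gyA + gyB)" unfolding gyA_def gyB_def using s_pos by (intro nf_add nf_sum nf_yn) auto
qed

lemma nf_gx: "nf gx" unfolding gx_def using s_pos by (intro nf_add nf_sum nf_yn) auto

lemma nf_xx: assumes al: "al \<noteq> 0" and be: "be \<noteq> 0" shows "nf (E e1 (x1 al + x1 be) 1)"
proof (cases "coset xi be = coset xi (- al)")
  case False
  show ?thesis by (rule nf_cong[OF rel_xx[OF al be False]]) (intro nf_sum nf_x0 sum_nonzero[OF False] e1_Ch)
next
  case True
  have "E e1 (x1 al + x1 be) 1 - ((\<Sum>i\<in>{1..<sp}. E e1 (x1 ((1 - xi ^ i) * al)) (int s)) + gx) \<in> JJ"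
    using rel_xx'[OF al] unfolding True diff_diff_add .
  moreover have "nf ((\<Sum>i\<in>{1..<sp}. E e1 (x1 ((1 - xi ^ i) * al)) (int s)) + gx)"
    using al one_minus_xi by (intro nf_add nf_sum nf_gx nf_x0) auto
  ultimately show ?thesis by (rule nf_cong)
qed

lemma nf_y: assumes l: "l \<in> Ch" and i: "i \<le> s" shows "nf (E l (yn i + zn j) c)"
proof (cases "i < s")
  case True then show ?thesis using l nf_yz by simp
next
  case False
  have "nf (E l 0 c \<odot> (E e1 (yn s) 1 \<odot> E e1 (zn j) 1))" by (intro nf_lmul nf_zmul nf_ys l)
  then show ?thesis using False i l by (simp add: E_left E_right del: single_one)
qed

lemma nf_yx: assumes l: "l \<in> Ch" and al: "al \<noteq> 0" shows "nf (E l (zn j + x1 al + y1) c)"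
proof (rule nf_cong[OF _ nf_x[OF l al]])
  have "E l 0 c \<odot> (E e1 (y1 + x1 al) 1 - E e1 (x1 al) 2) \<odot> E e1 (zn j) 1 \<in> JJ"
    using l by (intro JJ_right JJ_left rel_yx al SC_E AVs) simp_all
  then show "E l (zn j + x1 al + y1) c - E l (zn j + x1 al) (c * 2) \<in> JJ"
    using l by (simp add: sm_diff1 sm_diff2 E_left E_right add_ac del: single_one)
qed

lemma nf_ymul: assumes "nf u" shows "nf (u \<odot> E e1 y1 1)"
proof (rule nf_mult[OF assms])
  fix l m c assume "(l, m) \<in> NI"
  then show "nf (E l m c \<odot> E e1 y1 1)"
  proof (cases rule: NI_cases)
    case (1 i j)
    then have "E l m c \<odot> E e1 y1 1 = E l (yn (i + 1) + zn j) c" by (simp add: E_right single_add add_ac)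
    then show ?thesis using nf_y[OF 1(1), of "i + 1"] 1(2) by simp
  next
    case (2 j al)
    then have "E l m c \<odot> E e1 y1 1 = E l (zn j + x1 al + y1) c" by (simp add: E_right)
    then show ?thesis using nf_yx[OF 2(1,2)] by simp
  qed
qed (intro SC_E AVs; simp)

lemma nf_yix: assumes l: "l \<in> Ch" and al: "al \<noteq> 0" shows "nf (E l (yn i + zn j + x1 al) c)"
proof (induction i)
  case 0 show ?case using nf_x[OF l al] by simp
next
  case (Suc i)
  have "E l (yn i + zn j + x1 al) c \<odot> E e1 y1 1 = E l (yn (i + 1) + zn j + x1 al) c" using l by (simp add: E_right single_add add_ac)
  then show ?case using nf_ymul[OF Suc] unfolding plus_1_eq_Suc add.commute[of i 1] by simp
qed

lemma nf_xmul: assumes "nf u" and be: "be \<noteq> 0" shows "nf (u \<odot> E e1 (x1 be) 1)"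
proof (rule nf_mult[OF assms(1)])
  fix l m c assume "(l, m) \<in> NI"
  then show "nf (E l m c \<odot> E e1 (x1 be) 1)"
  proof (cases rule: NI_cases)
    case (1 i j)
    then have "E l m c \<odot> E e1 (x1 be) 1 = E l (yn i + zn j + x1 be) c" by (simp add: E_right)
    then show ?thesis using nf_yix[OF 1(1) be] by simp
  next
    case (2 j al)
    have "nf (E l 0 c \<odot> (E e1 (x1 al + x1 be) 1 \<odot> E e1 (zn j) 1))" by (intro nf_lmul nf_zmul nf_xx 2 be)
    then show ?thesis using 2 by (simp add: E_left E_right add_ac del: single_one)
  qed
qed (intro SC_E AVs; simp add: be)

text \<open>Monomials are built by right multiplication with one variable at a time, and each kind
  of variable preserves reducibility.\<close>

lemma nf_vars: "l \<in> Ch \<Longrightarrow> set xs \<subseteq> AV \<Longrightarrow> nf (E l (vars xs) c)"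
proof (induction xs rule: rev_induct)
  case Nil then show ?case using nf_yn[of l 0 c] s_pos by (simp del: single_one)
next
  case (snoc v xs)
  have IH: "nf (E l (vars xs) c)" using snoc by simp
  have v: "v \<in> AV" using snoc.prems by simp
  have e: "E l (vars (xs @ [v])) c = E l (vars xs) c \<odot> E e1 (pm_single v 1) 1" using snoc.prems by (simp add: E_right)
  show ?case
  proof (cases v)
    case VY then show ?thesis unfolding e using nf_ymul[OF IH] by simp
  next
    case VZ then show ?thesis unfolding e using nf_zmul[OF IH] by simp
  next
    case (VX S)
    then obtain al where "S = coset xi al" "al \<noteq> 0" using v by (auto simp: allowed_vars_def)
    then show ?thesis unfolding e using nf_xmul[OF IH] VX by simp
  qed
qed

theorem normal_form: "u \<in> SC \<Longrightarrow> nf u"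
proof (induction rule: SC_induct)
  case (E l m c)
  then show ?case using nf_vars[of l "lst m" c] keys_vars[of "lst m"] by simp
qed (simp_all add: nf_J skew_ideal.zero nf_add)

section \<open>The homomorphism to the Green ring\<close>

abbreviation lc :: "('g \<Rightarrow> 'k) \<Rightarrow> ('g, 'k) formal" where "lc l \<equiv> cls (V 1 l 0)"

text \<open>The module of a variable. The choice of an element of the coset is harmless because all
  its elements have the same \<open>sp\<close>-th power.\<close>

definition vm :: "'k var \<Rightarrow> ('g, 'k) hmod" where
  "vm v = (case v of VY \<Rightarrow> V 2 e1 0 | VZ \<Rightarrow> V (s + 1) e1 0 | VX S \<Rightarrow> V 1 e1 ((SOME b. b \<in> S) ^ sp))"

lemma vm_y: "vm VY = V 2 e1 0" and vm_z: "vm VZ = V (s + 1) e1 0" by (simp_all add: vm_def)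

lemma coset_pow: assumes "b \<in> coset xi al" shows "b ^ sp = al ^ sp"
proof -
  obtain i where b: "b = al * xi ^ i" using assms by (auto simp: coset_def)
  have "(xi ^ i) ^ sp = (xi ^ sp) ^ i" by (simp add: power_mult[symmetric] mult.commute)
  then show ?thesis using xi_pow[of sp] by (simp add: b power_mult_distrib)
qed

lemma vm_x: "vm (VX (coset xi al)) = V 1 e1 (al ^ sp)"
proof -
  have "(SOME b. b \<in> coset xi al) \<in> coset xi al" by (rule someI[of "\<lambda>b. b \<in> coset xi al", OF coset_self])
  then show ?thesis unfolding vm_def var.case by (simp add: coset_pow)
qed

lemma vm_weight [simp]: "is_weight_hmod G chi (vm v)" by (cases v) (simp_all add: vm_def)

lemma AV_cases:
  assumes "v \<in> AV"
  obtains "v = VY" | "v = VZ" | al where "al \<noteq> 0" "v = VX (coset xi al)"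
  using assms unfolding allowed_vars_def by blast

lemma lc_V: "l \<in> Ch \<Longrightarrow> m \<in> Ch \<Longrightarrow> t > 0 \<Longrightarrow> fm (lc l) (cls (V t m b)) \<approx> cls (V t (l \<star> m) b)"
  unfolding fm_cls by (rule V1_tensor)

lemma V_lc: "l \<in> Ch \<Longrightarrow> m \<in> Ch \<Longrightarrow> t > 0 \<Longrightarrow> b = 0 \<or> t = 1 \<Longrightarrow> fm (cls (V t l b)) (lc m) \<approx> cls (V t (l \<star> m) (b * m a ^ sb))"
  unfolding fm_cls by (rule tensor_V1)

lemma vm_form:
  assumes "v \<in> AV"
  obtains t b where "vm v = V t e1 b" "t > 0" "b = 0 \<or> t = 1"
  using assms
proof (cases rule: AV_cases)
  case 1 show ?thesis by (rule that[of 2 0]) (simp_all add: 1 vm_y)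
next
  case 2 show ?thesis by (rule that[of "s + 1" 0]) (simp_all add: 2 vm_z)
next
  case (3 al) show ?thesis by (rule that[of 1 "al ^ sp"]) (simp_all add: 3 vm_x)
qed

primrec mon :: "'k var list \<Rightarrow> ('g, 'k) formal" where
  "mon [] = lc e1"
| "mon (v # xs) = fm (cls (vm v)) (mon xs)"

lemma mon_fW [simp]: "mon xs \<in> fW" by (induction xs) simp_all

lemma lc_e1_vm: assumes "v \<in> AV" shows "fm (lc e1) (cls (vm v)) \<approx> cls (vm v)"
  using assms
proof (cases rule: vm_form)
  case (1 t b)
  then show ?thesis using lc_V[OF e1_Ch e1_Ch 1(2), of b] by simp
qed

lemma lc_e1_mon: assumes "set xs \<subseteq> AV" shows "fm (lc e1) (mon xs) \<approx> mon xs"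
proof (cases xs)
  case Nil then show ?thesis using lc_V[OF e1_Ch e1_Ch zl1, of 0] by simp
next
  case (Cons v ys)
  have "fm (lc e1) (fm (cls (vm v)) (mon ys)) \<approx> fm (fm (lc e1) (cls (vm v))) (mon ys)"
    by (rule geq_sym[OF fm_assoc]) simp_all
  also have "\<dots> \<approx> fm (cls (vm v)) (mon ys)" by (rule fm_cong1[OF lc_e1_vm]) (use assms Cons in simp_all)
  finally show ?thesis using Cons by simp
qed

lemma mon_append: "set xs \<subseteq> AV \<Longrightarrow> set ys \<subseteq> AV \<Longrightarrow> mon (xs @ ys) \<approx> fm (mon xs) (mon ys)"
proof (induction xs)
  case Nil then show ?case using geq_sym[OF lc_e1_mon[OF Nil(2)]] by simp
next
  case (Cons v xs)
  have "mon ((v # xs) @ ys) \<approx> fm (cls (vm v)) (fm (mon xs) (mon ys))"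
    unfolding append_Cons mon.simps by (rule fm_cong2) (use Cons in simp_all)
  also have "\<dots> \<approx> fm (mon (v # xs)) (mon ys)" unfolding mon.simps by (rule geq_sym[OF fm_assoc]) simp_all
  finally show ?case .
qed

text \<open>Moving \<open>l\<close> to the left turns the eigenvalue \<open>al ^ sp\<close> into
  \<open>al ^ sp * l a ^ sb\<close>, the \<open>sp\<close>-th power of \<open>l a ^ s * al\<close>.
  This explains the exponent \<open>s\<close> in the action on the variables.\<close>

lemma vm_move:
  assumes v: "v \<in> AV" and l: "l \<in> Ch"
  shows "fm (cls (vm v)) (lc l) \<approx> fm (lc l) (cls (vm (ren_var a s l v)))"
proof -
  have "\<exists>t b. vm v = V t e1 b \<and> t > 0 \<and> (b = 0 \<or> t = 1) \<and> vm (ren_var a s l v) = V t e1 (b * l a ^ sb)"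
    using v
  proof (cases rule: AV_cases)
    case 1 then show ?thesis by (intro exI[of _ 2] exI[of _ 0]) (simp add: vm_y ren_var_def)
  next
    case 2 then show ?thesis by (intro exI[of _ "s + 1"] exI[of _ 0]) (simp add: vm_z ren_var_def)
  next
    case (3 al)
    have "(l a ^ s * al) ^ sp = al ^ sp * l a ^ (s * sp)" by (simp add: power_mult_distrib power_mult mult.commute)
    also have "s * sp = sb" by (rule sb_eq[symmetric])
    finally show ?thesis unfolding 3(2) ren_var_coset[OF l] vm_x by (intro exI[of _ 1] exI[of _ "al ^ sp"]) simp
  qed
  then obtain t b where c: "vm v = V t e1 b \<and> t > 0 \<and> (b = 0 \<or> t = 1) \<and> vm (ren_var a s l v) = V t e1 (b * l a ^ sb)" by (elim exE)
  note tb = c[THEN conjunct1] c[THEN conjunct2, THEN conjunct1] c[THEN conjunct2, THEN conjunct2, THEN conjunct1] c[THEN conjunct2, THEN conjunct2, THEN conjunct2]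
  have "fm (cls (V t e1 b)) (lc l) \<approx> cls (V t (e1 \<star> l) (b * l a ^ sb))" by (rule V_lc[OF e1_Ch l tb(2,3)])
  also have "cls (V t (e1 \<star> l) (b * l a ^ sb)) = cls (V t (l \<star> e1) (b * l a ^ sb))" using l by simp
  also have "\<dots> \<approx> fm (lc l) (cls (V t e1 (b * l a ^ sb)))" by (rule geq_sym[OF lc_V[OF l e1_Ch tb(2)]])
  finally show ?thesis unfolding tb(1,4) .
qed

lemma mon_move: "set xs \<subseteq> AV \<Longrightarrow> l \<in> Ch \<Longrightarrow> fm (mon xs) (lc l) \<approx> fm (lc l) (mon (map (ren_var a s l) xs))"
proof (induction xs)
  case Nil
  have "fm (lc e1) (lc l) \<approx> lc (e1 \<star> l)" by (rule lc_V[OF e1_Ch Nil(2) zl1])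
  also have "lc (e1 \<star> l) = lc (l \<star> e1)" using Nil by simp
  also have "\<dots> \<approx> fm (lc l) (lc e1)" by (rule geq_sym[OF lc_V[OF Nil(2) e1_Ch zl1]])
  finally show ?case by simp
next
  case (Cons v xs)
  let ?v = "cls (vm v)" and ?v' = "cls (vm (ren_var a s l v))" and ?m' = "mon (map (ren_var a s l) xs)"
  have fl: "lc l \<in> fW" using Cons by simp
  have "fm (fm ?v (mon xs)) (lc l) \<approx> fm ?v (fm (mon xs) (lc l))" by (rule fm_assoc) (use fl in simp_all)
  also have "\<dots> \<approx> fm ?v (fm (lc l) ?m')" by (rule fm_cong2) (use Cons in simp_all)
  also have "\<dots> \<approx> fm (fm ?v (lc l)) ?m'" by (rule geq_sym[OF fm_assoc]) (use fl in simp_all)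
  also have "\<dots> \<approx> fm (fm (lc l) ?v') ?m'" by (rule fm_cong1[OF vm_move]) (use Cons in simp_all)
  also have "\<dots> \<approx> fm (lc l) (fm ?v' ?m')" by (rule fm_assoc) (use fl in simp_all)
  finally show ?case by simp
qed

lemma frag_two: "frag_cmul 2 u = u + u" by (rule poly_mapping_eqI) (simp add: lookup_add)

lemma yx_two: assumes b: "b \<noteq> 0" shows "cls (V 2 e1 0 \<boxtimes> V 1 e1 b) \<approx> frag_cmul 2 (cls (V 1 e1 b))"
proof -
  have "cls (V 2 e1 0 \<boxtimes> V 1 e1 b) \<approx> cls (V 1 e1 b) + cls (V 1 (chi \<star> e1) b)" by (rule V2_tensor(2)[OF e1_Ch zl1 b])
  also have "\<dots> \<approx> cls (V 1 e1 b) + cls (V 1 e1 b)" by (rule geq_add[OF geq_refl geq_sym[OF V_shift[OF e1_Ch zl1 b]]])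
  finally show ?thesis unfolding frag_two .
qed

lemma xy_two: assumes b: "b \<noteq> 0" shows "cls (V 1 e1 b \<boxtimes> V 2 e1 0) \<approx> frag_cmul 2 (cls (V 1 e1 b))"
proof -
  have "cls (V 1 e1 b \<boxtimes> V 2 e1 0) \<approx> cls (V 1 e1 b) + cls (V 1 chi b)" by (rule tensor_V2(2)[OF zl1 b])
  also have "cls (V 1 e1 b) + cls (V 1 chi b) = cls (V 1 e1 b) + cls (V 1 (chi \<star> e1) b)" by simp
  also have "\<dots> \<approx> cls (V 1 e1 b) + cls (V 1 e1 b)" by (rule geq_add[OF geq_refl geq_sym[OF V_shift[OF e1_Ch zl1 b]]])
  finally show ?thesis unfolding frag_two .
qed

lemma yz_comm: "cls (V 2 e1 0 \<boxtimes> V (s + 1) e1 0) \<approx> cls (V (s + 1) e1 0 \<boxtimes> V 2 e1 0)"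
proof -
  have nd: "\<not> s dvd s + 1" using s_ge2 by (simp add: dvd_add_right_iff)
  have "cls (V 2 e1 0 \<boxtimes> V (s + 1) e1 0) \<approx> cls (V (s + 1 + 1) e1 0) + cls (V (s + 1 - 1) (chi \<star> e1) 0)"
    using V2_tensor(1)[OF e1_Ch Suc_s_pos] unfolding if_not_P[OF nd] .
  moreover have "cls (V (s + 1) e1 0 \<boxtimes> V 2 e1 0) \<approx> cls (V (s + 1 + 1) e1 0) + cls (V (s + 1 - 1) chi 0)"
    using tensor_V2(1)[OF Suc_s_pos] unfolding if_not_P[OF nd] .
  ultimately show ?thesis unfolding cm_e1(2)[OF chi_Ch] by (rule geq_trans[OF _ geq_sym])
qed

lemma zx_comm: assumes b: "b \<noteq> 0" shows "cls (V (s + 1) e1 0 \<boxtimes> V 1 e1 b) \<approx> cls (V 1 e1 b \<boxtimes> V (s + 1) e1 0)"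
proof -
  have "cls (V (s + 1) e1 0 \<boxtimes> V 1 e1 b) \<approx> cls (V (1 + 1) e1 b) + cls (V (1 - 1) e1 b) + (\<Sum>k\<in>{1..<s}. cls (V 1 (cp k \<star> e1) b))"
    by (rule Vs1_tensor[OF e1_Ch zl1 b])
  also have "(\<Sum>k\<in>{1..<s}. cls (V 1 (cp k \<star> e1) b)) = (\<Sum>k\<in>{1..<s}. cls (V 1 (cp k) b))" by simp
  also have "cls (V (1 + 1) e1 b) + cls (V (1 - 1) e1 b) + (\<Sum>k\<in>{1..<s}. cls (V 1 (cp k) b)) \<approx> cls (V 2 e1 b) + 0 + (\<Sum>k\<in>{1..<s}. cls (V 1 (cp k) b))"
    using cls_V_0[OF e1_Ch, of b] by (intro geq_add) (simp_all add: one_add_one)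
  also have "cls (V 2 e1 b) + 0 + (\<Sum>k\<in>{1..<s}. cls (V 1 (cp k) b)) = cls (V 2 e1 b) + (\<Sum>k\<in>{1..<s}. cls (V 1 (cp k) b))" by simp
  also have "\<dots> \<approx> cls (V 1 e1 b \<boxtimes> V (s + 1) e1 0)" by (rule geq_sym[OF tensor_Vs1[OF b]])
  finally show ?thesis .
qed

text \<open>The contribution of one factor \<open>c = al + be * xi ^ i\<close> to a product of two
  \<open>x\<close> variables.\<close>

definition xterm :: "'k \<Rightarrow> ('g, 'k) formal" where
  "xterm c = (if c = 0 then \<Sum>m<sb. cls (V s (cp m) 0) else frag_cmul (int s) (cls (V 1 e1 (c ^ sp))))"

lemma xterm_xi: "xterm (c * xi ^ i) = xterm c"
proof -
  have "(c * xi ^ i) ^ sp = c ^ sp" by (rule coset_pow) (auto simp: coset_def)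
  then show ?thesis using xi_nz by (simp add: xterm_def)
qed

lemma xx_mult: "al \<noteq> 0 \<Longrightarrow> be \<noteq> 0 \<Longrightarrow> cls (V 1 e1 (al ^ sp) \<boxtimes> V 1 e1 (be ^ sp)) \<approx> (\<Sum>i<sp. xterm (al + be * xi ^ i))"
  unfolding xterm_def by (rule Vb_tensor_Vb)

text \<open>Replacing \<open>i\<close> by \<open>- i\<close> modulo \<open>sp\<close>, the factors
  \<open>al + be * xi ^ i\<close> and \<open>be + al * xi ^ (sp - i)\<close> differ by a power of
  \<open>xi\<close>, to which \<open>xterm\<close> is insensitive.\<close>

lemma xx_sym: "(\<Sum>i<sp. xterm (al + be * xi ^ i)) = (\<Sum>i<sp. xterm (be + al * xi ^ i))"
proof (rule sum.reindex_bij_witness[where i = "\<lambda>i. (sp - i) mod sp" and j = "\<lambda>i. (sp - i) mod sp"])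
  fix i assume i: "i \<in> {..<sp}"
  show inv: "(sp - (sp - i) mod sp) mod sp = i" using i by (cases "i = 0") auto
  show "(sp - i) mod sp \<in> {..<sp}" using sp_pos by simp
  have "i + (sp - i) mod sp = 0 \<or> i + (sp - i) mod sp = sp" using i by (cases "i = 0") auto
  then have x: "xi ^ i * xi ^ ((sp - i) mod sp) = 1" unfolding power_add[symmetric] using xi_pow[of sp] by auto
  have "(al + be * xi ^ i) * xi ^ ((sp - i) mod sp) = be * (xi ^ i * xi ^ ((sp - i) mod sp)) + al * xi ^ ((sp - i) mod sp)"
    by (simp add: algebra_simps)
  also have "\<dots> = be + al * xi ^ ((sp - i) mod sp)" unfolding x by simp
  finally show "xterm (be + al * xi ^ ((sp - i) mod sp)) = xterm (al + be * xi ^ i)" using xterm_xi[of "al + be * xi ^ i" "(sp - i) mod sp"] by simp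
next
  fix i assume i: "i \<in> {..<sp}"
  show "(sp - (sp - i) mod sp) mod sp = i" using i by (cases "i = 0") auto
  show "(sp - i) mod sp \<in> {..<sp}" using sp_pos by simp
qed

lemma xx_comm: assumes "al \<noteq> 0" "be \<noteq> 0" shows "cls (V 1 e1 (al ^ sp) \<boxtimes> V 1 e1 (be ^ sp)) \<approx> cls (V 1 e1 (be ^ sp) \<boxtimes> V 1 e1 (al ^ sp))"
  using geq_trans[OF xx_mult[OF assms] geq_sym[OF xx_mult[OF assms(2,1)], folded xx_sym]] .

lemma vm_comm:
  assumes v: "v \<in> AV" and w: "w \<in> AV"
  shows "fm (cls (vm v)) (cls (vm w)) \<approx> fm (cls (vm w)) (cls (vm v))"
  unfolding fm_cls using v
proof (cases rule: AV_cases)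
  case v1: 1
  show "cls (vm v \<boxtimes> vm w) \<approx> cls (vm w \<boxtimes> vm v)" using w
  proof (cases rule: AV_cases)
    case 1 then show ?thesis using v1 by simp
  next
    case 2 then show ?thesis unfolding v1 2 vm_y vm_z by (intro yz_comm)
  next
    case (3 al)
    then have b: "al ^ sp \<noteq> 0" by simp
    show ?thesis unfolding v1 3 vm_y vm_x by (rule geq_trans[OF yx_two[OF b] geq_sym[OF xy_two[OF b]]])
  qed
next
  case v2: 2
  show "cls (vm v \<boxtimes> vm w) \<approx> cls (vm w \<boxtimes> vm v)" using w
  proof (cases rule: AV_cases)
    case 1 then show ?thesis unfolding v2 1 vm_y vm_z by (intro geq_sym[OF yz_comm])
  next
    case 2 then show ?thesis using v2 by simp
  next
    case (3 al)
    then have b: "al ^ sp \<noteq> 0" by simp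
    show ?thesis unfolding v2 3 vm_z vm_x by (rule zx_comm[OF b])
  qed
next
  case v3: (3 be)
  then have c: "be ^ sp \<noteq> 0" by simp
  show "cls (vm v \<boxtimes> vm w) \<approx> cls (vm w \<boxtimes> vm v)" using w
  proof (cases rule: AV_cases)
    case 1 show ?thesis unfolding v3(2) 1 vm_y vm_x by (rule geq_trans[OF xy_two[OF c] geq_sym[OF yx_two[OF c]]])
  next
    case 2 show ?thesis unfolding v3(2) 2 vm_z vm_x by (rule geq_sym[OF zx_comm[OF c]])
  next
    case (3 al) show ?thesis unfolding v3(2) 3(2) vm_x by (rule xx_comm[OF v3(1) 3(1)])
  qed
qed

lemma mon_pull: "set us \<subseteq> AV \<Longrightarrow> v \<in> AV \<Longrightarrow> mon (us @ v # zs) \<approx> mon (v # us @ zs)"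
proof (induction us)
  case (Cons w us)
  let ?w = "cls (vm w)" and ?v = "cls (vm v)"
  have "fm ?w (mon (us @ v # zs)) \<approx> fm ?w (fm ?v (mon (us @ zs)))" by (rule fm_cong2) (use Cons in simp_all)
  also have "\<dots> \<approx> fm (fm ?w ?v) (mon (us @ zs))" by (rule geq_sym[OF fm_assoc]) simp_all
  also have "\<dots> \<approx> fm (fm ?v ?w) (mon (us @ zs))" by (rule fm_cong1[OF vm_comm]) (use Cons in simp_all)
  also have "\<dots> \<approx> fm ?v (fm ?w (mon (us @ zs)))" by (rule fm_assoc) simp_all
  finally show ?case by simp
qed simp

text \<open>The first variable of one list is pulled to the front of the other, and the tails are
  compared by induction.\<close>

lemma mon_perm: "mset xs = mset ys \<Longrightarrow> set xs \<subseteq> AV \<Longrightarrow> mon xs \<approx> mon ys"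
proof (induction xs arbitrary: ys)
  case (Cons v xs)
  have "v \<in> set ys" using Cons.prems(1) by (metis list.set_intros(1) mset_eq_setD)
  then obtain us zs where ys: "ys = us @ v # zs" by (meson split_list)
  have sy: "set ys \<subseteq> AV" using Cons.prems mset_eq_setD by blast
  have "mset xs = mset (us @ zs)" using Cons.prems(1) ys by simp
  then have "mon xs \<approx> mon (us @ zs)" using Cons.prems(2) by (intro Cons.IH) simp_all
  then have "mon (v # xs) \<approx> mon (v # us @ zs)" unfolding mon.simps by (rule fm_cong2) simp
  also have "\<dots> \<approx> mon ys" unfolding ys by (rule geq_sym[OF mon_pull]) (use sy ys in auto)
  finally show ?case .
qed simp

definition ph :: "('g \<Rightarrow> 'k) \<Rightarrow> ('k var \<Rightarrow>\<^sub>0 nat) \<Rightarrow> ('g, 'k) formal" where "ph l m = fm (lc l) (mon (lst m))"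

lemma ph_fW [simp]: "l \<in> Ch \<Longrightarrow> ph l m \<in> fW" by (simp add: ph_def)

lemma ph_vars: assumes xs: "set xs \<subseteq> AV" and l: "l \<in> Ch" shows "ph l (vars xs) \<approx> fm (lc l) (mon xs)"
proof -
  have m: "mset (lst (vars xs)) = mset xs" by (rule vars_mset) simp
  have "set (lst (vars xs)) \<subseteq> AV" using mset_eq_setD[OF m] xs by simp
  then have "mon (lst (vars xs)) \<approx> mon xs" using m by (intro mon_perm)
  then show ?thesis unfolding ph_def using l by (intro fm_cong2) simp_all
qed

text \<open>The only step that is not plain reassociation is to move \<open>l'\<close> to the left
  past the variables of \<open>m\<close>, and it renames them by \<open>ren l'\<close>, as the
  product of the skew group ring does.\<close>

lemma ph_mult:
  assumes l: "l \<in> Ch" "l' \<in> Ch" and m: "pm_keys m \<subseteq> AV" "pm_keys m' \<subseteq> AV"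
  shows "ph (l \<star> l') (ren l' m + m') \<approx> fm (ph l m) (ph l' m')"
proof -
  let ?xs = "lst m" and ?ys = "lst m'"
  let ?xr = "map (ren_var a s l') ?xs"
  have xs: "set ?xs \<subseteq> AV" and ys: "set ?ys \<subseteq> AV" using m keys_vars[of ?xs] keys_vars[of ?ys] by simp_all
  have xr: "set ?xr \<subseteq> AV" using xs ren_var_AV[OF l(2)] by auto
  have fl: "lc l \<in> fW" "lc l' \<in> fW" "lc (l \<star> l') \<in> fW" using l by simp_all
  have e: "ren l' m + m' = vars (?xr @ ?ys)" using ren_vars[of l' ?xs] by simp
  have "ph (l \<star> l') (ren l' m + m') \<approx> fm (lc (l \<star> l')) (mon (?xr @ ?ys))"
    unfolding e by (rule ph_vars) (use xr ys l in simp_all)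
  also have "\<dots> \<approx> fm (lc (l \<star> l')) (fm (mon ?xr) (mon ?ys))" by (rule fm_cong2[OF mon_append[OF xr ys] fl(3)])
  also have "\<dots> \<approx> fm (fm (lc l) (lc l')) (fm (mon ?xr) (mon ?ys))"
    by (rule fm_cong1[OF geq_sym[OF lc_V[OF l zl1]]]) simp
  also have "\<dots> \<approx> fm (lc l) (fm (lc l') (fm (mon ?xr) (mon ?ys)))" by (rule fm_assoc) (use fl in simp_all)
  also have "\<dots> \<approx> fm (lc l) (fm (fm (lc l') (mon ?xr)) (mon ?ys))" by (rule fm_cong2[OF geq_sym[OF fm_assoc]]) (use fl in simp_all)
  also have "\<dots> \<approx> fm (lc l) (fm (fm (mon ?xs) (lc l')) (mon ?ys))"
    by (rule fm_cong2[OF fm_cong1[OF geq_sym[OF mon_move[OF xs l(2)]]]]) (use fl in simp_all)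
  also have "\<dots> \<approx> fm (lc l) (fm (mon ?xs) (fm (lc l') (mon ?ys)))" by (rule fm_cong2[OF fm_assoc]) (use fl in simp_all)
  also have "\<dots> \<approx> fm (fm (lc l) (mon ?xs)) (fm (lc l') (mon ?ys))" by (rule geq_sym[OF fm_assoc]) (use fl in simp_all)
  finally show ?thesis unfolding ph_def .
qed

definition PhI :: "('g \<Rightarrow> 'k) \<Rightarrow> 'k zpoly \<Rightarrow> ('g, 'k) formal" where
  "PhI l p = (\<Sum>m\<in>pm_keys p. frag_cmul (pm_lookup p m) (ph l m))"

definition Ph :: "('g, 'k) skew \<Rightarrow> ('g, 'k) formal" where
  "Ph u = (\<Sum>l\<in>pm_keys u. PhI l (pm_lookup u l))"

lemma PhI_add: "PhI l (p + q) = PhI l p + PhI l q"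
  unfolding PhI_def by (rule setsum_keys_plus_distrib[where f = "\<lambda>m c. frag_cmul c (ph l m)"]) (simp_all add: frag_cmul_distrib)
lemma PhI_0: "PhI l 0 = 0" by (simp add: PhI_def)
lemma Ph_add: "Ph (u + v) = Ph u + Ph v"
  unfolding Ph_def by (rule setsum_keys_plus_distrib[where f = PhI]) (simp_all add: PhI_add PhI_0)
lemma Ph_0 [simp]: "Ph 0 = 0" by (simp add: Ph_def)
lemma Ph_neg: "Ph (- u) = - Ph u" using Ph_add[of u "- u"] by (simp add: eq_neg_iff_add_eq_0 add.commute)
lemma Ph_diff: "Ph (u - v) = Ph u - Ph v" using Ph_add[of u "- v"] by (simp add: Ph_neg)
lemma Ph_sum: "Ph (\<Sum>i\<in>I. f i) = (\<Sum>i\<in>I. Ph (f i))"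
  by (induction I rule: infinite_finite_induct) (simp_all add: Ph_add)
lemma Ph_E: "Ph (E l m c) = frag_cmul c (ph l m)"
proof (cases "c = 0")
  case False
  have "pm_single m c \<noteq> 0"
  proof
    assume z: "pm_single m c = 0"
    have "c = pm_lookup (pm_single m c) m" by simp
    also have "\<dots> = 0" unfolding z by simp
    finally show False using False by simp
  qed
  then show ?thesis using False by (simp add: Ph_def PhI_def skel_def)
qed simp

lemma Ph_fW [simp]: "u \<in> SC \<Longrightarrow> Ph u \<in> fW"
  by (induction rule: SC_induct) (simp_all add: Ph_E Ph_add)

lemma Ph_mult: assumes u: "u \<in> SC" and v: "v \<in> SC" shows "Ph (u \<odot> v) \<approx> fm (Ph u) (Ph v)"
  using u
proof (induction rule: SC_induct)
  case (E l m c)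
  note u = E
  show ?case using v
  proof (induction rule: SC_induct)
    case (E l' m' c')
    have "frag_cmul (c * c') (ph (l \<star> l') (ren l' m + m')) \<approx> frag_cmul (c * c') (fm (ph l m) (ph l' m'))"
      using u E by (intro geq_cmul ph_mult)
    then show ?case unfolding sm_E Ph_E fm_cmul1 fm_cmul2 frag_cmul_cmul mult.commute[of c' c] .
  qed (simp_all add: sm_add2 Ph_add fm_add2 geq_add)
qed (simp_all add: sm_add1 Ph_add fm_add1 geq_add)

subsection \<open>The defining relations hold in the Green ring\<close>

lemma mon_one: assumes "v \<in> AV" shows "mon [v] \<approx> cls (vm v)"
  using assms
proof (cases rule: vm_form)
  case (1 t b)
  have "e1 a = 1" using aG by (rule e1_apply)
  then show ?thesis using V_lc[OF e1_Ch e1_Ch 1(2,3)] by (simp add: 1(1))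
qed

lemma Ph_l: assumes l: "l \<in> Ch" shows "ph l 0 \<approx> lc l"
proof -
  have "ph l (vars []) \<approx> fm (lc l) (mon [])" by (rule ph_vars) (use l in simp_all)
  also have "fm (lc l) (mon []) \<approx> lc (l \<star> e1)" unfolding mon.simps by (rule lc_V[OF l e1_Ch zl1])
  also have "lc (l \<star> e1) = lc l" using l by simp
  finally show ?thesis by simp
qed

lemma Ph_v:
  assumes l: "l \<in> Ch" and v: "v \<in> AV" and tb: "vm v = V t e1 b" "t > 0"
  shows "ph l (pm_single v 1) \<approx> cls (V t l b)"
proof -
  have "ph l (vars [v]) \<approx> fm (lc l) (mon [v])" by (rule ph_vars) (use l v in simp_all)
  also have "\<dots> \<approx> fm (lc l) (cls (vm v))" by (rule fm_cong2[OF mon_one[OF v]]) (use l in simp)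
  also have "\<dots> \<approx> cls (V t (l \<star> e1) b)" unfolding tb(1) by (rule lc_V[OF l e1_Ch tb(2)])
  also have "cls (V t (l \<star> e1) b) = cls (V t l b)" using l by simp
  finally show ?thesis by simp
qed

lemma Ph_x: "l \<in> Ch \<Longrightarrow> al \<noteq> 0 \<Longrightarrow> ph l (x1 al) \<approx> cls (V 1 l (al ^ sp))"
  by (rule Ph_v) (simp_all add: vm_x)

lemma Ph_vw: assumes v: "v \<in> AV" and w: "w \<in> AV" shows "ph e1 (pm_single v 1 + pm_single w 1) \<approx> cls (vm v \<boxtimes> vm w)"
proof -
  have "ph e1 (vars [v, w]) \<approx> fm (lc e1) (mon [v, w])" by (rule ph_vars) (use v w in simp_all)
  also have "\<dots> \<approx> mon [v, w]" by (rule lc_e1_mon) (use v w in simp)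
  also have "mon [v, w] = fm (cls (vm v)) (mon [w])" by simp
  also have "\<dots> \<approx> fm (cls (vm v)) (cls (vm w))" by (rule fm_cong2[OF mon_one[OF w]]) simp
  finally show ?thesis by (simp add: fm_cls)
qed

lemma zero_geq: "u \<approx> v \<Longrightarrow> u - v \<approx> 0" using geq_diff[of G chi u v v v] by simp

lemma gen_chi: assumes al: "al \<noteq> 0" shows "Ph (E chi (x1 al) 1 - E e1 (x1 al) 1) \<approx> 0"
proof -
  have b: "al ^ sp \<noteq> 0" using al by simp
  have "ph chi (x1 al) \<approx> cls (V 1 (chi \<star> e1) (al ^ sp))" using Ph_x[OF chi_Ch al] by simp
  also have "\<dots> \<approx> cls (V 1 e1 (al ^ sp))" by (rule geq_sym[OF V_shift[OF e1_Ch zl1 b]])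
  also have "\<dots> \<approx> ph e1 (x1 al)" by (rule geq_sym[OF Ph_x[OF e1_Ch al]])
  finally have "ph chi (x1 al) - ph e1 (x1 al) \<approx> 0" by (rule zero_geq)
  then show ?thesis unfolding Ph_diff Ph_E by simp
qed

lemma gen_yx: assumes al: "al \<noteq> 0" shows "Ph (E e1 (y1 + x1 al) 1 - E e1 (x1 al) 2) \<approx> 0"
proof -
  have b: "al ^ sp \<noteq> 0" using al by simp
  have "ph e1 (y1 + x1 al) \<approx> cls (vm VY \<boxtimes> vm (VX (coset xi al)))" by (rule Ph_vw) (simp_all add: al)
  also have "\<dots> \<approx> frag_cmul 2 (cls (V 1 e1 (al ^ sp)))" unfolding vm_y vm_x by (rule yx_two[OF b])
  also have "\<dots> \<approx> frag_cmul 2 (ph e1 (x1 al))" by (rule geq_cmul[OF geq_sym[OF Ph_x[OF e1_Ch al]]])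
  finally have "ph e1 (y1 + x1 al) - frag_cmul 2 (ph e1 (x1 al)) \<approx> 0" by (rule zero_geq)
  then show ?thesis unfolding Ph_diff Ph_E by simp
qed

lemma Ph_xx: assumes al: "al \<noteq> 0" and be: "be \<noteq> 0" shows "ph e1 (x1 al + x1 be) \<approx> (\<Sum>i<sp. xterm (al + be * xi ^ i))"
proof -
  have "ph e1 (x1 al + x1 be) \<approx> cls (vm (VX (coset xi al)) \<boxtimes> vm (VX (coset xi be)))" by (rule Ph_vw) (simp_all add: al be)
  also have "\<dots> \<approx> (\<Sum>i<sp. xterm (al + be * xi ^ i))" unfolding vm_x by (rule xx_mult[OF al be])
  finally show ?thesis .
qed

lemma xterm_ph: assumes c: "c \<noteq> 0" shows "xterm c \<approx> frag_cmul (int s) (ph e1 (x1 c))"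
proof -
  have "xterm c = frag_cmul (int s) (cls (V 1 e1 (c ^ sp)))" using c by (simp add: xterm_def)
  also have "\<dots> \<approx> frag_cmul (int s) (ph e1 (x1 c))" by (rule geq_cmul[OF geq_sym[OF Ph_x[OF e1_Ch c]]])
  finally show ?thesis .
qed

lemma gen_xx: assumes al: "al \<noteq> 0" and be: "be \<noteq> 0" and ne: "coset xi be \<noteq> coset xi (- al)"
  shows "Ph (E e1 (x1 al + x1 be) 1 - (\<Sum>i<sp. E e1 (x1 (al + be * xi ^ i)) (int s))) \<approx> 0"
proof -
  have "ph e1 (x1 al + x1 be) \<approx> (\<Sum>i<sp. xterm (al + be * xi ^ i))" by (rule Ph_xx[OF al be])
  also have "\<dots> \<approx> (\<Sum>i<sp. frag_cmul (int s) (ph e1 (x1 (al + be * xi ^ i))))" by (intro geq_sum xterm_ph sum_nonzero[OF ne])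
  finally have "ph e1 (x1 al + x1 be) - (\<Sum>i<sp. frag_cmul (int s) (ph e1 (x1 (al + be * xi ^ i)))) \<approx> 0" by (rule zero_geq)
  then show ?thesis unfolding Ph_diff Ph_sum Ph_E by simp
qed

section \<open>Chebyshev expansions and the relation for \<open>y\<close>\<close>

abbreviation L2 where "L2 u \<equiv> fm (cls (V 2 e1 0)) u"

lemma V2_fW: "cls (V 2 e1 0) \<in> fW" by simp

lemma L2_ph: assumes l: "l \<in> Ch" shows "L2 (ph l (yn n)) \<approx> ph l (yn (n + 1))"
proof -
  have y: "ph e1 y1 \<approx> cls (V 2 e1 0)" by (rule Ph_v) (simp_all add: vm_y)
  have "L2 (ph l (yn n)) \<approx> fm (ph e1 y1) (ph l (yn n))" by (rule fm_cong1[OF geq_sym[OF y]]) (use l in simp)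
  also have "\<dots> \<approx> ph (e1 \<star> l) (ren l y1 + yn n)" by (rule geq_sym[OF ph_mult]) (use l in simp_all)
  also have "ph (e1 \<star> l) (ren l y1 + yn n) = ph l (yn (n + 1))" using l by (simp add: single_add add.commute)
  finally show ?thesis .
qed

lemma L2_V: assumes l: "l \<in> Ch" and t: "t > 0" "\<not> s dvd t" shows "L2 (cls (V t l 0)) \<approx> cls (V (t + 1) l 0) + cls (V (t - 1) (chi \<star> l) 0)"
  using V2_tensor(1)[OF l t(1)] unfolding if_not_P[OF t(2)] fm_cls .

lemma L2_Vs: assumes l: "l \<in> Ch" shows "L2 (cls (V s l 0)) \<approx> cls (V s l 0) + cls (V s (chi \<star> l) 0)"
  using V2_tensor(1)[OF l s_pos] unfolding fm_cls by simp

text \<open>The coefficients of the Chebyshev polynomials of the second kind, normalised by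
  \<open>U_(n+2) = y U_(n+1) - U_n\<close>.\<close>

definition uf :: "nat \<Rightarrow> nat \<Rightarrow> int" where "uf n j = (-1) ^ j * int ((n - j) choose j)"

lemma uf_0: "n div 2 < j \<Longrightarrow> uf n j = 0" by (auto simp: uf_def intro!: binomial_eq_0)

lemma uf_rec: "j \<le> n \<Longrightarrow> uf (n + 2) (Suc j) = uf (n + 1) (Suc j) - uf n j"
proof -
  assume j: "j \<le> n"
  have e: "n + 2 - Suc j = Suc (n - j)" "n + 1 - Suc j = n - j" using j by auto
  show ?thesis unfolding uf_def e binomial_Suc_Suc by (simp add: algebra_simps)
qed

text \<open>The Chebyshev polynomial in the class of \<open>V 2\<close>, its \<open>j\<close>-th
  term twisted by \<open>chi ^ j\<close>. The sum runs to \<open>n\<close> for a simple recursion;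
  the coefficients vanish past the middle, so the truncated exponents there do no harm.\<close>

definition U :: "nat \<Rightarrow> ('g \<Rightarrow> 'k) \<Rightarrow> ('g, 'k) formal" where
  "U n l = (\<Sum>j\<le>n. frag_cmul (uf n j) (ph (cp j \<star> l) (yn (n - 2 * j))))"

lemma U_half: "(\<Sum>j\<le>n. frag_cmul (uf n j) (F j)) = (\<Sum>j\<in>{0..n div 2}. frag_cmul (uf n j) (F j))"
  by (rule sum.mono_neutral_right) (auto simp: uf_0)

lemma L2_sum: "L2 (\<Sum>i\<in>I. frag_cmul (c i) (F i)) = (\<Sum>i\<in>I. frag_cmul (c i) (L2 (F i)))"
  by (simp add: fm_sum2 fm_cmul2)

lemma L2_U: assumes l: "l \<in> Ch" shows "L2 (U n l) \<approx> (\<Sum>j\<le>n. frag_cmul (uf n j) (ph (cp j \<star> l) (yn (n - 2 * j + 1))))"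
  unfolding U_def L2_sum by (intro geq_sum geq_cmul L2_ph) (use l in simp)

lemma U_rec: assumes l: "l \<in> Ch" shows "U (n + 2) l \<approx> L2 (U (n + 1) l) - U n (chi \<star> l)"
proof -
  define w where "w j = ph (cp j \<star> l) (yn (n + 2 - 2 * j))" for j
  have "U (n + 2) l = (\<Sum>j\<le>Suc (Suc n). frag_cmul (uf (n + 2) j) (w j))" by (simp add: U_def w_def)
  also have "\<dots> = frag_cmul (uf (n + 2) 0) (w 0) + (\<Sum>j\<le>Suc n. frag_cmul (uf (n + 2) (Suc j)) (w (Suc j)))" by (rule sum.atMost_Suc_shift)
  also have "(\<Sum>j\<le>Suc n. frag_cmul (uf (n + 2) (Suc j)) (w (Suc j))) = (\<Sum>j\<le>n. frag_cmul (uf (n + 2) (Suc j)) (w (Suc j)))"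
    using uf_0[of "n + 2" "Suc (Suc n)"] by simp
  also have "\<dots> = (\<Sum>j\<le>n. frag_cmul (uf (n + 1) (Suc j)) (w (Suc j)) - frag_cmul (uf n j) (w (Suc j)))"
  proof (intro sum.cong refl)
    fix j assume "j \<in> {..n}"
    then have j: "j \<le> n" by simp
    show "frag_cmul (uf (n + 2) (Suc j)) (w (Suc j)) = frag_cmul (uf (n + 1) (Suc j)) (w (Suc j)) - frag_cmul (uf n j) (w (Suc j))"
      unfolding uf_rec[OF j] by (rule poly_mapping_eqI) (simp add: lookup_minus left_diff_distrib)
  qed
  also have "\<dots> = (\<Sum>j\<le>n. frag_cmul (uf (n + 1) (Suc j)) (w (Suc j))) - (\<Sum>j\<le>n. frag_cmul (uf n j) (w (Suc j)))" by (rule sum_subtractf)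
  also have "frag_cmul (uf (n + 2) 0) (w 0) = frag_cmul (uf (n + 1) 0) (w 0)" by (simp add: uf_def)
  also have "frag_cmul (uf (n + 1) 0) (w 0) + ((\<Sum>j\<le>n. frag_cmul (uf (n + 1) (Suc j)) (w (Suc j))) - (\<Sum>j\<le>n. frag_cmul (uf n j) (w (Suc j))))
      = (\<Sum>j\<le>Suc n. frag_cmul (uf (n + 1) j) (w j)) - (\<Sum>j\<le>n. frag_cmul (uf n j) (w (Suc j)))"
    unfolding sum.atMost_Suc_shift[of _ n] by simp
  also have "(\<Sum>j\<le>n. frag_cmul (uf n j) (w (Suc j))) = U n (chi \<star> l)"
    unfolding U_def
  proof (intro sum.cong refl)
    fix j
    have "cp j \<star> (chi \<star> l) = cp (Suc j) \<star> l" unfolding cp_Suc[symmetric] using l by (simp add: cm_assoc[symmetric] cm_comm[of "cp j" chi])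
    moreover have "n + 2 - 2 * Suc j = n - 2 * j" by simp
    ultimately show "frag_cmul (uf n j) (w (Suc j)) = frag_cmul (uf n j) (ph (cp j \<star> (chi \<star> l)) (yn (n - 2 * j)))" unfolding w_def by simp
  qed
  also have "(\<Sum>j\<le>Suc n. frag_cmul (uf (n + 1) j) (w j)) - U n (chi \<star> l) \<approx> L2 (U (n + 1) l) - U n (chi \<star> l)"
  proof (rule geq_diff[OF geq_sym geq_refl])
    have "(\<Sum>j\<le>n + 1. frag_cmul (uf (n + 1) j) (ph (cp j \<star> l) (yn (n + 1 - 2 * j + 1)))) = (\<Sum>j\<le>Suc n. frag_cmul (uf (n + 1) j) (w j))"
    proof (intro sum.cong)
      fix j
      show "frag_cmul (uf (n + 1) j) (ph (cp j \<star> l) (yn (n + 1 - 2 * j + 1))) = frag_cmul (uf (n + 1) j) (w j)"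
      proof (cases "2 * j \<le> n + 1")
        case True
        then have "n + 1 - 2 * j + 1 = n + 2 - 2 * j" by simp
        then show ?thesis by (simp only: w_def)
      next
        case False
        then have "uf (n + 1) j = 0" by (intro uf_0) simp
        then show ?thesis by simp
      qed
    qed simp
    then show "L2 (U (n + 1) l) \<approx> (\<Sum>j\<le>Suc n. frag_cmul (uf (n + 1) j) (w j))" using L2_U[OF l, of "n + 1"] by simp
  qed
  finally show ?thesis .
qed

lemma not_dvd_lt: "0 < t \<Longrightarrow> t < s \<Longrightarrow> \<not> s dvd t" by (auto dest: dvd_imp_le)

text \<open>For \<open>t\<close> below \<open>s\<close> the product of \<open>V 2\<close> and
  \<open>V t\<close> is \<open>V (t + 1)\<close> plus the twist of \<open>V (t - 1)\<close> by
  \<open>chi\<close>, which is the recursion of \<open>U\<close>. At \<open>t = s\<close> the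
  product has another form, hence the bound on \<open>n\<close>.\<close>

lemma U_V: "l \<in> Ch \<Longrightarrow> n < s \<Longrightarrow> U n l \<approx> cls (V (n + 1) l 0)"
proof (induction n arbitrary: l rule: less_induct)
  case (less n)
  consider "n = 0" | "n = 1" | k where "n = k + 2" by (metis One_nat_def add_2_eq_Suc' not0_implies_Suc)
  then show ?case
  proof cases
    case 1 then show ?thesis using Ph_l[OF less.prems(1)] less.prems(1) by (simp add: U_def uf_def)
  next
    case 2
    have "ph l y1 \<approx> cls (V 2 l 0)" by (rule Ph_v) (simp_all add: vm_y less.prems)
    moreover have "U 1 l = ph l y1" using less.prems(1) by (simp add: U_def uf_def One_nat_def)
    ultimately show ?thesis using 2 by simp
  next
    case (3 k)
    have t: "k + 2 < s" using less.prems 3 by simp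
    have "U (k + 2) l \<approx> L2 (U (k + 1) l) - U k (chi \<star> l)" by (rule U_rec[OF less.prems(1)])
    also have "\<dots> \<approx> L2 (cls (V (k + 1 + 1) l 0)) - cls (V (k + 1) (chi \<star> l) 0)"
      using less.prems 3 by (intro geq_diff fm_cong2 less.IH) simp_all
    also have "\<dots> \<approx> cls (V (k + 1 + 1 + 1) l 0) + cls (V (k + 1 + 1 - 1) (chi \<star> l) 0) - cls (V (k + 1) (chi \<star> l) 0)"
      using t by (intro geq_diff geq_refl L2_V less.prems(1) not_dvd_lt) simp_all
    also have "\<dots> = cls (V (k + 2 + 1) l 0)"
    proof -
      have e: "k + 1 + 1 - 1 = k + 1" "k + 1 + 1 + 1 = k + 2 + 1" by simp_all
      show ?thesis unfolding e by (rule add_diff_cancel_right')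
    qed
    finally show ?thesis using 3 by simp
  qed
qed

text \<open>Ballot numbers: for \<open>n < s\<close> and \<open>2 * i \<le> n\<close> the
  multiplicity of \<open>V (n + 1 - 2 * i)\<close> in the \<open>n\<close>-th power of
  \<open>V 2\<close>. Past the middle they can be negative, but then they multiply an empty
  module.\<close>

definition df :: "nat \<Rightarrow> nat \<Rightarrow> int" where "df n i = int (n choose i) - (if i = 0 then 0 else int (n choose (i - 1)))"

lemma df_rec: "df (Suc n) (Suc i) = df n (Suc i) + df n i" by (cases i) (simp_all add: df_def)
lemma df_rec0: "df n 0 = 1" by (simp add: df_def)
lemma df_mid: "2 * i = n + 1 \<Longrightarrow> df n i = 0"
proof -
  assume i: "2 * i = n + 1"
  then have "n choose i = n choose (n - i)" "n - i = i - 1" "i \<noteq> 0" by (auto intro!: binomial_symmetric)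
  then show ?thesis by (simp add: df_def)
qed

lemma ph_y_V: "l \<in> Ch \<Longrightarrow> n < s \<Longrightarrow> ph l (yn n) \<approx> (\<Sum>i\<le>n. frag_cmul (df n i) (cls (V (n + 1 - 2 * i) (cp i \<star> l) 0)))"
proof (induction n)
  case 0 then show ?case using Ph_l[of l] by (simp add: df_def)
next
  case (Suc n)
  define v where "v i = cls (V (n + 2 - 2 * i) (cp i \<star> l) 0)" for i
  have l: "l \<in> Ch" using Suc.prems by simp
  have "ph l (yn (Suc n)) \<approx> L2 (ph l (yn n))" using geq_sym[OF L2_ph[OF l, of n]] by (simp only: Suc_eq_plus1)
  also have "\<dots> \<approx> L2 (\<Sum>i\<le>n. frag_cmul (df n i) (cls (V (n + 1 - 2 * i) (cp i \<star> l) 0)))"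
    using Suc by (intro fm_cong2) simp_all
  also have "\<dots> = (\<Sum>i\<le>n. frag_cmul (df n i) (L2 (cls (V (n + 1 - 2 * i) (cp i \<star> l) 0))))" by (rule L2_sum)
  also have "\<dots> \<approx> (\<Sum>i\<le>n. frag_cmul (df n i) (v i) + frag_cmul (df n i) (v (Suc i)))"
  proof (rule geq_sum)
    fix i
    have ci: "chi \<star> (cp i \<star> l) = cp (Suc i) \<star> l" unfolding cp_Suc[symmetric] using l by (simp add: cm_assoc)
    consider "2 * i \<le> n" | "2 * i = n + 1" | "2 * i \<ge> n + 2" by linarith
    then show "frag_cmul (df n i) (L2 (cls (V (n + 1 - 2 * i) (cp i \<star> l) 0))) \<approx> frag_cmul (df n i) (v i) + frag_cmul (df n i) (v (Suc i))"
    proof cases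
      case 1
      have e: "n + 1 - 2 * i + 1 = n + 2 - 2 * i" "n + 1 - 2 * i - 1 = n + 2 - 2 * Suc i" using 1 by auto
      have "L2 (cls (V (n + 1 - 2 * i) (cp i \<star> l) 0)) \<approx> v i + v (Suc i)"
        unfolding v_def ci[symmetric] e[symmetric] using 1 Suc.prems l by (intro L2_V not_dvd_lt) simp_all
      then show ?thesis unfolding frag_cmul_distrib2[symmetric] by (rule geq_cmul)
    next
      \<comment> \<open>Here the first class on the right is that of a \<open>V 1\<close>, not of an
        empty module; it is the coefficient that vanishes.\<close>
      case 2 then show ?thesis by (simp add: df_mid)
    next
      case 3
      then have z: "n + 1 - 2 * i = 0" "n + 2 - 2 * i = 0" "n + 2 - 2 * Suc i = 0" by auto
      have 0: "cls (V 0 (cp k \<star> l) 0) \<approx> 0" for k by (rule cls_V_0) (use l in simp)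
      have "L2 (cls (V 0 (cp i \<star> l) 0)) \<approx> L2 0" by (rule fm_cong2[OF 0]) simp
      then have a: "L2 (cls (V (n + 1 - 2 * i) (cp i \<star> l) 0)) \<approx> 0" unfolding z by simp
      have b: "v i + v (Suc i) \<approx> 0" using geq_add[OF 0 0, of i "Suc i"] unfolding v_def z by simp
      show ?thesis unfolding frag_cmul_distrib2[symmetric] by (rule geq_cmul[OF geq_trans[OF a geq_sym[OF b]]])
    qed
  qed
  also have "\<dots> = (\<Sum>i\<le>n. frag_cmul (df n i) (v i)) + (\<Sum>i\<le>n. frag_cmul (df n i) (v (Suc i)))" by (rule sum.distrib)
  also have "\<dots> \<approx> (\<Sum>i\<le>Suc n. frag_cmul (df n i) (v i)) + (\<Sum>i\<le>n. frag_cmul (df n i) (v (Suc i)))"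
  proof (rule geq_add[OF _ geq_refl])
    have z: "n + 2 - 2 * Suc n = 0" by simp
    have "v (Suc n) \<approx> 0" unfolding v_def z by (rule cls_V_0) (use l in simp)
    then have "frag_cmul (df n (Suc n)) (v (Suc n)) \<approx> frag_cmul (df n (Suc n)) 0" by (rule geq_cmul)
    then have "frag_cmul (df n (Suc n)) (v (Suc n)) \<approx> 0" by simp
    from geq_add[OF geq_refl geq_sym[OF this], of "\<Sum>i\<le>n. frag_cmul (df n i) (v i)"]
    have "(\<Sum>i\<le>n. frag_cmul (df n i) (v i)) + 0 \<approx> (\<Sum>i\<le>n. frag_cmul (df n i) (v i)) + frag_cmul (df n (Suc n)) (v (Suc n))" .
    then show "(\<Sum>i\<le>n. frag_cmul (df n i) (v i)) \<approx> (\<Sum>i\<le>Suc n. frag_cmul (df n i) (v i))" by simp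
  qed
  also have "\<dots> = (\<Sum>i\<le>Suc n. frag_cmul (df (Suc n) i) (v i))"
    unfolding sum.atMost_Suc_shift[of _ n] by (simp add: df_rec df_rec0 frag_cmul_distrib sum.distrib add_ac)
  also have "\<dots> = (\<Sum>i\<le>Suc n. frag_cmul (df (Suc n) i) (cls (V (Suc n + 1 - 2 * i) (cp i \<star> l) 0)))"
  proof -
    have e: "n + 2 = Suc n + 1" by simp
    show ?thesis unfolding v_def e ..
  qed
  finally show ?case .
qed

text \<open>Absorption shows that the division in the relation is exact: the coefficient is the
  ballot number \<open>C(s - 1, i) - C(s - 1, i - 1)\<close>.\<close>

lemma df_formula: assumes i: "0 < i" "2 * i < s" shows "(int (s - 2 * i) * int ((s - 1) choose i)) div int (s - i) = df (s - 1) i"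
proof -
  let ?n = "s - 1"
  have a: "i * (?n choose i) = ?n * (?n - 1 choose (i - 1))" by (rule times_binomial_minus1_eq[OF i(1)])
  have "(?n - (i - 1)) * (?n choose (i - 1)) = ?n * (?n - 1 choose (i - 1))" by (rule binomial_absorb_comp)
  moreover have "?n - (i - 1) = s - i" using i by simp
  ultimately have b: "(s - i) * (?n choose (i - 1)) = i * (?n choose i)" using a by simp
  have "int (s - i) * int (?n choose (i - 1)) = int i * int (?n choose i)" using b by (metis of_nat_mult)
  moreover have "int (s - 2 * i) = int (s - i) - int i" using i by simp
  ultimately have "int (s - 2 * i) * int (?n choose i) = int (s - i) * df ?n i"
    using i by (simp add: df_def algebra_simps)
  then show ?thesis using i by simp
qed

lemma Ph_uf: "Ph (\<Sum>j\<in>{0..n div 2}. E (cp (i + j)) (yn (n - 2 * j)) ((-1) ^ j * int ((n - j) choose j))) = U n (cp i)"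
  unfolding Ph_sum Ph_E U_def U_half[of n "\<lambda>j. ph (cp j \<star> cp i) (yn (n - 2 * j))"]
  by (intro sum.cong refl) (simp add: uf_def cp_add add.commute)

lemma gyA_eq: "Ph gyA = U (s - 1) e1 + U (s - 1) chi"
proof -
  have "gyA = (\<Sum>j\<in>{0..(s - 1) div 2}. E (cp (0 + j)) (yn (s - 1 - 2 * j)) ((-1) ^ j * int ((s - 1 - j) choose j)))
    + (\<Sum>j\<in>{0..(s - 1) div 2}. E (cp (1 + j)) (yn (s - 1 - 2 * j)) ((-1) ^ j * int ((s - 1 - j) choose j)))"
    unfolding gyA_def sum.distrib[symmetric] by (intro sum.cong refl) (simp add: add.commute)
  then have "Ph gyA = U (s - 1) (cp 0) + U (s - 1) (cp 1)" by (simp only: Ph_add Ph_uf)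
  then show ?thesis by (simp add: cp_1')
qed

text \<open>For fixed \<open>i\<close> the exponents of \<open>y\<close> exceed those of the
  Chebyshev expansion of \<open>V (s - 2 * i)\<close> by one, so the inner sum is \<open>y\<close>
  times that module, and the outer coefficient is its multiplicity.\<close>

lemma gyB_eq: "Ph gyB \<approx> (\<Sum>i\<in>{1..(s - 1) div 2}. frag_cmul (df (s - 1) i) (L2 (cls (V (s - 2 * i) (cp i) 0))))"
  unfolding gyB_def Ph_sum Ph_E
proof (rule geq_sum)
  fix i assume i: "i \<in> {1..(s - 1) div 2}"
  then have i1: "0 < i" "2 * i < s" using s_pos by auto
  define n where "n = s - 2 * i - 1"
  have s1: "s - 2 * i = n + 1" and ns: "n < s" using i1 by (auto simp: n_def)
  have "(\<Sum>j\<in>{0..n div 2}. frag_cmul ((-1) ^ j * ((int (s - 2 * i) * int ((s - 1) choose i)) div int (s - i)) * int ((n - j) choose j)) (ph (cp (i + j)) (yn (s - 2 * i - 2 * j))))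
     = (\<Sum>j\<in>{0..n div 2}. frag_cmul (df (s - 1) i) (frag_cmul (uf n j) (ph (cp j \<star> cp i) (yn (n - 2 * j + 1)))))"
  proof (intro sum.cong refl)
    fix j assume j: "j \<in> {0..n div 2}"
    have e1: "s - 2 * i - 2 * j = n - 2 * j + 1" using j s1 by auto
    have e2: "cp (i + j) = cp j \<star> cp i" by (simp add: cp_add add.commute)
    show "frag_cmul ((-1) ^ j * ((int (s - 2 * i) * int ((s - 1) choose i)) div int (s - i)) * int ((n - j) choose j)) (ph (cp (i + j)) (yn (s - 2 * i - 2 * j)))
      = frag_cmul (df (s - 1) i) (frag_cmul (uf n j) (ph (cp j \<star> cp i) (yn (n - 2 * j + 1))))"
      unfolding df_formula[OF i1] e1 e2 frag_cmul_cmul uf_def by (simp add: mult_ac)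
  qed
  also have "\<dots> = frag_cmul (df (s - 1) i) (\<Sum>j\<le>n. frag_cmul (uf n j) (ph (cp j \<star> cp i) (yn (n - 2 * j + 1))))"
    unfolding U_half[of n "\<lambda>j. ph (cp j \<star> cp i) (yn (n - 2 * j + 1))"] by (rule frag_cmul_sum[symmetric])
  also have "\<dots> \<approx> frag_cmul (df (s - 1) i) (L2 (U n (cp i)))" by (rule geq_cmul[OF geq_sym[OF L2_U[OF cp_Ch]]])
  also have "\<dots> \<approx> frag_cmul (df (s - 1) i) (L2 (cls (V (n + 1) (cp i) 0)))" by (rule geq_cmul[OF fm_cong2[OF U_V[OF cp_Ch ns] V2_fW]])
  finally show "(\<Sum>j\<in>{0..(s - 2 * i - 1) div 2}. frag_cmul ((-1) ^ j * ((int (s - 2 * i) * int ((s - 1) choose i)) div int (s - i)) * int ((s - 2 * i - 1 - j) choose j)) (ph (cp (i + j)) (yn (s - 2 * i - 2 * j))))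
     \<approx> frag_cmul (df (s - 1) i) (L2 (cls (V (s - 2 * i) (cp i) 0)))"
    unfolding n_def s1[unfolded n_def, symmetric] .
qed

text \<open>Expand \<open>y ^ (s - 1)\<close> by ballot numbers and multiply by \<open>y\<close>
  once more. The term \<open>i = 0\<close> is the product of \<open>V 2\<close> and
  \<open>V s\<close>, where the recursion breaks; it gives two modules of length \<open>s\<close>
  and thus \<open>gyA\<close>, while the remaining terms are \<open>gyB\<close>.\<close>

lemma gen_y: "Ph (E e1 (yn s) 1 - gyA - gyB) \<approx> 0"
proof -
  have s1: "s - 1 < s" "s - 1 + 1 = s" using s_pos by auto
  let ?F = "\<lambda>i. frag_cmul (df (s - 1) i) (L2 (cls (V (s - 2 * i) (cp i) 0)))"
  have "ph e1 (yn s) \<approx> L2 (ph e1 (yn (s - 1)))" using geq_sym[OF L2_ph[OF e1_Ch, of "s - 1"]] unfolding s1(2) .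
  also have "\<dots> \<approx> L2 (\<Sum>i\<le>s - 1. frag_cmul (df (s - 1) i) (cls (V (s - 1 + 1 - 2 * i) (cp i \<star> e1) 0)))"
    by (rule fm_cong2[OF ph_y_V[OF e1_Ch s1(1)] V2_fW])
  also have "\<dots> = (\<Sum>i\<le>s - 1. ?F i)" unfolding L2_sum s1(2) by simp
  also have "\<dots> = (\<Sum>i\<in>{0..(s - 1) div 2}. ?F i) + (\<Sum>i\<in>{(s - 1) div 2 <.. s - 1}. ?F i)"
    by (subst sum.union_disjoint[symmetric]) (auto intro!: sum.cong)
  also have "\<dots> \<approx> (\<Sum>i\<in>{0..(s - 1) div 2}. ?F i) + (\<Sum>i\<in>{(s - 1) div 2 <.. s - 1}. 0)"
  proof (intro geq_add geq_refl geq_sum)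
    fix i assume "i \<in> {(s - 1) div 2 <.. s - 1}"
    then have z: "s - 2 * i = 0" by auto
    have "L2 (cls (V 0 (cp i) 0)) \<approx> L2 0" by (rule fm_cong2[OF cls_V_0[OF cp_Ch] V2_fW])
    then have "L2 (cls (V 0 (cp i) 0)) \<approx> 0" by simp
    from geq_cmul[OF this, of "df (s - 1) i"] show "?F i \<approx> 0" unfolding z by simp
  qed
  also have "(\<Sum>i\<in>{0..(s - 1) div 2}. ?F i) + (\<Sum>i\<in>{(s - 1) div 2 <.. s - 1}. 0) = ?F 0 + (\<Sum>i\<in>{1..(s - 1) div 2}. ?F i)"
    by (simp add: sum.atLeast_Suc_atMost One_nat_def)
  also have "?F 0 + (\<Sum>i\<in>{1..(s - 1) div 2}. ?F i) \<approx> (cls (V s e1 0) + cls (V s chi 0)) + Ph gyB"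
  proof (rule geq_add[OF _ geq_sym[OF gyB_eq]])
    show "?F 0 \<approx> cls (V s e1 0) + cls (V s chi 0)" using L2_Vs[OF e1_Ch] by (simp add: df_rec0)
  qed
  also have "\<dots> \<approx> (U (s - 1) e1 + U (s - 1) chi) + Ph gyB"
    by (rule geq_add[OF geq_add[OF geq_sym geq_sym] geq_refl]) (use U_V[OF e1_Ch s1(1)] U_V[OF chi_Ch s1(1)] in \<open>simp_all only: s1(2)\<close>)
  also have "(U (s - 1) e1 + U (s - 1) chi) + Ph gyB = Ph gyA + Ph gyB" unfolding gyA_eq ..
  finally have "ph e1 (yn s) - (Ph gyA + Ph gyB) \<approx> 0" by (rule zero_geq)
  then show ?thesis unfolding Ph_diff Ph_E by (simp add: diff_diff_add)
qed

lemma cyc_shift: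
  fixes F :: "('g \<Rightarrow> 'k) \<Rightarrow> ('g, 'k) formal"
  shows "(\<Sum>i<sb. F (cp (i + j))) = (\<Sum>i<sb. F (cp i))"
proof (induction j)
  case (Suc j)
  have "(\<Sum>i<sb. F (cp (Suc i + j))) + F (cp (0 + j)) = (\<Sum>i<Suc sb. F (cp (i + j)))" by (subst sum.lessThan_Suc_shift) (simp add: add.commute)
  also have "\<dots> = (\<Sum>i<sb. F (cp (i + j))) + F (cp (sb + j))" by simp
  also have "cp (sb + j) = cp (0 + j)" using cp_period[of j] by (simp add: add.commute)
  finally show ?case using Suc by simp
qed simp

text \<open>A sum over a full period of \<open>chi\<close> absorbs the twist by
  \<open>chi ^ j\<close> in the Chebyshev expansion, which is why the relation can be written
  without that twist.\<close>

lemma gx_eq: "Ph gx \<approx> (\<Sum>i<sb. cls (V s (cp i) 0))"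
proof -
  let ?n = "s - 1"
  have s1: "s - 1 < s" "s - 1 + 1 = s" using s_pos by auto
  have "Ph gx = (\<Sum>i<sb. \<Sum>j\<in>{0..?n div 2}. frag_cmul (uf ?n j) (ph (cp i) (yn (?n - 2 * j))))"
    unfolding gx_def Ph_sum Ph_E uf_def ..
  also have "\<dots> = (\<Sum>j\<in>{0..?n div 2}. \<Sum>i<sb. frag_cmul (uf ?n j) (ph (cp i) (yn (?n - 2 * j))))" by (rule sum.swap)
  also have "\<dots> = (\<Sum>j\<in>{0..?n div 2}. \<Sum>i<sb. frag_cmul (uf ?n j) (ph (cp (i + j)) (yn (?n - 2 * j))))"
  proof (rule sum.cong[OF refl])
    fix j
    show "(\<Sum>i<sb. frag_cmul (uf ?n j) (ph (cp i) (yn (?n - 2 * j)))) = (\<Sum>i<sb. frag_cmul (uf ?n j) (ph (cp (i + j)) (yn (?n - 2 * j))))"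
      by (rule cyc_shift[symmetric, of "\<lambda>c. frag_cmul (uf ?n j) (ph c (yn (?n - 2 * j)))" j])
  qed
  also have "\<dots> = (\<Sum>i<sb. \<Sum>j\<in>{0..?n div 2}. frag_cmul (uf ?n j) (ph (cp (i + j)) (yn (?n - 2 * j))))" by (rule sum.swap)
  also have "\<dots> = (\<Sum>i<sb. U ?n (cp i))" unfolding Ph_uf[symmetric] Ph_sum Ph_E uf_def ..
  also have "\<dots> \<approx> (\<Sum>i<sb. cls (V s (cp i) 0))" using U_V[OF cp_Ch s1(1)] unfolding s1(2) by (intro geq_sum)
  finally show ?thesis .
qed

lemma gen_xx': assumes al: "al \<noteq> 0"
  shows "Ph (E e1 (x1 al + x1 (- al)) 1 - (\<Sum>i\<in>{1..<sp}. E e1 (x1 ((1 - xi ^ i) * al)) (int s)) - gx) \<approx> 0"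
proof -
  let ?S = "\<Sum>i\<in>{1..<sp}. frag_cmul (int s) (ph e1 (x1 ((1 - xi ^ i) * al)))"
  have "ph e1 (x1 al + x1 (- al)) \<approx> (\<Sum>i<sp. xterm (al + - al * xi ^ i))" using al by (intro Ph_xx) simp_all
  \<comment> \<open>The factor at \<open>i = 0\<close> is zero and contributes the nilpotent blocks;
    the others are nonzero.\<close>
  also have "(\<Sum>i<sp. xterm (al + - al * xi ^ i)) = xterm 0 + (\<Sum>i\<in>{1..<sp}. xterm ((1 - xi ^ i) * al))"
  proof -
    have "{..<sp} = insert 0 {1..<sp}" using sp_pos by auto
    then have "(\<Sum>i<sp. xterm (al + - al * xi ^ i)) = xterm (al + - al * xi ^ 0) + (\<Sum>i\<in>{1..<sp}. xterm (al + - al * xi ^ i))" by simp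
    then show ?thesis by (simp add: algebra_simps)
  qed
  also have "\<dots> \<approx> Ph gx + ?S"
  proof (rule geq_add)
    show "xterm 0 \<approx> Ph gx" using geq_sym[OF gx_eq] by (simp add: xterm_def)
    show "(\<Sum>i\<in>{1..<sp}. xterm ((1 - xi ^ i) * al)) \<approx> ?S" using al one_minus_xi by (intro geq_sum xterm_ph) auto
  qed
  finally have "ph e1 (x1 al + x1 (- al)) - (Ph gx + ?S) \<approx> 0" by (rule zero_geq)
  then show ?thesis unfolding Ph_diff Ph_sum Ph_E by (simp add: algebra_simps)
qed

lemma Ph_J: "u \<in> JJ \<Longrightarrow> Ph u \<approx> 0"
proof (induction rule: skew_ideal.induct)
  case (gen g u v)
  have g: "g \<in> SC" using Js_SC gen(1) by blast
  have g0: "Ph g \<approx> 0"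
    using gen(1) unfolding Js_eq
  proof (elim UnE)
    assume "g \<in> {E e1 (yn s) 1 - gyA - gyB}" then show ?thesis using gen_y by simp
  next
    assume "g \<in> {E chi (x1 al) 1 - E e1 (x1 al) 1 | al. al \<noteq> 0}" then show ?thesis using gen_chi by blast
  next
    assume "g \<in> {E e1 (y1 + x1 al) 1 - E e1 (x1 al) 2 | al. al \<noteq> 0}" then show ?thesis using gen_yx by blast
  next
    assume "g \<in> {E e1 (x1 al + x1 be) 1 - (\<Sum>i<sp. E e1 (x1 (al + be * xi ^ i)) (int s)) | al be.
          al \<noteq> 0 \<and> be \<noteq> 0 \<and> coset xi be \<noteq> coset xi (- al)}" then show ?thesis using gen_xx by blast
  next
    assume "g \<in> {E e1 (x1 al + x1 (- al)) 1 - (\<Sum>i\<in>{1..<sp}. E e1 (x1 ((1 - xi ^ i) * al)) (int s)) - gx | al. al \<noteq> 0}"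
    then show ?thesis using gen_xx' by blast
  qed
  have "Ph (u \<odot> g \<odot> v) \<approx> fm (Ph (u \<odot> g)) (Ph v)" by (rule Ph_mult[OF SC_mult[OF gen(2) g] gen(3)])
  also have "\<dots> \<approx> fm (fm (Ph u) (Ph g)) (Ph v)" by (rule fm_cong1[OF Ph_mult[OF gen(2) g] Ph_fW[OF gen(3)]])
  also have "\<dots> \<approx> fm (fm (Ph u) 0) (Ph v)" by (rule fm_cong1[OF fm_cong2[OF g0 Ph_fW[OF gen(2)]] Ph_fW[OF gen(3)]])
  finally show ?case by simp
next
  case (add u v)
  then show ?case using geq_add[of G chi "Ph u" 0 "Ph v" 0] by (simp add: Ph_add)
qed simp

subsection \<open>Leading terms and bijectivity\<close>

text \<open>Combinations of blocks of one eigenvalue and length below \<open>n\<close>, closed under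
  congruence so that membership depends on the class in the Green ring only.\<close>

inductive_set low :: "'k \<Rightarrow> nat \<Rightarrow> ('g, 'k) formal set" for b :: 'k and n :: nat where
  zero: "0 \<in> low b n"
| V: "0 < t \<Longrightarrow> t < n \<Longrightarrow> l \<in> Ch \<Longrightarrow> cls (V t l b) \<in> low b n"
| add: "u \<in> low b n \<Longrightarrow> v \<in> low b n \<Longrightarrow> u + v \<in> low b n"
| neg: "u \<in> low b n \<Longrightarrow> - u \<in> low b n"
| geq: "u \<in> low b n \<Longrightarrow> u \<approx> v \<Longrightarrow> v \<in> low b n"

lemma low_minv: "u \<in> low b n \<Longrightarrow> c \<noteq> b \<or> n \<le> k \<Longrightarrow> minv c k m u = 0"
proof (induction rule: low.induct)
  case (V t l)
  show ?case
  proof (cases "c = b")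
    case True
    then have "t < k" using V by simp
    then show ?thesis unfolding True using V(1) by (intro minv_smaller)
  next
    case False then show ?thesis using V(1) by (intro minv_other_eigenvalue)
  qed
next
  case (geq u v) then show ?case using minv_geq[OF geq(2), of c k m] by simp
qed (simp_all add: minv_add minv_minus)

lemma low_mono: "u \<in> low b n \<Longrightarrow> n \<le> n' \<Longrightarrow> u \<in> low b n'"
proof (induction rule: low.induct)
  case (V t l) then show ?case by (intro low.V) simp_all
next
  case (geq u v) then show ?case using low.geq by blast
qed (simp_all add: low.zero low.add low.neg)

lemma low_V: assumes "t < n" "l \<in> Ch" shows "cls (V t l b) \<in> low b n"
proof (cases "t = 0")
  case True then show ?thesis using low.geq[OF low.zero geq_sym[OF cls_V_0[OF assms(2)]]] by simp
next
  case False then show ?thesis using assms by (intro low.V) simp_all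
qed

lemma low_sum: "(\<And>i. i \<in> I \<Longrightarrow> f i \<in> low b n) \<Longrightarrow> (\<Sum>i\<in>I. f i) \<in> low b n"
  by (induction I rule: infinite_finite_induct) (simp_all add: low.zero low.add)

lemma low_sum_list: "(\<And>i. i \<in> set I \<Longrightarrow> f i \<in> low b n) \<Longrightarrow> (\<Sum>i\<leftarrow>I. f i) \<in> low b n"
  by (induction I) (simp_all add: low.zero low.add)

lemma low_remainder: assumes e: "u \<approx> v + r" and r: "r \<in> low b n" shows "u - v \<in> low b n"
proof -
  have "u - v \<approx> v + r - v" by (rule geq_diff[OF e geq_refl])
  then have "u - v \<approx> r" by simp
  then show ?thesis by (rule low.geq[OF r geq_sym])
qed

lemma low_of_lead: assumes "u - v \<in> low b n" "v \<in> low b n" shows "u \<in> low b n"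
  using low.add[OF assms] by simp

abbreviation zc :: "('g, 'k) formal" where "zc \<equiv> cls (V (s + 1) e1 0)"

lemma zc_fW: "zc \<in> fW" by simp

text \<open>The summand of length \<open>t + s\<close> occurs once and all others are shorter; their
  exact lengths do not matter.\<close>

lemma z_V0: assumes l: "l \<in> Ch" and t: "t > 0" shows "fm zc (cls (V t l 0)) - cls (V (t + s) l 0) \<in> low 0 (t + s)"
proof -
  obtain L where L: "\<forall>(t', l')\<in>set L. 0 < t' \<and> t' < t + s \<and> (\<exists>k. l' = cp k \<star> l)"
    "cls (V (s + 1) e1 0 \<boxtimes> V t l 0) \<approx> cls (V (t + s) l 0) + (\<Sum>(t', l')\<leftarrow>L. cls (V t' l' 0))"
    using Vs1_tensor_nil[OF l t] by (elim exE conjE)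
  have "(\<Sum>(t', l')\<leftarrow>L. cls (V t' l' 0)) \<in> low 0 (t + s)"
  proof (rule low_sum_list)
    fix q assume q: "q \<in> set L"
    obtain t' l' where e: "q = (t', l')" by (cases q)
    then have h: "t' < t + s" "\<exists>k. l' = cp k \<star> l" using bspec[OF L(1) q] by simp_all
    then have "l' \<in> Ch" using l by auto
    then show "(case q of (t', l') \<Rightarrow> cls (V t' l' 0)) \<in> low 0 (t + s)" using h(1) unfolding e by (simp add: low_V)
  qed
  then show ?thesis unfolding fm_cls by (rule low_remainder[OF L(2)])
qed

lemma z_Vb: assumes l: "l \<in> Ch" and t: "t > 0" and b: "b \<noteq> 0" shows "fm zc (cls (V t l b)) - cls (V (t + 1) l b) \<in> low b (t + 1)"
proof -
  have "cls (V (t - 1) l b) + (\<Sum>k\<in>{1..<s}. cls (V t (cp k \<star> l) b)) \<in> low b (t + 1)"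
    using l t by (intro low.add low_sum low_V) simp_all
  then show ?thesis unfolding fm_cls by (rule low_remainder[OF Vs1_tensor[OF l t b, unfolded add.assoc[of "cls (V (t + 1) l b)"]]])
qed

lemma y_V: assumes l: "l \<in> Ch" and t: "t > 0" "\<not> s dvd t" shows "L2 (cls (V t l 0)) - cls (V (t + 1) l 0) \<in> low 0 (t + 1)"
  by (rule low_remainder[OF L2_V[OF l t]]) (use l t in \<open>simp add: low_V\<close>)

lemma fm_low:
  assumes M: "cls M \<in> fW" and V: "\<And>t l. 0 < t \<Longrightarrow> t < n \<Longrightarrow> l \<in> Ch \<Longrightarrow> fm (cls M) (cls (V t l b)) \<in> low b n'"
  shows "u \<in> low b n \<Longrightarrow> fm (cls M) u \<in> low b n'"
proof (induction rule: low.induct)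
  case (V t l) then show ?case by (rule assms(2))
next
  case (geq u v) then show ?case using low.geq[OF _ fm_cong2[OF geq(2) M]] by blast
qed (simp_all add: low.zero low.add low.neg fm_add2 fm_neg2)

lemma z_low0: "u \<in> low 0 n \<Longrightarrow> fm zc u \<in> low 0 (n + s)"
proof (rule fm_low[OF zc_fW])
  fix t l assume h: "0 < t" "t < n" "l \<in> Ch"
  show "fm zc (cls (V t l 0)) \<in> low 0 (n + s)"
    by (rule low_of_lead[OF low_mono[OF z_V0[OF h(3,1)]] low_V]) (use h in simp_all)
qed

lemma z_lowb: assumes b: "b \<noteq> 0" shows "u \<in> low b n \<Longrightarrow> fm zc u \<in> low b (n + 1)"
proof (rule fm_low[OF zc_fW])
  fix t l assume h: "0 < t" "t < n" "l \<in> Ch"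
  show "fm zc (cls (V t l b)) \<in> low b (n + 1)"
    by (rule low_of_lead[OF low_mono[OF z_Vb[OF h(3,1) b]] low_V]) (use h in simp_all)
qed

lemma y_low: "u \<in> low 0 n \<Longrightarrow> L2 u \<in> low 0 (n + 1)"
proof (rule fm_low[OF V2_fW])
  fix t l assume h: "0 < t" "t < n" "l \<in> Ch"
  show "L2 (cls (V t l 0)) \<in> low 0 (n + 1)"
  proof (rule low.geq[OF _ geq_sym[OF V2_tensor(1)[OF h(3,1), folded fm_cls]]])
    show "(if s dvd t then cls (V t l 0) + cls (V t (chi \<star> l) 0) else cls (V (t + 1) l 0) + cls (V (t - 1) (chi \<star> l) 0)) \<in> low 0 (n + 1)"
      using h by (auto intro!: low.add low_V)
  qed
qed

definition lead :: "('g \<Rightarrow> 'k) \<Rightarrow> ('k var \<Rightarrow>\<^sub>0 nat) \<Rightarrow> 'k \<Rightarrow> nat \<Rightarrow> bool" where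
  "lead l m b n \<longleftrightarrow> ph l m - cls (V n l b) \<in> low b n"

text \<open>A variable fixed by all characters can be moved in front of \<open>l\<close>, so adding
  it to a monomial is left multiplication by its module.\<close>

lemma ph_var_mult:
  assumes l: "l \<in> Ch" and m: "pm_keys m \<subseteq> AV" and v: "v \<in> AV" "\<And>l. ren_var a s l v = v" and tb: "vm v = V t e1 b" "t > 0"
  shows "ph l (m + pm_single v 1) \<approx> fm (cls (V t e1 b)) (ph l m)"
proof -
  have "ph (e1 \<star> l) (ren l (pm_single v 1) + m) \<approx> fm (ph e1 (pm_single v 1)) (ph l m)"
    by (rule ph_mult[OF e1_Ch l _ m]) (use v in simp)
  also have "\<dots> \<approx> fm (cls (V t e1 b)) (ph l m)" by (rule fm_cong1[OF Ph_v[OF e1_Ch v(1) tb]]) (use l in simp)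
  also have "ph (e1 \<star> l) (ren l (pm_single v 1) + m) = ph l (m + pm_single v 1)" using l v(2) by (simp add: ren_single add.commute)
  finally show ?thesis .
qed

lemma ph_zmul: "l \<in> Ch \<Longrightarrow> pm_keys m \<subseteq> AV \<Longrightarrow> ph l (m + zn 1) \<approx> fm zc (ph l m)"
  by (rule ph_var_mult) (simp_all add: vm_z ren_var_def)
lemma ph_ymul: "l \<in> Ch \<Longrightarrow> pm_keys m \<subseteq> AV \<Longrightarrow> ph l (m + yn 1) \<approx> L2 (ph l m)"
  by (rule ph_var_mult) (simp_all add: vm_y ren_var_def)

lemma lead_step:
  assumes e: "ph l m' \<approx> fm (cls M) (ph l m)" and ld: "lead l m b n"
    and lo: "\<And>u. u \<in> low b n \<Longrightarrow> fm (cls M) u \<in> low b n'"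
    and V: "fm (cls M) (cls (V n l b)) - cls (V n' l b) \<in> low b n'"
  shows "lead l m' b n'"
proof -
  have "fm (cls M) (ph l m - cls (V n l b)) + (fm (cls M) (cls (V n l b)) - cls (V n' l b)) \<in> low b n'"
    by (rule low.add[OF lo[OF ld[unfolded lead_def]] V])
  then have r: "fm (cls M) (ph l m) - cls (V n' l b) \<in> low b n'" by (simp add: fm_diff2)
  show ?thesis unfolding lead_def by (rule low.geq[OF r geq_sym[OF geq_diff[OF e geq_refl]]])
qed

lemma zn_Suc: "zn (Suc j) = zn j + zn 1" unfolding single_add[symmetric] by (simp only: Suc_eq_plus1)
lemma yn_Suc: "yn (Suc j) = yn j + yn 1" unfolding single_add[symmetric] by (simp only: Suc_eq_plus1)

lemma lead_z: assumes l: "l \<in> Ch" shows "lead l (zn j) 0 (j * s + 1)"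
proof (induction j)
  case 0
  have "ph l 0 - lc l \<in> low 0 1" by (rule low.geq[OF low.zero geq_sym[OF zero_geq[OF Ph_l[OF l]]]])
  then show ?case by (simp add: lead_def)
next
  case (Suc j)
  have "lead l (zn (Suc j)) 0 (j * s + 1 + s)" unfolding zn_Suc
    by (rule lead_step[OF ph_zmul[OF l] Suc z_low0 z_V0[OF l]]) (simp_all add: keys_single_AV)
  moreover have "j * s + 1 + s = Suc j * s + 1" by simp
  ultimately show ?case by (simp only:)
qed

text \<open>Each \<open>z\<close> adds \<open>s\<close> to the leading length, and each
  \<open>y\<close> adds one unless the length is divisible by \<open>s\<close>. From
  \<open>j * s + 1\<close> this allows \<open>s - 1\<close> factors \<open>y\<close>, so division of
  the length minus one by \<open>s\<close> yields every length exactly once.\<close>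

lemma lead_yz: "l \<in> Ch \<Longrightarrow> i < s \<Longrightarrow> lead l (yn i + zn j) 0 (j * s + i + 1)"
proof (induction i)
  case 0 then show ?case using lead_z[of l j] by simp
next
  case (Suc i)
  have IH: "lead l (yn i + zn j) 0 (j * s + i + 1)" using Suc by simp
  have nd: "\<not> s dvd j * s + i + 1"
  proof
    assume "s dvd j * s + i + 1"
    then have "s dvd j * s + (i + 1)" by (simp only: add.assoc)
    then have "s dvd i + 1" by (simp only: dvd_add_right_iff[OF dvd_triv_right])
    then show False using Suc.prems by (auto dest: dvd_imp_le)
  qed
  have "lead l (yn i + zn j + yn 1) 0 (j * s + i + 1 + 1)"
    by (rule lead_step[OF ph_ymul[OF Suc.prems(1)] IH y_low y_V[OF Suc.prems(1) _ nd]]) (simp_all add: AVs)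
  moreover have "yn i + zn j + yn 1 = yn (Suc i) + zn j" unfolding yn_Suc by (simp only: add_ac)
  moreover have "j * s + i + 1 + 1 = j * s + Suc i + 1" by simp
  ultimately show ?case by (simp only:)
qed

lemma lead_zx: assumes l: "l \<in> Ch" and al: "al \<noteq> 0" shows "lead l (zn j + x1 al) (al ^ sp) (j + 1)"
proof (induction j)
  case 0
  have "ph l (x1 al) - cls (V 1 l (al ^ sp)) \<in> low (al ^ sp) 1" by (rule low.geq[OF low.zero geq_sym[OF zero_geq[OF Ph_x[OF l al]]]])
  then show ?case by (simp add: lead_def)
next
  case (Suc j)
  have b: "al ^ sp \<noteq> 0" using al by simp
  have "lead l (zn j + x1 al + zn 1) (al ^ sp) (j + 1 + 1)"
    by (rule lead_step[OF ph_zmul[OF l] Suc z_lowb[OF b] z_Vb[OF l _ b]]) (use al in \<open>simp_all add: AVs\<close>)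
  moreover have "zn j + x1 al + zn 1 = zn (Suc j) + x1 al" unfolding zn_Suc by (simp only: add_ac)
  ultimately show ?case by (simp only: Suc_eq_plus1)
qed

text \<open>The quotient is an \<open>sp\<close>-th root of unity. The \<open>sp\<close> distinct
  powers of \<open>xi\<close> exhaust the roots of \<open>X ^ sp - 1\<close>, so it is one of them.
  Hence the eigenvalue \<open>al ^ sp\<close> determines the variable.\<close>

lemma coset_pow_eq: assumes al: "al \<noteq> 0" and be: "be \<noteq> 0" and e: "al ^ sp = be ^ sp" shows "coset xi al = coset xi be"
proof -
  define p :: "'k poly" where "p = monom 1 sp - 1"
  have p: "poly p z = z ^ sp - 1" for z by (simp add: p_def poly_monom)
  have p0: "p \<noteq> 0"
  proof
    assume "p = 0"
    then have "poly p 0 = 0" by simp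
    then show False using sp_pos by (simp add: p zero_power)
  qed
  have dp: "degree p \<le> sp" unfolding p_def by (rule degree_diff_le) (simp_all add: degree_monom_le)
  have cR: "card {z. poly p z = 0} \<le> sp" using card_poly_roots_bound[OF p0] dp by simp
  have fR: "finite {z. poly p z = 0}" by (rule poly_roots_finite[OF p0])
  have inj: "inj_on (\<lambda>i. xi ^ i) {..<sp}"
  proof -
    have gen: "i = j" if "xi ^ i = xi ^ j" "i \<le> j" "j < sp" for i j
    proof -
      have "xi ^ (j - i) * xi ^ i = xi ^ j" unfolding power_add[symmetric] using that by simp
      then have "xi ^ (j - i) = 1" using that xi_nz by simp
      then have "sp dvd j - i" by (simp add: xi_pow)
      then show ?thesis using that by (auto dest: dvd_imp_le)
    qed
    show ?thesis
    proof (rule inj_onI)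
      fix i j assume h: "i \<in> {..<sp}" "j \<in> {..<sp}" "xi ^ i = xi ^ j"
      show "i = j"
      proof (cases "i \<le> j")
        case True then show ?thesis using gen[of i j] h by simp
      next
        case False then show ?thesis using gen[of j i] h by simp
      qed
    qed
  qed
  have "(\<lambda>i. xi ^ i) ` {..<sp} = {z. poly p z = 0}"
  proof (rule card_seteq[OF fR])
    show "(\<lambda>i. xi ^ i) ` {..<sp} \<subseteq> {z. poly p z = 0}"
    proof safe
      fix i
      have "(xi ^ i) ^ sp = (xi ^ sp) ^ i" by (simp add: power_mult[symmetric] mult.commute)
      then show "poly p (xi ^ i) = 0" using xi_pow[of sp] by (simp add: p)
    qed
    show "card {z. poly p z = 0} \<le> card ((\<lambda>i. xi ^ i) ` {..<sp})" using cR card_image[OF inj] by simp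
  qed
  moreover have "(be / al) ^ sp = 1"
  proof -
    have "al ^ sp \<noteq> 0" using al by simp
    then show ?thesis unfolding power_divide e[symmetric] by (rule divide_self)
  qed
  then have "be / al \<in> {z. poly p z = 0}" by (simp add: p)
  ultimately have "be / al \<in> (\<lambda>i. xi ^ i) ` {..<sp}" by simp
  then obtain i where "be / al = xi ^ i" by blast
  then have "be = al * xi ^ i" using al by (simp add: field_simps)
  then show ?thesis using xi_coset[of al i] by simp
qed

text \<open>Eigenvalue and length of the leading block of a normal monomial; together they determine
  the monomial. For nonzero \<open>b\<close> it is also recorded that the character is the chosen
  representative, since weights are then visible only modulo \<open>chi\<close>.\<close>

definition nfkey :: "('g \<Rightarrow> 'k) \<Rightarrow> ('k var \<Rightarrow>\<^sub>0 nat) \<Rightarrow> 'k \<Rightarrow> nat \<Rightarrow> bool" where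
  "nfkey l m b n \<longleftrightarrow> (\<exists>i j. m = yn i + zn j \<and> i < s \<and> b = 0 \<and> n = j * s + i + 1)
     \<or> (\<exists>j al. al \<noteq> 0 \<and> m = zn j + x1 al \<and> b = al ^ sp \<and> n = j + 1 \<and> rep l = l)"

lemma nfkey_cases:
  assumes "nfkey l m b n"
  obtains i j where "m = yn i + zn j" "i < s" "b = 0" "n = j * s + i + 1"
  | j al where "al \<noteq> 0" "m = zn j + x1 al" "b = al ^ sp" "n = j + 1" "rep l = l"
  using assms unfolding nfkey_def by blast

lemma nfkey_exists: "(l, m) \<in> NI \<Longrightarrow> \<exists>n b. nfkey l m b n"
  unfolding NI_def nfkey_def by blast

lemma nfkey_lead: assumes l: "l \<in> Ch" and k: "nfkey l m b n" shows "n > 0" "lead l m b n"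
proof -
  show "n > 0" using k by (cases rule: nfkey_cases) simp_all
  show "lead l m b n" using k
  proof (cases rule: nfkey_cases)
    case (1 i j) show ?thesis unfolding 1(1,3,4) by (rule lead_yz[OF l 1(2)])
  next
    case (2 j al) show ?thesis unfolding 2(2,3,4) by (rule lead_zx[OF l 2(1)])
  qed
qed

lemma nfkey_inj: assumes k: "nfkey l m b n" and k': "nfkey l' m' b n" shows "m = m'"
  using k
proof (cases rule: nfkey_cases)
  case m: (1 i j)
  show ?thesis using k'
  proof (cases rule: nfkey_cases)
    case (1 i' j')
    have e: "j * s + i = j' * s + i'" using m(4) 1(4) by simp
    have "(j * s + i) div s = j" "(j * s + i) mod s = i" using m(2) by simp_all
    moreover have "(j' * s + i') div s = j'" "(j' * s + i') mod s = i'" using 1(2) by simp_all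
    ultimately show ?thesis using e m(1) 1(1) by simp
  next
    case (2 j' al)
    have "al ^ sp = 0" using m(3) 2(3) by simp
    then show ?thesis using 2(1) by simp
  qed
next
  case m: (2 j al)
  show ?thesis using k'
  proof (cases rule: nfkey_cases)
    case (1 i' j')
    have "al ^ sp = 0" using m(3) 1(3) by simp
    then show ?thesis using m(1) by simp
  next
    case (2 j' al')
    have "al ^ sp = al' ^ sp" using m(3) 2(3) by simp
    then have "coset xi al = coset xi al'" by (rule coset_pow_eq[OF m(1) 2(1)])
    moreover have "j = j'" using m(4) 2(4) by simp
    ultimately show ?thesis unfolding m(2) 2(2) by simp
  qed
qed

lemma minv_lead: assumes "lead l m b n" "c \<noteq> b \<or> n \<le> k" shows "minv c k m' (ph l m) = minv c k m' (cls (V n l b))"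
  using low_minv[OF assms(1)[unfolded lead_def] assms(2), of m'] by (simp add: minv_diff)

text \<open>The leading block of the other term differs in the eigenvalue, is shorter, or has the
  same key and another character. In the last case the weights differ, and for nonzero
  \<open>b\<close> even the cosets do, because both characters are representatives.\<close>

lemma minv_ph_other:
  assumes l0: "l0 \<in> Ch" and l: "l \<in> Ch" and k0: "nfkey l0 m0 b n" and k: "nfkey l m b' n'" and n: "n' \<le> n" and ne: "\<not> (l = l0 \<and> m = m0)"
  shows "minv b n l0 (ph l m) = 0"
proof -
  note ld = nfkey_lead[OF l k]
  have e: "minv b n l0 (ph l m) = minv b n l0 (cls (V n' l b'))" by (rule minv_lead[OF ld(2)]) (simp add: n)
  have "minv b n l0 (cls (V n' l b')) = 0"
  proof (cases "b = b'")
    case False then show ?thesis by (rule minv_other_eigenvalue[OF ld(1)])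
  next
    case b: True
    show ?thesis
    proof (cases "n' < n")
      case True show ?thesis using minv_smaller[OF ld(1) True, of b l0 l] b by simp
    next
      case False
      then have n: "n' = n" using n by simp
      have ll: "l0 \<noteq> l" using ne nfkey_inj[OF k0, of l m] k b n by auto
      show ?thesis
      proof (cases "b = 0")
        case True
        show ?thesis using minv_other_weight[OF ld(1) l l0 ll] True b n by simp
      next
        case b0: False
        have r0: "rep l0 = l0" using k0 by (cases rule: nfkey_cases) (use b0 in simp_all)
        have r: "rep l = l" using k by (cases rule: nfkey_cases) (use b0 b in simp_all)
        have nc: "l0 \<noteq> cp i \<star> l" for i
        proof
          assume "l0 = cp i \<star> l"
          then have "rep l0 = rep l" by (rule rep_cong[OF l0 _ l])
          then show False using r0 r ll by simp
        qed
        show ?thesis using minv_other_coset[OF ld(1) l l0 nc, of b n] unfolding b .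
      qed
    qed
  qed
  then show ?thesis using e by simp
qed

lemma minv_ph_self: assumes l: "l \<in> Ch" and k: "nfkey l m b n" shows "minv b n l (ph l m) = 1"
  using minv_lead[OF nfkey_lead(2)[OF l k], of b n l] minv_self[OF nfkey_lead(1)[OF l k] l, of b] by simp

text \<open>Take a term of \<open>w\<close> whose leading block is longest. The invariant attached
  to that block vanishes on all other terms and is 1 on this one, so it reads off a nonzero
  coefficient; but it depends only on the class of \<open>Ph w\<close>, which is zero.\<close>

lemma nrm_kernel: assumes w: "nrm w" and z: "Ph w \<approx> 0" shows "w = 0"
proof (rule ccontr)
  assume w0: "w \<noteq> 0"
  define S where "S = Sigma (pm_keys w) (\<lambda>l. pm_keys (pm_lookup w l))"
  define c where "c p = pm_lookup (pm_lookup w (fst p)) (snd p)" for p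
  define N where "N p = (SOME n. \<exists>b. nfkey (fst p) (snd p) b n)" for p
  have fS: "finite S" unfolding S_def by (intro finite_SigmaI finite_keys)
  obtain l1 where l1: "l1 \<in> pm_keys w" using w0 by (metis keys_eq_empty ex_in_conv)
  then have "pm_lookup w l1 \<noteq> 0" by (simp add: in_keys_iff)
  then obtain m1 where "m1 \<in> pm_keys (pm_lookup w l1)" by (metis keys_eq_empty ex_in_conv)
  then have ne: "S \<noteq> {}" using l1 by (auto simp: S_def)
  have SN: "(fst p, snd p) \<in> NI" "fst p \<in> Ch" "c p \<noteq> 0" if "p \<in> S" for p
  proof -
    show c0: "c p \<noteq> 0" using that unfolding S_def c_def by (auto simp: in_keys_iff)
    then show NI: "(fst p, snd p) \<in> NI" using w unfolding nrm_def c_def by blast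
    then show "fst p \<in> Ch" using NI_SC by blast
  qed
  have KN: "\<exists>b. nfkey (fst p) (snd p) b (N p)" if "p \<in> S" for p
    unfolding N_def by (rule someI_ex[OF nfkey_exists[OF SN(1)[OF that]]])
  have "Max (N ` S) \<in> N ` S" using fS ne by (intro Max_in) simp_all
  then obtain p0 where p0: "p0 \<in> S" "N p0 = Max (N ` S)" by (metis imageE)
  have mx: "N q \<le> N p0" if "q \<in> S" for q unfolding p0(2) using fS that by (intro Max_ge) simp_all
  obtain b where b: "nfkey (fst p0) (snd p0) b (N p0)" using KN[OF p0(1)] by (elim exE)
  let ?i = "minv b (N p0) (fst p0)"
  have "Ph w = (\<Sum>p\<in>S. frag_cmul (c p) (ph (fst p) (snd p)))"
    unfolding Ph_def PhI_def S_def c_def by (subst sum.Sigma) (auto simp: case_prod_unfold)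
  then have "?i (Ph w) = (\<Sum>p\<in>S. c p * ?i (ph (fst p) (snd p)))" by (simp add: minv_sum minv_cmul)
  also have "\<dots> = (\<Sum>p\<in>S. if p = p0 then c p0 else 0)"
  proof (rule sum.cong[OF refl])
    fix p assume p: "p \<in> S"
    show "c p * ?i (ph (fst p) (snd p)) = (if p = p0 then c p0 else 0)"
    proof (cases "p = p0")
      case True then show ?thesis using minv_ph_self[OF SN(2)[OF p0(1)] b] by simp
    next
      case False
      obtain b' where b': "nfkey (fst p) (snd p) b' (N p)" using KN[OF p] by (elim exE)
      have "\<not> (fst p = fst p0 \<and> snd p = snd p0)" using False by (simp add: prod_eq_iff)
      then show ?thesis using minv_ph_other[OF SN(2)[OF p0(1)] SN(2)[OF p] b b' mx[OF p]] False by simp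
    qed
  qed
  also have "\<dots> = c p0" using fS p0(1) by simp
  finally have "?i (Ph w) = c p0" .
  moreover have "?i (Ph w) = 0" using minv_geq[OF z, of b "N p0" "fst p0"] by simp
  ultimately show False using SN(3)[OF p0(1)] by simp
qed

theorem Ph_kernel: assumes u: "u \<in> SC" shows "Ph u \<approx> 0 \<longleftrightarrow> u \<in> JJ"
proof
  assume z: "Ph u \<approx> 0"
  obtain w where w: "nrm w" "u - w \<in> JJ" using normal_form[OF u] unfolding nf_def by (elim exE conjE)
  have "Ph u - Ph w \<approx> 0" using Ph_J[OF w(2)] by (simp add: Ph_diff)
  from geq_diff[OF z this] have "Ph w \<approx> 0" by simp
  then have "w = 0" by (rule nrm_kernel[OF w(1)])
  then show "u \<in> JJ" using w(2) by simp
qed (rule Ph_J)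

definition img :: "('g, 'k) formal \<Rightarrow> bool" where "img w \<longleftrightarrow> (\<exists>u\<in>SC. Ph u \<approx> w)"

lemma img_geq: "img u \<Longrightarrow> u \<approx> v \<Longrightarrow> img v" unfolding img_def using geq_trans by blast
lemma img_0: "img 0" unfolding img_def by (rule bexI[of _ 0]) simp_all
lemma img_add: assumes "img u" "img v" shows "img (u + v)"
proof -
  obtain x y where x: "x \<in> SC" "Ph x \<approx> u" and y: "y \<in> SC" "Ph y \<approx> v" using assms unfolding img_def by blast
  have "Ph (x + y) \<approx> u + v" unfolding Ph_add by (rule geq_add[OF x(2) y(2)])
  then show ?thesis unfolding img_def using SC_add[OF x(1) y(1)] by (intro bexI)
qed
lemma img_neg: assumes "img u" shows "img (- u)"
proof -
  obtain x where x: "x \<in> SC" "Ph x \<approx> u" using assms unfolding img_def by blast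
  have "Ph (- x) \<approx> - u" unfolding Ph_neg by (rule geq_minus[OF x(2)])
  then show ?thesis unfolding img_def using SC_neg[OF x(1)] by (intro bexI)
qed
lemma img_diff: "img u \<Longrightarrow> img v \<Longrightarrow> img (u - v)" using img_add[of u "- v"] img_neg[of v] by simp
lemma img_ph: assumes "l \<in> Ch" "pm_keys m \<subseteq> AV" shows "img (ph l m)"
  unfolding img_def using SC_E[OF assms, of 1] by (intro bexI[of _ "E l m 1"]) (simp_all only: Ph_E frag_cmul_one geq_refl)

lemma img_low: assumes V: "\<And>t l. 0 < t \<Longrightarrow> t < n \<Longrightarrow> l \<in> Ch \<Longrightarrow> img (cls (V t l b))" shows "u \<in> low b n \<Longrightarrow> img u"
proof (induction rule: low.induct)
  case (V t l) then show ?case by (rule assms)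
next
  case (geq u v) show ?case by (rule img_geq[OF geq(3,2)])
qed (simp_all add: img_0 img_add img_neg)

text \<open>Algebraic closedness makes every nonzero eigenvalue that of some variable
  \<open>x_al\<close>.\<close>

lemma sp_root: "\<exists>al. al ^ sp = (b :: 'k)"
proof -
  have "\<exists>x. x ^ sp + (\<Sum>i<sp. (if i = 0 then - b else 0) * x ^ i) = 0"
    using alg[unfolded alg_closed_def, rule_format, of sp "\<lambda>i. if i = 0 then - b else 0"] sp_pos by simp
  then obtain x where x: "x ^ sp + (\<Sum>i<sp. (if i = 0 then - b else 0) * x ^ i) = 0" by (elim exE)
  have "(\<Sum>i<sp. (if i = 0 then - b else 0) * x ^ i) = (\<Sum>i<sp. if i = 0 then - b else 0)" by (intro sum.cong) auto
  also have "\<dots> = - b" using sp_pos by simp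
  finally show ?thesis using x by (intro exI[of _ x]) simp
qed

text \<open>Some monomial has \<open>V t l b\<close> as its leading block; the difference consists
  of shorter blocks of the same eigenvalue, which are in the image by induction on the
  length.\<close>

lemma img_V: "0 < t \<Longrightarrow> l \<in> Ch \<Longrightarrow> img (cls (V t l b))"
proof (induction t arbitrary: l rule: less_induct)
  case (less t)
  have "\<exists>m. pm_keys m \<subseteq> AV \<and> lead l m b t"
  proof (cases "b = 0")
    case True
    \<comment> \<open>Quotient and remainder of \<open>t - 1\<close> by \<open>s\<close> are the
      exponents of \<open>z\<close> and \<open>y\<close> whose monomial leads to length
      \<open>t\<close>.\<close>
    define i where "i = (t - 1) mod s"
    define j where "j = (t - 1) div s"
    have i: "i < s" using s_pos by (simp add: i_def)
    have t: "j * s + i + 1 = t" unfolding i_def j_def using less.prems(1) by simp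
    have "lead l (yn i + zn j) b t" using lead_yz[OF less.prems(2) i, of j] unfolding t True .
    moreover have "pm_keys (yn i + zn j) \<subseteq> AV" by (intro AVs)
    ultimately show ?thesis by blast
  next
    case False
    obtain al where al: "al ^ sp = b" using sp_root by blast
    then have al0: "al \<noteq> 0" using False sp_pos by (auto simp: zero_power)
    have t: "(t - 1) + 1 = t" using less.prems(1) by simp
    have "lead l (zn (t - 1) + x1 al) b t" using lead_zx[OF less.prems(2) al0, of "t - 1"] unfolding t al .
    moreover have "pm_keys (zn (t - 1) + x1 al) \<subseteq> AV" by (intro AVs al0)
    ultimately show ?thesis by blast
  qed
  then obtain m where m: "pm_keys m \<subseteq> AV" "lead l m b t" by (elim exE conjE)
  have "img (ph l m - cls (V t l b))" by (rule img_low[OF less.IH m(2)[unfolded lead_def]]) simp_all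
  from img_diff[OF img_ph[OF less.prems(2) m(1)] this] show ?case by simp
qed

theorem Ph_surj: "w \<in> fW \<Longrightarrow> img w"
proof (induction rule: fW_induct)
  case (cls M)
  obtain L where L: "\<forall>(t, l, b)\<in>set L. t > 0 \<and> l \<in> Ch" "cls M \<approx> (\<Sum>(t, l, b)\<leftarrow>L. cls (V t l b))"
    using weight_classification[OF cls] by (elim exE conjE)
  have "img (\<Sum>(t, l, b)\<leftarrow>L. cls (V t l b))" using L(1)
  proof (induction L)
    case (Cons q L)
    obtain t l b where q: "q = (t, l, b)" by (cases q)
    have "img (cls (V t l b))" using Cons.prems q by (intro img_V) simp_all
    then show ?case using Cons q by (simp add: img_add)
  qed (simp add: img_0)
  then show ?case by (rule img_geq[OF _ geq_sym[OF L(2)]])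
qed (simp_all add: img_0 img_diff)

end

theorem theorem4p16:
  fixes G :: "('g, 'm) monoid_scheme" and a :: 'g and chi :: "'g \<Rightarrow> 'k::field_char_0"
    and xi :: 'k and sb s sp :: nat
  assumes "alg_closed TYPE('k)"
    and "group G"
    and "a \<in> carrier G" and "\<forall>g\<in>carrier G. a \<otimes>\<^bsub>G\<^esub> g = g \<otimes>\<^bsub>G\<^esub> a"
    and "chi \<in> characters G" and "chi a \<noteq> 1"
    and "sb = char_order G chi" and "sb \<noteq> 0"
    and "s = elem_order (inverse (chi a))"
    and "sb = s * sp"
    and "elem_order xi = sp"
  shows "\<exists>\<Phi> :: ('g, 'k) skew \<Rightarrow> ('g, 'k) formal.
     (\<forall>u\<in>skew_carrier G xi. \<Phi> u \<in> formal_W G chi) \<and>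
     (\<forall>u\<in>skew_carrier G xi. \<forall>v\<in>skew_carrier G xi.
         \<Phi> (u + v) - \<Phi> u - \<Phi> v \<in> green_rel G chi) \<and>
     (\<forall>u\<in>skew_carrier G xi. \<forall>v\<in>skew_carrier G xi.
         \<Phi> (skew_mult G a s u v) - formal_mult G a (\<Phi> u) (\<Phi> v) \<in> green_rel G chi) \<and>
     (\<forall>l\<in>characters G. \<Phi> (skel l 1) - cls (Vt G chi 1 l) \<in> green_rel G chi) \<and>
     \<Phi> (skel (char_one G) (zvar VY)) - cls (Vt G chi 2 (char_one G)) \<in> green_rel G chi \<and>
     \<Phi> (skel (char_one G) (zvar VZ)) - cls (Vt G chi (s + 1) (char_one G)) \<in> green_rel G chi \<and>
     (\<forall>al::'k. al \<noteq> 0 \<longrightarrow>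
         \<Phi> (skel (char_one G) (zvar (VX (coset xi al)))) - cls (Vtb G chi 1 (char_one G) (al ^ sp))
           \<in> green_rel G chi) \<and>
     (\<forall>w\<in>formal_W G chi. \<exists>u\<in>skew_carrier G xi. \<Phi> u - w \<in> green_rel G chi) \<and>
     (\<forall>u\<in>skew_carrier G xi. \<Phi> u \<in> green_rel G chi \<longleftrightarrow> u \<in> skew_ideal G a s xi (J_gens G chi s sp sb xi))"
proof -
  interpret H: hopf_ctx G a chi xi sb s sp
    by (rule hopf_ctx.intro[OF assms])
  have rel: "u \<in> green_rel G chi" if "geq G chi u 0" for u using that by (simp add: geq_def)
  have one: "H.Ph (skel l 1) = H.ph l 0" for l
    using H.Ph_E[of l 0 1] by simp
  have var: "H.Ph (skel l (zvar v)) = H.ph l (Poly_Mapping.single v 1)" for l v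
    unfolding zvar_def H.Ph_E by simp
  have V0: "H.V t l 0 = Vt G chi t l" for t l by (simp add: H.V_def)
  have Vb: "H.V t l b = Vtb G chi t l b" if "b \<noteq> 0" for t l b using that by (simp add: H.V_def)
  show ?thesis
  proof (intro exI[of _ H.Ph] conjI ballI allI impI)
    fix u assume "u \<in> skew_carrier G xi" then show "H.Ph u \<in> formal_W G chi" by (rule H.Ph_fW)
  next
    fix u v show "H.Ph (u + v) - H.Ph u - H.Ph v \<in> green_rel G chi" by (simp add: H.Ph_add green_rel.zero)
  next
    fix u v assume "u \<in> skew_carrier G xi" "v \<in> skew_carrier G xi"
    from H.Ph_mult[OF this] show "H.Ph (skew_mult G a s u v) - formal_mult G a (H.Ph u) (H.Ph v) \<in> green_rel G chi" by (simp only: geq_def)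
  next
    fix l :: "'g \<Rightarrow> 'k" assume "l \<in> characters G"
    from H.Ph_l[OF this] show "H.Ph (skel l 1) - cls (Vt G chi 1 l) \<in> green_rel G chi" unfolding one V0 geq_def .
  next
    have "geq G chi (H.ph (char_one G) (Poly_Mapping.single VY 1)) (cls (H.V 2 (char_one G) 0))"
      by (rule H.Ph_v[OF H.e1_Ch H.VY_AV H.vm_y]) simp
    then show "H.Ph (skel (char_one G) (zvar VY)) - cls (Vt G chi 2 (char_one G)) \<in> green_rel G chi" unfolding var V0 geq_def .
  next
    have "geq G chi (H.ph (char_one G) (Poly_Mapping.single VZ 1)) (cls (H.V (s + 1) (char_one G) 0))"
      by (rule H.Ph_v[OF H.e1_Ch H.VZ_AV H.vm_z]) simp
    then show "H.Ph (skel (char_one G) (zvar VZ)) - cls (Vt G chi (s + 1) (char_one G)) \<in> green_rel G chi" unfolding var V0 geq_def .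
  next
    fix al :: 'k assume al: "al \<noteq> 0"
    then have b: "al ^ sp \<noteq> 0" by simp
    from H.Ph_x[OF H.e1_Ch al]
    show "H.Ph (skel (char_one G) (zvar (VX (coset xi al)))) - cls (Vtb G chi 1 (char_one G) (al ^ sp)) \<in> green_rel G chi"
      unfolding var Vb[OF b] geq_def .
  next
    fix w assume "w \<in> formal_W G chi"
    from H.Ph_surj[OF this] show "\<exists>u\<in>skew_carrier G xi. H.Ph u - w \<in> green_rel G chi" unfolding H.img_def geq_def .
  next
    fix u assume "u \<in> skew_carrier G xi"
    from H.Ph_kernel[OF this] show "H.Ph u \<in> green_rel G chi \<longleftrightarrow> u \<in> skew_ideal G a s xi (J_gens G chi s sp sb xi)" by (simp add: geq_def)
  qed
qed

end
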